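(* Suppose the mixing density $h$ belongs to one of the following families (in each case $b$ denotes the normalizing constant and $h$ is supported on $(0,\infty)$): (i) generalized inverse Gaussian: $h(u)=b\,u^{v-1}\exp\{-\frac12(\alpha u+\frac{\gamma}{u})\}$ with $\alpha,\gamma>0$, $v\in\mathbb{R}$; (ii) log-normal: $h(u)=\frac{b}{u}\exp\{-\frac{1}{2\gamma}(\log u-\mu_0)^2\}$ with $\gamma>0$, $\mu_0\in\mathbb{R}$; (iii) Fr\'echet: $h(u)=b\,u^{-(\alpha+1)}e^{-\gamma^\alpha/u^\alpha}$ with $\gamma>0$ and $\alpha>d/2$; (iv) inverted gamma: $h(u)=b\,u^{-\alpha-1}e^{-\gamma/u}$ with $\gamma>0$ and $\alpha>d/2$. Then the DA Markov operator $K$ is trace-class. If, in addition, $\int_0^\infty t^{\,n+\frac{(d+1-2a)d}{2}-1}\prod_{i=1}^n h(tz_i)\,dt<\infty$ for almost all $z\in\mathbb{R}_+^n$ (so that the Haar PX-DA algorithm is defined), then the Haar PX-DA Markov operator $K^*$ is also trace-class.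
   Context: Setting and standing assumptions. $n,p,d$ are positive integers, $a\in\mathbb{R}$, $\mathbb{R}_+=(0,\infty)$, and $\mathcal{S}_d$ is the space of $d\times d$ (real symmetric) positive definite matrices. $X$ is a fixed $n\times p$ real matrix with $i$th row $x_i^T$, $y$ is a fixed $n\times d$ real matrix with $i$th row $y_i^T$, and $\Lambda=(X:y)$ is the $n\times(p+d)$ concatenated matrix. A mixing density is a probability density $h:(0,\infty)\to[0,\infty)$. Throughout it is assumed that (S1) $\mathrm{rank}(\Lambda)=p+d$; (S2) $n>p+2d-2a$; (S3) $\int_0^\infty u^{d/2}h(u)\,du<\infty$; (S4) $\int_0^\infty u^{-\frac{n-p+2a-2d-1}{2}}h(u)\,du<\infty$. Posterior. For $\beta\in\mathbb{R}^{p\times d}$, $\Sigma\in\mathcal{S}_d$ let $$f(y|\beta,\Sigma)=\prod_{i=1}^n\left[\int_0^\infty \frac{u^{d/2}}{(2\pi)^{d/2}|\Sigma|^{1/2}}\exp\left\{-\frac u2 (y_i-\beta^Tx_i)^T\Sigma^{-1}(y_i-\beta^Tx_i)\right\}h(u)\,du\right],$$ the prior be $\omega(\beta,\Sigma)= |\Sigma|^{-a}I_{\mathcal{S}_d}(\Sigma)$, and $\pi(\beta,\Sigma|y)=f(y|\beta,\Sigma)\omega(\beta,\Sigma)/m(y)$, where $m(y)=\int_{\mathcal{S}_d}\int_{\mathbb{R}^{p\times d}}f(y|\beta,\Sigma)\omega(\beta,\Sigma)\,d\beta\,d\Sigma$, which is finite under (S1)–(S4). DA Markov chain. For $s\ge0$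 let $\psi(u;s)=b(s)u^{d/2}e^{-su/2}h(u)$, $u\in\mathbb{R}_+$, with $b(s)$ the normalizing constant making it a probability density. For $z\in\mathbb{R}_+^n$ let $Q=Q(z)$ be the $n\times n$ diagonal matrix with $i$th diagonal element $z_i^{-1}$, $\Omega=(X^TQ^{-1}X)^{-1}$, $\mu=(X^TQ^{-1}X)^{-1}X^TQ^{-1}y$. Let $\pi(z|\beta,\Sigma,y)=\prod_{i=1}^n\psi\big(z_i;(\beta^Tx_i-y_i)^T\Sigma^{-1}(\beta^Tx_i-y_i)\big)$; let $\pi(\Sigma|z,y)$ be the $\mathrm{IW}_d\big(n-p+2a-d-1,(y^TQ^{-1}y-\mu^T\Omega^{-1}\mu)^{-1}\big)$ density; and let $\pi(\beta|\Sigma,z,y)$ be the $\mathrm{N}_{p,d}(\mu,\Omega,\Sigma)$ density. Here $\mathrm{N}_{r,c}(\theta,A,B)$ (matrix normal; $\theta$ is $r\times c$, $A$ is $r\times r$ and $B$ is $c\times c$ positive definite) has density $(2\pi)^{-rc/2}|A|^{-c/2}|B|^{-r/2}\exp[-\frac12\mathrm{tr}\{A^{-1}(z-\theta)B^{-1}(z-\theta)^T\}]$ on $\mathbb{R}^{r\times c}$, and $\mathrm{IW}_r(m,\Theta)$ (inverse Wishart; $m>r-1$, $\Theta$ is $r\times r$ positive definite) has density proportional to $|w|^{-\frac{m+r+1}{2}}\exp\{-\frac12\mathrm{tr}(\Theta^{-1}w^{-1})\}$ on $\mathcal{S}_r$. The DA Markov chain on $\mathsf{X}=\mathbb{R}^{p\times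 d}\times\mathcal{S}_d$ has transition density $$k\big((\beta',\Sigma')|(\beta,\Sigma)\big)=\int_{\mathbb{R}_+^n}\pi(\beta'|\Sigma',z,y)\,\pi(\Sigma'|z,y)\,\pi(z|\beta,\Sigma,y)\,dz.$$ Haar PX-DA Markov chain. Under the integrability condition in the last sentence of the claim, for $z\in\mathbb{R}_+^n$ define the density $$e(v;z)=\frac{v^{\,n+\frac{(d+1-2a)d}{2}-1}\prod_{i=1}^nh(vz_i)}{\int_0^\infty t^{\,n+\frac{(d+1-2a)d}{2}-1}\prod_{i=1}^nh(tz_i)\,dt},\qquad v\in\mathbb{R}_+.$$ From current state $(\beta,\Sigma)\in\mathsf{X}$, the Haar PX-DA chain moves as follows: (1) draw $z'=(z_1',\dots,z_n')$ from $\pi(z'|\beta,\Sigma,y)$; (2) draw $v$ from $e(\cdot\,;z')$ and set $z=(vz_1',\dots,vz_n')$; (3) draw the new $\Sigma$ from $\pi(\cdot|z,y)$; (4) draw the new $\beta$ from $\pi(\cdot|\Sigma,z,y)$ with the new $\Sigma$. Thus its transition density $k^*$ is $$k^*\big((\beta',\Sigma')|(\beta,\Sigma)\big)=\int_{\mathbb{R}_+^n}\int_0^\infty\pi(\beta'|\Sigma',vz',y)\,\pi(\Sigma'|vz',y)\,e(v;z')\,\pi(z'|\beta,\Sigma,y)\,dv\,dz'.$$ Operators. $L_0^2$ is the Hilbert space of functions $f:\mathsf{X}\to\mathbb{R}$ with $\int_{\mathsf{X}} f^2\,\pi(\cdot|y)<\infty$ and $\int_{\mathsf{X}} f\,\pi(\cdot|y)=0$,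 with inner product $\langle f_1,f_2\rangle=\int_{\mathsf{X}} f_1f_2\,\pi(\beta,\Sigma|y)\,d\beta\,d\Sigma$. The operators $K,K^*:L_0^2\to L_0^2$ are $(Kf)(\beta,\Sigma)=\int_{\mathsf{X}}f(\beta',\Sigma')\,k((\beta',\Sigma')|(\beta,\Sigma))\,d\beta'\,d\Sigma'$ and likewise $K^*$ with $k^*$ in place of $k$. An operator of this kind is trace-class if it is compact and its eigenvalues are summable. *)

theory Defs
  imports "HOL-Analysis.Analysis"
begin

section \<open>Reference measures\<close>

definition pos_measure :: "real measure" where
  "pos_measure = restrict_space lborel {0<..}"

definition orthant_measure :: "(real ^ 'n) measure" where
  "orthant_measure = restrict_space lborel {z. \<forall>i. 0 < z $ i}"

definition spd :: "(real ^ 'd ^ 'd) set" where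
  "spd = {A. transpose A = A \<and> (\<forall>x. x \<noteq> 0 \<longrightarrow> 0 < x \<bullet> (A *v x))}"

text \<open>Lebesgue measure on the \<open>d(d+1)/2\<close>-dimensional space of symmetric matrices, i.e. the product
  of the differentials of the entries on and above the diagonal. The free coordinates are indexed by
  the unordered pairs \<open>{i, j}\<close> (singletons give the diagonal), so that no order on \<open>'d\<close> is needed.\<close>

definition sym_lborel :: "(real ^ 'd ^ 'd) measure" where
  "sym_lborel =
     distr (Pi\<^sub>M {s. \<exists>i j. s = {i, j}} (\<lambda>_. lborel)) borel (\<lambda>w. \<chi> i j. w {i, j})"

definition spd_measure :: "(real ^ 'd ^ 'd) measure" where
  "spd_measure = restrict_space sym_lborel spd"

definition state_measure :: "((real ^ 'd ^ 'p) \<times> (real ^ 'd ^ 'd)) measure" where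
  "state_measure = lborel \<Otimes>\<^sub>M spd_measure"

text \<open>The density with respect to \<open>M\<close> that is proportional to \<open>g\<close>.\<close>

definition normalized :: "'a measure \<Rightarrow> ('a \<Rightarrow> real) \<Rightarrow> 'a \<Rightarrow> real" where
  "normalized M g x = g x / (LINT t|M. g t)"


section \<open>Mixing densities\<close>

text \<open>Mixing densities live on \<open>(0,\<infinity>)\<close>; values of \<open>h\<close> at nonpositive arguments are never used.\<close>

definition mixing_density :: "(real \<Rightarrow> real) \<Rightarrow> bool" where
  "mixing_density h \<longleftrightarrow> (\<forall>u>0. 0 \<le> h u) \<and> has_bochner_integral pos_measure h 1"

definition gig_density :: "real \<Rightarrow> real \<Rightarrow> real \<Rightarrow> real \<Rightarrow> real" where
  "gig_density v \<alpha> \<gamma> =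
     normalized pos_measure (\<lambda>u. u powr (v - 1) * exp (- (1/2) * (\<alpha> * u + \<gamma> / u)))"

definition lognormal_density :: "real \<Rightarrow> real \<Rightarrow> real \<Rightarrow> real" where
  "lognormal_density \<mu>\<^sub>0 \<gamma> =
     normalized pos_measure (\<lambda>u. 1 / u * exp (- (1 / (2 * \<gamma>)) * (ln u - \<mu>\<^sub>0)\<^sup>2))"

definition frechet_density :: "real \<Rightarrow> real \<Rightarrow> real \<Rightarrow> real" where
  "frechet_density \<alpha> \<gamma> =
     normalized pos_measure (\<lambda>u. u powr (- (\<alpha> + 1)) * exp (- (\<gamma> powr \<alpha> / u powr \<alpha>)))"

definition inv_gamma_density :: "real \<Rightarrow> real \<Rightarrow> real \<Rightarrow> real" where
  "inv_gamma_density \<alpha> \<gamma> =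
     normalized pos_measure (\<lambda>u. u powr (- \<alpha> - 1) * exp (- \<gamma> / u))"


section \<open>Posterior\<close>

definition concat_cols :: "real ^ 'p ^ 'n \<Rightarrow> real ^ 'd ^ 'n \<Rightarrow> real ^ ('p + 'd) ^ 'n" where
  "concat_cols X y = (\<chi> i j. case j of Inl k \<Rightarrow> X $ i $ k | Inr l \<Rightarrow> y $ i $ l)"

definition sq_resid ::
    "real ^ 'p ^ 'n \<Rightarrow> real ^ 'd ^ 'n \<Rightarrow> real ^ 'd ^ 'p \<Rightarrow> real ^ 'd ^ 'd \<Rightarrow> 'n \<Rightarrow> real" where
  "sq_resid X y \<beta> S i =
     (let r = y $ i - transpose \<beta> *v (X $ i) in r \<bullet> (matrix_inv S *v r))"

definition likelihood ::
    "(real \<Rightarrow> real) \<Rightarrow> real ^ 'p ^ 'n \<Rightarrow> real ^ 'd ^ 'n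
      \<Rightarrow> (real ^ 'd ^ 'p) \<times> (real ^ 'd ^ 'd) \<Rightarrow> real" where
  "likelihood h X y = (\<lambda>(\<beta>, S). \<Prod>i\<in>UNIV.
     (LINT u|pos_measure.
        u powr (CARD('d) / 2) / ((2 * pi) powr (CARD('d) / 2) * det S powr (1/2))
        * exp (- (u / 2) * sq_resid X y \<beta> S i) * h u))"

definition posterior_density ::
    "(real \<Rightarrow> real) \<Rightarrow> real \<Rightarrow> real ^ 'p ^ 'n \<Rightarrow> real ^ 'd ^ 'n
      \<Rightarrow> (real ^ 'd ^ 'p) \<times> (real ^ 'd ^ 'd) \<Rightarrow> real" where
  "posterior_density h a X y =
     normalized state_measure (\<lambda>(\<beta>, S). likelihood h X y (\<beta>, S) * det S powr (- a))"

definition posterior ::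
    "(real \<Rightarrow> real) \<Rightarrow> real \<Rightarrow> real ^ 'p ^ 'n \<Rightarrow> real ^ 'd ^ 'n
      \<Rightarrow> ((real ^ 'd ^ 'p) \<times> (real ^ 'd ^ 'd)) measure" where
  "posterior h a X y = density state_measure (\<lambda>x. ennreal (posterior_density h a X y x))"


section \<open>Conditional densities\<close>

definition psi_density :: "nat \<Rightarrow> (real \<Rightarrow> real) \<Rightarrow> real \<Rightarrow> real \<Rightarrow> real" where
  "psi_density d h s =
     normalized pos_measure (\<lambda>u. u powr (d / 2) * exp (- (s * u / 2)) * h u)"

definition cond_z ::
    "(real \<Rightarrow> real) \<Rightarrow> real ^ 'p ^ 'n \<Rightarrow> real ^ 'd ^ 'n
      \<Rightarrow> (real ^ 'd ^ 'p) \<times> (real ^ 'd ^ 'd) \<Rightarrow> real ^ 'n \<Rightarrow> real" where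
  "cond_z h X y = (\<lambda>(\<beta>, S) z.
     \<Prod>i\<in>UNIV. psi_density CARD('d) h (sq_resid X y \<beta> S i) (z $ i))"

definition Q_mat :: "real ^ 'n \<Rightarrow> real ^ 'n ^ 'n" where
  "Q_mat z = (\<chi> i j. if i = j then inverse (z $ i) else 0)"

definition Omega_mat :: "real ^ 'p ^ 'n \<Rightarrow> real ^ 'n \<Rightarrow> real ^ 'p ^ 'p" where
  "Omega_mat X z = matrix_inv (transpose X ** matrix_inv (Q_mat z) ** X)"

definition mu_mat :: "real ^ 'p ^ 'n \<Rightarrow> real ^ 'd ^ 'n \<Rightarrow> real ^ 'n \<Rightarrow> real ^ 'd ^ 'p" where
  "mu_mat X y z =
     matrix_inv (transpose X ** matrix_inv (Q_mat z) ** X) ** transpose X ** matrix_inv (Q_mat z) ** y"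

definition inv_wishart_density :: "real \<Rightarrow> real ^ 'r ^ 'r \<Rightarrow> real ^ 'r ^ 'r \<Rightarrow> real" where
  "inv_wishart_density m \<Theta> = normalized spd_measure
     (\<lambda>w. det w powr (- (m + CARD('r) + 1) / 2)
          * exp (- (1/2) * trace (matrix_inv \<Theta> ** matrix_inv w)))"

definition matrix_normal_density ::
    "real ^ 'c ^ 'r \<Rightarrow> real ^ 'r ^ 'r \<Rightarrow> real ^ 'c ^ 'c \<Rightarrow> real ^ 'c ^ 'r \<Rightarrow> real" where
  "matrix_normal_density \<theta> A B z =
     (2 * pi) powr (- (real CARD('r) * real CARD('c)) / 2)
     * det A powr (- real CARD('c) / 2) * det B powr (- real CARD('r) / 2)
     * exp (- (1/2) * trace (matrix_inv A ** (z - \<theta>) ** matrix_inv B ** transpose (z - \<theta>)))"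

definition cond_Sigma ::
    "real \<Rightarrow> real ^ 'p ^ 'n \<Rightarrow> real ^ 'd ^ 'n \<Rightarrow> real ^ 'n \<Rightarrow> real ^ 'd ^ 'd \<Rightarrow> real" where
  "cond_Sigma a X y z = inv_wishart_density
     (real CARD('n) - real CARD('p) + 2 * a - real CARD('d) - 1)
     (matrix_inv (transpose y ** matrix_inv (Q_mat z) ** y
        - transpose (mu_mat X y z) ** matrix_inv (Omega_mat X z) ** mu_mat X y z))"

definition cond_beta ::
    "real ^ 'p ^ 'n \<Rightarrow> real ^ 'd ^ 'n \<Rightarrow> real ^ 'd ^ 'd \<Rightarrow> real ^ 'n \<Rightarrow> real ^ 'd ^ 'p \<Rightarrow> real" where
  "cond_beta X y S z = matrix_normal_density (mu_mat X y z) (Omega_mat X z) S"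


section \<open>The two Markov chains\<close>

text \<open>Transition densities take the new state first, the current state second.\<close>

definition da_kernel ::
    "(real \<Rightarrow> real) \<Rightarrow> real \<Rightarrow> real ^ 'p ^ 'n \<Rightarrow> real ^ 'd ^ 'n
      \<Rightarrow> (real ^ 'd ^ 'p) \<times> (real ^ 'd ^ 'd) \<Rightarrow> (real ^ 'd ^ 'p) \<times> (real ^ 'd ^ 'd) \<Rightarrow> real" where
  "da_kernel h a X y = (\<lambda>(\<beta>', S') x.
     LINT z|orthant_measure. cond_beta X y S' z \<beta>' * cond_Sigma a X y z S' * cond_z h X y x z)"

definition haar_weight :: "nat \<Rightarrow> real \<Rightarrow> (real \<Rightarrow> real) \<Rightarrow> real ^ 'n \<Rightarrow> real \<Rightarrow> real" where
  "haar_weight d a h z t =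
     t powr (real CARD('n) + (real d + 1 - 2 * a) * real d / 2 - 1) * (\<Prod>i\<in>UNIV. h (t * z $ i))"

definition haar_density :: "nat \<Rightarrow> real \<Rightarrow> (real \<Rightarrow> real) \<Rightarrow> real ^ 'n \<Rightarrow> real \<Rightarrow> real" where
  "haar_density d a h z = normalized pos_measure (haar_weight d a h z)"

definition haar_kernel ::
    "(real \<Rightarrow> real) \<Rightarrow> real \<Rightarrow> real ^ 'p ^ 'n \<Rightarrow> real ^ 'd ^ 'n
      \<Rightarrow> (real ^ 'd ^ 'p) \<times> (real ^ 'd ^ 'd) \<Rightarrow> (real ^ 'd ^ 'p) \<times> (real ^ 'd ^ 'd) \<Rightarrow> real" where
  "haar_kernel h a X y = (\<lambda>(\<beta>', S') x.
     LINT z'|orthant_measure. LINT v|pos_measure.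
       cond_beta X y S' (v *\<^sub>R z') \<beta>' * cond_Sigma a X y (v *\<^sub>R z') S'
       * haar_density CARD('d) a h z' v * cond_z h X y x z')"

definition kernel_op :: "'a measure \<Rightarrow> ('a \<Rightarrow> 'a \<Rightarrow> real) \<Rightarrow> ('a \<Rightarrow> real) \<Rightarrow> 'a \<Rightarrow> real" where
  "kernel_op M k f x = (LINT x'|M. f x' * k x' x)"


section \<open>Trace-class operators on the mean-zero square-integrable functions\<close>

text \<open>Elements of \<open>L\<^sub>0\<^sup>2\<close> are represented by functions; everything below is modulo \<open>M\<close>-null sets.\<close>

definition L20 :: "'a measure \<Rightarrow> ('a \<Rightarrow> real) set" where
  "L20 M = {f \<in> borel_measurable M. integrable M (\<lambda>x. (f x)\<^sup>2) \<and> (LINT x|M. f x) = 0}"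

definition L2_norm_on :: "'a measure \<Rightarrow> ('a \<Rightarrow> real) \<Rightarrow> real" where
  "L2_norm_on M f = sqrt (LINT x|M. f x * f x)"

definition linear_op_L20 :: "'a measure \<Rightarrow> (('a \<Rightarrow> real) \<Rightarrow> 'a \<Rightarrow> real) \<Rightarrow> bool" where
  "linear_op_L20 M T \<longleftrightarrow>
     (\<forall>f\<in>L20 M. T f \<in> L20 M) \<and>
     (\<forall>f\<in>L20 M. \<forall>g\<in>L20 M. (AE x in M. f x = g x) \<longrightarrow> (AE x in M. T f x = T g x)) \<and>
     (\<forall>f\<in>L20 M. \<forall>g\<in>L20 M. \<forall>a b.
        AE x in M. T (\<lambda>x. a * f x + b * g x) x = a * T f x + b * T g x)"

definition compact_op_L20 :: "'a measure \<Rightarrow> (('a \<Rightarrow> real) \<Rightarrow> 'a \<Rightarrow> real) \<Rightarrow> bool" where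
  "compact_op_L20 M T \<longleftrightarrow> linear_op_L20 M T \<and>
     (\<forall>F :: nat \<Rightarrow> 'a \<Rightarrow> real.
        (\<forall>n. F n \<in> L20 M) \<and> (\<exists>C. \<forall>n. L2_norm_on M (F n) \<le> C) \<longrightarrow>
        (\<exists>g\<in>L20 M. \<exists>r :: nat \<Rightarrow> nat. strict_mono r \<and>
           (\<lambda>n. L2_norm_on M (\<lambda>x. T (F (r n)) x - g x)) \<longlonglongrightarrow> 0))"

definition eigenspace :: "'a measure \<Rightarrow> (('a \<Rightarrow> real) \<Rightarrow> 'a \<Rightarrow> real) \<Rightarrow> real \<Rightarrow> ('a \<Rightarrow> real) set" where
  "eigenspace M T c = {f \<in> L20 M. AE x in M. T f x = c * f x}"

definition eigenvalues :: "'a measure \<Rightarrow> (('a \<Rightarrow> real) \<Rightarrow> 'a \<Rightarrow> real) \<Rightarrow> real set" where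
  "eigenvalues M T = {c. \<exists>f\<in>eigenspace M T c. \<not> (AE x in M. f x = 0)}"

definition AE_independent :: "'a measure \<Rightarrow> ('a \<Rightarrow> real) set \<Rightarrow> bool" where
  "AE_independent M B \<longleftrightarrow>
     (\<forall>w. (AE x in M. (\<Sum>f\<in>B. w f * f x) = 0) \<longrightarrow> (\<forall>f\<in>B. w f = 0))"

text \<open>Dimension of the eigenspace (possibly \<open>\<infinity>\<close>) as a subspace of \<open>L\<^sub>0\<^sup>2\<close>.\<close>

definition multiplicity_of :: "'a measure \<Rightarrow> (('a \<Rightarrow> real) \<Rightarrow> 'a \<Rightarrow> real) \<Rightarrow> real \<Rightarrow> ennreal" where
  "multiplicity_of M T c =
     (SUP B \<in> {B. finite B \<and> B \<subseteq> eigenspace M T c \<and> AE_independent M B}. of_nat (card B))"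

text \<open>Compact with summable eigenvalues, counted with multiplicity. Both operators this is used for
  are self-adjoint (the chains are reversible with respect to the posterior), so that all eigenvalues
  are real and geometric and algebraic multiplicities agree. The sum is taken in \<open>[0,\<infinity>]\<close>, where
  \<open>\<infinity> \<cdot> 0 = 0\<close>, hence a possibly infinite-dimensional kernel does not contribute.\<close>

definition trace_class_L20 :: "'a measure \<Rightarrow> (('a \<Rightarrow> real) \<Rightarrow> 'a \<Rightarrow> real) \<Rightarrow> bool" where
  "trace_class_L20 M T \<longleftrightarrow> compact_op_L20 M T \<and>
     (\<Sum>\<^sub>\<infinity>c\<in>eigenvalues M T. multiplicity_of M T c * ennreal \<bar>c\<bar>) < \<infinity>"

end

theory Submission
  imports Defs "HOL-Probability.Probability" "HOL-Library.Diagonal_Subsequence"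
begin

text \<open>
  Write \<open>x = (\<beta>, \<Sigma>)\<close>, let \<open>\<pi>(x, z)\<close> be the joint density of parameters and latent data, let \<open>P g (x) = E[g(z) | x]\<close>
  and let \<open>P'\<close> be the adjoint of \<open>P\<close>.
  The DA operator is \<open>K = P P'\<close>, so its trace is the squared Hilbert-Schmidt norm of \<open>P\<close>,
  \<open>\<integral>\<integral> \<pi>(x | z) \<pi>(z | x) dz dx\<close>. Bounding the normalising constant of \<open>\<psi>(\<cdot>; s)\<close> below by its part on \<open>(0, 3u/2)\<close> gives
  \<open>\<psi>(u; s) \<le> \<phi>(u) e\<^bsup>su/4\<^esup>\<close> with \<open>\<phi>(u) = u\<^bsup>d/2\<^esup> h(u) / \<integral>\<^sub>0\<^bsup>3u/2\<^esup> v\<^bsup>d/2\<^esup> h(v) dv\<close>. The exponential factors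
  merely replace \<open>z\<close> by \<open>z/2\<close> in the Gaussian kernel \<open>\<pi>(x | z)\<close>, whose integral over \<open>x\<close> is homogeneous in \<open>z\<close>;
  so the trace is at most a constant times \<open>(\<integral> \<phi>)\<^sup>n\<close>. The integral of \<open>\<phi>\<close> is finite near \<open>\<infinity>\<close> by the moment condition (S3), and near
  \<open>0\<close> because \<open>h(u) = O(u\<^sup>\<epsilon> h(v))\<close> uniformly for \<open>5u/4 \<le> v \<le> 3u/2\<close> in all four families.

  The Haar step is a conditional expectation \<open>R\<close> on functions of \<open>z\<close> (onto the scale-invariant ones), so
  \<open>K\<^sup>* = P R P' = (P R) (P R)'\<close>, and \<open>P R\<close> has a Hilbert-Schmidt norm not exceeding that of \<open>P\<close>.
\<close>


section \<open>Square-integrable functions\<close>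

text \<open>Trace class here means compactness together with summable eigenvalues, so the
  Hilbert-Schmidt bound must yield both. Each is reduced to an estimate that is uniform over finite
  orthonormal families: the sum of \<open>ip M (T e) e\<close> controls the eigenvalues with
  multiplicity, the sum of the squared norms of \<open>T e\<close> forces compactness. The factor
  3/2 balances two demands on a dilation factor k. Cutting the normalising integral at ku gives
  \<psi>(u; s) \<le> \<phi>(u) exp((k - 1)su/2). The Gaussian kernel, which carries exp(-su/2), must
  survive this factor, so k < 2. Near 0, \<phi> is controlled by comparing h(u) with the values of h
  at larger points, so k > 1. The scale symmetry (\<Sigma>, z) -> (c\<Sigma>, cz) is used twice. It
  makes the ratio of the Gaussian integrals at z/2 and at z a constant, so that the integral over z
  factorises. It also identifies the law of v in the Haar step as the law of the position on the ray
  through z under the marginal law of z, which is why averaging over v is a conditional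
  expectation.\<close>

definition L2 :: "'a measure \<Rightarrow> ('a \<Rightarrow> real) set" where
  "L2 M = {f \<in> borel_measurable M. integrable M (\<lambda>x. (f x)\<^sup>2)}"

definition ip :: "'a measure \<Rightarrow> ('a \<Rightarrow> real) \<Rightarrow> ('a \<Rightarrow> real) \<Rightarrow> real" where
  "ip M f g = (LINT x|M. f x * g x)"

text \<open>Only finite families occur: traces and Hilbert-Schmidt norms are expressed by bounds
  uniform over them, so that no basis of the space has to be chosen.\<close>

definition orthonormal_set :: "'a measure \<Rightarrow> ('a \<Rightarrow> real) set \<Rightarrow> bool" where
  "orthonormal_set M E \<longleftrightarrow> finite E \<and> E \<subseteq> L20 M \<and>
     (\<forall>e\<in>E. \<forall>f\<in>E. ip M e f = (if e = f then 1 else 0))"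

definition proj :: "'a measure \<Rightarrow> ('a \<Rightarrow> real) set \<Rightarrow> ('a \<Rightarrow> real) \<Rightarrow> 'a \<Rightarrow> real" where
  "proj M E f x = (\<Sum>e\<in>E. ip M f e * e x)"

lemma L2_norm_on_ip: "L2_norm_on M f = sqrt (ip M f f)"
  by (simp add: L2_norm_on_def ip_def)

lemma L20_subset_L2: "f \<in> L20 M \<Longrightarrow> f \<in> L2 M"
  by (simp add: L20_def L2_def)

lemma L2_measurable [measurable_dest]: "f \<in> L2 M \<Longrightarrow> f \<in> borel_measurable M"
  by (simp add: L2_def)

lemma L2_integrable_mult:
  assumes "f \<in> L2 M" "g \<in> L2 M"
  shows "integrable M (\<lambda>x. f x * g x)"
proof (rule Bochner_Integration.integrable_bound)
  show "integrable M (\<lambda>x. (f x)\<^sup>2 + (g x)\<^sup>2)"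
    using assms by (auto simp: L2_def)
  show "(\<lambda>x. f x * g x) \<in> borel_measurable M"
    using assms by (auto simp: L2_def)
  have "\<bar>a * b\<bar> \<le> \<bar>a\<^sup>2 + b\<^sup>2\<bar>" for a b :: real
  proof -
    have "0 \<le> (\<bar>a\<bar> - \<bar>b\<bar>)\<^sup>2" by simp
    then have "2 * (\<bar>a\<bar> * \<bar>b\<bar>) \<le> a\<^sup>2 + b\<^sup>2" by (simp add: power2_diff)
    moreover have "0 \<le> \<bar>a\<bar> * \<bar>b\<bar>" by simp
    ultimately show ?thesis unfolding abs_mult by linarith
  qed
  then show "AE x in M. norm (f x * g x) \<le> norm ((f x)\<^sup>2 + (g x)\<^sup>2)" by simp
qed

lemma L2_cmult: "f \<in> L2 M \<Longrightarrow> (\<lambda>x. c * f x) \<in> L2 M"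
  by (auto simp: L2_def power_mult_distrib)

lemma L2_add: "f \<in> L2 M \<Longrightarrow> g \<in> L2 M \<Longrightarrow> (\<lambda>x. f x + g x) \<in> L2 M"
  using L2_integrable_mult[of f M g] by (auto simp: L2_def power2_sum mult.assoc)

lemma L2_diff: "f \<in> L2 M \<Longrightarrow> g \<in> L2 M \<Longrightarrow> (\<lambda>x. f x - g x) \<in> L2 M"
  using L2_add[OF _ L2_cmult[of g M "-1"], of f] by simp

lemma L2_sum: "finite E \<Longrightarrow> (\<And>e. e \<in> E \<Longrightarrow> F e \<in> L2 M) \<Longrightarrow> (\<lambda>x. \<Sum>e\<in>E. F e x) \<in> L2 M"
proof (induction E rule: finite_induct)
  case empty then show ?case by (simp add: L2_def)
next
  case (insert a E) then show ?case using L2_add[of "F a" M "\<lambda>x. \<Sum>e\<in>E. F e x"] by auto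
qed

lemma ip_commute: "ip M f g = ip M g f"
  by (simp add: ip_def mult.commute)

lemma ip_cmult_left: "ip M (\<lambda>x. c * f x) g = c * ip M f g"
  by (simp add: ip_def mult.assoc)

lemma ip_add_left: "f \<in> L2 M \<Longrightarrow> f' \<in> L2 M \<Longrightarrow> g \<in> L2 M \<Longrightarrow>
    ip M (\<lambda>x. f x + f' x) g = ip M f g + ip M f' g"
  by (simp add: ip_def distrib_right L2_integrable_mult)

lemma ip_diff_left: "f \<in> L2 M \<Longrightarrow> f' \<in> L2 M \<Longrightarrow> g \<in> L2 M \<Longrightarrow>
    ip M (\<lambda>x. f x - f' x) g = ip M f g - ip M f' g"
  by (simp add: ip_def left_diff_distrib L2_integrable_mult)

lemma ip_sum_left: "finite E \<Longrightarrow> (\<And>e. e \<in> E \<Longrightarrow> F e \<in> L2 M) \<Longrightarrow> g \<in> L2 M \<Longrightarrow>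
    ip M (\<lambda>x. \<Sum>e\<in>E. F e x) g = (\<Sum>e\<in>E. ip M (F e) g)"
  unfolding ip_def sum_distrib_right
  by (rule Bochner_Integration.integral_sum) (auto intro: L2_integrable_mult)

lemma ip_nonneg: "0 \<le> ip M f f"
  by (simp add: ip_def)

lemma ip_cong_AE:
  assumes "f \<in> borel_measurable M" "f' \<in> borel_measurable M" "g \<in> borel_measurable M"
    "AE x in M. f x = f' x"
  shows "ip M f g = ip M f' g"
  unfolding ip_def using assms by (intro integral_cong_AE) auto

lemma ip_self_cong_AE:
  assumes "f \<in> L2 M" "g \<in> L2 M" "AE x in M. f x = g x"
  shows "ip M f f = ip M g g"
  unfolding ip_def using assms by (intro integral_cong_AE) (auto simp: L2_def)

lemma ip_eq_0_iff: "f \<in> L2 M \<Longrightarrow> ip M f f = 0 \<longleftrightarrow> (AE x in M. f x = 0)"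
  unfolding ip_def using integral_nonneg_eq_0_iff_AE[of M "\<lambda>x. f x * f x"] L2_integrable_mult[of f M f]
  by auto

text \<open>The squared norm of f + t g is a nonnegative quadratic polynomial in t, evaluated at its
  minimiser. If g has norm 0, it vanishes almost everywhere and both sides are 0.\<close>

lemma ip_cauchy_schwarz:
  assumes "f \<in> L2 M" "g \<in> L2 M"
  shows "(ip M f g)\<^sup>2 \<le> ip M f f * ip M g g"
proof -
  have main: "0 \<le> ip M f f + 2 * t * ip M f g + t\<^sup>2 * ip M g g" for t
  proof -
    have tg: "(\<lambda>x. t * g x) \<in> L2 M" using assms by (simp add: L2_cmult)
    let ?k = "\<lambda>x. f x + t * g x"
    have lin: "ip M ?k h = ip M f h + t * ip M g h" if "h \<in> L2 M" for h
      using assms tg that by (simp add: ip_add_left ip_cmult_left)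
    have "ip M ?k ?k = ip M ?k f + t * ip M ?k g"
      using lin[OF L2_add[OF assms(1) tg]] by (simp only: ip_commute[of M f ?k] ip_commute[of M g ?k])
    also have "\<dots> = ip M f f + 2 * t * ip M f g + t\<^sup>2 * ip M g g"
      by (simp only: lin assms ip_commute[of M g f]) (simp add: power2_eq_square algebra_simps)
    finally show ?thesis using ip_nonneg[of M ?k] by simp
  qed
  show ?thesis
  proof (cases "ip M g g = 0")
    case True
    have "AE x in M. g x = 0" using True ip_eq_0_iff assms by blast
    then have "ip M g f = ip M (\<lambda>x. 0) f"
      using assms by (intro ip_cong_AE) (auto simp: L2_def)
    then show ?thesis using True by (simp add: ip_commute[of M f g]) (simp add: ip_def)
  next
    case False
    then have pos: "ip M g g > 0" using ip_nonneg[of M g] by linarith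
    have "0 \<le> ip M f f + 2 * (- ip M f g / ip M g g) * ip M f g + (- ip M f g / ip M g g)\<^sup>2 * ip M g g"
      by (rule main)
    then show ?thesis using pos by (simp add: field_simps power2_eq_square)
  qed
qed

lemma proj_L2: "finite E \<Longrightarrow> E \<subseteq> L2 M \<Longrightarrow> proj M E f \<in> L2 M"
  unfolding proj_def[abs_def] by (rule L2_sum) (auto intro: L2_cmult)

lemma orthonormal_setD:
  assumes "orthonormal_set M E"
  shows "finite E" "E \<subseteq> L20 M" "E \<subseteq> L2 M" "\<And>e f. e \<in> E \<Longrightarrow> f \<in> E \<Longrightarrow> ip M e f = (if e = f then 1 else 0)"
  using assms L20_subset_L2 by (auto simp: orthonormal_set_def)

lemma orthonormal_set_insert:
  assumes E: "orthonormal_set M E" and g: "g \<in> L20 M" "ip M g g = 1"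
    and orth: "\<And>e. e \<in> E \<Longrightarrow> ip M g e = 0"
  shows "orthonormal_set M (insert g E)" "g \<notin> E"
proof -
  show nin: "g \<notin> E" using orth g(2) by force
  have "ip M e f = (if e = f then 1 else 0)" if "e \<in> insert g E" "f \<in> insert g E" for e f
  proof (cases "e = g"; cases "f = g")
    assume "e = g" "f = g" then show ?thesis using g by simp
  next
    assume "e = g" "f \<noteq> g" then show ?thesis using that orth[of f] by simp
  next
    assume "e \<noteq> g" "f = g" then show ?thesis using that orth[of e] by (simp add: ip_commute[of M e g])
  next
    assume "e \<noteq> g" "f \<noteq> g" then show ?thesis using that orthonormal_setD(4)[OF E] by simp
  qed
  then show "orthonormal_set M (insert g E)"
    using E g(1) by (auto simp: orthonormal_set_def)
qed

lemma residual_orthogonal: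
  assumes E: "orthonormal_set M E" and f: "f \<in> L2 M" and e: "e \<in> E"
  shows "ip M (\<lambda>x. f x - proj M E f x) e = 0"
proof -
  note D = orthonormal_setD[OF E]
  have "ip M (proj M E f) e = (\<Sum>e'\<in>E. ip M (\<lambda>x. ip M f e' * e' x) e)"
    unfolding proj_def[abs_def] using D e by (intro ip_sum_left) (auto intro: L2_cmult)
  also have "\<dots> = (\<Sum>e'\<in>E. if e' = e then ip M f e' else 0)"
    using D e by (intro sum.cong) (auto simp: ip_cmult_left)
  also have "\<dots> = ip M f e" using D e by simp
  finally show ?thesis using f D e proj_L2[of E M f] by (subst ip_diff_left) auto
qed

text \<open>Pythagoras: the residual r is orthogonal to the projection, hence <r, r> = <r, f>. The
  equality gives Bessel's inequality and also shows that passing to the residual does not increase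
  the norm, which the compactness proof uses.\<close>

lemma residual_norm:
  assumes E: "orthonormal_set M E" and f: "f \<in> L2 M"
  shows "ip M (\<lambda>x. f x - proj M E f x) (\<lambda>x. f x - proj M E f x) = ip M f f - (\<Sum>e\<in>E. (ip M f e)\<^sup>2)"
proof -
  note D = orthonormal_setD[OF E]
  let ?r = "\<lambda>x. f x - proj M E f x"
  have p: "proj M E f \<in> L2 M" using D proj_L2[of E M f] by auto
  have r: "?r \<in> L2 M" using f p by (rule L2_diff)
  have "ip M (proj M E f) ?r = (\<Sum>e\<in>E. ip M (\<lambda>x. ip M f e * e x) ?r)"
    unfolding proj_def[abs_def] using D r by (intro ip_sum_left) (auto intro: L2_cmult simp: proj_def)
  also have "\<dots> = 0"
    using residual_orthogonal[OF E f] by (simp add: ip_cmult_left ip_commute[of M _ ?r])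
  finally have 1: "ip M ?r ?r = ip M f ?r"
    using f p r by (simp add: ip_diff_left)
  have "ip M (proj M E f) f = (\<Sum>e\<in>E. ip M (\<lambda>x. ip M f e * e x) f)"
    unfolding proj_def[abs_def] using D f by (intro ip_sum_left) (auto intro: L2_cmult)
  also have "\<dots> = (\<Sum>e\<in>E. (ip M f e)\<^sup>2)"
    by (simp add: ip_cmult_left ip_commute[of M _ f] power2_eq_square)
  finally have "ip M ?r f = ip M f f - (\<Sum>e\<in>E. (ip M f e)\<^sup>2)"
    using f p by (simp add: ip_diff_left)
  then show ?thesis using 1 by (simp add: ip_commute)
qed

lemma bessel_inequality:
  "orthonormal_set M E \<Longrightarrow> f \<in> L2 M \<Longrightarrow> (\<Sum>e\<in>E. (ip M f e)\<^sup>2) \<le> ip M f f"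
  using residual_norm[of M E f] ip_nonneg[of M "\<lambda>x. f x - proj M E f x"] by linarith

section \<open>Mean-zero functions over a finite measure: orthonormalisation and
  completeness\<close>

context finite_measure
begin

lemma L2_const: "(\<lambda>x. c) \<in> L2 M"
  by (simp add: L2_def)

text \<open>Mean zero is orthogonality to the constant 1, which is square-integrable because the
  measure is finite; closure properties then follow from linearity of \<open>ip\<close>.\<close>

lemma L20_iff: "f \<in> L20 M \<longleftrightarrow> f \<in> L2 M \<and> ip M f (\<lambda>x. 1) = 0"
  by (auto simp: L20_def L2_def ip_def)

lemma L20_cmult: "f \<in> L20 M \<Longrightarrow> (\<lambda>x. c * f x) \<in> L20 M"
  by (simp add: L20_iff L2_cmult ip_cmult_left)

lemma L20_add: "f \<in> L20 M \<Longrightarrow> g \<in> L20 M \<Longrightarrow> (\<lambda>x. f x + g x) \<in> L20 M"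
  by (simp add: L20_iff L2_add ip_add_left L2_const)

lemma L20_diff: "f \<in> L20 M \<Longrightarrow> g \<in> L20 M \<Longrightarrow> (\<lambda>x. f x - g x) \<in> L20 M"
  by (simp add: L20_iff L2_diff ip_diff_left L2_const)

lemma L20_zero: "(\<lambda>x. 0) \<in> L20 M"
  by (simp add: L20_def)

lemma AE_independentD:
  "AE_independent M B \<Longrightarrow> AE x in M. (\<Sum>f\<in>B. w f * f x) = 0 \<Longrightarrow> f \<in> B \<Longrightarrow> w f = 0"
  unfolding AE_independent_def by blast

text \<open>The subspace \<open>U\<close> is arbitrary so that the orthonormal family can be kept
  inside an eigenspace. The last clause, that every \<open>e\<close> is a combination of members of
  \<open>B\<close>, is carried for the induction: it lets independence of \<open>insert b B\<close>
  be applied to the residual of \<open>b\<close>.\<close>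

lemma gram_schmidt:
  assumes "finite B" "B \<subseteq> U" "U \<subseteq> L20 M" "(\<lambda>x. 0) \<in> U"
    and U: "\<And>f g a b. f \<in> U \<Longrightarrow> g \<in> U \<Longrightarrow> (\<lambda>x. a * f x + b * g x) \<in> U"
    and "AE_independent M B"
  shows "\<exists>E. orthonormal_set M E \<and> E \<subseteq> U \<and> card E = card B \<and>
    (\<forall>e\<in>E. \<exists>w. \<forall>x. e x = (\<Sum>f\<in>B. w f * f x))"
  using assms(1,2,6)
proof (induction B rule: finite_induct)
  case empty
  then show ?case by (intro exI[of _ "{}"]) (auto simp: orthonormal_set_def)
next
  case (insert b B)
  have "AE_independent M B"
    unfolding AE_independent_def
  proof safe
    fix w f assume w: "AE x in M. (\<Sum>f\<in>B. w f * f x) = 0" and "f \<in> B"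
    let ?w = "\<lambda>f. if f = b then 0 else w f"
    have "(\<Sum>f\<in>insert b B. ?w f * f x) = (\<Sum>f\<in>B. w f * f x)" for x
      using insert.hyps by (subst sum.insert) (auto intro!: sum.cong)
    with w have "AE x in M. (\<Sum>f\<in>insert b B. ?w f * f x) = 0" by simp
    from AE_independentD[OF insert.prems(2) this insertI2[OF \<open>f \<in> B\<close>]]
    have "?w f = 0" .
    then show "w f = 0" using insert.hyps \<open>f \<in> B\<close> by (auto split: if_splits)
  qed
  then obtain E where E: "orthonormal_set M E" "E \<subseteq> U" "card E = card B"
    and span: "\<forall>e\<in>E. \<exists>w. \<forall>x. e x = (\<Sum>f\<in>B. w f * f x)"
    using insert.IH insert.prems by auto
  note D = orthonormal_setD[OF E(1)]
  obtain w where w: "\<And>e x. e \<in> E \<Longrightarrow> e x = (\<Sum>f\<in>B. w e f * f x)"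
    using bchoice[OF span] by blast
  define g where "g x = b x - proj M E b x" for x
  have bU: "b \<in> U" and bL: "b \<in> L2 M" using insert.prems assms(3) L20_subset_L2 by auto
  have sumU: "finite F \<Longrightarrow> F \<subseteq> U \<Longrightarrow> (\<lambda>x. \<Sum>e\<in>F. ip M b e * e x) \<in> U" for F
  proof (induction F rule: finite_induct)
    case empty then show ?case using assms by simp
  next
    case (insert e F) 
    then show ?case using U[of e "\<lambda>x. \<Sum>e\<in>F. ip M b e * e x" "ip M b e" 1] by simp
  qed
  have gU: "g \<in> U"
    using U[OF bU sumU[OF D(1) E(2)], of 1 "-1"] by (simp add: g_def[abs_def] proj_def)
  have gL: "g \<in> L2 M" "g \<in> L20 M" using gU assms(3) L20_subset_L2[of g M] by auto
  have comb: "b x - g x = (\<Sum>f\<in>B. (\<Sum>e\<in>E. ip M b e * w e f) * f x)" for x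
  proof -
    have "b x - g x = (\<Sum>e\<in>E. ip M b e * e x)" by (simp add: g_def proj_def)
    also have "\<dots> = (\<Sum>e\<in>E. ip M b e * (\<Sum>f\<in>B. w e f * f x))"
      by (intro sum.cong refl arg_cong[where f="\<lambda>t. _ * t"] w)
    also have "\<dots> = (\<Sum>f\<in>B. (\<Sum>e\<in>E. ip M b e * w e f) * f x)"
      by (subst sum_distrib_left, subst sum.swap) (simp add: sum_distrib_right mult.assoc)
    finally show ?thesis .
  qed
  \<comment> \<open>The coefficient of \<open>b\<close> is 1, so a residual that vanishes almost
    everywhere would contradict independence.\<close>
  define W where "W f = (if f = b then 1 else - (\<Sum>e\<in>E. ip M b e * w e f))" for f
  have gW: "g x = (\<Sum>f\<in>insert b B. W f * f x)" for x
  proof -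
    have "(\<Sum>f\<in>insert b B. W f * f x) = b x + (\<Sum>f\<in>B. W f * f x)"
      using insert.hyps by (simp add: W_def)
    also have "(\<Sum>f\<in>B. W f * f x) = (\<Sum>f\<in>B. - ((\<Sum>e\<in>E. ip M b e * w e f) * f x))"
      using insert.hyps by (intro sum.cong) (auto simp: W_def)
    also have "\<dots> = g x - b x" using comb[of x] by (simp add: sum_negf)
    finally show ?thesis by simp
  qed
  have "ip M g g \<noteq> 0"
  proof
    assume "ip M g g = 0"
    then have "AE x in M. g x = 0" using ip_eq_0_iff gL by blast
    then have "AE x in M. (\<Sum>f\<in>insert b B. W f * f x) = 0" using gW by simp
    from AE_independentD[OF insert.prems(2) this insertI1] have "W b = 0" .
    then show False by (simp add: W_def)
  qed
  then have pos: "ip M g g > 0" using ip_nonneg[of M g] by linarith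
  define e' where "e' x = (1 / sqrt (ip M g g)) * g x" for x
  have e'U: "e' \<in> U" using U[OF gU gU, of "1 / sqrt (ip M g g)" 0] by (simp add: e'_def[abs_def])
  have orth: "ip M e' e = 0" if "e \<in> E" for e
  proof -
    have "ip M e' e = (1 / sqrt (ip M g g)) * ip M g e" by (subst e'_def[abs_def]) (rule ip_cmult_left)
    then show ?thesis using residual_orthogonal[OF E(1) bL that] by (simp add: g_def[abs_def])
  qed
  have unit: "ip M e' e' = 1"
  proof -
    have "ip M e' e' = (1 / sqrt (ip M g g)) * ip M g e'"
      by (subst (1) e'_def[abs_def]) (rule ip_cmult_left)
    also have "ip M g e' = (1 / sqrt (ip M g g)) * ip M g g"
      by (subst ip_commute, subst e'_def[abs_def]) (rule ip_cmult_left)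
    also have "(1 / sqrt (ip M g g)) * ((1 / sqrt (ip M g g)) * ip M g g) = 1" using pos by (simp add: field_simps)
    finally show ?thesis .
  qed
  have ON: "orthonormal_set M (insert e' E)" and nin: "e' \<notin> E"
    using orthonormal_set_insert[OF E(1) _ unit orth] e'U assms(3) by auto
  have "\<exists>w. \<forall>x. e x = (\<Sum>f\<in>insert b B. w f * f x)" if e: "e \<in> insert e' E" for e
  proof (cases "e = e'")
    case True
    then show ?thesis
      by (intro exI[of _ "\<lambda>f. (1 / sqrt (ip M g g)) * W f"])
        (simp only: e'_def gW sum_distrib_left mult.assoc simp_thms)
  next
    case False
    then have eE: "e \<in> E" using e by simp
    show ?thesis
    proof (intro exI allI)
      fix x
      have "(\<Sum>f\<in>insert b B. (if f = b then 0 else w e f) * f x) = (\<Sum>f\<in>B. w e f * f x)"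
        using insert.hyps by (subst sum.insert) (auto intro!: sum.cong)
      then show "e x = (\<Sum>f\<in>insert b B. (if f = b then 0 else w e f) * f x)"
        by (simp only: w[OF eE, symmetric])
    qed
  qed
  moreover have "card (insert e' E) = card (insert b B)" using nin D(1) E(3) insert.hyps by simp
  ultimately show ?case using ON e'U E(2)
    by (intro exI[of _ "insert e' E"]) auto
qed

text \<open>Riesz-Fischer. A subsequence with rapidly decreasing increments has increments summable
  in L1, the measure being finite, so it converges almost everywhere. Fatou's lemma then transfers
  the Cauchy bounds to the limit.\<close>

lemma L20_complete:
  fixes F :: "nat \<Rightarrow> 'a \<Rightarrow> real"
  assumes F: "\<And>n. F n \<in> L20 M"
    and Cauchy: "\<And>\<epsilon>. \<epsilon> > 0 \<Longrightarrow> \<exists>N. \<forall>m\<ge>N. \<forall>n\<ge>N. ip M (\<lambda>x. F m x - F n x) (\<lambda>x. F m x - F n x) < \<epsilon>"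
  shows "\<exists>g\<in>L20 M. (\<lambda>n. ip M (\<lambda>x. F n x - g x) (\<lambda>x. F n x - g x)) \<longlonglongrightarrow> 0"
proof -
  let ?d = "\<lambda>m n. ip M (\<lambda>x. F m x - F n x) (\<lambda>x. F m x - F n x)"
  have FL: "F n \<in> L2 M" for n using F L20_subset_L2 by auto
  have [measurable]: "F n \<in> borel_measurable M" for n using FL by (simp add: L2_def)
  obtain N where N: "\<And>k m n. m \<ge> N k \<Longrightarrow> n \<ge> N k \<Longrightarrow> ?d m n < (1/4)^k"
    using Cauchy[of "(1/4)^k" for k] by (simp, metis)
  \<comment> \<open>Summing the thresholds makes the indices increase and dominate
    \<open>N k\<close>; the extra \<open>k\<close> forces \<open>s k\<close> to infinity, so that
    the subsequence enters every tail.\<close>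
  define s where "s k = (\<Sum>i\<le>k. N i) + k" for k
  have s_ge: "N k \<le> s k" for k
    unfolding s_def using member_le_sum[of k "{..k}" N] by simp
  have s_mono: "s k \<le> s (Suc k)" for k by (simp add: s_def)
  have s_id: "k \<le> s k" for k by (simp add: s_def)
  have d: "?d (s (Suc k)) (s k) < (1/4)^k" for k
    using N[of k "s (Suc k)" "s k"] s_ge[of k] s_mono[of k] by linarith
  define C where "C = measure M (space M)"
  \<comment> \<open>Weighted arithmetic-geometric mean: |f| is at most
    \<open>(1/2)^k + 2^k * f^2\<close>. The second term integrates to at most
    \<open>2^k * (1/4)^k\<close>, which is again \<open>(1/2)^k\<close>.\<close>
  have L1: "(\<integral>\<^sup>+x. ennreal \<bar>F (s (Suc k)) x - F (s k) x\<bar> \<partial>M) \<le> ennreal ((C + 1) * (1/2)^k)" for k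
  proof -
    let ?f = "\<lambda>x. F (s (Suc k)) x - F (s k) x"
    have fL: "?f \<in> L2 M" using FL by (intro L2_diff)
    have int: "integrable M (\<lambda>x. (1/2)^k + 2^k * (?f x)\<^sup>2)"
      using fL by (auto simp: L2_def)
    have "(\<integral>\<^sup>+x. ennreal \<bar>?f x\<bar> \<partial>M) \<le> (\<integral>\<^sup>+x. ennreal ((1/2)^k + 2^k * (?f x)\<^sup>2) \<partial>M)"
    proof (intro nn_integral_mono ennreal_leI)
      fix x
      have "0 \<le> (\<bar>?f x\<bar> * 2^k - 1)\<^sup>2" by simp
      then have "2 * (2^k * \<bar>?f x\<bar>) \<le> 1 + 2^k * 2^k * (?f x)\<^sup>2"
        by (simp add: power2_diff power_mult_distrib power2_eq_square algebra_simps)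
      then have "\<bar>?f x\<bar> * 2^k \<le> 1 + 2^k * 2^k * (?f x)\<^sup>2"
        by (simp add: mult.commute) (smt (verit) abs_ge_zero mult_nonneg_nonneg zero_le_power)
      then show "\<bar>?f x\<bar> \<le> (1/2)^k + 2^k * (?f x)\<^sup>2"
        by (simp add: field_simps power_one_over)
    qed
    also have "\<dots> = ennreal (LINT x|M. (1/2)^k + 2^k * (?f x)\<^sup>2)"
      using int by (intro nn_integral_eq_integral) auto
    also have "(LINT x|M. (1/2)^k + 2^k * (?f x)\<^sup>2) = (1/2)^k * C + 2^k * ?d (s (Suc k)) (s k)"
      using fL by (subst Bochner_Integration.integral_add) (auto simp: L2_def C_def ip_def power2_eq_square)
    also have "\<dots> \<le> (1/2)^k * C + 2^k * (1/4)^k"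
      using d[of k] by simp
    also have "(2::real)^k * (1/4)^k = (1/2)^k" by (simp flip: power_mult_distrib)
    finally show ?thesis by (simp add: algebra_simps ennreal_leI)
  qed
  have C0: "0 \<le> C" by (simp add: C_def)
  have "(\<integral>\<^sup>+x. (\<Sum>k. ennreal \<bar>F (s (Suc k)) x - F (s k) x\<bar>) \<partial>M) =
      (\<Sum>k. \<integral>\<^sup>+x. ennreal \<bar>F (s (Suc k)) x - F (s k) x\<bar> \<partial>M)"
    by (rule nn_integral_suminf) simp
  also have "\<dots> \<le> (\<Sum>k. ennreal ((C + 1) * (1/2)^k))"
    by (intro suminf_le L1) auto
  also have "\<dots> = ennreal (\<Sum>k. (C + 1) * (1/2)^k)"
    using C0 by (intro suminf_ennreal2 summable_mult summable_geometric) auto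
  finally have "(\<integral>\<^sup>+x. (\<Sum>k. ennreal \<bar>F (s (Suc k)) x - F (s k) x\<bar>) \<partial>M) \<noteq> \<infinity>"
    by (metis ennreal_less_top infinity_ennreal_def leD top.not_eq_extremum)
  then have "AE x in M. (\<Sum>k. ennreal \<bar>F (s (Suc k)) x - F (s k) x\<bar>) \<noteq> \<infinity>"
    by (intro nn_integral_PInf_AE) auto
  then have conv: "AE x in M. (\<lambda>k. F (s k) x) \<longlonglongrightarrow> lim (\<lambda>k. F (s k) x)"
  proof eventually_elim
    case (elim x)
    have "summable (\<lambda>k. \<bar>F (s (Suc k)) x - F (s k) x\<bar>)"
      using elim by (intro summable_suminf_not_top) auto
    then have "summable (\<lambda>k. F (s (Suc k)) x - F (s k) x)"
      by (rule summable_rabs_cancel)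
    then have "convergent (\<lambda>n. \<Sum>k<n. F (s (Suc k)) x - F (s k) x)"
      by (simp add: summable_iff_convergent)
    then have "convergent (\<lambda>n. F (s n) x - F (s 0) x)"
      using sum_lessThan_telescope[of "\<lambda>n. F (s n) x"] by simp
    then have "convergent (\<lambda>n. F (s n) x)"
      by (simp add: convergent_diff_const_right_iff)
    then show ?case by (simp add: convergent_LIMSEQ_iff)
  qed
  define g where "g x = lim (\<lambda>k. F (s k) x)" for x
  have [measurable]: "g \<in> borel_measurable M" unfolding g_def[abs_def] by measurable
  \<comment> \<open>Fatou is applied to F n minus the subsequence with \<open>n\<close> outside the
    subsequence, so the whole sequence converges, not only the chosen subsequence.\<close>
  have bound: "(\<integral>\<^sup>+x. ennreal ((F n x - g x)\<^sup>2) \<partial>M) \<le> ennreal \<epsilon>"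
    if K: "\<And>m n. m \<ge> K \<Longrightarrow> n \<ge> K \<Longrightarrow> ?d m n < \<epsilon>" and n: "n \<ge> K" for n K \<epsilon>
  proof -
    have "(\<integral>\<^sup>+x. ennreal ((F n x - g x)\<^sup>2) \<partial>M) = (\<integral>\<^sup>+x. liminf (\<lambda>k. ennreal ((F n x - F (s k) x)\<^sup>2)) \<partial>M)"
    proof (rule nn_integral_cong_AE)
      show "AE x in M. ennreal ((F n x - g x)\<^sup>2) = liminf (\<lambda>k. ennreal ((F n x - F (s k) x)\<^sup>2))"
        using conv
      proof eventually_elim
        case (elim x)
        have "(\<lambda>k. ennreal ((F n x - F (s k) x)\<^sup>2)) \<longlonglongrightarrow> ennreal ((F n x - g x)\<^sup>2)"
          using elim unfolding g_def by (intro tendsto_intros)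
        then show ?case by (intro lim_imp_Liminf[symmetric]) simp_all
      qed
    qed
    also have "\<dots> \<le> liminf (\<lambda>k. \<integral>\<^sup>+x. ennreal ((F n x - F (s k) x)\<^sup>2) \<partial>M)"
      by (rule nn_integral_liminf) simp
    also have "\<dots> \<le> liminf (\<lambda>k::nat. ennreal \<epsilon>)"
    proof (rule Liminf_mono)
      have "(\<integral>\<^sup>+x. ennreal ((F n x - F (s k) x)\<^sup>2) \<partial>M) \<le> ennreal \<epsilon>" if "k \<ge> K" for k
      proof -
        have "(\<lambda>x. F n x - F (s k) x) \<in> L2 M" using FL by (intro L2_diff)
        then have "(\<integral>\<^sup>+x. ennreal ((F n x - F (s k) x)\<^sup>2) \<partial>M) = ennreal (?d n (s k))"
          by (subst nn_integral_eq_integral) (auto simp: L2_def ip_def power2_eq_square)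
        also have "\<dots> \<le> ennreal \<epsilon>"
          using K[of n "s k"] n that s_id[of k] by (intro ennreal_leI) auto
        finally show ?thesis .
      qed
      then show "\<forall>\<^sub>F k in sequentially. (\<integral>\<^sup>+x. ennreal ((F n x - F (s k) x)\<^sup>2) \<partial>M) \<le> ennreal \<epsilon>"
        unfolding eventually_sequentially by blast
    qed
    also have "\<dots> = ennreal \<epsilon>" by (simp add: Liminf_const)
    finally show ?thesis .
  qed
  obtain K where K: "\<And>m n. m \<ge> K \<Longrightarrow> n \<ge> K \<Longrightarrow> ?d m n < 1" using Cauchy[of 1] by auto
  have FgL: "(\<lambda>x. F K x - g x) \<in> L2 M"
    unfolding L2_def using order_le_less_trans[OF bound[OF K order_refl] ennreal_less_top]
    by (auto intro!: integrableI_bounded)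
  have gL: "g \<in> L2 M" using L2_diff[OF FL[of K] FgL] by simp
  have dg: "ip M (\<lambda>x. F n x - g x) (\<lambda>x. F n x - g x) \<le> \<epsilon>"
    if K: "\<And>m n. m \<ge> K \<Longrightarrow> n \<ge> K \<Longrightarrow> ?d m n < \<epsilon>" and n: "n \<ge> K" and "\<epsilon> > 0" for n K \<epsilon>
  proof -
    have "(\<lambda>x. F n x - g x) \<in> L2 M" using FL gL by (intro L2_diff)
    then have "(\<integral>\<^sup>+x. ennreal ((F n x - g x)\<^sup>2) \<partial>M) = ennreal (ip M (\<lambda>x. F n x - g x) (\<lambda>x. F n x - g x))"
      by (subst nn_integral_eq_integral) (auto simp: L2_def ip_def power2_eq_square)
    then show ?thesis using bound[OF K n] \<open>\<epsilon> > 0\<close> by (simp add: ennreal_le_iff)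
  qed
  have lim: "(\<lambda>n. ip M (\<lambda>x. F n x - g x) (\<lambda>x. F n x - g x)) \<longlonglongrightarrow> 0"
  proof (rule LIMSEQ_I)
    fix r :: real assume r: "r > 0"
    obtain K where K: "\<And>m n. m \<ge> K \<Longrightarrow> n \<ge> K \<Longrightarrow> ?d m n < r/2" using Cauchy[of "r/2"] r by auto
    have "norm (ip M (\<lambda>x. F n x - g x) (\<lambda>x. F n x - g x) - 0) < r" if "n \<ge> K" for n
      using dg[OF K that] r ip_nonneg[of M "\<lambda>x. F n x - g x"] by auto
    then show "\<exists>no. \<forall>n\<ge>no. norm (ip M (\<lambda>x. F n x - g x) (\<lambda>x. F n x - g x) - 0) < r" by blast
  qed
  \<comment> \<open>The functions F n have mean zero, so the mean of F n - g is minus that of g; by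
    Cauchy-Schwarz it is controlled by a norm that tends to 0.\<close>
  have "(ip M g (\<lambda>x. 1))\<^sup>2 \<le> ip M (\<lambda>x. F n x - g x) (\<lambda>x. F n x - g x) * ip M (\<lambda>x. 1) (\<lambda>x. 1)" for n
  proof -
    have "ip M (\<lambda>x. F n x - g x) (\<lambda>x. 1) = - ip M g (\<lambda>x. 1)"
      using F[of n] gL by (subst ip_diff_left) (auto simp: L20_iff L2_const)
    then show ?thesis using ip_cauchy_schwarz[OF L2_diff[OF FL[of n] gL] L2_const[of 1]] by simp
  qed
  then have "(ip M g (\<lambda>x. 1))\<^sup>2 \<le> 0 * ip M (\<lambda>x. 1) (\<lambda>x. 1)"
    by (intro LIMSEQ_le_const[OF tendsto_mult_right[OF lim]]) auto
  then have "g \<in> L20 M" using gL by (simp add: L20_iff)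
  then show ?thesis using lim by blast
qed

end

text \<open>Suprema over independent index sets may be approached simultaneously. The summand
  \<open>A\<close> collects the terms already chosen, which is what the induction over
  \<open>F\<close> needs. Later \<open>c\<close> runs through eigenvalues and \<open>s c\<close>
  through finite independent subsets of the eigenspace.\<close>

lemma sum_SUP_le_ennreal:
  fixes g :: "'c \<Rightarrow> 'b \<Rightarrow> ennreal"
  assumes "finite F" "\<And>c. c \<in> F \<Longrightarrow> I c \<noteq> {}"
    and "\<And>s. (\<And>c. c \<in> F \<Longrightarrow> s c \<in> I c) \<Longrightarrow> A + (\<Sum>c\<in>F. g c (s c)) \<le> K"
  shows "A + (\<Sum>c\<in>F. SUP b\<in>I c. g c b) \<le> K"
  using assms
proof (induction F arbitrary: A rule: finite_induct)
  case empty
  then show ?case by simp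
next
  case (insert c F)
  have "A + g c b + (\<Sum>c\<in>F. SUP b\<in>I c. g c b) \<le> K" if b: "b \<in> I c" for b
  proof (rule insert.IH)
    show "\<And>c. c \<in> F \<Longrightarrow> I c \<noteq> {}" using insert.prems by simp
    fix s assume s: "\<And>c. c \<in> F \<Longrightarrow> s c \<in> I c"
    have "A + (\<Sum>c'\<in>insert c F. g c' ((s(c := b)) c')) \<le> K"
      using s b by (intro insert.prems(2)) auto
    also have "(\<Sum>c'\<in>insert c F. g c' ((s(c := b)) c')) = g c b + (\<Sum>c\<in>F. g c (s c))"
      using insert.hyps by (subst sum.insert) (auto intro!: sum.cong)
    finally show "A + g c b + (\<Sum>c\<in>F. g c (s c)) \<le> K" by (simp add: add.assoc)
  qed
  then have "(SUP b\<in>I c. (A + (\<Sum>c\<in>F. SUP b\<in>I c. g c b)) + g c b) \<le> K"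
    by (intro SUP_least) (simp add: ac_simps)
  also have "(SUP b\<in>I c. (A + (\<Sum>c\<in>F. SUP b\<in>I c. g c b)) + g c b) =
      (A + (\<Sum>c\<in>F. SUP b\<in>I c. g c b)) + (SUP b\<in>I c. g c b)"
    using insert.prems(1)[of c] by (subst ennreal_SUP_add_right) auto
  finally show ?case using insert.hyps by (simp add: ac_simps)
qed

text \<open>Bolzano-Weierstrass applied to one index after the other; passing to a further
  subsequence keeps the convergence already achieved.\<close>

lemma bounded_family_convergent_subsequence:
  fixes a :: "'i \<Rightarrow> nat \<Rightarrow> real"
  assumes "finite E" "\<And>e. e \<in> E \<Longrightarrow> bounded (range (a e))"
  shows "\<exists>r. strict_mono (r :: nat \<Rightarrow> nat) \<and> (\<forall>e\<in>E. convergent (\<lambda>n. a e (r n)))"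
  using assms
proof (induction E rule: finite_induct)
  case empty
  then show ?case by (intro exI[of _ id]) (auto simp: strict_mono_def)
next
  case (insert e E)
  then obtain r where r: "strict_mono r" "\<forall>e\<in>E. convergent (\<lambda>n. a e (r n))" by auto
  have "bounded (range (\<lambda>n. a e (r n)))"
    using insert.prems[of e] by (auto intro: bounded_subset)
  then obtain l r' where r': "strict_mono (r' :: nat \<Rightarrow> nat)" "((\<lambda>n. a e (r n)) \<circ> r') \<longlonglongrightarrow> l"
    using bounded_imp_convergent_subsequence by blast
  have "convergent (\<lambda>n. a e' ((r \<circ> r') n))" if "e' \<in> insert e E" for e'
  proof (cases "e' = e")
    case True then show ?thesis using r' by (auto simp: convergent_def o_def)
  next
    case False
    then have "convergent ((\<lambda>n. a e' (r n)) \<circ> r')"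
      using r that r' by (intro convergent_subseq_convergent) auto
    then show ?thesis by (simp add: o_def)
  qed
  then show ?case using strict_mono_o[OF r(1) r'(1)] by blast
qed

section \<open>A trace-class criterion\<close>

context finite_measure
begin

context
  fixes T :: "('a \<Rightarrow> real) \<Rightarrow> 'a \<Rightarrow> real" and C1 C2 :: real
  assumes lin: "linear_op_L20 M T"
    and sym: "\<And>f g. f \<in> L20 M \<Longrightarrow> g \<in> L20 M \<Longrightarrow> ip M (T f) g = ip M f (T g)"
    and tr: "\<And>E. orthonormal_set M E \<Longrightarrow> (\<Sum>e\<in>E. \<bar>ip M (T e) e\<bar>) \<le> C1"
    and hs: "\<And>E. orthonormal_set M E \<Longrightarrow> (\<Sum>e\<in>E. ip M (T e) (T e)) \<le> C2"
begin

lemma T_L20: "f \<in> L20 M \<Longrightarrow> T f \<in> L20 M"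
  using lin by (simp add: linear_op_L20_def)

lemma T_lincomb: "f \<in> L20 M \<Longrightarrow> g \<in> L20 M \<Longrightarrow>
    AE x in M. T (\<lambda>x. a * f x + b * g x) x = a * T f x + b * T g x"
  using lin by (simp add: linear_op_L20_def)

lemma T_zero: "AE x in M. T (\<lambda>x. 0) x = 0"
  using T_lincomb[OF L20_zero L20_zero, of 0 0] by simp

lemma T_cmult: "f \<in> L20 M \<Longrightarrow> AE x in M. T (\<lambda>x. c * f x) x = c * T f x"
  using T_lincomb[OF _ L20_zero, of f c 0] by simp

lemma T_diff: "f \<in> L20 M \<Longrightarrow> g \<in> L20 M \<Longrightarrow> AE x in M. T (\<lambda>x. f x - g x) x = T f x - T g x"
  using T_lincomb[of f g 1 "-1"] by simp

lemma T_sum: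
  assumes "finite E" "E \<subseteq> L20 M"
  shows "(\<lambda>x. \<Sum>e\<in>E. c e * e x) \<in> L20 M \<and>
    (AE x in M. T (\<lambda>x. \<Sum>e\<in>E. c e * e x) x = (\<Sum>e\<in>E. c e * T e x))"
  using assms
proof (induction E rule: finite_induct)
  case empty
  then show ?case using T_zero by (simp add: L20_zero)
next
  case (insert e E)
  let ?g = "\<lambda>x. \<Sum>e\<in>E. c e * e x"
  have g: "?g \<in> L20 M" "AE x in M. T ?g x = (\<Sum>e\<in>E. c e * T e x)" using insert by auto
  have e: "e \<in> L20 M" using insert by simp
  have "(\<lambda>x. c e * e x + ?g x) \<in> L20 M" using e g by (intro L20_add L20_cmult)
  moreover have "AE x in M. T (\<lambda>x. c e * e x + 1 * ?g x) x = c e * T e x + 1 * T ?g x"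
    using e g(1) by (rule T_lincomb)
  with g(2) have "AE x in M. T (\<lambda>x. c e * e x + ?g x) x = c e * T e x + (\<Sum>e\<in>E. c e * T e x)"
    by eventually_elim simp
  ultimately show ?case using insert.hyps by simp
qed

lemma ip_T_cong:
  assumes "f \<in> L20 M" "g \<in> L2 M" "AE x in M. T f x = g x"
  shows "ip M (T f) (T f) = ip M g g"
  unfolding ip_def using assms T_L20[of f]
  by (intro integral_cong_AE) (auto simp: L20_def L2_def)

lemma eigenspace_orthonormal:
  assumes "e \<in> eigenspace M T c" "ip M e e = 1"
  shows "ip M (T e) e = c"
proof -
  have e: "e \<in> L20 M" "AE x in M. T e x = c * e x" using assms by (auto simp: eigenspace_def)
  have "ip M (T e) e = ip M (\<lambda>x. c * e x) e"
    using e T_L20[of e] by (intro ip_cong_AE) (auto simp: L20_def)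
  then show ?thesis using assms by (simp add: ip_cmult_left)
qed

lemma eigenspaces_orthogonal:
  assumes "e \<in> eigenspace M T c" "f \<in> eigenspace M T c'" "c \<noteq> c'"
  shows "ip M e f = 0"
proof -
  have e: "e \<in> L20 M" "AE x in M. T e x = c * e x" and f: "f \<in> L20 M" "AE x in M. T f x = c' * f x"
    using assms by (auto simp: eigenspace_def)
  have "ip M (T e) f = ip M (\<lambda>x. c * e x) f"
    using e f T_L20[of e] by (intro ip_cong_AE) (auto simp: L20_def)
  moreover have "ip M (T f) e = ip M (\<lambda>x. c' * f x) e"
    using e f T_L20[of f] by (intro ip_cong_AE) (auto simp: L20_def)
  ultimately have "c * ip M e f = c' * ip M e f"
    using sym[OF e(1) f(1)] by (simp only: ip_cmult_left ip_commute[of M e "T f"] ip_commute[of M f e])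
  then show ?thesis using assms(3) by auto
qed

lemma eigenspace_onb:
  assumes "finite B" "B \<subseteq> eigenspace M T c" "AE_independent M B"
  shows "\<exists>E. orthonormal_set M E \<and> E \<subseteq> eigenspace M T c \<and> card E = card B"
proof -
  have "(\<lambda>x. a * f x + b * g x) \<in> eigenspace M T c"
    if "f \<in> eigenspace M T c" "g \<in> eigenspace M T c" for a b f g
  proof -
    have f: "f \<in> L20 M" "AE x in M. T f x = c * f x" and g: "g \<in> L20 M" "AE x in M. T g x = c * g x"
      using that by (auto simp: eigenspace_def)
    have "AE x in M. T (\<lambda>x. a * f x + b * g x) x = c * (a * f x + b * g x)"
      using f(2) g(2) T_lincomb[OF f(1) g(1), of a b] by eventually_elim (simp add: algebra_simps)
    then show ?thesis using f g by (simp add: eigenspace_def L20_add L20_cmult)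
  qed
  moreover have "(\<lambda>x. 0) \<in> eigenspace M T c" using T_zero by (simp add: eigenspace_def L20_zero)
  moreover have "eigenspace M T c \<subseteq> L20 M" by (auto simp: eigenspace_def)
  ultimately show ?thesis using gram_schmidt[OF assms(1,2) _ _ _ assms(3)] by blast
qed

text \<open>An infinite sum in [0, \<infinity>] is bounded through its finite partial sums. For
  finitely many eigenvalues, the independent sets that compete in the multiplicities are
  orthonormalised inside their eigenspaces. Eigenvectors of different eigenvalues are orthogonal, so
  the union is one orthonormal family, and each member contributes |c| to the sum bounded by
  \<open>tr\<close>.\<close>

lemma eigenvalue_sum_finite:
  "(\<Sum>\<^sub>\<infinity>c\<in>eigenvalues M T. multiplicity_of M T c * ennreal \<bar>c\<bar>) \<le> ennreal C1"
proof (rule infsum_le_finite_sums)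
  show "(\<lambda>c. multiplicity_of M T c * ennreal \<bar>c\<bar>) summable_on eigenvalues M T" by (rule nonneg_summable_on_complete) simp
  fix F assume F: "finite F" "F \<subseteq> eigenvalues M T"
  let ?I = "\<lambda>c. {B. finite B \<and> B \<subseteq> eigenspace M T c \<and> AE_independent M B}"
  have "0 + (\<Sum>c\<in>F. SUP B\<in>?I c. ennreal \<bar>c\<bar> * of_nat (card B)) \<le> ennreal C1"
  proof (rule sum_SUP_le_ennreal[OF F(1)])
    show "?I c \<noteq> {}" for c by (auto intro!: exI[of _ "{}"] simp: AE_independent_def)
    fix s assume s: "\<And>c. c \<in> F \<Longrightarrow> s c \<in> ?I c"
    have "\<forall>c\<in>F. \<exists>E. orthonormal_set M E \<and> E \<subseteq> eigenspace M T c \<and> card E = card (s c)"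
      using s eigenspace_onb by blast
    then obtain E where E: "\<And>c. c \<in> F \<Longrightarrow> orthonormal_set M (E c)"
      "\<And>c. c \<in> F \<Longrightarrow> E c \<subseteq> eigenspace M T c" "\<And>c. c \<in> F \<Longrightarrow> card (E c) = card (s c)"
      by metis
    have cross: "ip M e f = 0" if "c \<in> F" "c' \<in> F" "c \<noteq> c'" "e \<in> E c" "f \<in> E c'" for c c' e f
      using eigenspaces_orthogonal[of e c f c'] E(2) that by blast
    \<comment> \<open>A common member would be orthogonal to itself while having norm 1.
      Disjointness is what makes the cardinalities add up.\<close>
    have disj: "E c \<inter> E c' = {}" if "c \<in> F" "c' \<in> F" "c \<noteq> c'" for c c'
    proof (rule ccontr)
      assume "E c \<inter> E c' \<noteq> {}"
      then obtain e where "e \<in> E c" "e \<in> E c'" by blast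
      then show False using cross[OF that, of e e] orthonormal_setD(4)[OF E(1)[OF that(1)], of e e] by simp
    qed
    have "orthonormal_set M (\<Union>c\<in>F. E c)"
      unfolding orthonormal_set_def
    proof (intro conjI ballI)
      show "finite (\<Union>c\<in>F. E c)" using F E(1) orthonormal_setD by blast
      show "(\<Union>c\<in>F. E c) \<subseteq> L20 M" using E(1) orthonormal_setD by blast
      fix e f assume "e \<in> (\<Union>c\<in>F. E c)" "f \<in> (\<Union>c\<in>F. E c)"
      then obtain c c' where c: "c \<in> F" "e \<in> E c" "c' \<in> F" "f \<in> E c'" by blast
      show "ip M e f = (if e = f then 1 else 0)"
      proof (cases "c = c'")
        case True then show ?thesis using c orthonormal_setD(4)[OF E(1)[OF c(1)]] by simp
      next
        case False
        then have "e \<noteq> f" using disj[OF c(1) c(3)] c by blast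
        then show ?thesis using cross[OF c(1) c(3) False c(2) c(4)] by simp
      qed
    qed
    then have "(\<Sum>e\<in>(\<Union>c\<in>F. E c). \<bar>ip M (T e) e\<bar>) \<le> C1" by (rule tr)
    also have "(\<Sum>e\<in>(\<Union>c\<in>F. E c). \<bar>ip M (T e) e\<bar>) = (\<Sum>c\<in>F. \<Sum>e\<in>E c. \<bar>ip M (T e) e\<bar>)"
      using F E(1) disj orthonormal_setD(1) by (intro sum.UNION_disjoint) blast+
    also have "\<dots> = (\<Sum>c\<in>F. \<bar>c\<bar> * real (card (s c)))"
    proof (rule sum.cong[OF refl])
      fix c assume c: "c \<in> F"
      have "(\<Sum>e\<in>E c. \<bar>ip M (T e) e\<bar>) = (\<Sum>e\<in>E c. \<bar>c\<bar>)"
        using E(2)[OF c] orthonormal_setD(4)[OF E(1)[OF c]]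
        by (intro sum.cong) (auto simp: eigenspace_orthonormal)
      then show "(\<Sum>e\<in>E c. \<bar>ip M (T e) e\<bar>) = \<bar>c\<bar> * real (card (s c))" using E(3)[OF c] by simp
    qed
    finally have "ennreal (\<Sum>c\<in>F. \<bar>c\<bar> * real (card (s c))) \<le> ennreal C1" by (rule ennreal_leI)
    then show "0 + (\<Sum>c\<in>F. ennreal \<bar>c\<bar> * of_nat (card (s c))) \<le> ennreal C1"
      by (simp flip: sum_ennreal add: ennreal_mult ennreal_of_nat_eq_real_of_nat)
  qed
  then show "(\<Sum>c\<in>F. multiplicity_of M T c * ennreal \<bar>c\<bar>) \<le> ennreal C1"
    by (simp add: multiplicity_of_def SUP_mult_left_ennreal mult.commute)
qed

text \<open>The Hilbert-Schmidt bound limits the size of an orthonormal family all of whose members are stretched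
  by more than \<open>\<epsilon>\<close>; take a largest one.\<close>

lemma small_off_finite_orthonormal:
  assumes eps: "\<epsilon> > 0"
  shows "\<exists>E. orthonormal_set M E \<and> (\<forall>f\<in>L20 M. (\<forall>e\<in>E. ip M f e = 0) \<longrightarrow> ip M (T f) (T f) \<le> \<epsilon> * ip M f f)"
proof -
  define P where "P n \<longleftrightarrow> (\<exists>E. orthonormal_set M E \<and> card E = n \<and> (\<forall>e\<in>E. ip M (T e) (T e) > \<epsilon>))" for n
  have "P 0" unfolding P_def by (intro exI[of _ "{}"]) (simp add: orthonormal_set_def)
  moreover have "n \<le> nat \<lceil>C2 / \<epsilon>\<rceil>" if "P n" for n
  proof -
    obtain E where E: "orthonormal_set M E" "card E = n" "\<And>e. e \<in> E \<Longrightarrow> ip M (T e) (T e) > \<epsilon>"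
      using \<open>P n\<close> P_def by auto
    have "real n * \<epsilon> = (\<Sum>e\<in>E. \<epsilon>)" using E by simp
    also have "\<dots> \<le> (\<Sum>e\<in>E. ip M (T e) (T e))" using E(3) by (intro sum_mono) (auto intro: less_imp_le)
    also have "\<dots> \<le> C2" using hs E by simp
    finally have "real n \<le> C2 / \<epsilon>" using eps by (simp add: field_simps)
    then show ?thesis by linarith
  qed
  ultimately obtain n where n: "P n" "\<And>m. P m \<Longrightarrow> m \<le> n"
    using Nat.ex_has_greatest_nat[of P 0 "nat \<lceil>C2 / \<epsilon>\<rceil>"] by auto
  obtain E where E: "orthonormal_set M E" "card E = n" "\<And>e. e \<in> E \<Longrightarrow> ip M (T e) (T e) > \<epsilon>"
    using \<open>P n\<close> P_def by auto
  note D = orthonormal_setD[OF E(1)]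
  have "ip M (T f) (T f) \<le> \<epsilon> * ip M f f" if f: "f \<in> L20 M" and orth: "\<forall>e\<in>E. ip M f e = 0" for f
  proof (rule ccontr)
    assume neg: "\<not> ip M (T f) (T f) \<le> \<epsilon> * ip M f f"
    have "ip M f f \<noteq> 0"
    proof
      assume 0: "ip M f f = 0"
      then have "AE x in M. f x = 0" using ip_eq_0_iff f L20_subset_L2 by blast
      then have "AE x in M. T f x = T (\<lambda>x. 0) x"
        using lin f L20_zero unfolding linear_op_L20_def by simp
      with T_zero have "AE x in M. T f x = 0" by eventually_elim simp
      then have "ip M (T f) (T f) = 0" using ip_eq_0_iff T_L20[OF f] L20_subset_L2 by blast
      then show False using neg 0 by simp
    qed
    then have pos: "ip M f f > 0" using ip_nonneg[of M f] by linarith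
    define k where "k = 1 / sqrt (ip M f f)"
    have k2: "k * k * ip M f f = 1" using pos by (simp add: k_def)
    define g where "g x = k * f x" for x
    have g: "g \<in> L20 M" unfolding g_def[abs_def] using f by (rule L20_cmult)
    have gg: "ip M g g = 1"
    proof -
      have "ip M g g = k * ip M f g" by (subst (1) g_def[abs_def]) (rule ip_cmult_left)
      also have "ip M f g = k * ip M f f" by (subst ip_commute, subst g_def[abs_def]) (rule ip_cmult_left)
      finally show ?thesis using k2 by (simp add: mult.assoc)
    qed
    have ge: "ip M g e = 0" if "e \<in> E" for e using orth that by (simp add: g_def[abs_def] ip_cmult_left)
    have "ip M (T g) (T g) = ip M (\<lambda>x. k * T f x) (\<lambda>x. k * T f x)"
      using T_cmult[OF f, of k] g T_L20[OF f] L20_subset_L2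
      by (intro ip_T_cong L2_cmult) (auto simp: g_def[abs_def])
    also have "\<dots> = k * k * ip M (T f) (T f)" by (simp add: ip_def mult_ac)
    also have "\<dots> > k * k * (\<epsilon> * ip M f f)"
      using neg pos by (intro mult_strict_left_mono) (auto simp: k_def)
    finally have Tg: "ip M (T g) (T g) > \<epsilon>" using k2 by (simp add: mult_ac)
    have "orthonormal_set M (insert g E)" "g \<notin> E"
      using orthonormal_set_insert[OF E(1) g gg ge] by auto
    then have "P (Suc n)" unfolding P_def using E Tg D(1)
      by (intro exI[of _ "insert g E"]) auto
    then show False using n(2)[of "Suc n"] by simp
  qed
  then show ?thesis using E(1) by blast
qed

lemma ip_sum_sq_le: "f \<in> L2 M \<Longrightarrow> g \<in> L2 M \<Longrightarrow>
    ip M (\<lambda>x. f x + g x) (\<lambda>x. f x + g x) \<le> 2 * ip M f f + 2 * ip M g g"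
proof -
  assume fg: "f \<in> L2 M" "g \<in> L2 M"
  have "ip M (\<lambda>x. f x + g x) (\<lambda>x. f x + g x) \<le> (LINT x|M. 2 * (f x * f x) + 2 * (g x * g x))"
    unfolding ip_def
  proof (rule integral_mono)
    show "integrable M (\<lambda>x. (f x + g x) * (f x + g x))" using L2_add[OF fg] L2_add[OF fg] by (rule L2_integrable_mult)
    show "integrable M (\<lambda>x. 2 * (f x * f x) + 2 * (g x * g x))" using L2_integrable_mult[OF fg(1) fg(1)] L2_integrable_mult[OF fg(2) fg(2)]
      by (intro Bochner_Integration.integrable_add integrable_mult_right)
    fix x
    have "0 \<le> (f x - g x)\<^sup>2" by simp
    then show "(f x + g x) * (f x + g x) \<le> 2 * (f x * f x) + 2 * (g x * g x)"
      by (simp add: power2_eq_square algebra_simps)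
  qed
  also have "\<dots> = 2 * ip M f f + 2 * ip M g g"
    using fg by (simp add: ip_def L2_integrable_mult)
  finally show ?thesis .
qed

text \<open>A difference D' of two members is split into its projection p onto a finite family off
  which \<open>T\<close> is small, and the rest q. T q is small because D' is bounded; T p depends
  on finitely many coefficients, which converge along a subsequence. The family depends on
  \<epsilon>, so only an \<epsilon>-Cauchy property results and the rest is left to a diagonal
  argument.\<close>

lemma almost_Cauchy_subsequence:
  assumes F: "\<And>n. F n \<in> L20 M" and K: "\<And>n. ip M (F n) (F n) \<le> K" and eps: "\<epsilon> > 0"
  shows "\<exists>r. strict_mono (r :: nat \<Rightarrow> nat) \<and> (\<exists>N. \<forall>m\<ge>N. \<forall>n\<ge>N.
    ip M (\<lambda>x. T (F (r m)) x - T (F (r n)) x) (\<lambda>x. T (F (r m)) x - T (F (r n)) x) < \<epsilon>)"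
proof -
  have K0: "K \<ge> 0" using K[of 0] ip_nonneg[of M "F 0"] by linarith
  \<comment> \<open>Differences have squared norm at most 4K and splitting a sum costs a factor 2,
    so the part off the family contributes at most 8\<delta>K, which is at most \<epsilon>/2. The 1
    added to K avoids division by 0.\<close>
  define \<delta> where "\<delta> = \<epsilon> / (16 * (K + 1))"
  have \<delta>: "\<delta> > 0" using eps K0 by (simp add: \<delta>_def)
  have "8 * \<delta> * K \<le> 8 * \<delta> * (K + 1)" using \<delta> by simp
  also have "\<dots> = \<epsilon> / 2" using K0 unfolding \<delta>_def by (simp add: divide_simps)
  finally have \<delta>K: "8 * \<delta> * K < \<epsilon>" using eps by linarith
  obtain E where E: "orthonormal_set M E"
    "\<And>f. f \<in> L20 M \<Longrightarrow> \<forall>e\<in>E. ip M f e = 0 \<Longrightarrow> ip M (T f) (T f) \<le> \<delta> * ip M f f"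
    using small_off_finite_orthonormal[OF \<delta>] by blast
  note D = orthonormal_setD[OF E(1)]
  have "\<exists>r. strict_mono (r :: nat \<Rightarrow> nat) \<and> (\<forall>e\<in>E. convergent (\<lambda>n. ip M (F (r n)) e))"
  proof (rule bounded_family_convergent_subsequence[OF D(1)])
    fix e assume e: "e \<in> E"
    have "\<bar>ip M (F n) e\<bar> \<le> sqrt K" for n
    proof -
      have "(ip M (F n) e)\<^sup>2 \<le> ip M (F n) (F n) * ip M e e"
        using F[of n] e D by (intro ip_cauchy_schwarz) (auto intro: L20_subset_L2)
      also have "\<dots> \<le> K" using K[of n] D(4)[OF e e] by simp
      finally show ?thesis using real_le_rsqrt real_sqrt_abs real_sqrt_le_iff by metis
    qed
    then show "bounded (range (\<lambda>n. ip M (F n) e))" unfolding bounded_iff by auto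
  qed
  then obtain r where r: "strict_mono (r :: nat \<Rightarrow> nat)" "\<And>e. e \<in> E \<Longrightarrow> convergent (\<lambda>n. ip M (F (r n)) e)"
    by blast
  let ?c = "\<lambda>m n e. ip M (\<lambda>x. F (r m) x - F (r n) x) e"
  let ?s = "\<lambda>m n. (\<Sum>e\<in>E. (?c m n e)\<^sup>2)"
  define A where "A = (\<Sum>e\<in>E. ip M (T e) (T e))"
  have FL: "F n \<in> L2 M" for n using F L20_subset_L2 by blast
  have key: "ip M (\<lambda>x. T (F (r m)) x - T (F (r n)) x) (\<lambda>x. T (F (r m)) x - T (F (r n)) x)
      \<le> 8 * \<delta> * K + 2 * (A * ?s m n)" for m n
  proof -
    define D' where "D' x = F (r m) x - F (r n) x" for x
    have D': "D' \<in> L20 M" "D' \<in> L2 M" unfolding D'_def[abs_def] using F L20_subset_L2 by (auto intro: L20_diff L2_diff)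
    define p where "p = proj M E D'"
    have p: "p \<in> L20 M" "AE x in M. T p x = (\<Sum>e\<in>E. ip M D' e * T e x)"
      using T_sum[OF D(1,2), of "ip M D'"] by (auto simp: p_def proj_def[abs_def])
    define q where "q x = D' x - p x" for x
    have q: "q \<in> L20 M" unfolding q_def[abs_def] using D' p by (intro L20_diff)
    have Tdiff: "AE x in M. T (F (r m)) x - T (F (r n)) x = T q x + (\<Sum>e\<in>E. ip M D' e * T e x)"
      using T_diff[OF F F, of "r m" "r n"] p(2) T_diff[OF D'(1) p(1)]
      by eventually_elim (simp add: D'_def[abs_def] q_def[abs_def])
    have TeL: "T e \<in> L2 M" if "e \<in> E" for e using that D T_L20 L20_subset_L2 by blast
    have TL: "T f \<in> L2 M" if "f \<in> L20 M" for f using that T_L20 L20_subset_L2 by blast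
    let ?S = "\<lambda>x. \<Sum>e\<in>E. ip M D' e * T e x"
    have SL: "?S \<in> L2 M" using TeL D by (intro L2_sum L2_cmult)
    have "ip M (\<lambda>x. T (F (r m)) x - T (F (r n)) x) (\<lambda>x. T (F (r m)) x - T (F (r n)) x)
        = ip M (\<lambda>x. T q x + ?S x) (\<lambda>x. T q x + ?S x)"
      using Tdiff TL[OF F] TL[OF q] SL by (intro ip_self_cong_AE L2_diff L2_add)
    also have "\<dots> \<le> 2 * ip M (T q) (T q) + 2 * ip M ?S ?S"
      using TL[OF q] SL by (rule ip_sum_sq_le)
    also have "ip M (T q) (T q) \<le> \<delta> * ip M q q"
      using q residual_orthogonal[OF E(1) D'(2)] by (intro E(2)) (auto simp: q_def[abs_def] p_def)
    also have "ip M q q \<le> ip M D' D'"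
      using residual_norm[OF E(1) D'(2)] sum_nonneg[of E "\<lambda>e. (ip M D' e)\<^sup>2"]
      by (simp add: q_def[abs_def] p_def)
    also have "ip M D' D' \<le> 4 * K"
    proof -
      have "ip M D' D' \<le> 2 * ip M (F (r m)) (F (r m)) + 2 * ip M (\<lambda>x. - 1 * F (r n) x) (\<lambda>x. - 1 * F (r n) x)"
        unfolding D'_def[abs_def] using ip_sum_sq_le[OF FL L2_cmult[OF FL], of "r m" "-1" "r n"] by simp
      also have "ip M (\<lambda>x. - 1 * F (r n) x) (\<lambda>x. - 1 * F (r n) x) = ip M (F (r n)) (F (r n))"
        by (simp add: ip_def)
      finally show ?thesis using K[of "r m"] K[of "r n"] by linarith
    qed
    \<comment> \<open>Pointwise Cauchy-Schwarz over the index set separates the coefficients from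
      the fixed functions T e; the latter integrate to the constant \<open>A\<close>.\<close>
    also have "ip M ?S ?S \<le> A * (\<Sum>e\<in>E. (ip M D' e)\<^sup>2)"
    proof -
      have "ip M ?S ?S = (LINT x|M. ?S x * ?S x)" by (rule ip_def)
      also have "\<dots> \<le> (LINT x|M. (\<Sum>e\<in>E. (ip M D' e)\<^sup>2) * (\<Sum>e\<in>E. T e x * T e x))"
      proof (rule integral_mono)
        show "integrable M (\<lambda>x. ?S x * ?S x)" using SL SL by (rule L2_integrable_mult)
        show "integrable M (\<lambda>x. (\<Sum>e\<in>E. (ip M D' e)\<^sup>2) * (\<Sum>e\<in>E. T e x * T e x))"
          using TeL by (auto intro!: L2_integrable_mult)
        show "?S x * ?S x \<le> (\<Sum>e\<in>E. (ip M D' e)\<^sup>2) * (\<Sum>e\<in>E. T e x * T e x)" for x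
          using Cauchy_Schwarz_ineq_sum[of "\<lambda>e. ip M D' e" "\<lambda>e. T e x" E]
          by (simp add: power2_eq_square)
      qed
      also have "\<dots> = (\<Sum>e\<in>E. (ip M D' e)\<^sup>2) * A"
        using TeL by (simp add: A_def ip_def L2_integrable_mult Bochner_Integration.integral_sum)
      finally show ?thesis by (simp add: mult.commute)
    qed
    finally have "ip M (\<lambda>x. T (F (r m)) x - T (F (r n)) x) (\<lambda>x. T (F (r m)) x - T (F (r n)) x)
      \<le> 2 * (\<delta> * (4 * K)) + 2 * (A * (\<Sum>e\<in>E. (ip M D' e)\<^sup>2))"
      using \<delta> by (simp add: mult_left_mono)
    then show ?thesis by (simp add: D'_def[abs_def] mult_ac)
  qed
  have A0: "A \<ge> 0" unfolding A_def by (intro sum_nonneg ip_nonneg)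
  define \<eta> where "\<eta> = \<epsilon> - 8 * \<delta> * K"
  have \<eta>: "\<eta> > 0" using \<delta>K by (simp add: \<eta>_def)
  \<comment> \<open>Each of the \<open>card E\<close> squared coefficients may use an equal share of
    the margin \<eta> left by the part off the family; the added ones make the final inequality
    strict.\<close>
  define \<rho> where "\<rho> = \<eta> / (2 * (A + 1) * (real (card E) + 1))"
  have \<rho>: "\<rho> > 0" using \<eta> A0 by (simp add: \<rho>_def)
  have "\<exists>N. \<forall>m\<ge>N. \<forall>n\<ge>N. \<forall>e\<in>E. (?c m n e)\<^sup>2 < \<rho>"
  proof -
    have "\<forall>e\<in>E. \<exists>N. \<forall>m\<ge>N. \<forall>n\<ge>N. (?c m n e)\<^sup>2 < \<rho>"
    proof
      fix e assume e: "e \<in> E"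
      have "Cauchy (\<lambda>n. ip M (F (r n)) e)" using r(2)[OF e] by (rule convergent_Cauchy)
      then obtain N where "\<And>m n. m \<ge> N \<Longrightarrow> n \<ge> N \<Longrightarrow> dist (ip M (F (r m)) e) (ip M (F (r n)) e) < sqrt \<rho>"
        using \<rho> unfolding Cauchy_def by (metis real_sqrt_gt_zero)
      then have "\<bar>?c m n e\<bar> < sqrt \<rho>" if "m \<ge> N" "n \<ge> N" for m n
        using that D(3) e FL by (subst ip_diff_left) (auto simp: dist_real_def)
      then have "(?c m n e)\<^sup>2 < \<rho>" if "m \<ge> N" "n \<ge> N" for m n
        using that real_sqrt_less_iff[of "(?c m n e)\<^sup>2" \<rho>] by simp
      then show "\<exists>N. \<forall>m\<ge>N. \<forall>n\<ge>N. (?c m n e)\<^sup>2 < \<rho>" by blast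
    qed
    then obtain N where N: "\<And>e m n. e \<in> E \<Longrightarrow> m \<ge> N e \<Longrightarrow> n \<ge> N e \<Longrightarrow> (?c m n e)\<^sup>2 < \<rho>" by metis
    have "N e \<le> (\<Sum>e\<in>E. N e)" if "e \<in> E" for e using that D(1) by (simp add: member_le_sum)
    then show ?thesis using N by (intro exI[of _ "\<Sum>e\<in>E. N e"]) (meson le_trans)
  qed
  then obtain N where N: "\<And>m n e. m \<ge> N \<Longrightarrow> n \<ge> N \<Longrightarrow> e \<in> E \<Longrightarrow> (?c m n e)\<^sup>2 < \<rho>" by blast
  have "ip M (\<lambda>x. T (F (r m)) x - T (F (r n)) x) (\<lambda>x. T (F (r m)) x - T (F (r n)) x) < \<epsilon>"
    if "m \<ge> N" "n \<ge> N" for m n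
  proof -
    have "?s m n \<le> real (card E) * \<rho>" using N[OF that] by (intro sum_bounded_above) (auto intro: less_imp_le)
    then have "2 * (A * ?s m n) \<le> 2 * (A * (real (card E) * \<rho>))" using A0 by (simp add: mult_left_mono)
    also have "\<dots> < \<eta>"
    proof -
      have "2 * (A * (real (card E) * \<rho>)) < 2 * (A + 1) * (real (card E) + 1) * \<rho>"
        using A0 \<rho> by (simp add: algebra_simps add_pos_nonneg)
      also have "\<dots> = \<eta>" using A0 by (simp add: \<rho>_def)
      finally show ?thesis .
    qed
    finally show ?thesis using key[of m n] by (simp add: \<eta>_def)
  qed
  then show ?thesis using r(1) by blast
qed

text \<open>\<open>P k\<close> is the Cauchy property with tolerance 1/(k+1). It is inherited by
  subsequences, so the diagonal sequence has all of these properties once its first k+1 terms are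
  dropped. Completeness supplies the limit.\<close>

lemma compact_op: "compact_op_L20 M T"
  unfolding compact_op_L20_def
proof (intro conjI allI impI)
  show "linear_op_L20 M T" by (rule lin)
  fix F :: "nat \<Rightarrow> 'a \<Rightarrow> real"
  assume "(\<forall>n. F n \<in> L20 M) \<and> (\<exists>C. \<forall>n. L2_norm_on M (F n) \<le> C)"
  then obtain C where F: "\<And>n. F n \<in> L20 M" and C: "\<And>n. sqrt (ip M (F n) (F n)) \<le> C"
    by (auto simp: L2_norm_on_ip)
  have K: "ip M (F n) (F n) \<le> C\<^sup>2" for n
    using C[of n] by (simp add: ip_nonneg sqrt_le_D)
  let ?d = "\<lambda>m n. ip M (\<lambda>x. T (F m) x - T (F n) x) (\<lambda>x. T (F m) x - T (F n) x)"
  define P where "P k s \<longleftrightarrow> (\<exists>N. \<forall>m\<ge>N. \<forall>n\<ge>N. ?d (s m) (s n) < 1 / real (Suc k))"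
    for k and s :: "nat \<Rightarrow> nat"
  interpret S: subseqs P
  proof
    fix k and s :: "nat \<Rightarrow> nat"
    show "\<exists>r'. strict_mono r' \<and> P k (s \<circ> r')"
      using almost_Cauchy_subsequence[of "\<lambda>n. F (s n)" "C\<^sup>2" "1 / real (Suc k)"] F K
      by (auto simp: P_def)
  qed
  define r where "r = S.diagseq"
  have r: "strict_mono r" unfolding r_def by (rule S.subseq_diagseq)
  have Pk: "P k (r \<circ> ((+) (Suc k)))" for k
    unfolding r_def
  proof (rule S.diagseq_holds)
    fix r s :: "nat \<Rightarrow> nat" and n assume r: "strict_mono r" and "P n s"
    then obtain N where N: "\<And>m m'. m \<ge> N \<Longrightarrow> m' \<ge> N \<Longrightarrow> ?d (s m) (s m') < 1 / real (Suc n)" by (auto simp: P_def)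
    have "?d (s (r m)) (s (r m')) < 1 / real (Suc n)" if "m \<ge> N" "m' \<ge> N" for m m'
      using seq_suble[OF r, of m] seq_suble[OF r, of m'] that by (intro N) auto
    then show "P n (s \<circ> r)" by (auto simp: P_def)
  qed
  have "\<exists>g\<in>L20 M. (\<lambda>n. ip M (\<lambda>x. T (F (r n)) x - g x) (\<lambda>x. T (F (r n)) x - g x)) \<longlonglongrightarrow> 0"
  proof (rule L20_complete)
    show "T (F (r n)) \<in> L20 M" for n using F T_L20 by blast
    fix \<epsilon> :: real assume "\<epsilon> > 0"
    then obtain k where k: "1 / real (Suc k) < \<epsilon>" using nat_approx_posE by blast
    obtain N where N: "\<And>m n. m \<ge> N \<Longrightarrow> n \<ge> N \<Longrightarrow> ?d (r (Suc k + m)) (r (Suc k + n)) < 1 / real (Suc k)"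
      using Pk[of k] by (auto simp: P_def)
    have "?d (r m) (r n) < \<epsilon>" if "m \<ge> Suc k + N" "n \<ge> Suc k + N" for m n
    proof -
      have "N \<le> m - Suc k" "N \<le> n - Suc k" "Suc k + (m - Suc k) = m" "Suc k + (n - Suc k) = n"
        using that by linarith+
      then show ?thesis using N[of "m - Suc k" "n - Suc k"] k by (metis order_less_trans)
    qed
    then show "\<exists>N. \<forall>m\<ge>N. \<forall>n\<ge>N. ?d (r m) (r n) < \<epsilon>" by blast
  qed
  then obtain g where g: "g \<in> L20 M" "(\<lambda>n. ip M (\<lambda>x. T (F (r n)) x - g x) (\<lambda>x. T (F (r n)) x - g x)) \<longlonglongrightarrow> 0"
    by blast
  have "(\<lambda>n. L2_norm_on M (\<lambda>x. T (F (r n)) x - g x)) \<longlonglongrightarrow> 0"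
    unfolding L2_norm_on_ip using tendsto_real_sqrt[OF g(2)] by simp
  then show "\<exists>g\<in>L20 M. \<exists>r. strict_mono r \<and> (\<lambda>n. L2_norm_on M (\<lambda>x. T (F (r n)) x - g x)) \<longlonglongrightarrow> 0"
    using g(1) r by blast
qed

text \<open>Both halves are read off finite orthonormal families: summability from the trace bound
  on orthonormal eigenvectors, compactness from the Hilbert-Schmidt bound.\<close>

theorem trace_class_criterion: "trace_class_L20 M T"
  unfolding trace_class_L20_def
  using compact_op order_le_less_trans[OF eigenvalue_sum_finite ennreal_less_top] by simp

end

end

section \<open>Integral operators that factor through a square-integrable kernel\<close>

text \<open>The kernel is the joint density relative to the product of the marginal laws
  \<open>M\<close> of the parameter and \<open>V\<close> of the latent data, which is why both of
  its partial integrals are 1. In this normalisation the conditional expectation and its adjoint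
  integrate against the same kernel, and \<open>rho_L2\<close> is the Hilbert-Schmidt
  condition.\<close>

locale factor_kernel = M: finite_measure M + V: finite_measure V
  for M :: "'a measure" and V :: "'b measure" +
  fixes \<rho> :: "'a \<Rightarrow> 'b \<Rightarrow> real"
  assumes rho_measurable [measurable]: "(\<lambda>(x, z). \<rho> x z) \<in> borel_measurable (M \<Otimes>\<^sub>M V)"
    and rho_nonneg: "\<And>x z. 0 \<le> \<rho> x z"
    and marg_M: "AE z in V. (LINT x|M. \<rho> x z) = 1"
    and marg_V: "AE x in M. (LINT z|V. \<rho> x z) = 1"
    and rho_L2: "(\<integral>\<^sup>+x. \<integral>\<^sup>+z. ennreal ((\<rho> x z)\<^sup>2) \<partial>V \<partial>M) < \<infinity>"
begin

sublocale P: pair_sigma_finite M V ..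

definition A :: "('a \<Rightarrow> real) \<Rightarrow> 'b \<Rightarrow> real" where
  "A f z = ip M f (\<lambda>x. \<rho> x z)"

text \<open>The transition density relative to \<open>M\<close>: draw z given x, then x' given
  z.\<close>

definition ks :: "'a \<Rightarrow> 'a \<Rightarrow> real" where
  "ks x' x = ip V (\<rho> x') (\<rho> x)"

text \<open>The diagonal of \<open>ks\<close>. Its integral I bounds the trace, and I * I bounds the
  squared Hilbert-Schmidt norm of the composed operator.\<close>

definition R :: "'a \<Rightarrow> real" where
  "R x = ip V (\<rho> x) (\<rho> x)"

lemma rho_measurable_slice [measurable]:
  "x \<in> space M \<Longrightarrow> \<rho> x \<in> borel_measurable V" "z \<in> space V \<Longrightarrow> (\<lambda>x. \<rho> x z) \<in> borel_measurable M"
  using measurable_Pair2[OF rho_measurable] measurable_Pair1[OF rho_measurable] by simp_all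

lemma rho_measurable' [measurable]: "(\<lambda>(z, x). \<rho> x z) \<in> borel_measurable (V \<Otimes>\<^sub>M M)"
  using measurable_pair_swap[OF rho_measurable] by (simp add: split_def)

lemma rho2_integrable: "integrable (M \<Otimes>\<^sub>M V) (\<lambda>(x, z). (\<rho> x z)\<^sup>2)"
proof (rule integrableI_bounded)
  show "(\<lambda>(x, z). (\<rho> x z)\<^sup>2) \<in> borel_measurable (M \<Otimes>\<^sub>M V)" by measurable
  have "(\<integral>\<^sup>+p. ennreal (norm (case p of (x, z) \<Rightarrow> (\<rho> x z)\<^sup>2)) \<partial>(M \<Otimes>\<^sub>M V)) =
      (\<integral>\<^sup>+x. \<integral>\<^sup>+z. ennreal ((\<rho> x z)\<^sup>2) \<partial>V \<partial>M)"
    by (subst V.nn_integral_fst[symmetric]) auto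
  then show "(\<integral>\<^sup>+p. ennreal (norm (case p of (x, z) \<Rightarrow> (\<rho> x z)\<^sup>2)) \<partial>(M \<Otimes>\<^sub>M V)) < \<infinity>"
    using rho_L2 by simp
qed

lemma rho_L2_V: "AE x in M. x \<in> space M \<and> \<rho> x \<in> L2 V"
  using P.AE_integrable_fst[OF rho2_integrable] AE_space[of M]
  by eventually_elim (simp add: L2_def)

lemma rho_L2_M: "AE z in V. z \<in> space V \<and> (\<lambda>x. \<rho> x z) \<in> L2 M"
  using P.AE_integrable_snd[of "\<lambda>x z. (\<rho> x z)\<^sup>2"] rho2_integrable AE_space[of V]
  by (auto elim!: eventually_elim2 simp: L2_def)

lemma A_measurable [measurable (raw)]:
  assumes [measurable]: "f \<in> borel_measurable M"
  shows "A f \<in> borel_measurable V"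
proof -
  have [measurable]: "(\<lambda>p. \<rho> (snd p) (fst p)) \<in> borel_measurable (V \<Otimes>\<^sub>M M)"
    using rho_measurable' by (simp add: split_def)
  have "(\<lambda>(z, x). f x * \<rho> x z) \<in> borel_measurable (V \<Otimes>\<^sub>M M)"
    unfolding split_def by measurable
  from M.borel_measurable_lebesgue_integral[OF this]
  show ?thesis by (simp add: A_def[abs_def] ip_def)
qed

lemma ks_measurable [measurable]: "(\<lambda>(x', x). ks x' x) \<in> borel_measurable (M \<Otimes>\<^sub>M M)"
  unfolding ks_def ip_def by measurable

lemma R_measurable [measurable]: "R \<in> borel_measurable M"
  unfolding R_def[abs_def] ip_def by measurable

lemma R_nonneg: "0 \<le> R x" by (simp add: R_def ip_nonneg)

lemma R_integrable: "integrable M R"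
  using P.integrable_fst[OF rho2_integrable] by (simp add: R_def[abs_def] ip_def power2_eq_square)

lemma R_integral: "(LINT z|V. LINT x|M. (\<rho> x z)\<^sup>2) = (LINT x|M. R x)"
  using P.Fubini_integral[of "\<lambda>x z. (\<rho> x z)\<^sup>2"] rho2_integrable
  by (simp add: R_def ip_def power2_eq_square)

text \<open>The integrand is dominated by \<open>(f x)^2 * (b z)^2\<close> plus
  \<open>(\<rho> x z)^2\<close>, both integrable for the product measure. This licenses the exchange
  of integrals behind \<open>adjoint\<close>.\<close>

lemma bilinear_integrable:
  assumes f: "f \<in> L2 M" and b: "b \<in> L2 V"
  shows "integrable (M \<Otimes>\<^sub>M V) (\<lambda>(x, z). f x * b z * \<rho> x z)"
proof (rule Bochner_Integration.integrable_bound)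
  have [measurable]: "f \<in> borel_measurable M" "b \<in> borel_measurable V" using f b by (auto simp: L2_def)
  have "integrable (M \<Otimes>\<^sub>M V) (\<lambda>(x, z). (f x)\<^sup>2 * (b z)\<^sup>2)"
  proof (rule P.Fubini_integrable)
    show "AE x in M. integrable V (\<lambda>z. case (x, z) of (x, z) \<Rightarrow> (f x)\<^sup>2 * (b z)\<^sup>2)"
      using b by (auto simp: L2_def)
    show "integrable M (\<lambda>x. LINT z|V. norm (case (x, z) of (x, z) \<Rightarrow> (f x)\<^sup>2 * (b z)\<^sup>2))"
      using f by (auto simp: L2_def)
  qed measurable
  then show "integrable (M \<Otimes>\<^sub>M V) (\<lambda>p. (case p of (x, z) \<Rightarrow> (f x)\<^sup>2 * (b z)\<^sup>2) + (case p of (x, z) \<Rightarrow> (\<rho> x z)\<^sup>2))"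
    using rho2_integrable by (rule Bochner_Integration.integrable_add)
  show "(\<lambda>(x, z). f x * b z * \<rho> x z) \<in> borel_measurable (M \<Otimes>\<^sub>M V)" by measurable
  have "\<bar>c * d\<bar> \<le> \<bar>c\<^sup>2 + d\<^sup>2\<bar>" for c d :: real
  proof -
    have "0 \<le> (\<bar>c\<bar> - \<bar>d\<bar>)\<^sup>2" by simp
    then have "2 * (\<bar>c\<bar> * \<bar>d\<bar>) \<le> c\<^sup>2 + d\<^sup>2" by (simp add: power2_diff)
    moreover have "0 \<le> \<bar>c\<bar> * \<bar>d\<bar>" by simp
    ultimately show ?thesis unfolding abs_mult by linarith
  qed
  note bound = this[of "f x * b z" "\<rho> x z" for x z, unfolded power_mult_distrib]
  show "AE p in M \<Otimes>\<^sub>M V. norm (case p of (x, z) \<Rightarrow> f x * b z * \<rho> x z)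
      \<le> norm ((case p of (x, z) \<Rightarrow> (f x)\<^sup>2 * (b z)\<^sup>2) + (case p of (x, z) \<Rightarrow> (\<rho> x z)\<^sup>2))"
    using bound by (auto simp: split_def)
qed

lemma adjoint:
  assumes f: "f \<in> L2 M" and b: "b \<in> L2 V"
  shows "(LINT x|M. f x * ip V b (\<rho> x)) = (LINT z|V. b z * A f z)"
proof -
  have "(LINT z|V. LINT x|M. f x * b z * \<rho> x z) = (LINT x|M. LINT z|V. f x * b z * \<rho> x z)"
    by (rule P.Fubini_integral) (use bilinear_integrable[OF f b] in simp)
  moreover have "(LINT x|M. f x * b z * \<rho> x z) = b z * A f z" for z
  proof -
    have "(\<lambda>x. f x * b z * \<rho> x z) = (\<lambda>x. b z * (f x * \<rho> x z))" by (simp add: mult_ac)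
    then show ?thesis by (simp add: A_def ip_def)
  qed
  moreover have "(LINT z|V. f x * b z * \<rho> x z) = f x * ip V b (\<rho> x)" for x
    by (simp add: ip_def mult.assoc)
  ultimately show ?thesis by simp
qed

lemma A_L2:
  assumes f: "f \<in> L2 M"
  shows "A f \<in> L2 V"
proof -
  have [measurable]: "f \<in> borel_measurable M" using f by (simp add: L2_def)
  have int: "integrable V (\<lambda>z. ip M f f * (LINT x|M. (\<rho> x z)\<^sup>2))"
    using P.integrable_snd[of "\<lambda>x z. (\<rho> x z)\<^sup>2"] rho2_integrable by simp
  have "integrable V (\<lambda>z. (A f z)\<^sup>2)"
  proof (rule Bochner_Integration.integrable_bound[OF int])
    show "AE z in V. norm ((A f z)\<^sup>2) \<le> norm (ip M f f * (LINT x|M. (\<rho> x z)\<^sup>2))"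
      using rho_L2_M
    proof eventually_elim
      case (elim z)
      have "(A f z)\<^sup>2 \<le> ip M f f * ip M (\<lambda>x. \<rho> x z) (\<lambda>x. \<rho> x z)"
        unfolding A_def using f elim by (intro ip_cauchy_schwarz) auto
      then show ?case by (simp add: ip_def power2_eq_square)
    qed
  qed measurable
  then show ?thesis by (simp add: L2_def)
qed

text \<open>Cauchy-Schwarz in \<open>V\<close> bounds the square of \<open>ks x' x\<close> by R x R
  x', so almost every slice is square-integrable and Bessel's inequality can be applied to
  it.\<close>

lemma ks_slice:
  assumes x: "x \<in> space M" "\<rho> x \<in> L2 V"
  shows "(\<lambda>x'. ks x' x) \<in> L2 M" "ip M (\<lambda>x'. ks x' x) (\<lambda>x'. ks x' x) \<le> R x * (LINT x|M. R x)"
proof -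
  have [measurable]: "(\<lambda>x'. ks x' x) \<in> borel_measurable M"
    using measurable_Pair1[OF ks_measurable x(1)] by simp
  have bound: "AE x' in M. (ks x' x)\<^sup>2 \<le> R x * R x'"
    using rho_L2_V
  proof eventually_elim
    case (elim x')
    then show ?case using ip_cauchy_schwarz[of "\<rho> x'" V "\<rho> x"] x by (simp add: ks_def R_def mult.commute)
  qed
  have int: "integrable M (\<lambda>x'. R x * R x')" using R_integrable by simp
  have "integrable M (\<lambda>x'. (ks x' x)\<^sup>2)"
    by (rule Bochner_Integration.integrable_bound[OF int]) (use bound R_nonneg in \<open>auto elim!: eventually_mono\<close>)
  then show L: "(\<lambda>x'. ks x' x) \<in> L2 M" by (simp add: L2_def)
  have "ip M (\<lambda>x'. ks x' x) (\<lambda>x'. ks x' x) \<le> (LINT x'|M. R x * R x')"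
    unfolding ip_def using bound int L2_integrable_mult[OF L L]
    by (intro integral_mono_AE) (auto simp: power2_eq_square)
  then show "ip M (\<lambda>x'. ks x' x) (\<lambda>x'. ks x' x) \<le> R x * (LINT x|M. R x)" by simp
qed

text \<open>\<open>T\<close> is the composition of \<open>A\<close> with its adjoint, so <T f, g> =
  <A f, A g>: \<open>T\<close> is symmetric and nonnegative. It preserves the mean since
  \<open>A\<close> and its adjoint both fix the constant 1. Bessel for the slices of the kernel at
  fixed z bounds the trace; Bessel for the slices of \<open>ks\<close> bounds the Hilbert-Schmidt
  norm.\<close>

theorem trace_class:
  assumes T_meas: "\<And>f. f \<in> L20 M \<Longrightarrow> T f \<in> borel_measurable M"
    and T_eq: "\<And>f. f \<in> L20 M \<Longrightarrow> AE x in M. T f x = (LINT x'|M. f x' * ks x' x)"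
  shows "trace_class_L20 M T"
proof -
  define I where "I = (LINT x|M. R x)"
  have L: "f \<in> L2 M" if "f \<in> L20 M" for f using that by (rule L20_subset_L2)
  have Tip: "AE x in M. x \<in> space M \<and> \<rho> x \<in> L2 V \<and> T f x = ip M f (\<lambda>x'. ks x' x)"
    if "f \<in> L20 M" for f
    using T_eq[OF that] rho_L2_V by eventually_elim (simp add: ip_def)
  have TA: "AE x in M. T f x = ip V (A f) (\<rho> x)" if f: "f \<in> L20 M" for f
    using Tip[OF f]
  proof eventually_elim
    case (elim x)
    have "T f x = (LINT x'|M. f x' * ip V (\<rho> x) (\<rho> x'))"
      using elim by (simp add: ip_def ks_def mult.commute)
    also have "\<dots> = (LINT z|V. \<rho> x z * A f z)" using L[OF f] elim by (intro adjoint) auto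
    finally show ?case by (simp add: ip_def mult.commute)
  qed
  have T_L2: "T f \<in> L2 M" if f: "f \<in> L20 M" for f
  proof -
    have [measurable]: "T f \<in> borel_measurable M" by (rule T_meas[OF f])
    have int: "integrable M (\<lambda>x. ip M f f * (R x * I))" using R_integrable by simp
    have "integrable M (\<lambda>x. (T f x)\<^sup>2)"
    proof (rule Bochner_Integration.integrable_bound[OF int])
      show "AE x in M. norm ((T f x)\<^sup>2) \<le> norm (ip M f f * (R x * I))"
        using Tip[OF f]
      proof eventually_elim
        case (elim x)
        then have "(T f x)\<^sup>2 \<le> ip M f f * ip M (\<lambda>x'. ks x' x) (\<lambda>x'. ks x' x)"
          using L[OF f] ks_slice(1)[of x] by (simp add: ip_cauchy_schwarz)
        also have "\<dots> \<le> ip M f f * (R x * I)"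
          using ks_slice(2)[of x] elim by (intro mult_left_mono ip_nonneg) (auto simp: I_def)
        finally show ?case by simp
      qed
    qed measurable
    then show ?thesis by (simp add: L2_def)
  qed
  have ip_T: "ip M (T f) g = ip V (A f) (A g)" if f: "f \<in> L20 M" and g: "g \<in> L2 M" for f g
  proof -
    have [measurable]: "g \<in> borel_measurable M" "A f \<in> borel_measurable V"
      using g L[OF f] by (auto simp: L2_def)
    have "ip M (T f) g = (LINT x|M. g x * ip V (A f) (\<rho> x))"
      unfolding ip_def[of M] using TA[OF f] T_meas[OF f]
      by (intro integral_cong_AE) (auto simp: ip_def mult.commute)
    also have "\<dots> = (LINT z|V. A f z * A g z)" using g A_L2[OF L[OF f]] by (intro adjoint)
    finally show ?thesis by (simp add: ip_def)
  qed
  have A_const: "AE z in V. A (\<lambda>x. 1) z = 1"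
    using marg_M by eventually_elim (simp add: A_def ip_def)
  have T_mean: "ip M (T f) (\<lambda>x. 1) = 0" if f: "f \<in> L20 M" for f
  proof -
    have fL: "f \<in> L2 M" by (rule L[OF f])
    have [measurable]: "f \<in> borel_measurable M" using fL by (simp add: L2_def)
    have "ip M (T f) (\<lambda>x. 1) = ip V (A f) (A (\<lambda>x. 1))" using f M.L2_const by (rule ip_T)
    also have "\<dots> = (LINT z|V. 1 * A f z)"
      unfolding ip_def using A_const by (intro integral_cong_AE) auto
    also have "\<dots> = (LINT x|M. f x * ip V (\<lambda>z. 1) (\<rho> x))"
      using fL V.L2_const[of 1] by (rule adjoint[symmetric])
    also have "\<dots> = (LINT x|M. f x)"
      using marg_V by (intro integral_cong_AE) (auto simp: ip_def)
    also have "\<dots> = 0" using f by (simp add: L20_def)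
    finally show ?thesis .
  qed
  have lin: "linear_op_L20 M T"
    unfolding linear_op_L20_def
  proof (intro conjI ballI impI allI)
    show "T f \<in> L20 M" if "f \<in> L20 M" for f using T_L2 T_mean that by (simp add: M.L20_iff)
    show "AE x in M. T f x = T g x" if "f \<in> L20 M" "g \<in> L20 M" "AE x in M. f x = g x" for f g
      using Tip[OF that(1)] Tip[OF that(2)]
    proof eventually_elim
      case (elim x)
      have "ip M f (\<lambda>x'. ks x' x) = ip M g (\<lambda>x'. ks x' x)"
        using L2_measurable[OF L[OF that(1)]] L2_measurable[OF L[OF that(2)]]
          L2_measurable[OF ks_slice(1)[of x]] that(3) elim by (intro ip_cong_AE) blast+
      then show ?case using elim by simp
    qed
    show "AE x in M. T (\<lambda>x. a * f x + b * g x) x = a * T f x + b * T g x"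
      if "f \<in> L20 M" "g \<in> L20 M" for f g a b
      using Tip[OF that(1)] Tip[OF that(2)] Tip[OF M.L20_add[OF M.L20_cmult[OF that(1)] M.L20_cmult[OF that(2)]], of a b]
    proof eventually_elim
      case (elim x)
      then show ?case using L[OF that(1)] L[OF that(2)] ks_slice(1)[of x]
        by (simp add: ip_add_left ip_cmult_left L2_cmult)
    qed
  qed
  show ?thesis
  proof (rule M.trace_class_criterion[OF lin])
    show "ip M (T f) g = ip M f (T g)" if "f \<in> L20 M" "g \<in> L20 M" for f g
      using ip_T[OF that(1) L[OF that(2)]] ip_T[OF that(2) L[OF that(1)]] ip_commute by metis
    fix E assume E: "orthonormal_set M E"
    note D = orthonormal_setD[OF E]
    have bess: "AE z in V. (\<Sum>e\<in>E. (A e z)\<^sup>2) \<le> (LINT x|M. (\<rho> x z)\<^sup>2)"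
      using rho_L2_M
    proof eventually_elim
      case (elim z)
      have "A e z = ip M (\<lambda>x. \<rho> x z) e" for e unfolding A_def by (rule ip_commute)
      moreover have "(\<Sum>e\<in>E. (ip M (\<lambda>x. \<rho> x z) e)\<^sup>2) \<le> ip M (\<lambda>x. \<rho> x z) (\<lambda>x. \<rho> x z)"
        using elim by (intro bessel_inequality[OF E]) simp
      moreover have "ip M (\<lambda>x. \<rho> x z) (\<lambda>x. \<rho> x z) = (LINT x|M. (\<rho> x z)\<^sup>2)"
        by (simp add: ip_def power2_eq_square)
      ultimately show ?case by simp
    qed
    have AL: "A e \<in> L2 V" if "e \<in> E" for e using D(3) that by (intro A_L2) auto
    have "(\<Sum>e\<in>E. \<bar>ip M (T e) e\<bar>) = (\<Sum>e\<in>E. ip V (A e) (A e))"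
    proof (rule sum.cong[OF refl])
      fix e assume "e \<in> E"
      then show "\<bar>ip M (T e) e\<bar> = ip V (A e) (A e)"
        using D(2,3) ip_T[of e e] ip_nonneg[of V "A e"] by (metis abs_of_nonneg subsetD)
    qed
    also have "\<dots> = (LINT z|V. (\<Sum>e\<in>E. (A e z)\<^sup>2))"
      unfolding ip_def power2_eq_square using AL by (intro Bochner_Integration.integral_sum[symmetric] L2_integrable_mult)
    also have "\<dots> \<le> (LINT z|V. LINT x|M. (\<rho> x z)\<^sup>2)"
      using bess AL P.integrable_snd[of "\<lambda>x z. (\<rho> x z)\<^sup>2"] rho2_integrable
      by (intro integral_mono_AE) (auto simp: L2_def)
    also have "\<dots> = I" by (simp add: R_integral I_def)
    finally show "(\<Sum>e\<in>E. \<bar>ip M (T e) e\<bar>) \<le> I" .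
    have "AE x in M. \<forall>e\<in>E. x \<in> space M \<and> \<rho> x \<in> L2 V \<and> T e x = ip M e (\<lambda>x'. ks x' x)"
      using D(1,2) Tip by (intro AE_finite_allI) auto
    then have hsb: "AE x in M. (\<Sum>e\<in>E. T e x * T e x) \<le> R x * I"
      using rho_L2_V
    proof eventually_elim
      case (elim x)
      let ?k = "\<lambda>x'. ks x' x"
      have "(\<Sum>e\<in>E. T e x * T e x) = (\<Sum>e\<in>E. (ip M ?k e)\<^sup>2)"
      proof (rule sum.cong[OF refl])
        fix e assume "e \<in> E"
        then have "T e x = ip M e ?k" using elim(1) by blast
        then show "T e x * T e x = (ip M ?k e)\<^sup>2"
          by (simp only: ip_commute[of M e ?k] power2_eq_square)
      qed
      also have "\<dots> \<le> ip M ?k ?k" using ks_slice(1)[of x] elim(2) by (intro bessel_inequality[OF E]) auto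
      also have "\<dots> \<le> R x * I" using ks_slice(2)[of x] elim(2) by (simp add: I_def)
      finally show ?case .
    qed
    have TL: "T e \<in> L2 M" if "e \<in> E" for e using D(2) T_L2 that by auto
    have "(\<Sum>e\<in>E. ip M (T e) (T e)) = (LINT x|M. (\<Sum>e\<in>E. T e x * T e x))"
      unfolding ip_def using TL by (intro Bochner_Integration.integral_sum[symmetric] L2_integrable_mult)
    also have "\<dots> \<le> (LINT x|M. R x * I)"
    proof (rule integral_mono_AE)
      show "integrable M (\<lambda>x. \<Sum>e\<in>E. T e x * T e x)"
        by (intro Bochner_Integration.integrable_sum L2_integrable_mult TL)
      show "integrable M (\<lambda>x. R x * I)" using R_integrable by simp
    qed (rule hsb)
    also have "\<dots> = I * I" by (simp add: I_def)
    finally show "(\<Sum>e\<in>E. ip M (T e) (T e)) \<le> I * I" .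
  qed
qed

end

text \<open>Here \<open>\<theta> x z\<close> is the conditional density of the parameter given the latent data, \<open>w\<close> the
  unnormalised marginal of the latent data and \<open>J\<close> the unnormalised posterior.\<close>

theorem trace_class_latent_kernel:
  fixes L :: "'a measure" and N :: "'b measure"
  assumes "sigma_finite_measure L" "sigma_finite_measure N"
    and [measurable]: "J \<in> borel_measurable L" "w \<in> borel_measurable N"
      "(\<lambda>(x, z). \<theta> x z) \<in> borel_measurable (L \<Otimes>\<^sub>M N)"
    and J_pos: "\<And>x. x \<in> space L \<Longrightarrow> 0 < J x"
    and theta_nonneg: "\<And>x z. 0 \<le> \<theta> x z" and w_nonneg: "\<And>z. 0 \<le> w z"
    and m: "0 < m" "(\<integral>\<^sup>+x. ennreal (J x) \<partial>L) = ennreal m"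
    and theta_1: "AE z in N. (\<integral>\<^sup>+x. ennreal (\<theta> x z) \<partial>L) = 1"
    and theta_w: "AE x in L. (\<integral>\<^sup>+z. ennreal (\<theta> x z * w z) \<partial>N) = ennreal (J x)"
    and theta_sq: "(\<integral>\<^sup>+x. \<integral>\<^sup>+z. ennreal ((\<theta> x z)\<^sup>2 * w z / J x) \<partial>N \<partial>L) < \<infinity>"
    and k: "\<And>x x'. x \<in> space L \<Longrightarrow> x' \<in> space L \<Longrightarrow>
      k x' x = (LINT z|N. \<theta> x' z * \<theta> x z * w z) / J x"
  shows "trace_class_L20 (density L (\<lambda>x. ennreal (J x / m))) (kernel_op L k)"
proof -
  interpret L: sigma_finite_measure L by fact
  interpret N: sigma_finite_measure N by fact
  interpret LN: pair_sigma_finite L N ..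
  define M where "M = density L (\<lambda>x. ennreal (J x / m))"
  define V where "V = density N (\<lambda>z. ennreal (w z / m))"
  have sets [measurable_cong]: "sets M = sets L" "sets V = sets N" by (simp_all add: M_def V_def)
  have space: "space M = space L" "space V = space N" by (simp_all add: M_def V_def)
  \<comment> \<open>The joint density \<open>\<theta> * w / m\<close> divided by the product of the
    marginal densities \<open>J / m\<close> and \<open>w / m\<close>. Positivity of \<open>J\<close>
    is known only on the space of \<open>L\<close>, hence the case distinction.\<close>
  define \<rho> where "\<rho> x z = (if x \<in> space L then m * \<theta> x z / J x else 0)" for x z
  have theta_slice [measurable]: "x \<in> space L \<Longrightarrow> \<theta> x \<in> borel_measurable N"
    "z \<in> space N \<Longrightarrow> (\<lambda>x. \<theta> x z) \<in> borel_measurable L" for x z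
    using measurable_Pair2[OF assms(5)] measurable_Pair1[OF assms(5)] by simp_all
  have Jm: "ennreal (J x / m) * ennreal (c / J x) = ennreal (c / m)" if "x \<in> space L" "0 \<le> c" for c x
    using J_pos[OF that(1)] m that by (simp flip: ennreal_mult)
  have nnM: "(\<integral>\<^sup>+x. g x \<partial>M) = (\<integral>\<^sup>+x. ennreal (J x / m) * g x \<partial>L)" if "g \<in> borel_measurable L" for g
    unfolding M_def using that by (intro nn_integral_density) auto
  have nnV: "(\<integral>\<^sup>+x. g x \<partial>V) = (\<integral>\<^sup>+x. ennreal (w x / m) * g x \<partial>N)" if "g \<in> borel_measurable N" for g
    unfolding V_def using that by (intro nn_integral_density) auto
  \<comment> \<open>Integrating \<open>\<theta> * w\<close> in both orders shows that
    \<open>w\<close> has the same total mass m as \<open>J\<close>.\<close>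
  have "(\<integral>\<^sup>+z. ennreal (w z) \<partial>N) = (\<integral>\<^sup>+z. \<integral>\<^sup>+x. ennreal (\<theta> x z) * ennreal (w z) \<partial>L \<partial>N)"
  proof (rule nn_integral_cong_AE)
    show "AE z in N. ennreal (w z) = (\<integral>\<^sup>+x. ennreal (\<theta> x z) * ennreal (w z) \<partial>L)"
      using theta_1 AE_space by eventually_elim (simp add: nn_integral_multc)
  qed
  also have "\<dots> = (\<integral>\<^sup>+x. \<integral>\<^sup>+z. ennreal (\<theta> x z * w z) \<partial>N \<partial>L)"
    by (subst LN.Fubini') (auto simp: ennreal_mult theta_nonneg w_nonneg)
  also have "\<dots> = (\<integral>\<^sup>+x. ennreal (J x) \<partial>L)" using theta_w by (rule nn_integral_cong_AE)
  also have "\<dots> = ennreal m" by (rule m(2))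
  finally have w_int: "(\<integral>\<^sup>+z. ennreal (w z) \<partial>N) = ennreal m" .
  have div_m: "ennreal (c / m) = ennreal c * ennreal (1 / m)" if "0 \<le> c" for c
    using m that by (simp flip: ennreal_mult)
  have J0: "x \<in> space L \<Longrightarrow> 0 \<le> J x" for x using J_pos by (simp add: less_imp_le)
  interpret M: finite_measure M
  proof
    have "emeasure M (space M) = (\<integral>\<^sup>+x. ennreal (J x / m) \<partial>L)"
      unfolding M_def by (simp add: emeasure_density nn_integral_set_ennreal cong: nn_integral_cong)
    also have "\<dots> = (\<integral>\<^sup>+x. ennreal (J x) * ennreal (1 / m) \<partial>L)"
      using J0 by (intro nn_integral_cong div_m)
    also have "\<dots> = ennreal m * ennreal (1 / m)" using m by (simp add: nn_integral_multc)
    finally show "emeasure M (space M) \<noteq> \<infinity>" by (simp add: ennreal_mult_eq_top_iff)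
  qed
  interpret V: finite_measure V
  proof
    have "emeasure V (space V) = (\<integral>\<^sup>+x. ennreal (w x / m) \<partial>N)"
      unfolding V_def by (simp add: emeasure_density nn_integral_set_ennreal cong: nn_integral_cong)
    also have "\<dots> = (\<integral>\<^sup>+x. ennreal (w x) * ennreal (1 / m) \<partial>N)"
      using w_nonneg by (intro nn_integral_cong div_m)
    also have "\<dots> = ennreal m * ennreal (1 / m)" using w_int by (simp add: nn_integral_multc)
    finally show "emeasure V (space V) \<noteq> \<infinity>" by (simp add: ennreal_mult_eq_top_iff)
  qed
  have rho_nonneg: "0 \<le> \<rho> x z" for x z
    using theta_nonneg J0 m by (simp add: \<rho>_def)
  have rho_meas [measurable]: "(\<lambda>(x, z). \<rho> x z) \<in> borel_measurable (L \<Otimes>\<^sub>M N)"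
  proof -
    have "(\<lambda>(x, z). m * \<theta> x z / J x) \<in> borel_measurable (L \<Otimes>\<^sub>M N)" by measurable
    then show ?thesis
      by (rule measurable_cong[THEN iffD1, rotated]) (auto simp: \<rho>_def space_pair_measure)
  qed
  have rho_slice [measurable]: "x \<in> space L \<Longrightarrow> \<rho> x \<in> borel_measurable N"
    "z \<in> space N \<Longrightarrow> (\<lambda>x. \<rho> x z) \<in> borel_measurable L" for x z
    using measurable_Pair2[OF rho_meas] measurable_Pair1[OF rho_meas] by simp_all
  interpret factor_kernel M V \<rho>
  proof
    show "(\<lambda>(x, z). \<rho> x z) \<in> borel_measurable (M \<Otimes>\<^sub>M V)" by measurable
    show "0 \<le> \<rho> x z" for x z by (rule rho_nonneg)
    have "AE z in N. (LINT x|M. \<rho> x z) = 1"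
      using theta_1 AE_space
    proof eventually_elim
      case (elim z)
      have "(\<integral>\<^sup>+x. ennreal (\<rho> x z) \<partial>M) = (\<integral>\<^sup>+x. ennreal (J x / m) * ennreal (\<rho> x z) \<partial>L)"
        using elim by (intro nnM) auto
      also have "\<dots> = (\<integral>\<^sup>+x. ennreal (\<theta> x z) \<partial>L)"
        using Jm m theta_nonneg by (intro nn_integral_cong) (simp add: \<rho>_def)
      finally have "(\<integral>\<^sup>+x. ennreal (\<rho> x z) \<partial>M) = 1" using elim by simp
      moreover have "(\<lambda>x. \<rho> x z) \<in> borel_measurable M" using elim by measurable
      ultimately show ?case by (subst integral_eq_nn_integral) (auto simp: rho_nonneg)
    qed
    then show "AE z in V. (LINT x|M. \<rho> x z) = 1" unfolding V_def by (subst AE_density) auto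
    have "AE x in L. (LINT z|V. \<rho> x z) = 1"
      using theta_w AE_space
    proof eventually_elim
      case (elim x)
      have J: "J x > 0" using elim J_pos by simp
      have "(\<integral>\<^sup>+z. ennreal (\<rho> x z) \<partial>V) = (\<integral>\<^sup>+z. ennreal (w z / m) * ennreal (\<rho> x z) \<partial>N)"
        using elim by (intro nnV) auto
      also have "\<dots> = (\<integral>\<^sup>+z. ennreal (\<theta> x z * w z) * ennreal (1 / J x) \<partial>N)"
      proof (rule nn_integral_cong)
        fix z
        have "w z / m * (m * \<theta> x z / J x) = \<theta> x z * w z * (1 / J x)" using m by simp
        then show "ennreal (w z / m) * ennreal (\<rho> x z) = ennreal (\<theta> x z * w z) * ennreal (1 / J x)"
          using elim m theta_nonneg w_nonneg J by (simp add: \<rho>_def flip: ennreal_mult)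
      qed
      also have "\<dots> = ennreal (J x) * ennreal (1 / J x)" using elim by (simp add: nn_integral_multc)
      also have "\<dots> = 1" using J by (simp flip: ennreal_mult)
      finally have "(\<integral>\<^sup>+z. ennreal (\<rho> x z) \<partial>V) = 1" .
      moreover have "\<rho> x \<in> borel_measurable V" using elim by measurable
      ultimately show ?case by (subst integral_eq_nn_integral) (auto simp: rho_nonneg)
    qed
    then show "AE x in M. (LINT z|V. \<rho> x z) = 1" unfolding M_def by (subst AE_density) auto
    have "(\<integral>\<^sup>+x. \<integral>\<^sup>+z. ennreal ((\<rho> x z)\<^sup>2) \<partial>V \<partial>M) =
        (\<integral>\<^sup>+x. ennreal (J x / m) * (\<integral>\<^sup>+z. ennreal ((\<rho> x z)\<^sup>2) \<partial>V) \<partial>L)"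
      by (rule nnM) measurable
    also have "\<dots> = (\<integral>\<^sup>+x. \<integral>\<^sup>+z. ennreal ((\<theta> x z)\<^sup>2 * w z / J x) \<partial>N \<partial>L)"
    proof (rule nn_integral_cong)
      fix x assume x: "x \<in> space L"
      have J: "J x > 0" by (rule J_pos[OF x])
      have "ennreal (J x / m) * (\<integral>\<^sup>+z. ennreal ((\<rho> x z)\<^sup>2) \<partial>V) =
          ennreal (J x / m) * (\<integral>\<^sup>+z. ennreal (w z / m) * ennreal ((\<rho> x z)\<^sup>2) \<partial>N)"
        using x by (subst nnV) auto
      also have "\<dots> = (\<integral>\<^sup>+z. ennreal (J x / m) * (ennreal (w z / m) * ennreal ((\<rho> x z)\<^sup>2)) \<partial>N)"
        using x by (intro nn_integral_cmult[symmetric]) measurable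
      also have "\<dots> = (\<integral>\<^sup>+z. ennreal ((\<theta> x z)\<^sup>2 * w z / J x) \<partial>N)"
      proof (rule nn_integral_cong)
        fix z
        have "J x / m * (w z / m * (m * \<theta> x z / J x)\<^sup>2) = (\<theta> x z)\<^sup>2 * w z / J x"
          using m J by (simp add: field_simps power2_eq_square)
        moreover have "0 \<le> w z / m * (\<rho> x z)\<^sup>2" "0 \<le> J x / m" "0 \<le> w z / m" using w_nonneg m J by auto
        ultimately show "ennreal (J x / m) * (ennreal (w z / m) * ennreal ((\<rho> x z)\<^sup>2)) =
            ennreal ((\<theta> x z)\<^sup>2 * w z / J x)"
          using x by (simp add: \<rho>_def flip: ennreal_mult)
      qed
      finally show "ennreal (J x / m) * (\<integral>\<^sup>+z. ennreal ((\<rho> x z)\<^sup>2) \<partial>V) =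
          (\<integral>\<^sup>+z. ennreal ((\<theta> x z)\<^sup>2 * w z / J x) \<partial>N)" .
    qed
    finally show "(\<integral>\<^sup>+x. \<integral>\<^sup>+z. ennreal ((\<rho> x z)\<^sup>2) \<partial>V \<partial>M) < \<infinity>" using theta_sq by simp
  qed
  \<comment> \<open>The density \<open>k\<close> is relative to \<open>L\<close> and
    \<open>ks\<close> is relative to \<open>M\<close>; the factor J x' / m converts one into the
    other.\<close>
  have kop: "kernel_op L k f x = (LINT x'|M. f x' * ks x' x)"
    if f: "f \<in> borel_measurable M" and x: "x \<in> space L" for f x
  proof -
    have ksm [measurable]: "(\<lambda>x'. ks x' x) \<in> borel_measurable L"
      using measurable_Pair1[OF ks_measurable, of x] x by (simp add: space)
    have [measurable]: "f \<in> borel_measurable L" using f by (simp add: M_def)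
    have "(LINT x'|M. f x' * ks x' x) = (LINT x'|L. J x' / m * (f x' * ks x' x))"
      unfolding M_def using J_pos m
      by (subst integral_density) (auto intro!: AE_I2 divide_nonneg_nonneg less_imp_le)
    also have "\<dots> = (LINT x'|L. f x' * k x' x)"
    proof (rule Bochner_Integration.integral_cong[OF refl])
      fix x' assume x': "x' \<in> space L"
      have "ks x' x = (LINT z|N. w z / m * (\<rho> x' z * \<rho> x z))"
      proof -
        have "ks x' x = (LINT z|density N (\<lambda>z. ennreal (w z / m)). \<rho> x' z * \<rho> x z)"
          by (simp add: ks_def ip_def) (simp add: V_def)
        also have "\<dots> = (LINT z|N. w z / m * (\<rho> x' z * \<rho> x z))"
          using w_nonneg m x x' by (subst integral_density) auto
        finally show ?thesis .
      qed
      also have "\<dots> = (LINT z|N. (m / (J x' * J x)) * (\<theta> x' z * \<theta> x z * w z))"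
        using m x x' by (intro Bochner_Integration.integral_cong refl) (simp add: \<rho>_def)
      also have "\<dots> = m / (J x' * J x) * (LINT z|N. \<theta> x' z * \<theta> x z * w z)" by simp
      finally show "J x' / m * (f x' * ks x' x) = f x' * k x' x"
        using J_pos[OF x] J_pos[OF x'] m by (simp add: k[OF x x'])
    qed
    finally show ?thesis by (simp add: kernel_op_def)
  qed
  have "trace_class_L20 M (kernel_op L k)"
  proof (rule trace_class)
    fix f assume f: "f \<in> L20 M"
    then have [measurable]: "f \<in> borel_measurable M" by (simp add: L20_def)
    have "(\<lambda>x. LINT x'|M. f x' * ks x' x) \<in> borel_measurable M" by measurable
    then show "kernel_op L k f \<in> borel_measurable M"
      by (rule measurable_cong[THEN iffD1, rotated]) (simp add: kop space)
    show "AE x in M. kernel_op L k f x = (LINT x'|M. f x' * ks x' x)"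
      by (rule AE_I2) (simp add: kop space)
  qed
  then show ?thesis by (simp add: M_def)
qed

text \<open>If the posterior normaliser is \<open>\<infinity>\<close>, the Bochner integral is \<open>0\<close>, hence so is the density.\<close>

lemma trace_class_null_density:
  assumes "\<And>f. f \<in> borel_measurable M \<Longrightarrow> T f \<in> borel_measurable M" and M: "emeasure M (space M) = 0"
  shows "trace_class_L20 M T"
proof -
  interpret finite_measure M by standard (simp add: M)
  have AE0: "AE x in M. P x" for P
    by (rule AE_I[where N="space M"]) (auto simp: M)
  have ip0: "ip M f g = 0" for f g
    unfolding ip_def by (rule integral_eq_zero_AE) (rule AE0)
  have L20: "f \<in> L20 M \<longleftrightarrow> f \<in> borel_measurable M" for f
  proof -
    have "integrable M (\<lambda>x. (f x)\<^sup>2)" if "f \<in> borel_measurable M"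
      using that integrable_cong_AE[of "\<lambda>x. (f x)\<^sup>2" M "\<lambda>x. 0"] AE0 by auto
    moreover have "(LINT x|M. f x) = 0" by (rule integral_eq_zero_AE) (rule AE0)
    ultimately show ?thesis by (auto simp: L20_def)
  qed
  have E: "E = {}" if "orthonormal_set M E" for E
    using orthonormal_setD(4)[OF that] ip0 by force
  show ?thesis
  proof (rule trace_class_criterion)
    show "linear_op_L20 M T" using assms(1) AE0 by (auto simp: linear_op_L20_def L20)
    show "(\<Sum>e\<in>E. \<bar>ip M (T e) e\<bar>) \<le> 0" "(\<Sum>e\<in>E. ip M (T e) (T e)) \<le> 0" if "orthonormal_set M E" for E
      using E[OF that] by simp_all
  qed (simp add: ip0)
qed

section \<open>Linear substitutions and Gaussian integrals\<close>

text \<open>Uniqueness of Lebesgue measure: compare the two sides of Fubini's theorem for \<open>f(x + y) g(y)\<close>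
  with \<open>g\<close> the indicator of the unit cube.\<close>

lemma translation_invariant_nn_integral:
  fixes \<mu> :: "'a::euclidean_space measure"
  assumes "sigma_finite_measure \<mu>" and [measurable_cong]: "sets \<mu> = sets borel"
    and trans: "\<And>f t. f \<in> borel_measurable borel \<Longrightarrow> (\<integral>\<^sup>+x. f (x + t) \<partial>\<mu>) = (\<integral>\<^sup>+x. f x \<partial>\<mu>)"
    and refl: "\<And>f. f \<in> borel_measurable borel \<Longrightarrow> (\<integral>\<^sup>+x. f (- x) \<partial>\<mu>) = (\<integral>\<^sup>+x. f x \<partial>\<mu>)"
    and f [measurable]: "f \<in> borel_measurable borel"
  shows "(\<integral>\<^sup>+x. f x \<partial>\<mu>) = emeasure \<mu> (cbox 0 One) * (\<integral>\<^sup>+x. f x \<partial>lborel)"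
proof -
  interpret mu: sigma_finite_measure \<mu> by fact
  interpret P: pair_sigma_finite \<mu> "lborel :: 'a measure" ..
  define g :: "'a \<Rightarrow> ennreal" where "g = indicator (cbox 0 One)"
  have [measurable]: "g \<in> borel_measurable borel" unfolding g_def by simp
  have lt: "(\<integral>\<^sup>+y. k (y + t) \<partial>lborel) = (\<integral>\<^sup>+y. k y \<partial>lborel)" if [measurable]: "k \<in> borel_measurable borel"
    for k :: "'a \<Rightarrow> ennreal" and t
  proof -
    have "(\<integral>\<^sup>+y. k y \<partial>lborel) = (\<integral>\<^sup>+y. k y \<partial>distr lborel borel (\<lambda>x. t + x))"
      by (simp only: lborel_distr_plus)
    also have "\<dots> = (\<integral>\<^sup>+y. k (t + y) \<partial>lborel)" by (rule nn_integral_distr) auto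
    finally show ?thesis by (simp add: add.commute)
  qed
  have g1: "(\<integral>\<^sup>+y. g y \<partial>lborel) = 1"
    unfolding g_def by (simp add: emeasure_lborel_cbox_eq)
  have gmu: "(\<integral>\<^sup>+x. g x \<partial>\<mu>) = emeasure \<mu> (cbox 0 One)"
    unfolding g_def by simp
  have "(\<integral>\<^sup>+x. f x \<partial>\<mu>) = (\<integral>\<^sup>+y. (\<integral>\<^sup>+x. f x \<partial>\<mu>) * g y \<partial>lborel)"
    using g1 by (subst nn_integral_cmult) auto
  also have "\<dots> = (\<integral>\<^sup>+y. (\<integral>\<^sup>+x. f (x + y) * g y \<partial>\<mu>) \<partial>lborel)"
    by (intro nn_integral_cong) (subst trans[OF f, symmetric], rule nn_integral_multc[symmetric], measurable)
  also have "\<dots> = (\<integral>\<^sup>+x. (\<integral>\<^sup>+y. f (x + y) * g y \<partial>lborel) \<partial>\<mu>)"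
    by (rule P.Fubini') measurable
  \<comment> \<open>Translating y moves the shift from f to g. Reflection and translation invariance
    of \<mu> then make the x-integral of g(y - x) independent of y.\<close>
  also have "\<dots> = (\<integral>\<^sup>+x. (\<integral>\<^sup>+y. f y * g (y - x) \<partial>lborel) \<partial>\<mu>)"
  proof (rule nn_integral_cong)
    fix x
    show "(\<integral>\<^sup>+y. f (x + y) * g y \<partial>lborel) = (\<integral>\<^sup>+y. f y * g (y - x) \<partial>lborel)"
      using lt[of "\<lambda>y. f y * g (y - x)" x] by (simp add: add.commute)
  qed
  also have "\<dots> = (\<integral>\<^sup>+y. (\<integral>\<^sup>+x. f y * g (y - x) \<partial>\<mu>) \<partial>lborel)"
    by (rule P.Fubini'[symmetric]) measurable
  also have "\<dots> = (\<integral>\<^sup>+y. f y * emeasure \<mu> (cbox 0 One) \<partial>lborel)"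
  proof (rule nn_integral_cong)
    fix y
    have "(\<integral>\<^sup>+x. f y * g (y - x) \<partial>\<mu>) = f y * (\<integral>\<^sup>+x. g (y - x) \<partial>\<mu>)"
      by (rule nn_integral_cmult) measurable
    also have "(\<integral>\<^sup>+x. g (y - x) \<partial>\<mu>) = (\<integral>\<^sup>+x. g (x + y) \<partial>\<mu>)"
      using refl[of "\<lambda>x. g (x + y)"] by (simp add: add.commute)
    also have "\<dots> = emeasure \<mu> (cbox 0 One)" using trans[of g y] gmu by simp
    finally show "(\<integral>\<^sup>+x. f y * g (y - x) \<partial>\<mu>) = f y * emeasure \<mu> (cbox 0 One)" .
  qed
  also have "\<dots> = emeasure \<mu> (cbox 0 One) * (\<integral>\<^sup>+x. f x \<partial>lborel)"
    by (subst nn_integral_multc) (auto simp: mult.commute)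
  finally show ?thesis .
qed

text \<open>For a linear bijection the factor is the reciprocal of the absolute determinant. The
  encoding through integrals of nonnegative functions lets maps on spaces of matrices be treated
  without coordinates.\<close>

definition pullback_factor :: "('a::euclidean_space \<Rightarrow> 'a) \<Rightarrow> real \<Rightarrow> bool" where
  "pullback_factor \<phi> c \<longleftrightarrow> 0 < c \<and>
     (\<forall>f \<in> borel_measurable borel. (\<integral>\<^sup>+x. f (\<phi> x) \<partial>lborel) = ennreal c * (\<integral>\<^sup>+x. f x \<partial>lborel))"

lemma pullback_factorD:
  "pullback_factor \<phi> c \<Longrightarrow> f \<in> borel_measurable borel \<Longrightarrow>
    (\<integral>\<^sup>+x. f (\<phi> x) \<partial>lborel) = ennreal c * (\<integral>\<^sup>+x. f x \<partial>lborel)"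
  "pullback_factor \<phi> c \<Longrightarrow> 0 < c"
  by (auto simp: pullback_factor_def)

lemma pullback_factor_unique:
  fixes \<phi> :: "'a::euclidean_space \<Rightarrow> 'a"
  assumes "pullback_factor \<phi> c" "pullback_factor \<phi> c'"
  shows "c = c'"
proof -
  let ?g = "indicator (cbox 0 One) :: 'a \<Rightarrow> ennreal"
  have 1: "(\<integral>\<^sup>+y. ?g y \<partial>lborel) = 1"
    by (simp add: emeasure_lborel_cbox_eq)
  have "ennreal c * 1 = ennreal c' * 1"
    using assms(1)[THEN pullback_factorD(1), of ?g] assms(2)[THEN pullback_factorD(1), of ?g] 1 by simp
  then show ?thesis using assms[THEN pullback_factorD(2)] by simp
qed

lemma linear_borel_measurable:
  fixes \<phi> :: "'a::euclidean_space \<Rightarrow> 'b::euclidean_space"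
  shows "linear \<phi> \<Longrightarrow> \<phi> \<in> borel_measurable borel"
  by (intro borel_measurable_continuous_onI linear_continuous_on linear_conv_bounded_linear[THEN iffD1])

lemma pullback_factor_comp:
  assumes "pullback_factor \<phi> c" "pullback_factor \<psi> c'" "linear \<phi>"
  shows "pullback_factor (\<phi> \<circ> \<psi>) (c * c')"
  unfolding pullback_factor_def
proof (intro conjI ballI)
  show "0 < c * c'" using assms(1,2)[THEN pullback_factorD(2)] by simp
  fix f :: "'a \<Rightarrow> ennreal" assume f: "f \<in> borel_measurable borel"
  have "(\<lambda>x. f (\<phi> x)) \<in> borel_measurable borel"
    using f linear_borel_measurable[OF assms(3)] by (rule measurable_compose[rotated])
  then show "(\<integral>\<^sup>+x. f ((\<phi> \<circ> \<psi>) x) \<partial>lborel) = ennreal (c * c') * (\<integral>\<^sup>+x. f x \<partial>lborel)"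
    using pullback_factorD(1)[OF assms(2), of "\<lambda>x. f (\<phi> x)"] pullback_factorD(1)[OF assms(1) f]
      assms(1,2)[THEN pullback_factorD(2)]
    by (simp add: ennreal_mult mult_ac)
qed

text \<open>The image of Lebesgue measure under a linear bijection is again invariant under
  translations and reflection, so it is a multiple of Lebesgue measure. The multiple is finite
  because the preimage of the cube is bounded, and nonzero because the image measure is not
  null.\<close>

lemma pullback_factor_exists:
  fixes \<phi> :: "'a::euclidean_space \<Rightarrow> 'a"
  assumes lin: "linear \<phi>" "linear \<psi>" and inv: "\<And>x. \<phi> (\<psi> x) = x" "\<And>x. \<psi> (\<phi> x) = x"
  shows "\<exists>c. pullback_factor \<phi> c"
proof -
  note [measurable] = lin[THEN linear_borel_measurable]
  define \<mu> where "\<mu> = distr lborel borel \<phi>"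
  have nn: "(\<integral>\<^sup>+x. f x \<partial>\<mu>) = (\<integral>\<^sup>+x. f (\<phi> x) \<partial>lborel)" if "f \<in> borel_measurable borel" for f :: "'a \<Rightarrow> ennreal"
    unfolding \<mu>_def using that by (subst nn_integral_distr) auto
  \<comment> \<open>Sigma-finiteness of the image is pulled back from Lebesgue measure, which \<psi>
    recovers from it.\<close>
  have "distr \<mu> borel \<psi> = distr lborel borel (\<psi> \<circ> \<phi>)"
    unfolding \<mu>_def by (rule distr_distr) auto
  also have "\<dots> = lborel" using inv by (simp add: o_def distr_id2)
  finally have eq: "distr \<mu> borel \<psi> = lborel" .
  have sf: "sigma_finite_measure \<mu>"
  proof (rule sigma_finite_measure_distr)
    show "sigma_finite_measure (distr \<mu> borel \<psi>)" unfolding eq by (rule lborel.sigma_finite_measure_axioms)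
    show "\<psi> \<in> measurable \<mu> borel" by (simp add: \<mu>_def)
  qed
  have main: "(\<integral>\<^sup>+x. f x \<partial>\<mu>) = emeasure \<mu> (cbox 0 One) * (\<integral>\<^sup>+x. f x \<partial>lborel)"
    if [measurable]: "f \<in> borel_measurable borel" for f
  proof (rule translation_invariant_nn_integral[OF sf])
    show "sets \<mu> = sets borel" by (simp add: \<mu>_def)
    fix f :: "'a \<Rightarrow> ennreal" and t assume [measurable]: "f \<in> borel_measurable borel"
    have "(\<integral>\<^sup>+x. f (\<phi> x) \<partial>lborel) = (\<integral>\<^sup>+x. f (\<phi> x) \<partial>distr lborel borel (\<lambda>x. \<psi> t + x))"
      by (simp only: lborel_distr_plus)
    also have "\<dots> = (\<integral>\<^sup>+x. f (\<phi> (\<psi> t + x)) \<partial>lborel)" by (rule nn_integral_distr) auto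
    also have "\<dots> = (\<integral>\<^sup>+x. f (\<phi> x + t) \<partial>lborel)"
      using lin inv by (simp add: linear_add add.commute)
    finally show "(\<integral>\<^sup>+x. f (x + t) \<partial>\<mu>) = (\<integral>\<^sup>+x. f x \<partial>\<mu>)" by (simp add: nn)
  next
    fix f :: "'a \<Rightarrow> ennreal" assume [measurable]: "f \<in> borel_measurable borel"
    have "distr lborel borel uminus = (lborel :: 'a measure)"
      using lborel_affine[of "-1" "0 :: 'a"] by (simp add: density_1)
    then have "(\<integral>\<^sup>+x. f (\<phi> x) \<partial>lborel) = (\<integral>\<^sup>+x. f (\<phi> x) \<partial>distr lborel borel uminus)"
      by simp
    also have "\<dots> = (\<integral>\<^sup>+x. f (\<phi> (- x)) \<partial>lborel)" by (rule nn_integral_distr) auto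
    finally show "(\<integral>\<^sup>+x. f (- x) \<partial>\<mu>) = (\<integral>\<^sup>+x. f x \<partial>\<mu>)" using lin by (simp add: nn linear_neg)
  qed fact
  have "bounded (\<psi> ` cbox 0 One)"
    using lin by (intro bounded_linear_image bounded_cbox) (simp add: linear_conv_bounded_linear)
  then have "emeasure lborel (\<psi> ` cbox 0 One) < \<infinity>" by (rule emeasure_bounded_finite)
  moreover have "\<phi> -` cbox 0 One = \<psi> ` cbox 0 One"
    by (rule set_eqI) (metis imageE imageI inv vimageE vimageI2)
  ultimately have fin: "emeasure \<mu> (cbox 0 One) < \<infinity>" by (simp add: \<mu>_def emeasure_distr)
  have "emeasure \<mu> (cbox 0 One) \<noteq> 0"
  proof
    assume "emeasure \<mu> (cbox 0 One) = 0"
    then have "(\<integral>\<^sup>+x. 1 \<partial>lborel) = (0::ennreal)" using main[of "\<lambda>x. 1"] nn[of "\<lambda>x. 1"] by simp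
    then show False by simp
  qed
  then obtain c where c: "emeasure \<mu> (cbox 0 One) = ennreal c" "0 < c"
    using fin by (cases "emeasure \<mu> (cbox 0 One)") (auto simp: less_le)
  then have "pullback_factor \<phi> c"
    unfolding pullback_factor_def using main nn by auto
  then show ?thesis ..
qed

text \<open>The factor is a multiplicative character of the general linear group. Shears are commutators and
  transpositions are involutions, so it is trivial on them and is determined by its values on
  diagonal matrices.\<close>

lemma pullback_factor_det:
  fixes \<Phi> :: "real^'k^'k \<Rightarrow> 'a::euclidean_space \<Rightarrow> 'a"
  assumes hom: "\<And>A B. \<Phi> (A ** B) = \<Phi> A \<circ> \<Phi> B" and id: "\<Phi> (mat 1) = id" and lin: "\<And>A. linear (\<Phi> A)"
    and diag: "\<And>A. (\<And>i j. i \<noteq> j \<Longrightarrow> A $ i $ j = 0) \<Longrightarrow> det A \<noteq> 0 \<Longrightarrow> pullback_factor (\<Phi> A) (1 / \<bar>det A\<bar> ^ m)"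
    and A: "det A \<noteq> 0"
  shows "pullback_factor (\<Phi> A) (1 / \<bar>det A\<bar> ^ m)"
proof -
  have ex: "\<exists>c. pullback_factor (\<Phi> A) c" if A: "det A \<noteq> 0" for A
  proof -
    obtain B where "A ** B = mat 1" "B ** A = mat 1"
      using A invertible_det_nz[of A] by (auto simp: invertible_def)
    then show ?thesis
      using hom[of A B] hom[of B A] id
      by (intro pullback_factor_exists[OF lin[of A] lin[of B]]) (auto simp: fun_eq_iff)
  qed
  have "det A \<noteq> 0 \<longrightarrow> pullback_factor (\<Phi> A) (1 / \<bar>det A\<bar> ^ m)"
  proof (induction A rule: induct_matrix_elementary)
    case (1 A B)
    show ?case
    proof
      assume "det (A ** B) \<noteq> 0"
      then have "pullback_factor (\<Phi> A) (1 / \<bar>det A\<bar> ^ m)" "pullback_factor (\<Phi> B) (1 / \<bar>det B\<bar> ^ m)"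
        using 1 by (auto simp: det_mul)
      from pullback_factor_comp[OF this lin]
      show "pullback_factor (\<Phi> (A ** B)) (1 / \<bar>det (A ** B)\<bar> ^ m)"
        by (simp add: hom det_mul abs_mult power_mult_distrib)
    qed
  next
    case (2 A i)
    then show ?case using det_zero_row(2)[of i A] by simp
  next
    case (3 A)
    then show ?case using diag by blast
  next
    case (4 m' n')
    define S :: "real^'k^'k" where "S = (\<chi> i j. mat 1 $ i $ Transposition.transpose m' n' j)"
    have Sk: "S $ i $ k = (if k = Transposition.transpose m' n' i then 1 else 0)" for i k
    proof -
      have "(i = Transposition.transpose m' n' k) = (k = Transposition.transpose m' n' i)"
        by (metis transpose_involutory)
      then show ?thesis by (simp only: S_def mat_def vec_lambda_beta)
    qed
    have "(S ** S) $ i $ j = (mat 1 :: real^'k^'k) $ i $ j" for i j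
    proof -
      have "(S ** S) $ i $ j = (\<Sum>k\<in>UNIV. if k = Transposition.transpose m' n' i then S $ k $ j else 0)"
        unfolding matrix_matrix_mult_def vec_lambda_beta by (rule sum.cong) (auto simp: Sk[of i])
      also have "\<dots> = S $ (Transposition.transpose m' n' i) $ j" by simp
      also have "\<dots> = (mat 1 :: real^'k^'k) $ i $ j" by (simp add: Sk mat_def)
      finally show ?thesis .
    qed
    then have SS: "S ** S = mat 1" by (simp add: vec_eq_iff)
    then have d: "det S * det S = 1" using det_mul[of S S] by simp
    then have d1: "\<bar>det S\<bar> = 1" using square_eq_1_iff[of "det S"] by auto
    have "det S \<noteq> 0" using d by (metis mult_zero_left zero_neq_one)
    then obtain c where c: "pullback_factor (\<Phi> S) c" using ex by blast
    have "\<Phi> S \<circ> \<Phi> S = id" by (simp only: SS id flip: hom)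
    then have "pullback_factor (id :: 'a \<Rightarrow> 'a) (c * c)" using pullback_factor_comp[OF c c lin] by metis
    moreover have "pullback_factor (id :: 'a \<Rightarrow> 'a) 1" by (simp add: pullback_factor_def)
    ultimately have "c * c = 1" by (rule pullback_factor_unique)
    then have "c = 1" using pullback_factorD(2)[OF c] square_eq_1_iff[of c] by auto
    then show ?case using c d1 by (simp add: S_def)
  next
    case (5 m' n' t)
    define E :: "real^'k^'k" where "E = (\<chi> i j. if i = m' \<and> j = n' then t else of_bool (i = j))"
    \<comment> \<open>Doubling one coordinate conjugates the shear by t into the shear by 2t, which
      is \<open>E ** E\<close>. Writing this without the inverse of \<open>D\<close>, the factors
      satisfy e c = c c e, whence c = 1.\<close>
    define D :: "real^'k^'k" where "D = (\<chi> i j. if i = j then (if i = m' then 2 else 1) else 0)"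
    have comm: "D ** E = E ** E ** D"
    proof -
      have DE: "(D ** E) $ i $ j = (if i = m' then 2 else 1) * E $ i $ j" for i j
      proof -
        have "(D ** E) $ i $ j = (\<Sum>k\<in>UNIV. if k = i then (if i = m' then 2 else 1) * E $ i $ j else 0)"
          unfolding matrix_matrix_mult_def vec_lambda_beta by (rule sum.cong) (auto simp: D_def)
        then show ?thesis by simp
      qed
      have XD: "(X ** D) $ i $ j = X $ i $ j * (if j = m' then 2 else 1)" for X :: "real^'k^'k" and i j
      proof -
        have "(X ** D) $ i $ j = (\<Sum>k\<in>UNIV. if k = j then X $ i $ j * (if j = m' then 2 else 1) else 0)"
          unfolding matrix_matrix_mult_def vec_lambda_beta by (rule sum.cong) (auto simp: D_def)
        then show ?thesis by simp
      qed
      have E_alt: "E $ i $ k = of_bool (i = k) + of_bool (i = m' \<and> k = n') * t" for i k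
        using 5 by (auto simp: E_def)
      have "(E ** E) $ i $ j = (\<Sum>k\<in>UNIV. (if k = i then E $ k $ j else 0) +
          (if k = n' then of_bool (i = m') * t * E $ k $ j else 0))" for i j
        unfolding matrix_matrix_mult_def vec_lambda_beta
        by (rule sum.cong) (auto simp: E_alt[of i] distrib_right)
      then have EE: "(E ** E) $ i $ j = E $ i $ j + of_bool (i = m') * t * E $ n' $ j" for i j
        by (simp add: sum.distrib)
      show ?thesis
        using 5 by (auto simp: vec_eq_iff DE XD EE E_alt)
    qed
    have dD: "det D \<noteq> 0" by (subst det_diagonal) (auto simp: D_def)
    show ?case
      unfolding E_def[symmetric]
    proof
      assume dE: "det E \<noteq> 0"
      have "det D * det E = det E * det E * det D" using arg_cong[OF comm, of det] by (simp add: det_mul)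
      then have d1: "det E = 1" using dD dE by simp
      obtain c e where c: "pullback_factor (\<Phi> E) c" and e: "pullback_factor (\<Phi> D) e" using ex dD dE by blast
      have "pullback_factor (\<Phi> D \<circ> \<Phi> E) (e * c)" using e c lin by (rule pullback_factor_comp)
      moreover have "pullback_factor (\<Phi> E \<circ> (\<Phi> E \<circ> \<Phi> D)) (c * (c * e))"
        using e c lin by (intro pullback_factor_comp)
      moreover have "\<Phi> E \<circ> (\<Phi> E \<circ> \<Phi> D) = \<Phi> D \<circ> \<Phi> E"
        using comm by (simp flip: hom add: matrix_mul_assoc)
      ultimately have "e * c = c * (c * e)" using pullback_factor_unique by metis
      then have "c = 1" using pullback_factorD(2)[OF c] pullback_factorD(2)[OF e] by simp
      then show "pullback_factor (\<Phi> E) (1 / \<bar>det E\<bar> ^ m)"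
        using c d1 by simp
    qed
  qed
  then show ?thesis using A by blast
qed

section \<open>Left and right matrix multiplication as substitutions\<close>

lemma prod_Basis_vec:
  "(\<Prod>b\<in>(Basis :: ('a::euclidean_space^'n) set). g b) = (\<Prod>i\<in>UNIV. \<Prod>u\<in>Basis. g (axis i u))"
proof -
  have "(Basis :: ('a^'n) set) = (\<Union>i\<in>UNIV. axis i ` Basis)" by (auto simp: Basis_vec_def)
  then have "(\<Prod>b\<in>(Basis :: ('a^'n) set). g b) = (\<Prod>i\<in>UNIV. \<Prod>b\<in>axis i ` Basis. g b)"
    by (rule ssubst) (rule prod.UNION_disjoint, auto simp: axis_eq_axis)
  also have "\<dots> = (\<Prod>i\<in>UNIV. \<Prod>u\<in>Basis. g (axis i u))"
    by (intro prod.cong refl prod.reindex_cong[where l="axis _"]) (auto simp: inj_on_def axis_eq_axis)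
  finally show ?thesis .
qed

lemma prod_Basis_mat:
  "(\<Prod>b\<in>(Basis :: (real^'d^'p) set). g b) = (\<Prod>i\<in>UNIV. \<Prod>j\<in>UNIV. g (axis i (axis j 1)))"
  by (simp add: prod_Basis_vec)

lemma inner_mat_eq: "\<beta> \<bullet> axis i (axis j 1) = \<beta> $ i $ j" for \<beta> :: "real^'d^'p"
  by (simp add: inner_axis)

text \<open>Multiplication by a diagonal matrix, from either side, rescales every entry separately;
  this supplies the diagonal case for both matrix actions.\<close>

lemma pullback_factor_entrywise:
  fixes c :: "'p::finite \<Rightarrow> 'd::finite \<Rightarrow> real"
  assumes "\<And>i j. c i j \<noteq> 0"
  shows "pullback_factor (\<lambda>\<beta> :: real^'d^'p. \<chi> i j. c i j * \<beta> $ i $ j) (1 / \<bar>\<Prod>i\<in>UNIV. \<Prod>j\<in>UNIV. c i j\<bar>)"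
proof -
  define c' :: "real^'d^'p \<Rightarrow> real" where "c' b = b \<bullet> (\<chi> i j. c i j)" for b
  define T :: "real^'d^'p \<Rightarrow> real^'d^'p" where "T x = 0 + (\<Sum>b\<in>Basis. (c' b * (x \<bullet> b)) *\<^sub>R b)" for x
  have c'_axis: "c' (axis i (axis j 1)) = c i j" for i j
    unfolding c'_def by (simp add: inner_axis')
  have T: "T x = (\<chi> i j. c i j * x $ i $ j)" for x
  proof (rule euclidean_eqI)
    fix b :: "real^'d^'p" assume b: "b \<in> Basis"
    then obtain i j where ij: "b = axis i (axis j 1)" by (auto simp: Basis_vec_def)
    have "T x \<bullet> b = c' b * (x \<bullet> b)"
      using b by (simp add: T_def inner_sum_left_Basis)
    then show "T x \<bullet> b = (\<chi> i j. c i j * x $ i $ j) \<bullet> b"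
      by (simp add: ij c'_axis inner_mat_eq)
  qed
  have nz: "b \<in> Basis \<Longrightarrow> c' b \<noteq> 0" for b using assms by (auto simp: Basis_vec_def c'_axis)
  have prod: "(\<Prod>b\<in>Basis. \<bar>c' b\<bar>) = \<bar>\<Prod>i\<in>UNIV. \<Prod>j\<in>UNIV. c i j\<bar>"
    by (simp add: prod_Basis_mat c'_axis abs_prod)
  let ?d = "\<bar>\<Prod>i\<in>UNIV. \<Prod>j\<in>UNIV. c i j\<bar>"
  have d: "?d > 0" using assms by simp
  have aff: "lborel = density (distr lborel borel T) (\<lambda>_. ennreal (\<Prod>j\<in>Basis. \<bar>c' j\<bar>))"
    unfolding T_def[abs_def] using nz by (rule lborel_affine_euclidean)
  have [measurable]: "T \<in> borel_measurable borel"
    unfolding T_def[abs_def] by measurable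
  have "(\<integral>\<^sup>+x. f (T x) \<partial>lborel) = ennreal (1 / ?d) * (\<integral>\<^sup>+x. f x \<partial>lborel)"
    if [measurable]: "f \<in> borel_measurable borel" for f
  proof -
    have "(\<integral>\<^sup>+x. f x \<partial>lborel) = ennreal ?d * (\<integral>\<^sup>+x. f (T x) \<partial>lborel)"
      by (subst aff) (simp add: nn_integral_density nn_integral_distr nn_integral_cmult prod)
    then show ?thesis using d by (simp add: mult.assoc[symmetric] flip: ennreal_mult)
  qed
  then show ?thesis using d by (simp add: pullback_factor_def T[abs_def])
qed

lemma linear_matrix_mul_left: "linear (\<lambda>\<beta> :: real^'d^'p. (A :: real^'p^'q) ** \<beta>)"
  by (rule linearI) (simp_all add: matrix_matrix_mult_def vec_eq_iff sum.distrib sum_distrib_left distrib_left mult_ac)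

lemma linear_matrix_mul_right: "linear (\<lambda>\<beta> :: real^'d^'p. \<beta> ** (A :: real^'q^'d))"
  by (rule linearI) (simp_all add: matrix_matrix_mult_def vec_eq_iff sum.distrib sum_distrib_left distrib_left distrib_right mult_ac)

text \<open>\<open>A\<close> acts on each of the d columns separately, hence the exponent.\<close>

lemma pullback_factor_left_mult:
  fixes A :: "real^'p^'p"
  assumes "det A \<noteq> 0"
  shows "pullback_factor (\<lambda>\<beta> :: real^'d^'p. A ** \<beta>) (1 / \<bar>det A\<bar> ^ CARD('d))"
proof (rule pullback_factor_det[where \<Phi>="\<lambda>A \<beta>. A ** \<beta>"])
  fix A :: "real^'p^'p" assume diag: "\<And>i j. i \<noteq> j \<Longrightarrow> A $ i $ j = 0" and d: "det A \<noteq> 0"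
  have det: "det A = (\<Prod>i\<in>UNIV. A $ i $ i)" using diag by (rule det_diagonal)
  have "A ** \<beta> = (\<chi> i j. A $ i $ i * \<beta> $ i $ j)" for \<beta> :: "real^'d^'p"
  proof -
    have "(\<Sum>k\<in>UNIV. A $ i $ k * \<beta> $ k $ j) = (\<Sum>k\<in>UNIV. if k = i then A $ i $ i * \<beta> $ i $ j else 0)" for i j
      using diag by (intro sum.cong) auto
    then show ?thesis by (simp add: matrix_matrix_mult_def vec_eq_iff)
  qed
  moreover have "pullback_factor (\<lambda>\<beta> :: real^'d^'p. \<chi> i j. A $ i $ i * \<beta> $ i $ j)
      (1 / \<bar>\<Prod>i\<in>UNIV. \<Prod>j\<in>(UNIV :: 'd set). A $ i $ i\<bar>)"
    using d det by (intro pullback_factor_entrywise) auto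
  ultimately show "pullback_factor (\<lambda>\<beta> :: real^'d^'p. A ** \<beta>) (1 / \<bar>det A\<bar> ^ CARD('d))"
    by (simp add: det abs_prod prod_power_distrib power_abs)
qed (use assms in \<open>auto simp: fun_eq_iff matrix_mul_assoc linear_matrix_mul_left\<close>)

text \<open>The transpose turns right multiplication into a homomorphism in \<open>A\<close> rather
  than an antihomomorphism, as \<open>pullback_factor_det\<close> demands.\<close>

lemma pullback_factor_right_mult:
  fixes A :: "real^'d^'d"
  assumes "det A \<noteq> 0"
  shows "pullback_factor (\<lambda>\<beta> :: real^'d^'p. \<beta> ** transpose A) (1 / \<bar>det A\<bar> ^ CARD('p))"
proof (rule pullback_factor_det[where \<Phi>="\<lambda>A \<beta>. \<beta> ** transpose A"])
  fix A :: "real^'d^'d" assume diag: "\<And>i j. i \<noteq> j \<Longrightarrow> A $ i $ j = 0" and d: "det A \<noteq> 0"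
  have det: "det A = (\<Prod>i\<in>UNIV. A $ i $ i)" using diag by (rule det_diagonal)
  have "\<beta> ** transpose A = (\<chi> i j. A $ j $ j * \<beta> $ i $ j)" for \<beta> :: "real^'d^'p"
  proof -
    have "(\<Sum>k\<in>UNIV. \<beta> $ i $ k * A $ j $ k) = (\<Sum>k\<in>UNIV. if k = j then A $ j $ j * \<beta> $ i $ j else 0)" for i j
      using diag by (intro sum.cong) (auto simp: mult.commute)
    then show ?thesis by (simp add: matrix_matrix_mult_def transpose_def vec_eq_iff)
  qed
  moreover have "pullback_factor (\<lambda>\<beta> :: real^'d^'p. \<chi> i j. A $ j $ j * \<beta> $ i $ j)
      (1 / \<bar>\<Prod>i\<in>(UNIV :: 'p set). \<Prod>j\<in>UNIV. A $ j $ j\<bar>)"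
    using d det by (intro pullback_factor_entrywise) auto
  ultimately show "pullback_factor (\<lambda>\<beta> :: real^'d^'p. \<beta> ** transpose A) (1 / \<bar>det A\<bar> ^ CARD('p))"
    by (simp add: det abs_prod power_abs)
qed (use assms in \<open>auto simp: fun_eq_iff matrix_mul_assoc matrix_transpose_mul linear_matrix_mul_right\<close>)

section \<open>Positive definite matrices and the matrix normal integral\<close>

lemma spdD: "A \<in> spd \<Longrightarrow> transpose A = A" "A \<in> spd \<Longrightarrow> x \<noteq> 0 \<Longrightarrow> 0 < x \<bullet> (A *v x)"
  by (auto simp: spd_def)

lemma spd_inner_commute: "A \<in> spd \<Longrightarrow> x \<bullet> (A *v y) = y \<bullet> (A *v x)"
  by (metis dot_lmul_matrix inner_commute spdD(1) transpose_matrix_vector)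

text \<open>The columns of \<open>B\<close> form an orthonormal basis for the inner product x
  \<bullet> (A y). A largest orthonormal set exists since such sets are independent; a vector
  outside its span would give, after one Gram-Schmidt step, a larger one.\<close>

lemma spd_orthonormal_basis:
  fixes A :: "real^'n^'n"
  assumes A: "A \<in> spd"
  shows "\<exists>B :: real^'n^'n. transpose B ** A ** B = mat 1"
proof -
  define ON where "ON S \<longleftrightarrow> finite S \<and> (\<forall>u\<in>S. \<forall>v\<in>S. u \<bullet> (A *v v) = (if u = v then 1 else 0))" for S
  have lincomb: "(\<Sum>v\<in>S. c v *\<^sub>R v) \<bullet> (A *v u) = c u" if S: "ON S" and u: "u \<in> S" for S c u
  proof -
    have "(\<Sum>v\<in>S. c v *\<^sub>R v) \<bullet> (A *v u) = (\<Sum>v\<in>S. c v * (v \<bullet> (A *v u)))"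
      by (simp add: inner_sum_left)
    also have "\<dots> = (\<Sum>v\<in>S. if v = u then c u else 0)"
      using S u by (intro sum.cong) (auto simp: ON_def)
    finally show ?thesis using S u by (simp add: ON_def)
  qed
  have indep: "independent S" if S: "ON S" for S
  proof -
    have "c u = 0" if "(\<Sum>v\<in>S. c v *\<^sub>R v) = 0" "u \<in> S" for c u
      using lincomb[OF S that(2), of c] that(1) by simp
    then show ?thesis using S by (subst independent_explicit_finite_subsets) (metis (no_types, lifting) ON_def lincomb finite_subset inner_zero_left subset_iff)
  qed
  have "card S \<le> CARD('n)" if "ON S" for S
    using independent_bound[OF indep[OF that]] by simp
  moreover have "ON {}" by (simp add: ON_def)
  ultimately obtain S where S: "ON S" and max: "\<And>S'. ON S' \<Longrightarrow> card S' \<le> card S"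
    using ex_has_greatest_nat[of ON "{}" card "Suc CARD('n)"] by (auto simp: less_Suc_eq_le)
  have finS: "finite S" using S by (simp add: ON_def)
  have "span S = UNIV"
  proof (rule ccontr)
    assume "span S \<noteq> UNIV"
    then obtain u where u: "u \<notin> span S" by auto
    define w where "w = u - (\<Sum>v\<in>S. (u \<bullet> (A *v v)) *\<^sub>R v)"
    have "(\<Sum>v\<in>S. (u \<bullet> (A *v v)) *\<^sub>R v) \<in> span S" by (intro span_sum span_scale span_base)
    then have "w \<noteq> 0" using u by (auto simp: w_def)
    then have pos: "0 < w \<bullet> (A *v w)" by (rule spdD(2)[OF A])
    have orth: "w \<bullet> (A *v v) = 0" if "v \<in> S" for v
      using lincomb[OF S that, of "\<lambda>v. u \<bullet> (A *v v)"] by (simp add: w_def inner_diff_left)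
    define w' where "w' = (1 / sqrt (w \<bullet> (A *v w))) *\<^sub>R w"
    have w'v: "w' \<bullet> (A *v v) = 0" if "v \<in> S" for v using orth[OF that] by (simp add: w'_def)
    have w'w': "w' \<bullet> (A *v w') = 1"
      using pos by (simp add: w'_def matrix_vector_mult_scaleR)
    have "w' \<notin> S" using w'v w'w' by force
    moreover have "ON (insert w' S)"
      unfolding ON_def
    proof (intro conjI ballI)
      show "finite (insert w' S)" using finS by simp
      fix u v assume uv: "u \<in> insert w' S" "v \<in> insert w' S"
      consider "u = w'" "v = w'" | "u = w'" "v \<in> S" "v \<noteq> w'" | "u \<in> S" "v = w'" "u \<noteq> w'" | "u \<in> S" "v \<in> S"
        using uv \<open>w' \<notin> S\<close> by blast
      then show "u \<bullet> (A *v v) = (if u = v then 1 else 0)"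
      proof cases
        case 1 then show ?thesis using w'w' by simp
      next
        case 2 then show ?thesis using w'v by simp
      next
        case 3 then show ?thesis using w'v[of u] spd_inner_commute[OF A, of u w'] by simp
      next
        case 4 then show ?thesis using S by (simp add: ON_def)
      qed
    qed
    ultimately show False using max[of "insert w' S"] finS by simp
  qed
  then have "card S = CARD('n)"
    using dim_eq_card_independent[OF indep[OF S]] by (metis dim_UNIV dim_span DIM_cart DIM_real mult.right_neutral)
  then obtain f where f: "bij_betw f (UNIV :: 'n set) S"
    using finite_same_card_bij[of "UNIV :: 'n set" S] finS by auto
  define B :: "real^'n^'n" where "B = (\<chi> i j. f j $ i)"
  have col: "B *v axis j 1 = f j" for j
    by (simp add: B_def vec_eq_iff matrix_vector_mul_component inner_axis)
  have "(transpose B ** A ** B) $ i $ j = (mat 1 :: real^'n^'n) $ i $ j" for i j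
  proof -
    have "(transpose B ** A ** B) $ i $ j = axis i 1 \<bullet> ((transpose B ** A ** B) *v axis j 1)"
      by (simp add: inner_axis' matrix_vector_mul_component inner_axis)
    also have "\<dots> = (B *v axis i 1) \<bullet> (A *v (B *v axis j 1))"
      by (simp add: matrix_vector_mul_assoc[symmetric] del: transpose_matrix_vector)
        (metis dot_lmul_matrix inner_commute transpose_matrix_vector)
    also have "\<dots> = (mat 1 :: real^'n^'n) $ i $ j"
      using S f by (auto simp: col ON_def bij_betw_def mat_def inj_on_def)
    finally show ?thesis .
  qed
  then show ?thesis by (intro exI[of _ B]) (simp add: vec_eq_iff)
qed

lemma trace_mat_mult_transpose: "trace (\<beta> ** transpose \<beta>) = \<beta> \<bullet> \<beta>" for \<beta> :: "real^'d^'p"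
  by (simp add: trace_def matrix_matrix_mult_def transpose_def inner_vec_def)

lemma nn_integral_exp_square: "(\<integral>\<^sup>+x. ennreal (exp (- x\<^sup>2 / 2)) \<partial>lborel) = ennreal (sqrt (2 * pi))"
proof -
  have "exp (- x\<^sup>2 / 2) = sqrt (2 * pi) * std_normal_density x" for x
    by (simp add: std_normal_density_def)
  then have "(\<integral>\<^sup>+x. ennreal (exp (- x\<^sup>2 / 2)) \<partial>lborel) = ennreal (sqrt (2 * pi)) * (\<integral>\<^sup>+x. ennreal (std_normal_density x) \<partial>lborel)"
    by (simp add: ennreal_mult nn_integral_cmult normal_density_nonneg)
  also have "(\<integral>\<^sup>+x. ennreal (std_normal_density x) \<partial>lborel) = ennreal 1"
    by (subst nn_integral_eq_integral) (auto simp: normal_density_nonneg)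
  finally show ?thesis by simp
qed

lemma nn_integral_gaussian_inner:
  "(\<integral>\<^sup>+\<beta>. ennreal (exp (- (1/2) * (\<beta> \<bullet> \<beta>))) \<partial>(lborel :: 'a::euclidean_space measure)) = ennreal ((2 * pi) powr (DIM('a) / 2))"
proof -
  have "exp (- (1/2) * (\<beta> \<bullet> \<beta>)) = (\<Prod>b\<in>Basis. exp (- (\<beta> \<bullet> b)\<^sup>2 / 2))" for \<beta> :: 'a
    by (subst euclidean_inner) (simp add: exp_sum[symmetric] sum_distrib_left sum_negf power2_eq_square flip: sum_divide_distrib)
  then have "(\<integral>\<^sup>+\<beta>. ennreal (exp (- (1/2) * (\<beta> \<bullet> \<beta>))) \<partial>(lborel :: 'a measure)) =
      (\<integral>\<^sup>+\<beta>. (\<Prod>b\<in>Basis. ennreal (exp (- (\<beta> \<bullet> b)\<^sup>2 / 2))) \<partial>(lborel :: 'a measure))"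
    by (simp add: prod_ennreal)
  also have "\<dots> = (\<Prod>b\<in>(Basis :: 'a set). (\<integral>\<^sup>+x. ennreal (exp (- x\<^sup>2 / 2)) \<partial>lborel))"
    by (rule nn_integral_lborel_prod) auto
  also have "\<dots> = ennreal (sqrt (2 * pi)) ^ DIM('a)" by (simp only: nn_integral_exp_square prod_constant)
  also have "\<dots> = ennreal ((2 * pi) powr (DIM('a) / 2))"
    by (simp add: ennreal_power powr_half_sqrt[symmetric] powr_realpow[symmetric] powr_powr)
  finally show ?thesis .
qed

lemma spd_det_pos:
  fixes A :: "real^'n^'n"
  assumes "A \<in> spd"
  shows "0 < det A"
proof -
  obtain B :: "real^'n^'n" where "transpose B ** A ** B = mat 1" using spd_orthonormal_basis[OF assms] by blast
  from arg_cong[OF this, of det] have "det B * det A * det B = 1" by (simp add: det_mul)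
  then have 1: "(det B)\<^sup>2 * det A = 1" by (simp add: power2_eq_square mult_ac)
  then show ?thesis by (metis mult_le_0_iff not_le zero_le_power2 zero_less_one)
qed

text \<open>With \<open>U\<close> and \<open>V\<close> from bases adapted to \<open>A\<close> and
  \<open>B\<close>, the substitution of \<open>U ** \<beta> ** transpose V\<close> for the centred
  variable turns the exponent into the standard one. The determinants of \<open>U\<close> and
  \<open>V\<close> are inverse square roots of those of \<open>A\<close> and \<open>B\<close> up to
  sign.\<close>

theorem nn_integral_matrix_gaussian:
  fixes A :: "real^'p^'p" and B :: "real^'d^'d"
  assumes A: "A \<in> spd" and B: "B \<in> spd"
  shows "(\<integral>\<^sup>+\<beta>. ennreal (exp (- (1/2) * trace (A ** (\<beta> - \<mu>) ** B ** transpose (\<beta> - \<mu>)))) \<partial>lborel)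
    = ennreal ((2 * pi) powr (real CARD('p) * real CARD('d) / 2) * det A powr (- real CARD('d) / 2)
        * det B powr (- real CARD('p) / 2))"
proof -
  obtain U :: "real^'p^'p" where U: "transpose U ** A ** U = mat 1" using spd_orthonormal_basis[OF A] by blast
  obtain V :: "real^'d^'d" where V: "transpose V ** B ** V = mat 1" using spd_orthonormal_basis[OF B] by blast
  have dU: "(det U)\<^sup>2 * det A = 1" using arg_cong[OF U, of det] by (simp add: det_mul power2_eq_square mult_ac)
  have dV: "(det V)\<^sup>2 * det B = 1" using arg_cong[OF V, of det] by (simp add: det_mul power2_eq_square mult_ac)
  have nz: "det U \<noteq> 0" "det V \<noteq> 0" using dU dV by auto
  have root: "1 / \<bar>u\<bar> ^ k = a powr (real k / 2)" if "u\<^sup>2 * a = 1" "0 < a" for u a :: real and k :: nat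
  proof -
    have "\<bar>u\<bar> = 1 / sqrt a" using that
      by (metis abs_1 nonzero_eq_divide_eq real_sqrt_abs real_sqrt_gt_zero real_sqrt_mult real_sqrt_one less_irrefl)
    then show ?thesis using that
      by (simp add: power_divide powr_half_sqrt[symmetric] powr_realpow[symmetric] powr_powr)
  qed
  define f :: "real^'d^'p \<Rightarrow> ennreal" where "f \<beta> = ennreal (exp (- (1/2) * trace (A ** \<beta> ** B ** transpose \<beta>)))" for \<beta>
  have meas_tr: "(\<lambda>\<beta> :: real^'d^'p. trace (A ** \<beta> ** B ** transpose \<beta>)) \<in> borel_measurable borel"
    by (intro borel_measurable_continuous_onI)
      (simp add: trace_def matrix_matrix_mult_def transpose_def, intro continuous_intros)
  have [measurable]: "f \<in> borel_measurable borel" unfolding f_def[abs_def] using meas_tr by measurable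
  have "(\<integral>\<^sup>+\<beta>. f (\<beta> - \<mu>) \<partial>lborel) = (\<integral>\<^sup>+\<beta>. f (\<beta> - \<mu>) \<partial>distr lborel borel ((+) \<mu>))"
    by (simp only: lborel_distr_plus)
  also have "\<dots> = (\<integral>\<^sup>+\<beta>. f \<beta> \<partial>lborel)" by (subst nn_integral_distr) auto
  finally have shift: "(\<integral>\<^sup>+\<beta>. f (\<beta> - \<mu>) \<partial>lborel) = (\<integral>\<^sup>+\<beta>. f \<beta> \<partial>lborel)" .
  have "pullback_factor ((\<lambda>\<beta> :: real^'d^'p. U ** \<beta>) \<circ> (\<lambda>\<beta>. \<beta> ** transpose V))
      (1 / \<bar>det U\<bar> ^ CARD('d) * (1 / \<bar>det V\<bar> ^ CARD('p)))"
    using nz by (intro pullback_factor_comp pullback_factor_left_mult pullback_factor_right_mult linear_matrix_mul_left)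
  from pullback_factorD(1)[OF this, of f]
  have sub: "(\<integral>\<^sup>+\<beta>. f (U ** (\<beta> ** transpose V)) \<partial>lborel) =
      ennreal (det A powr (real CARD('d) / 2) * det B powr (real CARD('p) / 2)) * (\<integral>\<^sup>+\<beta>. f \<beta> \<partial>lborel)"
    by (simp add: root[OF dU spd_det_pos[OF A]] root[OF dV spd_det_pos[OF B]])
  have quad: "trace (A ** (U ** (\<beta> ** transpose V)) ** B ** transpose (U ** (\<beta> ** transpose V))) = \<beta> \<bullet> \<beta>"
    for \<beta> :: "real^'d^'p"
  proof -
    have "A ** (U ** (\<beta> ** transpose V)) ** B ** transpose (U ** (\<beta> ** transpose V))
      = A ** U ** \<beta> ** (transpose V ** B ** V) ** transpose \<beta> ** transpose U"
      by (simp add: matrix_transpose_mul matrix_mul_assoc)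
    also have "\<dots> = (A ** U ** \<beta> ** transpose \<beta>) ** transpose U" by (simp add: V)
    also have "trace \<dots> = trace (transpose U ** (A ** U ** \<beta> ** transpose \<beta>))" by (rule trace_mul_sym)
    also have "transpose U ** (A ** U ** \<beta> ** transpose \<beta>) = (transpose U ** A ** U) ** \<beta> ** transpose \<beta>"
      by (simp add: matrix_mul_assoc)
    finally show ?thesis by (simp add: U trace_mat_mult_transpose)
  qed
  let ?c = "det A powr (real CARD('d) / 2) * det B powr (real CARD('p) / 2)"
  have "ennreal ?c * (\<integral>\<^sup>+\<beta>. f \<beta> \<partial>lborel) = ennreal ((2 * pi) powr (real CARD('p) * real CARD('d) / 2))"
    using nn_integral_gaussian_inner[where 'a="real^'d^'p"] by (simp add: sub[symmetric]) (simp add: f_def quad)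
  then have "ennreal (1 / ?c) * (ennreal ?c * (\<integral>\<^sup>+\<beta>. f \<beta> \<partial>lborel)) =
      ennreal (1 / ?c) * ennreal ((2 * pi) powr (real CARD('p) * real CARD('d) / 2))" by simp
  moreover have "ennreal (1 / ?c) * (ennreal ?c * (\<integral>\<^sup>+\<beta>. f \<beta> \<partial>lborel)) = (\<integral>\<^sup>+\<beta>. f \<beta> \<partial>lborel)"
    using spd_det_pos[OF A] spd_det_pos[OF B]
    by (simp add: mult.assoc[symmetric] flip: ennreal_mult)
  ultimately have "(\<integral>\<^sup>+\<beta>. f \<beta> \<partial>lborel) = ennreal (1 / ?c * (2 * pi) powr (real CARD('p) * real CARD('d) / 2))"
    by (simp flip: ennreal_mult)
  also have "1 / ?c * (2 * pi) powr (real CARD('p) * real CARD('d) / 2) =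
    (2 * pi) powr (real CARD('p) * real CARD('d) / 2) * det A powr (- real CARD('d) / 2)
        * det B powr (- real CARD('p) / 2)"
    by (simp add: powr_minus field_simps)
  finally show ?thesis using shift by (simp add: f_def)
qed

section \<open>The reference measures\<close>

lemma spd_borel [measurable]: "(spd :: (real^'d^'d) set) \<in> sets borel"
proof -
  have cont: "continuous_on UNIV (\<lambda>A :: real^'d^'d. x \<bullet> (A *v x))" for x
    by (simp add: inner_vec_def matrix_vector_mult_def) (intro continuous_intros)
  have closed: "closed (\<Inter>x\<in>sphere 0 1. {A :: real^'d^'d. e \<le> x \<bullet> (A *v x)})" for e
    by (intro closed_INT ballI closed_Collect_le cont continuous_on_const)
  have sym: "closed {A :: real^'d^'d. transpose A = A}"
    by (intro closed_Collect_eq) (simp_all add: transpose_def, intro continuous_intros)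
  have "spd = {A :: real^'d^'d. transpose A = A} \<inter>
      (\<Union>k::nat. \<Inter>x\<in>sphere 0 1. {A. 1 / real (Suc k) \<le> x \<bullet> (A *v x)})" (is "_ = ?R")
  proof (intro equalityI subsetI)
    fix A :: "real^'d^'d" assume A: "A \<in> spd"
    have "\<exists>x\<in>sphere 0 1. \<forall>y\<in>sphere 0 1. x \<bullet> (A *v x) \<le> y \<bullet> (A *v y)"
      by (intro continuous_attains_inf)
        (auto intro!: continuous_intros matrix_vector_mult_linear_continuous_on simp: linear_continuous_on)
    then obtain x where x: "x \<in> sphere 0 1" "\<And>y. y \<in> sphere 0 1 \<Longrightarrow> x \<bullet> (A *v x) \<le> y \<bullet> (A *v y)" by blast
    have "0 < x \<bullet> (A *v x)" using x(1) by (intro spdD(2)[OF A]) auto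
    then obtain k where "1 / real (Suc k) < x \<bullet> (A *v x)" using nat_approx_posE by blast
    then have "1 / real (Suc k) \<le> y \<bullet> (A *v y)" if "y \<in> sphere 0 1" for y
      using x(2)[OF that] by linarith
    then show "A \<in> ?R" using spdD(1)[OF A] by blast
  next
    fix A :: "real^'d^'d" assume A: "A \<in> ?R"
    then obtain k :: nat where k: "\<forall>x\<in>sphere 0 1. 1 / real (Suc k) \<le> x \<bullet> (A *v x)" by blast
    have "0 < x \<bullet> (A *v x)" if "x \<noteq> 0" for x
    proof -
      have "0 < (1 / real (Suc k)) * (norm x)\<^sup>2" using that by simp
      also have "\<dots> \<le> (((1 / norm x) *\<^sub>R x) \<bullet> (A *v ((1 / norm x) *\<^sub>R x))) * (norm x)\<^sup>2"
        using that by (intro mult_right_mono k[rule_format]) auto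
      also have "\<dots> = x \<bullet> (A *v x)" using that by (simp add: matrix_vector_mult_scaleR power2_eq_square)
      finally show ?thesis .
    qed
    then show "A \<in> spd" using A by (simp add: spd_def)
  qed
  also have "\<dots> \<in> sets borel"
    by (intro sets.Int sets.countable_UN image_subsetI borel_closed sym closed)
  finally show ?thesis .
qed

section \<open>Lebesgue measure on symmetric matrices and its behaviour under scaling\<close>

definition sym_index :: "'d set set" where
  "sym_index = {s. \<exists>i j. s = {i, j}}"

lemma finite_sym_index [simp]: "finite (sym_index :: 'd::finite set set)"
  by (rule finite)

text \<open>Singletons count the diagonal entries, two-element sets the entries above it; the total
  is the exponent in the change of scale.\<close>

lemma card_sym_index:
  "real (card (sym_index :: 'd::finite set set)) = real CARD('d) * (real CARD('d) + 1) / 2"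
proof -
  have "(sym_index :: 'd set set) = {s. s \<subseteq> UNIV \<and> card s = 1} \<union> {s. s \<subseteq> UNIV \<and> card s = 2}"
    by (auto simp: sym_index_def card_1_singleton_iff card_2_iff)
  then have "card (sym_index :: 'd set set) = card {s. s \<subseteq> (UNIV :: 'd set) \<and> card s = 1} + card {s. s \<subseteq> (UNIV :: 'd set) \<and> card s = 2}"
    by (rule trans[OF arg_cong[where f=card] card_Un_disjoint[OF finite finite]]) auto
  also have "\<dots> = CARD('d) + (CARD('d) choose 2)"
    unfolding n_subsets[OF finite] by simp
  finally have "card (sym_index :: 'd set set) = CARD('d) + (CARD('d) choose 2)" .
  moreover have "2 * (CARD('d) choose 2) = CARD('d) * (CARD('d) - 1)"
    by (simp add: choose_two)
  ultimately have "2 * card (sym_index :: 'd set set) = CARD('d) * (CARD('d) + 1)"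
    by (cases "CARD('d)") (auto simp: algebra_simps)
  then have "2 * real (card (sym_index :: 'd set set)) = real CARD('d) * (real CARD('d) + 1)"
    by (metis of_nat_mult of_nat_numeral of_nat_add of_nat_1)
  then show ?thesis by simp
qed

abbreviation sym_coords :: "('d::finite set \<Rightarrow> real) measure" where
  "sym_coords \<equiv> Pi\<^sub>M sym_index (\<lambda>_. lborel)"

definition sym_of :: "('d::finite set \<Rightarrow> real) \<Rightarrow> real^'d^'d" where
  "sym_of w = (\<chi> i j. w {i, j})"

lemma mem_sym_index [simp]: "{i, j} \<in> sym_index"
  by (auto simp: sym_index_def)

lemma sym_of_measurable [measurable]: "sym_of \<in> borel_measurable sym_coords"
proof (subst borel_measurable_euclidean_space, intro ballI)
  fix b :: "real^'d^'d" assume "b \<in> Basis"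
  then obtain i j where b: "b = axis i (axis j 1)" by (auto simp: Basis_vec_def)
  have "(\<lambda>w. w {i, j}) \<in> measurable sym_coords lborel"
    by (rule measurable_component_singleton) simp
  then show "(\<lambda>w. sym_of w \<bullet> b) \<in> borel_measurable sym_coords"
    by (simp add: b inner_mat_eq sym_of_def)
qed

lemma sym_lborel_eq: "sym_lborel = distr sym_coords borel sym_of"
  by (simp add: sym_lborel_def sym_index_def[symmetric] sym_of_def[abs_def])

lemma sets_sym_lborel [simp, measurable_cong]: "sets sym_lborel = sets borel"
  by (simp add: sym_lborel_eq)

lemma space_sym_lborel [simp]: "space sym_lborel = UNIV"
  by (simp add: sym_lborel_eq)

interpretation lborel_product: product_sigma_finite "\<lambda>_. lborel :: real measure" ..

text \<open>An image measure need not be sigma-finite. Here every coordinate is an entry of the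
  matrix, so the preimage of a ball lies in a cube and has finite measure.\<close>

lemma sigma_finite_sym_lborel: "sigma_finite_measure (sym_lborel :: (real^'d^'d) measure)"
proof
  define C :: "nat \<Rightarrow> (real^'d^'d) set" where "C k = cball 0 (real k)" for k
  have "emeasure sym_lborel (C k) \<noteq> \<infinity>" for k
  proof -
    have "emeasure sym_lborel (C k) = emeasure sym_coords (sym_of -` C k \<inter> space sym_coords)"
      unfolding sym_lborel_eq by (rule emeasure_distr) (auto simp: C_def)
    also have "\<dots> \<le> emeasure (sym_coords :: ('d set \<Rightarrow> real) measure) (Pi\<^sub>E sym_index (\<lambda>_. {- real k..real k}))"
    proof (rule emeasure_mono)
      show "sym_of -` C k \<inter> space sym_coords \<subseteq> Pi\<^sub>E sym_index (\<lambda>_. {- real k..real k})"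
      proof (intro subsetI PiE_I)
        fix w s assume w: "w \<in> sym_of -` C k \<inter> space sym_coords"
        { assume "s \<in> (sym_index :: 'd set set)"
          then obtain i j where s: "s = {i, j}" by (auto simp: sym_index_def)
          have "\<bar>w s\<bar> = \<bar>sym_of w $ i $ j\<bar>" by (simp add: s sym_of_def)
          also have "\<dots> \<le> norm (sym_of w)" using component_le_norm_cart Finite_Cartesian_Product.norm_nth_le order_trans by blast
          also have "\<dots> \<le> real k" using w by (simp add: C_def)
          finally show "w s \<in> {- real k..real k}" by auto }
        { assume "s \<notin> (sym_index :: 'd set set)"
          then show "w s = undefined" using w by (auto simp: space_PiM PiE_def extensional_def) }
      qed
    qed (auto intro!: sets_PiM_I_finite)
    also have "\<dots> = (\<Prod>s\<in>(sym_index :: 'd set set). emeasure lborel {- real k..real k})"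
      by (rule lborel_product.emeasure_PiM) auto
    also have "\<dots> < \<infinity>" by (simp add: ennreal_power)
    finally show ?thesis by simp
  qed
  moreover have "(\<Union>k. C k) = UNIV"
    by (auto simp: C_def real_arch_simple)
  ultimately show "\<exists>A. countable A \<and> A \<subseteq> sets (sym_lborel :: (real^'d^'d) measure) \<and>
      \<Union>A = space sym_lborel \<and> (\<forall>a\<in>A. emeasure sym_lborel a \<noteq> \<infinity>)"
    by (intro exI[of _ "range C"]) (auto simp: C_def)
qed

lemma nn_integral_pos_scale:
  assumes [measurable]: "f \<in> borel_measurable borel" and c: "0 < c"
  shows "(\<integral>\<^sup>+x. f x \<partial>lborel) = ennreal c * (\<integral>\<^sup>+x. f (c * x) \<partial>(lborel :: real measure))"
  using nn_integral_real_affine[of f c 0] c by simp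

text \<open>A product measure is determined by its values on boxes, where each coordinate
  contributes one factor \<open>c\<close>.\<close>

lemma sym_coords_scale:
  assumes c: "0 < c"
  shows "density (distr sym_coords sym_coords (\<lambda>w. \<lambda>s\<in>sym_index. c * w s)) (\<lambda>_. ennreal (c ^ card (sym_index :: 'd set set)))
    = (sym_coords :: ('d::finite set \<Rightarrow> real) measure)" (is "?L = _")
proof (rule lborel_product.PiM_eqI)
  let ?T = "\<lambda>w. \<lambda>s\<in>(sym_index :: 'd set set). c * w s"
  have T [measurable]: "?T \<in> measurable sym_coords sym_coords"
    by (intro measurable_restrict) measurable
  show "finite (sym_index :: 'd set set)" "sets ?L = sets sym_coords" by simp_all
  fix A :: "'d set \<Rightarrow> real set" assume A: "\<And>s. s \<in> sym_index \<Longrightarrow> A s \<in> sets lborel"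
  let ?B = "Pi\<^sub>E sym_index A"
  have B: "?B \<in> sets sym_coords" using A by (intro sets_PiM_I_finite) auto
  have A': "s \<in> sym_index \<Longrightarrow> (\<lambda>x. c * x) -` A s \<in> sets borel" for s
    using A[of s] by (intro measurable_sets_borel[of _ borel]) auto
  have pre: "?T -` ?B \<inter> space sym_coords = Pi\<^sub>E sym_index (\<lambda>s. (\<lambda>x. c * x) -` A s)"
    by (auto simp: space_PiM PiE_iff extensional_def)
  have one: "ennreal c * emeasure lborel ((\<lambda>x. c * x) -` A s) = emeasure lborel (A s)" if s: "s \<in> sym_index" for s
  proof -
    have "(\<integral>\<^sup>+x. indicator (A s) x \<partial>lborel) = ennreal c * (\<integral>\<^sup>+x. indicator (A s) (c * x) \<partial>lborel)"
      using A[OF s] c by (intro nn_integral_pos_scale) auto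
    also have "(\<lambda>x. indicator (A s) (c * x) :: ennreal) = indicator ((\<lambda>x. c * x) -` A s)"
      by (auto simp: fun_eq_iff indicator_def)
    finally show ?thesis using A[OF s] A'[OF s] by simp
  qed
  have "emeasure ?L ?B = ennreal (c ^ card (sym_index :: 'd set set)) * emeasure sym_coords (?T -` ?B \<inter> space sym_coords)"
    using B by (simp add: emeasure_density_const emeasure_distr)
  also have "\<dots> = ennreal c ^ card (sym_index :: 'd set set) * (\<Prod>s\<in>sym_index. emeasure lborel ((\<lambda>x. c * x) -` A s))"
    using A' c unfolding pre by (subst lborel_product.emeasure_PiM) (auto simp: ennreal_power)
  also have "\<dots> = (\<Prod>s\<in>sym_index. ennreal c * emeasure lborel ((\<lambda>x. c * x) -` A s))"
    by (simp add: prod.distrib)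
  also have "\<dots> = (\<Prod>s\<in>sym_index. emeasure lborel (A s))"
    by (rule prod.cong[OF refl one])
  finally show "emeasure ?L ?B = (\<Prod>s\<in>sym_index. emeasure lborel (A s))" .
qed

lemma nn_integral_sym_lborel_scale:
  fixes f :: "real^'d^'d \<Rightarrow> ennreal"
  assumes [measurable]: "f \<in> borel_measurable borel" and c: "0 < c"
  shows "(\<integral>\<^sup>+S. f S \<partial>sym_lborel) = ennreal (c powr (real CARD('d) * (real CARD('d) + 1) / 2)) * (\<integral>\<^sup>+S. f (c *\<^sub>R S) \<partial>sym_lborel)"
proof -
  let ?T = "\<lambda>w. \<lambda>s\<in>(sym_index :: 'd set set). c * w s"
  have T [measurable]: "?T \<in> measurable sym_coords sym_coords"
    by (intro measurable_restrict) measurable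
  have T_of: "sym_of (?T w) = c *\<^sub>R sym_of w" for w
    by (simp add: sym_of_def vec_eq_iff)
  have "(\<integral>\<^sup>+S. f S \<partial>sym_lborel) = (\<integral>\<^sup>+w. f (sym_of w) \<partial>sym_coords)"
    unfolding sym_lborel_eq by (rule nn_integral_distr) auto
  also have "\<dots> = (\<integral>\<^sup>+w. f (sym_of w) \<partial>density (distr sym_coords sym_coords ?T) (\<lambda>_. ennreal (c ^ card (sym_index :: 'd set set))))"
    by (simp only: sym_coords_scale[OF c])
  also have "\<dots> = ennreal (c ^ card (sym_index :: 'd set set)) * (\<integral>\<^sup>+w. f (sym_of w) \<partial>distr sym_coords sym_coords ?T)"
    by (subst nn_integral_density) (auto simp: nn_integral_cmult)
  also have "(\<integral>\<^sup>+w. f (sym_of w) \<partial>distr sym_coords sym_coords ?T) = (\<integral>\<^sup>+w. f (c *\<^sub>R sym_of w) \<partial>sym_coords)"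
    by (subst nn_integral_distr) (auto simp: T_of)
  also have "\<dots> = (\<integral>\<^sup>+S. f (c *\<^sub>R S) \<partial>sym_lborel)"
    unfolding sym_lborel_eq by (subst nn_integral_distr) auto
  also have "c ^ card (sym_index :: 'd set set) = c powr (real CARD('d) * (real CARD('d) + 1) / 2)"
    using c by (simp add: powr_realpow[symmetric] card_sym_index)
  finally show ?thesis .
qed

lemma space_spd_measure [simp]: "space spd_measure = spd"
  by (simp add: spd_measure_def space_restrict_space)

lemma spd_measure_measurable: "f \<in> borel_measurable borel \<Longrightarrow> f \<in> borel_measurable spd_measure"
  unfolding spd_measure_def by (rule measurable_restrict_space1) simp

lemma ident_spd_measure [measurable]: "(\<lambda>S. S) \<in> borel_measurable spd_measure"
  by (rule spd_measure_measurable) simp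

lemma sigma_finite_spd_measure: "sigma_finite_measure spd_measure"
  unfolding spd_measure_def by (rule sigma_finite_measure_restrict_space[OF sigma_finite_sym_lborel]) simp

lemma spd_scaleR: "0 < c \<Longrightarrow> c *\<^sub>R S \<in> spd \<longleftrightarrow> S \<in> spd"
  by (auto simp: spd_def transpose_scalar matrix_vector_mult_scaleR scaleR_matrix_vector_assoc[symmetric] zero_less_mult_iff)

lemma nn_integral_spd_scale:
  fixes f :: "real^'d^'d \<Rightarrow> ennreal"
  assumes f: "f \<in> borel_measurable spd_measure" and c: "0 < c"
  shows "(\<integral>\<^sup>+S. f S \<partial>spd_measure) = ennreal (c powr (real CARD('d) * (real CARD('d) + 1) / 2)) * (\<integral>\<^sup>+S. f (c *\<^sub>R S) \<partial>spd_measure)"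
proof -
  let ?g = "\<lambda>S. f S * indicator spd S"
  have [measurable]: "?g \<in> borel_measurable borel"
    using f unfolding spd_measure_def by (subst (asm) borel_measurable_restrict_space_iff_ennreal) auto
  have "(\<integral>\<^sup>+S. f S \<partial>spd_measure) = (\<integral>\<^sup>+S. ?g S \<partial>sym_lborel)"
    unfolding spd_measure_def by (rule nn_integral_restrict_space) simp
  also have "\<dots> = ennreal (c powr (real CARD('d) * (real CARD('d) + 1) / 2)) * (\<integral>\<^sup>+S. ?g (c *\<^sub>R S) \<partial>sym_lborel)"
    using c by (intro nn_integral_sym_lborel_scale) auto
  also have "(\<lambda>S. ?g (c *\<^sub>R S)) = (\<lambda>S. f (c *\<^sub>R S) * indicator spd S)"
    using spd_scaleR[OF c] by (auto simp: fun_eq_iff indicator_def)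
  also have "(\<integral>\<^sup>+S. f (c *\<^sub>R S) * indicator spd S \<partial>sym_lborel) = (\<integral>\<^sup>+S. f (c *\<^sub>R S) \<partial>spd_measure)"
    unfolding spd_measure_def by (rule nn_integral_restrict_space[symmetric]) simp
  finally show ?thesis .
qed

lemma sigma_finite_state_measure:
  "sigma_finite_measure (state_measure :: ((real^'d^'p) \<times> (real^'d^'d)) measure)"
proof -
  interpret S: sigma_finite_measure "spd_measure :: (real^'d^'d) measure" by (rule sigma_finite_spd_measure)
  interpret P: pair_sigma_finite "lborel :: (real^'d^'p) measure" "spd_measure :: (real^'d^'d) measure" ..
  show ?thesis unfolding state_measure_def by (rule P.sigma_finite_measure_axioms)
qed

lemma space_state_measure: "space state_measure = UNIV \<times> spd"
  by (simp add: state_measure_def space_pair_measure)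

lemma state_measurable [measurable]:
  "fst \<in> borel_measurable state_measure" "snd \<in> measurable state_measure spd_measure" "snd \<in> borel_measurable state_measure"
proof -
  show "fst \<in> borel_measurable state_measure" unfolding state_measure_def by simp
  show 1: "snd \<in> measurable state_measure spd_measure" unfolding state_measure_def by simp
  show "snd \<in> borel_measurable state_measure" using measurable_compose[OF 1 ident_spd_measure] by simp
qed

subsection \<open>Positive numbers and the positive orthant\<close>

lemma space_pos_measure [simp]: "space pos_measure = {0<..}"
  by (simp add: pos_measure_def space_restrict_space)

lemma nn_integral_pos_measure: "(\<integral>\<^sup>+u. f u \<partial>pos_measure) = (\<integral>\<^sup>+u. f u * indicator {0<..} u \<partial>lborel)"
  unfolding pos_measure_def by (rule nn_integral_restrict_space) simp

lemma pos_measure_measurable: "f \<in> borel_measurable borel \<Longrightarrow> f \<in> borel_measurable pos_measure"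
  unfolding pos_measure_def by (rule measurable_restrict_space1) simp

lemma ident_pos_measure [measurable]: "(\<lambda>u. u) \<in> borel_measurable pos_measure"
  by (rule pos_measure_measurable) simp

lemma sigma_finite_pos_measure: "sigma_finite_measure pos_measure"
  unfolding pos_measure_def by (rule sigma_finite_measure_restrict_space[OF lborel.sigma_finite_measure_axioms]) simp

lemma orthant_borel [measurable]: "{z :: real^'n. \<forall>i. 0 < z $ i} \<in> sets borel"
proof -
  have "{z :: real^'n. \<forall>i. 0 < z $ i} = (\<Inter>i\<in>UNIV. {z. 0 < z $ i})" by auto
  moreover have "open {z :: real^'n. 0 < z $ i}" for i by (intro open_Collect_less continuous_intros)
  ultimately show ?thesis by (simp add: open_INT)
qed

lemma space_orthant_measure: "space orthant_measure = {z. \<forall>i. 0 < z $ i}"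
  by (simp add: orthant_measure_def space_restrict_space)

lemma nn_integral_orthant_measure:
  "(\<integral>\<^sup>+z. f z \<partial>orthant_measure) = (\<integral>\<^sup>+z. f z * indicator {z. \<forall>i. 0 < z $ i} z \<partial>lborel)"
  unfolding orthant_measure_def by (rule nn_integral_restrict_space) simp

lemma ident_orthant_measure [measurable]: "(\<lambda>z. z) \<in> borel_measurable orthant_measure"
  unfolding orthant_measure_def by (rule measurable_restrict_space1) simp

lemma sigma_finite_orthant_measure: "sigma_finite_measure (orthant_measure :: (real^'n) measure)"
  unfolding orthant_measure_def
  by (rule sigma_finite_measure_restrict_space[OF lborel.sigma_finite_measure_axioms]) simp

lemma vec_nth_measurable [measurable (raw)]: "f \<in> borel_measurable M \<Longrightarrow> (\<lambda>x. f x $ i) \<in> borel_measurable M"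
  for f :: "'a \<Rightarrow> 'b::euclidean_space^'n"
  by (rule borel_measurable_continuous_on[where f="\<lambda>x. x $ i"]) (intro continuous_intros)

lemma nn_integral_orthant_prod:
  fixes f :: "'n::finite \<Rightarrow> real \<Rightarrow> ennreal"
  assumes [measurable]: "\<And>i. f i \<in> borel_measurable borel"
  shows "(\<integral>\<^sup>+z. (\<Prod>i\<in>UNIV. f i (z $ i)) \<partial>orthant_measure) = (\<Prod>i\<in>UNIV. \<integral>\<^sup>+u. f i u \<partial>pos_measure)"
proof -
  \<comment> \<open>The product formula for Lebesgue integrals is indexed by basis vectors;
    \<open>idx\<close> recovers the coordinate from the vector.\<close>
  define idx :: "real^'n \<Rightarrow> 'n" where "idx b = (THE i. b = axis i 1)" for b
  have idx: "idx (axis i 1) = i" for i unfolding idx_def by (rule the_equality) (auto simp: axis_eq_axis)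
  define F where "F b u = f (idx b) u * indicator {0<..} u" for b u
  have ind: "indicator {z. \<forall>i. 0 < z $ i} z = (\<Prod>i\<in>UNIV. indicator {0<..} (z $ i) :: ennreal)" for z :: "real^'n"
    by (auto simp: indicator_def)
  have "(\<integral>\<^sup>+z. (\<Prod>i\<in>UNIV. f i (z $ i)) \<partial>orthant_measure) = (\<integral>\<^sup>+z. (\<Prod>b\<in>Basis. F b (z \<bullet> b)) \<partial>lborel)"
    by (simp add: nn_integral_orthant_measure ind prod.distrib[symmetric] prod_Basis_vec F_def idx inner_axis)
  also have "\<dots> = (\<Prod>b\<in>Basis. \<integral>\<^sup>+u. F b u \<partial>lborel)"
    by (rule nn_integral_lborel_prod) (auto simp: F_def)
  also have "\<dots> = (\<Prod>i\<in>UNIV. \<integral>\<^sup>+u. f i u \<partial>pos_measure)"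
    by (simp add: prod_Basis_vec F_def idx nn_integral_pos_measure)
  finally show ?thesis .
qed

lemma nn_integral_orthant_scale:
  fixes f :: "real^'n \<Rightarrow> ennreal"
  assumes f: "f \<in> borel_measurable orthant_measure" and v: "0 < v"
  shows "(\<integral>\<^sup>+z. f z \<partial>orthant_measure) = ennreal (v ^ CARD('n)) * (\<integral>\<^sup>+z. f (v *\<^sub>R z) \<partial>orthant_measure)"
proof -
  let ?O = "{z :: real^'n. \<forall>i. 0 < z $ i}"
  let ?g = "\<lambda>z. f z * indicator ?O z"
  have [measurable]: "?g \<in> borel_measurable borel"
    using f unfolding orthant_measure_def by (subst (asm) borel_measurable_restrict_space_iff_ennreal) auto
  have "(\<integral>\<^sup>+z. ?g z \<partial>lborel) = (\<integral>\<^sup>+z. ?g z \<partial>density (distr lborel borel (\<lambda>z. 0 + v *\<^sub>R z)) (\<lambda>_. ennreal (\<bar>v\<bar> ^ DIM(real^'n))))"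
    using lborel_affine[of v "0 :: real^'n"] v by simp
  also have "\<dots> = ennreal (v ^ CARD('n)) * (\<integral>\<^sup>+z. ?g (v *\<^sub>R z) \<partial>lborel)"
    using v by (simp add: nn_integral_density nn_integral_distr nn_integral_cmult)
  also have "(\<lambda>z. ?g (v *\<^sub>R z)) = (\<lambda>z. f (v *\<^sub>R z) * indicator ?O z)"
    using v by (auto simp: fun_eq_iff indicator_def zero_less_mult_iff)
  finally show ?thesis by (simp add: nn_integral_orthant_measure)
qed

lemma pos_measure_measurableD:
  "f \<in> borel_measurable pos_measure \<Longrightarrow> (\<lambda>x. f x * indicator {0<..} x :: ennreal) \<in> borel_measurable borel"
  unfolding pos_measure_def by (subst (asm) borel_measurable_restrict_space_iff_ennreal) auto

lemma nn_integral_pos_measure_scale: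
  fixes f :: "real \<Rightarrow> ennreal"
  assumes f: "f \<in> borel_measurable pos_measure" and c: "0 < c"
  shows "(\<integral>\<^sup>+x. f x \<partial>pos_measure) = ennreal c * (\<integral>\<^sup>+x. f (c * x) \<partial>pos_measure)"
proof -
  let ?g = "\<lambda>x. f x * indicator {0<..} x"
  have [measurable]: "?g \<in> borel_measurable borel" by (rule pos_measure_measurableD[OF f])
  have "(\<integral>\<^sup>+x. ?g x \<partial>lborel) = ennreal c * (\<integral>\<^sup>+x. ?g (c * x) \<partial>lborel)"
    using c by (intro nn_integral_pos_scale) auto
  also have "(\<lambda>x. ?g (c * x)) = (\<lambda>x. f (c * x) * indicator {0<..} x)"
    using c by (auto simp: fun_eq_iff indicator_def zero_less_mult_iff)
  finally show ?thesis by (simp add: nn_integral_pos_measure)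
qed

text \<open>\<open>dx / x\<close> is a Haar measure of the unimodular group \<open>(0, \<infinity>)\<close>, hence invariant under inversion. As
  for translations above, both sides are compared by Fubini, with a second function supported on \<open>[1, 2]\<close>.\<close>

lemma nn_integral_inversion_borel:
  fixes f :: "real \<Rightarrow> ennreal"
  assumes f [measurable]: "f \<in> borel_measurable borel"
  shows "(\<integral>\<^sup>+x. f (1 / x) * ennreal (1 / x) \<partial>pos_measure) = (\<integral>\<^sup>+x. f x * ennreal (1 / x) \<partial>pos_measure)"
proof -
  interpret S: sigma_finite_measure pos_measure by (rule sigma_finite_pos_measure)
  interpret P: pair_sigma_finite pos_measure pos_measure ..
  define J :: "(real \<Rightarrow> ennreal) \<Rightarrow> ennreal" where "J g = (\<integral>\<^sup>+x. g x * ennreal (1 / x) \<partial>pos_measure)" for g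
  have meas: "(\<lambda>x. g x) \<in> borel_measurable pos_measure" if "g \<in> borel_measurable borel" for g :: "real \<Rightarrow> ennreal"
    using that by (rule pos_measure_measurable)
  have scale: "J (\<lambda>x. g (c * x)) = J g" if [measurable]: "g \<in> borel_measurable borel" and c: "0 < c" for g c
  proof -
    have "J g = ennreal c * (\<integral>\<^sup>+x. g (c * x) * ennreal (1 / (c * x)) \<partial>pos_measure)"
      unfolding J_def using c by (intro nn_integral_pos_measure_scale pos_measure_measurable) auto
    also have "\<dots> = (\<integral>\<^sup>+x. ennreal c * (g (c * x) * ennreal (1 / (c * x))) \<partial>pos_measure)"
      by (rule nn_integral_cmult[symmetric]) (intro meas, measurable)
    also have "\<dots> = J (\<lambda>x. g (c * x))"
      unfolding J_def
    proof (rule nn_integral_cong)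
      fix x :: real assume "x \<in> space pos_measure"
      then have "ennreal c * ennreal (1 / (c * x)) = ennreal (1 / x)" using c by (simp flip: ennreal_mult)
      then show "ennreal c * (g (c * x) * ennreal (1 / (c * x))) = g (c * x) * ennreal (1 / x)"
        by (metis mult.assoc mult.commute)
    qed
    finally show ?thesis by simp
  qed
  \<comment> \<open>On [1, 2] the density 1/x lies between 1/2 and 1, so \<open>J g\<close> is
    neither 0 nor \<infinity> and can be cancelled at the end.\<close>
  define g :: "real \<Rightarrow> ennreal" where "g = indicator {1..2}"
  have [measurable]: "g \<in> borel_measurable borel" by (simp add: g_def)
  have Jg_le: "J g \<le> 1"
  proof -
    have "J g \<le> (\<integral>\<^sup>+x. indicator {1..2::real} x \<partial>lborel)"
      unfolding J_def nn_integral_pos_measure by (intro nn_integral_mono) (auto simp: g_def indicator_def)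
    then show ?thesis by simp
  qed
  have Jg_ge: "J g \<ge> ennreal (1/2)"
  proof -
    have "ennreal (1/2) = (\<integral>\<^sup>+x. ennreal (1/2) * indicator {1..2::real} x \<partial>lborel)" by (simp add: nn_integral_cmult)
    also have "\<dots> \<le> J g"
      unfolding J_def nn_integral_pos_measure
    proof (intro nn_integral_mono)
      fix x :: real
      show "ennreal (1/2) * indicator {1..2} x \<le> g x * ennreal (1 / x) * indicator {0<..} x"
      proof (cases "x \<in> {1..2}")
        case True
        then have "1/2 \<le> 1 / x" by (simp add: field_simps)
        moreover have "indicator {1..2} x = (1::ennreal)" "indicator {0<..} x = (1::ennreal)" using True by auto
        ultimately show ?thesis by (simp only: g_def mult_1_left mult_1_right ennreal_leI)
      qed simp
    qed
    finally show ?thesis .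
  qed
  have "J g * J (\<lambda>x. f (1 / x)) = (\<integral>\<^sup>+x. (g x * ennreal (1 / x)) * J (\<lambda>y. f (1 / y)) \<partial>pos_measure)"
    unfolding J_def[of g] by (rule nn_integral_multc[symmetric]) (intro meas, measurable)
  also have "\<dots> = (\<integral>\<^sup>+x. \<integral>\<^sup>+y. (g x * ennreal (1 / x)) * (f (x / y) * ennreal (1 / y)) \<partial>pos_measure \<partial>pos_measure)"
  proof (rule nn_integral_cong)
    fix x :: real assume "x \<in> space pos_measure"
    then have x: "0 < x" by simp
    \<comment> \<open>Scale invariance replaces y by y/x, which couples the two variables through
      x/y; after the exchange, x is replaced by yx and f is left with a single variable.\<close>
    have "J (\<lambda>y. f (1 / y)) = J (\<lambda>y. f (1 / (1 / x * y)))"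
      using x by (intro scale[symmetric]) auto
    also have "\<dots> = (\<integral>\<^sup>+y. f (x / y) * ennreal (1 / y) \<partial>pos_measure)"
      unfolding J_def by (intro nn_integral_cong) simp
    finally show "(g x * ennreal (1 / x)) * J (\<lambda>y. f (1 / y)) =
        (\<integral>\<^sup>+y. (g x * ennreal (1 / x)) * (f (x / y) * ennreal (1 / y)) \<partial>pos_measure)"
      by (simp only:) (rule nn_integral_cmult[symmetric], intro meas, measurable)
  qed
  also have "\<dots> = (\<integral>\<^sup>+y. \<integral>\<^sup>+x. (g x * ennreal (1 / x)) * (f (x / y) * ennreal (1 / y)) \<partial>pos_measure \<partial>pos_measure)"
    by (rule P.Fubini') measurable
  also have "\<dots> = (\<integral>\<^sup>+y. \<integral>\<^sup>+x. (g (y * x) * ennreal (1 / x)) * (f x * ennreal (1 / y)) \<partial>pos_measure \<partial>pos_measure)"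
  proof (rule nn_integral_cong)
    fix y :: real assume "y \<in> space pos_measure"
    then have y: "0 < y" by simp
    have "(\<integral>\<^sup>+x. (g x * ennreal (1 / x)) * (f (x / y) * ennreal (1 / y)) \<partial>pos_measure) = J (\<lambda>x. g x * f (x / y) * ennreal (1 / y))"
      unfolding J_def by (intro nn_integral_cong) (simp add: mult_ac)
    also have "\<dots> = J (\<lambda>x. g (y * x) * f (y * x / y) * ennreal (1 / y))" using y by (intro scale[symmetric]) auto
    also have "\<dots> = (\<integral>\<^sup>+x. (g (y * x) * ennreal (1 / x)) * (f x * ennreal (1 / y)) \<partial>pos_measure)"
      unfolding J_def using y by (intro nn_integral_cong) (simp add: mult_ac)
    finally show "(\<integral>\<^sup>+x. (g x * ennreal (1 / x)) * (f (x / y) * ennreal (1 / y)) \<partial>pos_measure) =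
       (\<integral>\<^sup>+x. (g (y * x) * ennreal (1 / x)) * (f x * ennreal (1 / y)) \<partial>pos_measure)" .
  qed
  also have "\<dots> = (\<integral>\<^sup>+x. \<integral>\<^sup>+y. (g (y * x) * ennreal (1 / x)) * (f x * ennreal (1 / y)) \<partial>pos_measure \<partial>pos_measure)"
    by (rule P.Fubini') measurable
  also have "\<dots> = (\<integral>\<^sup>+x. (f x * ennreal (1 / x)) * J g \<partial>pos_measure)"
  proof (rule nn_integral_cong)
    fix x :: real assume "x \<in> space pos_measure"
    then have x: "0 < x" by simp
    have "(\<integral>\<^sup>+y. (g (y * x) * ennreal (1 / x)) * (f x * ennreal (1 / y)) \<partial>pos_measure) =
        (\<integral>\<^sup>+y. (f x * ennreal (1 / x)) * (g (x * y) * ennreal (1 / y)) \<partial>pos_measure)"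
      by (intro nn_integral_cong) (simp add: mult_ac)
    also have "\<dots> = (f x * ennreal (1 / x)) * J (\<lambda>y. g (x * y))"
      unfolding J_def by (rule nn_integral_cmult) (intro meas, measurable)
    finally show "(\<integral>\<^sup>+y. (g (y * x) * ennreal (1 / x)) * (f x * ennreal (1 / y)) \<partial>pos_measure) = (f x * ennreal (1 / x)) * J g"
      using scale[of g x] x by simp
  qed
  also have "\<dots> = J f * J g"
    unfolding J_def[of f] by (rule nn_integral_multc) (intro meas, measurable)
  finally have "J g * J (\<lambda>x. f (1 / x)) = J g * J f" by (simp add: mult.commute)
  moreover have "J g \<noteq> 0" "J g \<noteq> \<top>" using Jg_ge Jg_le by (auto simp: top_unique)
  ultimately have "J (\<lambda>x. f (1 / x)) = J f" by (simp add: ennreal_mult_cancel_left)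
  then show ?thesis by (simp add: J_def)
qed

lemma nn_integral_inversion:
  fixes f :: "real \<Rightarrow> ennreal"
  assumes f: "f \<in> borel_measurable pos_measure"
  shows "(\<integral>\<^sup>+x. f (1 / x) * ennreal (1 / x) \<partial>pos_measure) = (\<integral>\<^sup>+x. f x * ennreal (1 / x) \<partial>pos_measure)"
proof -
  let ?g = "\<lambda>x. f x * indicator {0<..} x"
  have "(\<integral>\<^sup>+x. f (1 / x) * ennreal (1 / x) \<partial>pos_measure) = (\<integral>\<^sup>+x. ?g (1 / x) * ennreal (1 / x) \<partial>pos_measure)"
    by (intro nn_integral_cong) simp
  also have "\<dots> = (\<integral>\<^sup>+x. ?g x * ennreal (1 / x) \<partial>pos_measure)"
    by (rule nn_integral_inversion_borel[OF pos_measure_measurableD[OF f]])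
  also have "\<dots> = (\<integral>\<^sup>+x. f x * ennreal (1 / x) \<partial>pos_measure)"
    by (intro nn_integral_cong) simp
  finally show ?thesis .
qed

section \<open>Completing the square\<close>

lemma matrix_inv_eqI:
  fixes A B :: "real^'n^'n"
  assumes "A ** B = mat 1"
  shows "matrix_inv A = B"
proof -
  have BA: "B ** A = mat 1" using assms matrix_left_right_inverse by blast
  have inv: "A ** matrix_inv A = mat 1 \<and> matrix_inv A ** A = mat 1"
    unfolding matrix_inv_def by (rule someI[of _ B]) (use assms BA in blast)
  have "matrix_inv A = (B ** A) ** matrix_inv A" by (simp add: BA)
  also have "\<dots> = B ** (A ** matrix_inv A)" by (simp only: matrix_mul_assoc)
  also have "\<dots> = B" using inv by simp
  finally show ?thesis .
qed

lemma matrix_inv_spd_mult: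
  fixes A :: "real^'n^'n"
  assumes "A \<in> spd"
  shows "A ** matrix_inv A = mat 1" "matrix_inv A ** A = mat 1"
proof -
  obtain B where B: "A ** B = mat 1" "B ** A = mat 1"
    using spd_det_pos[OF assms] invertible_det_nz[of A] by (auto simp: invertible_def)
  have "matrix_inv A = B" by (rule matrix_inv_eqI[OF B(1)])
  with B show "A ** matrix_inv A = mat 1" "matrix_inv A ** A = mat 1" by simp_all
qed

lemma matrix_inv_matrix_inv: "A \<in> spd \<Longrightarrow> matrix_inv (matrix_inv A) = A" for A :: "real^'n^'n"
  by (rule matrix_inv_eqI) (rule matrix_inv_spd_mult)

lemma matrix_inv_spd:
  fixes A :: "real^'n^'n"
  assumes A: "A \<in> spd"
  shows "matrix_inv A \<in> spd"
proof -
  let ?B = "matrix_inv A"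
  have "A ** transpose ?B = transpose (?B ** A)" by (simp add: matrix_transpose_mul spdD(1)[OF A])
  also have "\<dots> = mat 1" by (simp add: matrix_inv_spd_mult[OF A])
  finally have "transpose ?B = ?B" by (rule matrix_inv_eqI[symmetric])
  moreover have "0 < x \<bullet> (?B *v x)" if "x \<noteq> 0" for x
  proof -
    have x: "x = A *v (?B *v x)" by (simp add: matrix_vector_mul_assoc matrix_inv_spd_mult[OF A])
    then have "?B *v x \<noteq> 0" using that by (metis matrix_vector_mult_0_right)
    then have "0 < (?B *v x) \<bullet> (A *v (?B *v x))" by (rule spdD(2)[OF A])
    then show ?thesis using x by (simp add: inner_commute)
  qed
  ultimately show ?thesis by (simp add: spd_def)
qed

lemma det_matrix_inv_spd: "A \<in> spd \<Longrightarrow> det (matrix_inv A) = 1 / det A" for A :: "real^'n^'n"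
  using arg_cong[OF matrix_inv_spd_mult(1), of A det] spd_det_pos[of A] by (simp add: det_mul field_simps)

lemma matrix_diff_ldistrib: "A ** (B - C) = A ** B - A ** C" for A :: "real^'n^'m"
  by (simp add: matrix_matrix_mult_def vec_eq_iff sum_subtractf right_diff_distrib)

lemma matrix_diff_rdistrib: "(A - B) ** C = A ** C - B ** C" for A :: "real^'n^'m"
  by (simp add: matrix_matrix_mult_def vec_eq_iff sum_subtractf left_diff_distrib)

lemma matrix_add_rdistrib: "(A + B) ** C = A ** C + B ** C" for A :: "real^'n^'m"
  by (simp add: matrix_matrix_mult_def vec_eq_iff sum.distrib distrib_right)

lemma matrix_vector_mult_minus: "A *v (- v) = - (A *v v)" for A :: "real^'n^'m"
  by (simp add: matrix_vector_mult_def vec_eq_iff sum_negf)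

lemma transpose_diff: "transpose (A - B) = transpose A - transpose B" for A :: "real^'n^'m"
  by (simp add: transpose_def vec_eq_iff)

lemma matrix_mult_zero [simp]: "A ** (0 :: real^'n^'k) = 0" "(0 :: real^'k^'n) ** B = 0"
  by (simp_all add: matrix_matrix_mult_def vec_eq_iff)

section \<open>Weighted Gram matrices and weighted least squares\<close>

definition diag_mat :: "real^'n \<Rightarrow> real^'n^'n" where
  "diag_mat z = (\<chi> i j. if i = j then z $ i else 0)"

lemma mult_diag_mat: "(A ** diag_mat z) $ i $ j = A $ i $ j * z $ j"
proof -
  have "(A ** diag_mat z) $ i $ j = (\<Sum>k\<in>UNIV. if k = j then A $ i $ j * z $ j else 0)"
    unfolding matrix_matrix_mult_def vec_lambda_beta by (rule sum.cong) (auto simp: diag_mat_def)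
  then show ?thesis by simp
qed

lemma transpose_diag_mat: "transpose (diag_mat z) = diag_mat z"
  by (auto simp: diag_mat_def transpose_def vec_eq_iff)

lemma matrix_inv_Q_mat:
  fixes z :: "real^'n"
  assumes "\<forall>i. 0 < z $ i"
  shows "matrix_inv (Q_mat z) = diag_mat z"
proof (rule matrix_inv_eqI)
  have nz: "z $ i \<noteq> 0" for i using assms by (metis less_irrefl)
  have "(Q_mat z ** diag_mat z) $ i $ j = (mat 1 :: real^'n^'n) $ i $ j" for i j
    by (simp add: mult_diag_mat Q_mat_def mat_def nz)
  then show "Q_mat z ** diag_mat z = mat 1" by (simp add: vec_eq_iff)
qed

lemma weighted_gram_trace:
  fixes R :: "real^'d^'n"
  assumes "transpose T = T"
  shows "(\<Sum>i\<in>UNIV. z $ i * (R $ i \<bullet> (T *v R $ i))) = trace (transpose R ** diag_mat z ** R ** T)"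
proof -
  have T: "T $ k $ j = T $ j $ k" for j k
    using arg_cong[OF assms, of "\<lambda>M. M $ j $ k"] by (simp add: transpose_def)
  have "trace (transpose R ** diag_mat z ** R ** T) = (\<Sum>j\<in>UNIV. \<Sum>k\<in>UNIV. \<Sum>i\<in>UNIV. R $ i $ j * z $ i * R $ i $ k * T $ k $ j)"
    by (simp add: trace_def matrix_matrix_mult_def[of _ T] matrix_matrix_mult_def[of _ R] mult_diag_mat transpose_def sum_distrib_right)
  also have "\<dots> = (\<Sum>j\<in>UNIV. \<Sum>i\<in>UNIV. \<Sum>k\<in>UNIV. R $ i $ j * z $ i * R $ i $ k * T $ k $ j)"
    by (intro sum.cong refl sum.swap)
  also have "\<dots> = (\<Sum>i\<in>UNIV. \<Sum>j\<in>UNIV. \<Sum>k\<in>UNIV. R $ i $ j * z $ i * R $ i $ k * T $ k $ j)"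
    by (rule sum.swap)
  also have "\<dots> = (\<Sum>i\<in>UNIV. z $ i * (R $ i \<bullet> (T *v R $ i)))"
    by (simp add: inner_vec_def matrix_vector_mult_def sum_distrib_left T mult_ac)
  finally show ?thesis by simp
qed

text \<open>The quadratic form is the sum of \<open>z $ i\<close> times the squared entries of E v,
  positive as soon as E v is nonzero. It is applied to the design matrix and to the least squares
  residual.\<close>

lemma weighted_gram_spd:
  fixes E :: "real^'k^'n"
  assumes z: "\<forall>i. 0 < z $ i" and inj: "\<And>v. E *v v = 0 \<Longrightarrow> v = 0"
  shows "transpose E ** diag_mat z ** E \<in> spd"
proof -
  let ?P = "transpose E ** diag_mat z ** E"
  have "transpose ?P = ?P" by (simp add: matrix_transpose_mul transpose_diag_mat matrix_mul_assoc)
  moreover have "0 < v \<bullet> (?P *v v)" if "v \<noteq> 0" for v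
  proof -
    have "diag_mat z *v (E *v v) = (\<chi> i. z $ i * (E *v v) $ i)"
    proof -
      have "(\<Sum>j\<in>UNIV. diag_mat z $ i $ j * u $ j) = (\<Sum>j\<in>UNIV. if j = i then z $ i * u $ i else 0)" for u :: "real^'n" and i
        by (rule sum.cong) (auto simp: diag_mat_def)
      then show ?thesis by (simp add: matrix_vector_mult_def[of "diag_mat z"] vec_eq_iff)
    qed
    moreover have "v \<bullet> (?P *v v) = (E *v v) \<bullet> (diag_mat z *v (E *v v))"
    proof -
      have "v \<bullet> (?P *v v) = v \<bullet> (transpose E *v (diag_mat z *v (E *v v)))"
        by (simp only: matrix_vector_mul_assoc matrix_mul_assoc)
      also have "\<dots> = (diag_mat z *v (E *v v)) \<bullet> (E *v v)"
        by (simp only: transpose_matrix_vector inner_commute[of v] dot_lmul_matrix)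
      finally show ?thesis by (simp only: inner_commute)
    qed
    ultimately have "v \<bullet> (?P *v v) = (\<Sum>i\<in>UNIV. z $ i * ((E *v v) $ i)\<^sup>2)"
      by (simp add: inner_vec_def power2_eq_square mult_ac)
    moreover obtain i where i: "(E *v v) $ i \<noteq> 0" using inj[of v] \<open>v \<noteq> 0\<close> by (auto simp: vec_eq_iff)
    then have "0 < (\<Sum>i\<in>UNIV. z $ i * ((E *v v) $ i)\<^sup>2)"
      using z by (intro sum_pos2[where i=i]) (auto simp: less_imp_le)
    ultimately show ?thesis by simp
  qed
  ultimately show ?thesis by (simp add: spd_def)
qed

lemma concat_cols_mult: "concat_cols X y *v v = X *v (\<chi> k. v $ Inl k) + y *v (\<chi> l. v $ Inr l)"
  by (simp add: vec_eq_iff matrix_vector_mult_def concat_cols_def UNIV_Plus_UNIV[symmetric] sum.Plus del: UNIV_Plus_UNIV)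

text \<open>The columns of \<open>X\<close> and \<open>y\<close> are jointly independent:
  \<open>X\<close> alone is injective, and no nontrivial combination of columns of \<open>y\<close>
  lies in the range of \<open>X\<close>.\<close>

lemma full_rank_concat:
  fixes X :: "real^'p^'n" and y :: "real^'d^'n"
  assumes rank: "rank (concat_cols X y) = CARD('p) + CARD('d)" and 0: "X *v u + y *v w = 0"
  shows "u = 0" "w = 0"
proof -
  define v :: "real^('p + 'd)" where "v = (\<chi> i. case i of Inl k \<Rightarrow> u $ k | Inr l \<Rightarrow> w $ l)"
  have "concat_cols X y *v v = 0" using 0 by (simp add: concat_cols_mult v_def)
  moreover have "inj ((*v) (concat_cols X y))"
    using rank by (simp flip: full_rank_injective)
  ultimately have "v = 0" by (metis injD matrix_vector_mult_0_right)
  then have "v $ Inl k = 0" "v $ Inr l = 0" for k l by simp_all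
  then show "u = 0" "w = 0" by (simp_all add: v_def vec_eq_iff)
qed

text \<open>The Schur complement of the block of \<open>X\<close> in the weighted Gram matrix of the
  concatenation of \<open>X\<close> and \<open>y\<close>; its inverse is the scale matrix of the
  inverse Wishart law.\<close>

definition schur_mat :: "real^'p^'n \<Rightarrow> real^'d^'n \<Rightarrow> real^'n \<Rightarrow> real^'d^'d" where
  "schur_mat X y z = transpose y ** matrix_inv (Q_mat z) ** y
        - transpose (mu_mat X y z) ** matrix_inv (Omega_mat X z) ** mu_mat X y z"

context
  fixes X :: "real^'p^'n" and y :: "real^'d^'n" and z :: "real^'n"
  assumes rank: "rank (concat_cols X y) = CARD('p) + CARD('d)" and z: "\<forall>i. 0 < z $ i"
begin

lemma gram_X_spd: "transpose X ** diag_mat z ** X \<in> spd"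
proof (rule weighted_gram_spd[OF z])
  fix v assume "X *v v = 0"
  then show "v = 0" using full_rank_concat(1)[OF rank, of v 0] by simp
qed

lemma Omega_eq: "Omega_mat X z = matrix_inv (transpose X ** diag_mat z ** X)"
  by (simp add: Omega_mat_def matrix_inv_Q_mat[OF z])

lemma Omega_spd: "Omega_mat X z \<in> spd"
  unfolding Omega_eq by (rule matrix_inv_spd[OF gram_X_spd])

lemma matrix_inv_Omega: "matrix_inv (Omega_mat X z) = transpose X ** diag_mat z ** X"
  unfolding Omega_eq by (rule matrix_inv_matrix_inv[OF gram_X_spd])

text \<open>The weighted least squares residual is orthogonal to the columns of \<open>X\<close>;
  this removes the cross terms in every later expansion.\<close>

lemma normal_equations: "transpose X ** diag_mat z ** (y - X ** mu_mat X y z) = 0"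
proof -
  let ?P = "transpose X ** diag_mat z ** X"
  have "transpose X ** diag_mat z ** (X ** mu_mat X y z) = (?P ** matrix_inv ?P) ** transpose X ** diag_mat z ** y"
    by (simp add: mu_mat_def matrix_inv_Q_mat[OF z] matrix_mul_assoc)
  also have "\<dots> = transpose X ** diag_mat z ** y" by (simp add: matrix_inv_spd_mult[OF gram_X_spd])
  finally show ?thesis by (simp add: matrix_diff_ldistrib)
qed

lemma normal_equations': "transpose (y - X ** mu_mat X y z) ** diag_mat z ** X = 0"
proof -
  have "transpose (y - X ** mu_mat X y z) ** diag_mat z ** X = transpose (transpose X ** diag_mat z ** (y - X ** mu_mat X y z))"
    by (simp add: matrix_transpose_mul transpose_diag_mat matrix_mul_assoc)
  also have "\<dots> = 0" by (simp only: normal_equations) (simp add: transpose_def vec_eq_iff)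
  finally show ?thesis .
qed

lemma schur_eq: "schur_mat X y z = transpose (y - X ** mu_mat X y z) ** diag_mat z ** (y - X ** mu_mat X y z)"
proof -
  let ?\<mu> = "mu_mat X y z" and ?D = "diag_mat z"
  let ?E = "y - X ** ?\<mu>"
  have "transpose ?E ** ?D ** ?E = transpose ?E ** ?D ** y - (transpose ?E ** ?D ** X) ** ?\<mu>"
    by (simp only: matrix_diff_ldistrib[of "transpose ?E ** ?D"] matrix_mul_assoc)
  also have "\<dots> = transpose ?E ** ?D ** y" by (simp only: normal_equations') simp
  also have "\<dots> = transpose y ** ?D ** y - transpose ?\<mu> ** (transpose X ** ?D ** y)"
    by (simp add: transpose_diff matrix_diff_rdistrib matrix_transpose_mul matrix_mul_assoc)
  also have "transpose X ** ?D ** y = transpose X ** ?D ** X ** ?\<mu>"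
    using normal_equations by (simp add: matrix_diff_ldistrib matrix_mul_assoc)
  finally show ?thesis
    by (simp add: schur_mat_def matrix_inv_Omega matrix_inv_Q_mat[OF z] matrix_mul_assoc)
qed

lemma schur_spd: "schur_mat X y z \<in> spd"
  unfolding schur_eq
proof (rule weighted_gram_spd[OF z])
  fix v assume "(y - X ** mu_mat X y z) *v v = 0"
  then have "X *v (- (mu_mat X y z *v v)) + y *v v = 0"
    by (simp add: matrix_vector_mult_diff_rdistrib matrix_vector_mul_assoc[symmetric] matrix_vector_mult_minus)
  then show "v = 0" by (rule full_rank_concat(2)[OF rank])
qed

text \<open>Write the residual at \<beta> as the least squares residual minus X times the deviation
  of \<beta> from \<open>mu_mat\<close>. The cross terms vanish, leaving the exponent of the matrix
  normal law plus that of the inverse Wishart law.\<close>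

lemma sum_sq_resid:
  assumes S: "S \<in> spd"
  shows "(\<Sum>i\<in>UNIV. z $ i * sq_resid X y \<beta> S i) =
    trace (matrix_inv (Omega_mat X z) ** (\<beta> - mu_mat X y z) ** matrix_inv S ** transpose (\<beta> - mu_mat X y z))
    + trace (schur_mat X y z ** matrix_inv S)"
proof -
  let ?\<mu> = "mu_mat X y z" and ?D = "diag_mat z" and ?T = "matrix_inv S"
  let ?E = "y - X ** ?\<mu>" and ?\<Delta> = "\<beta> - ?\<mu>" and ?R = "y - X ** \<beta>"
  have row: "y $ i - transpose \<beta> *v (X $ i) = ?R $ i" for i
    by (simp add: vec_eq_iff matrix_vector_mult_def matrix_matrix_mult_def transpose_def mult.commute del: transpose_matrix_vector)
  have R: "?R = ?E - X ** ?\<Delta>" by (simp add: matrix_diff_ldistrib)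
  have "transpose ?R ** ?D ** ?R = transpose ?R ** ?D ** ?E - (transpose ?R ** ?D) ** (X ** ?\<Delta>)"
    by (subst (2) R) (rule matrix_diff_ldistrib)
  also have "transpose ?R ** ?D ** ?E = transpose ?E ** ?D ** ?E - transpose ?\<Delta> ** (transpose X ** ?D ** ?E)"
    by (subst R) (simp only: transpose_diff[of ?E] matrix_diff_rdistrib matrix_transpose_mul matrix_mul_assoc)
  also have "\<dots> = schur_mat X y z" by (simp only: normal_equations schur_eq) simp
  also have "(transpose ?R ** ?D) ** (X ** ?\<Delta>) = (transpose ?E ** ?D ** X) ** ?\<Delta> - transpose ?\<Delta> ** (transpose X ** ?D ** X) ** ?\<Delta>"
    by (subst R) (simp only: transpose_diff[of ?E] matrix_diff_rdistrib matrix_transpose_mul matrix_mul_assoc)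
  also have "\<dots> = - (transpose ?\<Delta> ** (transpose X ** ?D ** X) ** ?\<Delta>)" by (simp only: normal_equations') simp
  finally have gram: "transpose ?R ** ?D ** ?R = schur_mat X y z + transpose ?\<Delta> ** (transpose X ** ?D ** X) ** ?\<Delta>" by simp
  have "(\<Sum>i\<in>UNIV. z $ i * sq_resid X y \<beta> S i) = (\<Sum>i\<in>UNIV. z $ i * (?R $ i \<bullet> (?T *v ?R $ i)))"
    by (simp only: sq_resid_def row Let_def)
  also have "\<dots> = trace (transpose ?R ** ?D ** ?R ** ?T)"
    by (rule weighted_gram_trace) (rule spdD(1)[OF matrix_inv_spd[OF S]])
  also have "\<dots> = trace (schur_mat X y z ** ?T) + trace (transpose ?\<Delta> ** ((transpose X ** ?D ** X) ** ?\<Delta> ** ?T))"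
    by (simp add: gram matrix_add_rdistrib trace_add matrix_mul_assoc)
  also have "trace (transpose ?\<Delta> ** ((transpose X ** ?D ** X) ** ?\<Delta> ** ?T)) = trace (((transpose X ** ?D ** X) ** ?\<Delta> ** ?T) ** transpose ?\<Delta>)"
    by (rule trace_mul_sym)
  finally show ?thesis by (simp add: matrix_inv_Omega)
qed

end

section \<open>The joint density of parameters and latent data\<close>

text \<open>The joint density up to constants and up to a factor depending on z alone, which cancels
  from the conditional law of the parameters. In the exponent, n/2 comes from the n Gaussian factors
  and a from the prior.\<close>

definition joint_G :: "real \<Rightarrow> real^'p^'n \<Rightarrow> real^'d^'n \<Rightarrow> (real^'d^'p) \<times> (real^'d^'d) \<Rightarrow> real^'n \<Rightarrow> real" where
  "joint_G a X y = (\<lambda>(\<beta>, S) z. exp (- (1/2) * (\<Sum>i\<in>UNIV. z $ i * sq_resid X y \<beta> S i))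
      * det S powr (- (real CARD('n) / 2) - a))"

definition norm_G :: "real \<Rightarrow> real^'p^'n \<Rightarrow> real^'d^'n \<Rightarrow> real^'n \<Rightarrow> ennreal" where
  "norm_G a X y z = (\<integral>\<^sup>+x. ennreal (joint_G a X y x z) \<partial>state_measure)"

lemma joint_G_nonneg: "0 \<le> joint_G a X y x z"
  by (simp add: joint_G_def split_def)

lemma borel_measurable_trace_quadratic:
  fixes A :: "real^'p^'p" and B :: "real^'d^'d"
  shows "(\<lambda>\<beta>. trace (A ** (\<beta> - \<mu>) ** B ** transpose (\<beta> - \<mu>))) \<in> borel_measurable borel"
proof -
  have "(\<lambda>\<beta> :: real^'d^'p. trace (A ** \<beta> ** B ** transpose \<beta>)) \<in> borel_measurable borel"
    by (intro borel_measurable_continuous_onI)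
      (simp add: trace_def matrix_matrix_mult_def transpose_def, intro continuous_intros)
  from measurable_compose[OF _ this, of "\<lambda>\<beta>. \<beta> - \<mu>" borel] show ?thesis by simp
qed

lemma det_measurable [measurable (raw)]:
  fixes A :: "'a \<Rightarrow> real^'d^'d"
  assumes [measurable]: "\<And>i j. (\<lambda>x. A x $ i $ j) \<in> borel_measurable M"
  shows "(\<lambda>x. det (A x)) \<in> borel_measurable M"
  unfolding det_def by measurable

text \<open>\<open>matrix_inv\<close> is defined by choice; Cramer's rule exhibits it as a rational
  function of the entries, from which measurability is read off.\<close>

lemma matrix_inv_mult_cramer:
  fixes S :: "real^'d^'d"
  assumes S: "S \<in> spd"
  shows "matrix_inv S *v r = (\<chi> k. det (\<chi> i j. if j = k then r $ i else S $ i $ j) / det S)"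
proof -
  have "S *v (matrix_inv S *v r) = r" by (simp add: matrix_vector_mul_assoc matrix_inv_spd_mult[OF S])
  then show ?thesis using cramer[of S "matrix_inv S *v r" r] spd_det_pos[OF S] by simp
qed

lemma borel_measurable_state [measurable]:
  "(\<lambda>x. fst x $ i $ j) \<in> borel_measurable state_measure" "(\<lambda>x. snd x $ k $ l) \<in> borel_measurable state_measure"
  by measurable

lemma sq_resid_measurable [measurable]:
  fixes X :: "real^'p^'n" and y :: "real^'d^'n"
  shows "(\<lambda>x. sq_resid X y (fst x) (snd x) i) \<in> borel_measurable state_measure"
proof -
  define r where "r x j = y $ i $ j - (\<Sum>k\<in>UNIV. fst x $ k $ j * X $ i $ k)" for x :: "(real^'d^'p) \<times> (real^'d^'d)" and j
  have [measurable]: "(\<lambda>x. r x j) \<in> borel_measurable state_measure" for j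
    unfolding r_def by measurable
  have "sq_resid X y (fst x) (snd x) i = (\<Sum>k\<in>UNIV. r x k * (det (\<chi> i' j. if j = k then r x i' else snd x $ i' $ j) / det (snd x)))"
    if "x \<in> space state_measure" for x
  proof -
    have S: "snd x \<in> spd" using that by (auto simp: space_state_measure)
    have "y $ i - transpose (fst x) *v (X $ i) = (\<chi> j. r x j)"
      by (simp add: vec_eq_iff r_def matrix_vector_mult_def transpose_def del: transpose_matrix_vector)
    then show ?thesis
      by (simp only: sq_resid_def Let_def matrix_inv_mult_cramer[OF S] inner_vec_def vec_lambda_beta inner_real_def)
  qed
  moreover have "(\<lambda>x. (\<Sum>k\<in>UNIV. r x k * (det (\<chi> i' j. if j = k then r x i' else snd x $ i' $ j) / det (snd x)))) \<in> borel_measurable state_measure"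
    by (intro borel_measurable_sum borel_measurable_times borel_measurable_divide det_measurable) (simp_all, measurable)
  ultimately show ?thesis by (subst measurable_cong) auto
qed

lemma joint_G_measurable [measurable]:
  fixes X :: "real^'p^'n" and y :: "real^'d^'n"
  shows "(\<lambda>p. joint_G a X y (fst p) (snd p)) \<in> borel_measurable (state_measure \<Otimes>\<^sub>M orthant_measure)"
proof -
  have [measurable]: "(\<lambda>p. sq_resid X y (fst (fst p)) (snd (fst p)) i) \<in> borel_measurable (state_measure \<Otimes>\<^sub>M orthant_measure)" for i
    using measurable_compose[OF measurable_fst sq_resid_measurable[of X y i]] by simp
  have [measurable]: "(\<lambda>p. snd p $ i) \<in> borel_measurable (state_measure \<Otimes>\<^sub>M orthant_measure)" for i :: 'n
    using measurable_compose[OF measurable_snd ident_orthant_measure] by measurable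

  have [measurable]: "(\<lambda>p. snd (fst p) $ i $ j) \<in> borel_measurable (state_measure \<Otimes>\<^sub>M orthant_measure)" for i j :: 'd
    using measurable_compose[OF measurable_fst borel_measurable_state(2)[of i j]] by simp
  have [measurable]: "(\<lambda>p. det (snd (fst p))) \<in> borel_measurable (state_measure \<Otimes>\<^sub>M orthant_measure)"
    by measurable
  show ?thesis unfolding joint_G_def split_def by measurable
qed

lemma joint_G_slice [measurable]:
  "z \<in> space orthant_measure \<Longrightarrow> (\<lambda>x. joint_G a X y x z) \<in> borel_measurable state_measure"
  "x \<in> space state_measure \<Longrightarrow> (\<lambda>z. joint_G a X y x z) \<in> borel_measurable orthant_measure"
  using measurable_compose[OF measurable_Pair1' joint_G_measurable] measurable_compose[OF measurable_Pair2' joint_G_measurable]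
  by fastforce+

lemma norm_G_measurable [measurable]:
  fixes X :: "real^'p^'n" and y :: "real^'d^'n"
  shows "norm_G a X y \<in> borel_measurable orthant_measure"
proof -
  interpret sigma_finite_measure "state_measure :: ((real^'d^'p) \<times> (real^'d^'d)) measure" by (rule sigma_finite_state_measure)
  have "(\<lambda>(z, x). ennreal (joint_G a X y x z)) \<in> borel_measurable (orthant_measure \<Otimes>\<^sub>M state_measure)"
    using measurable_compose[OF measurable_pair_swap' joint_G_measurable[of a X y]] by (simp add: split_def)
  from borel_measurable_nn_integral[OF this] show ?thesis by (simp add: norm_G_def[abs_def])
qed

text \<open>Where \<open>norm_G\<close> is infinite, the Bochner integral in the inverse Wishart density is \<open>0\<close> and so are both sides.\<close>

lemma cond_beta_cond_Sigma:
  fixes X :: "real^'p^'n" and y :: "real^'d^'n"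
  assumes rank: "rank (concat_cols X y) = CARD('p) + CARD('d)" and z: "\<forall>i. 0 < z $ i" and S: "S \<in> spd"
  shows "cond_beta X y S z \<beta> * cond_Sigma a X y z S = joint_G a X y (\<beta>, S) z / enn2real (norm_G a X y z)"
proof -
  let ?p = "real CARD('p)" and ?d = "real CARD('d)" and ?n = "real CARD('n)"
  let ?\<Omega> = "Omega_mat X z" and ?\<mu> = "mu_mat X y z" and ?W = "schur_mat X y z"
  note \<Omega> = Omega_spd[OF rank z] and W = schur_spd[OF rank z] and sq = sum_sq_resid[OF rank z]
  \<comment> \<open>The unnormalised inverse Wishart density: with m = n - p + 2a - d - 1 the
    exponent m + d + 1 becomes n - p + 2a.\<close>
  define iw :: "real^'d^'d \<Rightarrow> real" where "iw w = det w powr (- (?n - ?p + 2 * a) / 2) * exp (- (1/2) * trace (?W ** matrix_inv w))" for w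
  define IW where "IW = (\<integral>\<^sup>+w. ennreal (iw w) \<partial>spd_measure)"
  have iw_nonneg: "0 \<le> iw w" for w by (simp add: iw_def)
  have inner: "(\<integral>\<^sup>+\<beta>. ennreal (joint_G a X y (\<beta>, w) z) \<partial>lborel) =
      ennreal ((2 * pi) powr (?p * ?d / 2) * det ?\<Omega> powr (?d / 2)) * ennreal (iw w)" if w: "w \<in> spd" for w
  proof -
    have dw: "0 < det w" by (rule spd_det_pos[OF w])
    have dO: "det (matrix_inv ?\<Omega>) = 1 / det ?\<Omega>" "0 < det ?\<Omega>" by (rule det_matrix_inv_spd[OF \<Omega>]) (rule spd_det_pos[OF \<Omega>])
    have dwi: "det (matrix_inv w) = 1 / det w" by (rule det_matrix_inv_spd[OF w])
    let ?e = "\<lambda>\<beta>. exp (- (1/2) * trace (matrix_inv ?\<Omega> ** (\<beta> - ?\<mu>) ** matrix_inv w ** transpose (\<beta> - ?\<mu>)))"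
    let ?k = "exp (- (1/2) * trace (?W ** matrix_inv w)) * det w powr (- (?n / 2) - a)"
    have meas: "?e \<in> borel_measurable borel"
      using borel_measurable_trace_quadratic[of "matrix_inv ?\<Omega>" ?\<mu> "matrix_inv w"] by measurable
    have "joint_G a X y (\<beta>, w) z = ?k * ?e \<beta>" for \<beta>
      unfolding joint_G_def prod.case sq[OF w] distrib_left exp_add by (simp only: mult_ac)
    then have "(\<integral>\<^sup>+\<beta>. ennreal (joint_G a X y (\<beta>, w) z) \<partial>lborel) = (\<integral>\<^sup>+\<beta>. ennreal ?k * ennreal (?e \<beta>) \<partial>lborel)"
      by (simp add: ennreal_mult)
    also have "\<dots> = ennreal ?k * (\<integral>\<^sup>+\<beta>. ennreal (?e \<beta>) \<partial>lborel)"
      using meas by (intro nn_integral_cmult) auto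
    also have "\<dots> = ennreal ?k * ennreal ((2 * pi) powr (?p * ?d / 2) * det (matrix_inv ?\<Omega>) powr (- ?d / 2)
        * det (matrix_inv w) powr (- ?p / 2))"
      by (subst nn_integral_matrix_gaussian[OF matrix_inv_spd[OF \<Omega>] matrix_inv_spd[OF w]]) simp
    also have "\<dots> = ennreal (?k * ((2 * pi) powr (?p * ?d / 2) * det ?\<Omega> powr (?d / 2) * det w powr (?p / 2)))"
    proof -
      have flip: "(1 / x) powr (- t / 2) = x powr (t / 2)" if "0 < x" for x t :: real
        using that by (simp add: powr_divide powr_minus)
      show ?thesis unfolding dO(1) dwi flip[OF dw] flip[OF dO(2)] by (simp flip: ennreal_mult)
    qed
    also have "?k * ((2 * pi) powr (?p * ?d / 2) * det ?\<Omega> powr (?d / 2) * det w powr (?p / 2)) =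
        ((2 * pi) powr (?p * ?d / 2) * det ?\<Omega> powr (?d / 2)) * iw w"
    proof -
      have "det w powr (- (?n / 2) - a) * det w powr (?p / 2) = det w powr (- (?n - ?p + 2 * a) / 2)"
        by (simp add: powr_add[symmetric] field_simps)
      then show ?thesis by (simp add: iw_def mult_ac)
    qed
    finally show ?thesis by (simp add: ennreal_mult iw_nonneg)
  qed
  have norm_eq: "norm_G a X y z = ennreal ((2 * pi) powr (?p * ?d / 2) * det ?\<Omega> powr (?d / 2)) * IW"
    and iw_meas: "(\<lambda>w. ennreal (iw w)) \<in> borel_measurable spd_measure"
  proof -
    let ?c = "ennreal ((2 * pi) powr (?p * ?d / 2) * det ?\<Omega> powr (?d / 2))"
    interpret Sp: sigma_finite_measure "spd_measure :: (real^'d^'d) measure" by (rule sigma_finite_spd_measure)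
    interpret P: pair_sigma_finite "lborel :: (real^'d^'p) measure" "spd_measure :: (real^'d^'d) measure" ..
    have z': "z \<in> space orthant_measure" using z by (simp add: space_orthant_measure)
    have Gm: "(\<lambda>x. ennreal (joint_G a X y x z)) \<in> borel_measurable (lborel \<Otimes>\<^sub>M spd_measure)"
      using joint_G_slice(1)[OF z', of a X y] by (simp add: state_measure_def)
    \<comment> \<open>Measurability of \<open>iw\<close> is inherited from the inner integral of
      Tonelli's theorem, of which \<open>iw\<close> is a positive multiple.\<close>
    have "(\<lambda>w. \<integral>\<^sup>+\<beta>. ennreal (joint_G a X y (\<beta>, w) z) \<partial>lborel) \<in> borel_measurable spd_measure"
      using Gm by (intro lborel.borel_measurable_nn_integral) (simp add: split_def measurable_pair_swap_iff[of _ _ lborel])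
    then have m1: "(\<lambda>w. ?c * ennreal (iw w)) \<in> borel_measurable spd_measure"
      by (rule measurable_cong[THEN iffD1, rotated]) (simp add: inner)
    have c0: "0 < (2 * pi) powr (?p * ?d / 2) * det ?\<Omega> powr (?d / 2)" using spd_det_pos[OF \<Omega>] by simp
    have one: "ennreal (1 / c) * ennreal c = 1" if "0 < c" for c :: real
      using that by (simp flip: ennreal_mult)
    have "(\<lambda>w. ennreal (1 / ((2 * pi) powr (?p * ?d / 2) * det ?\<Omega> powr (?d / 2))) * (?c * ennreal (iw w))) \<in> borel_measurable spd_measure"
      using m1 by (rule borel_measurable_times_ennreal[OF borel_measurable_const])
    then show m2: "(\<lambda>w. ennreal (iw w)) \<in> borel_measurable spd_measure"
      by (simp only: mult.assoc[symmetric] one[OF c0] mult_1_left)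
    have "norm_G a X y z = (\<integral>\<^sup>+w. \<integral>\<^sup>+\<beta>. ennreal (joint_G a X y (\<beta>, w) z) \<partial>lborel \<partial>spd_measure)"
      unfolding norm_G_def state_measure_def by (rule P.nn_integral_snd[symmetric, OF Gm, simplified])
    also have "\<dots> = (\<integral>\<^sup>+w. ?c * ennreal (iw w) \<partial>spd_measure)" by (intro nn_integral_cong inner) simp
    also have "\<dots> = ?c * IW" unfolding IW_def by (rule nn_integral_cmult[OF m2])
    finally show "norm_G a X y z = ?c * IW" .
  qed
  have IW_real: "(LINT w|spd_measure. iw w) = enn2real IW"
  proof -
    have "(\<lambda>w. enn2real (ennreal (iw w))) \<in> borel_measurable spd_measure" using iw_meas by measurable
    then show ?thesis unfolding IW_def by (intro integral_eq_nn_integral) (simp_all add: iw_nonneg)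
  qed
  have Sig: "cond_Sigma a X y z S = iw S / enn2real IW"
  proof -
    have e: "- (?n - ?p + 2 * a - ?d - 1 + ?d + 1) / 2 = - (?n - ?p + 2 * a) / 2" by simp
    have "cond_Sigma a X y z S = normalized spd_measure iw S"
      unfolding cond_Sigma_def inv_wishart_density_def schur_mat_def[symmetric]
      by (simp only: matrix_inv_matrix_inv[OF W] e iw_def[abs_def])
    then show ?thesis by (simp add: normalized_def IW_real)
  qed
  have G: "joint_G a X y (\<beta>, S) z = exp (- (1/2) * trace (matrix_inv ?\<Omega> ** (\<beta> - ?\<mu>) ** matrix_inv S ** transpose (\<beta> - ?\<mu>)))
      * det S powr (- ?p / 2) * iw S"
  proof -
    have "- x / 2 + - (n' - x + 2 * a') / 2 = - (n' / 2) - a'" for x n' a' :: real by (simp add: field_simps)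
    then have pw: "det S powr (- (?n / 2) - a) = det S powr (- ?p / 2) * det S powr (- (?n - ?p + 2 * a) / 2)"
      by (simp only: powr_add[symmetric])
    show ?thesis
      unfolding joint_G_def prod.case sq[OF S] distrib_left exp_add iw_def pw by (simp only: mult_ac)
  qed
  have "enn2real (norm_G a X y z) = (2 * pi) powr (?p * ?d / 2) * det ?\<Omega> powr (?d / 2) * enn2real IW"
    by (simp add: norm_eq enn2real_mult)
  then show ?thesis
    unfolding cond_beta_def matrix_normal_density_def Sig G
    by (simp add: powr_minus field_simps)
qed

section \<open>Homogeneity of the joint density\<close>

lemma det_scaleR: "det (c *\<^sub>R S) = c ^ CARD('d) * det S" for S :: "real^'d^'d"
proof -
  have "c *\<^sub>R S = (\<chi> i. c *s S $ i)" by (simp add: vec_eq_iff)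
  then have "det (c *\<^sub>R S) = (\<Prod>i\<in>(UNIV :: 'd set). c) * det (\<chi> i. S $ i)" by (simp only: det_rows_mul)
  then show ?thesis by simp
qed

lemma matrix_inv_scaleR:
  fixes S :: "real^'d^'d"
  assumes "S \<in> spd" "0 < c"
  shows "matrix_inv (c *\<^sub>R S) = (1 / c) *\<^sub>R matrix_inv S"
proof (rule matrix_inv_eqI)
  have "(c *\<^sub>R S) ** ((1 / c) *\<^sub>R matrix_inv S) = (c * (1 / c)) *\<^sub>R (S ** matrix_inv S)"
    by (simp add: matrix_matrix_mult_def vec_eq_iff sum_distrib_left mult_ac)
  then show "(c *\<^sub>R S) ** ((1 / c) *\<^sub>R matrix_inv S) = mat 1"
    using assms by (simp add: matrix_inv_spd_mult)
qed

text \<open>Scaling the covariance divides the squared residuals by c, which cancels against the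
  scaling of z; only the power of the determinant remains.\<close>

lemma joint_G_scale:
  fixes X :: "real^'p^'n" and y :: "real^'d^'n"
  assumes S: "S \<in> spd" and c: "0 < c"
  shows "joint_G a X y (\<beta>, c *\<^sub>R S) (c *\<^sub>R z) = c powr (- real CARD('d) * (real CARD('n) / 2 + a)) * joint_G a X y (\<beta>, S) z"
proof -
  have "sq_resid X y \<beta> (c *\<^sub>R S) i = sq_resid X y \<beta> S i / c" for i
    by (simp add: sq_resid_def Let_def matrix_inv_scaleR[OF assms] scaleR_matrix_vector_assoc[symmetric])
  moreover have "det (c *\<^sub>R S) powr (- (real CARD('n) / 2) - a) =
      c powr (- real CARD('d) * (real CARD('n) / 2 + a)) * det S powr (- (real CARD('n) / 2) - a)"
  proof -
    have "(c ^ CARD('d)) powr (- (real CARD('n) / 2) - a) = c powr (real CARD('d) * (- (real CARD('n) / 2) - a))"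
      using c by (simp add: powr_realpow[symmetric] powr_powr)
    also have "real CARD('d) * (- (real CARD('n) / 2) - a) = - real CARD('d) * (real CARD('n) / 2 + a)"
      by (simp add: algebra_simps)
    finally show ?thesis using c spd_det_pos[OF S] by (simp add: det_scaleR powr_mult)
  qed
  ultimately show ?thesis using c by (simp add: joint_G_def)
qed

text \<open>The exponent is d(d+1)/2 from Lebesgue measure on symmetric matrices minus d(n/2 + a)
  from the determinant. It makes the comparison of z/2 with z a constant and accounts for the power
  in the Haar weight.\<close>

lemma norm_G_scale:
  fixes X :: "real^'p^'n" and y :: "real^'d^'n"
  assumes z: "\<forall>i. 0 < z $ i" and c: "0 < c"
  shows "norm_G a X y (c *\<^sub>R z) =
    ennreal (c powr ((real CARD('d) + 1 - 2 * a) * real CARD('d) / 2 - real CARD('d) * real CARD('n) / 2)) * norm_G a X y z"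
proof -
  interpret Sp: sigma_finite_measure "spd_measure :: (real^'d^'d) measure" by (rule sigma_finite_spd_measure)
  let ?e1 = "real CARD('d) * (real CARD('d) + 1) / 2" and ?e2 = "- real CARD('d) * (real CARD('n) / 2 + a)"
  have Gm: "(\<lambda>x. ennreal (joint_G a X y x z)) \<in> borel_measurable (lborel \<Otimes>\<^sub>M spd_measure)"
    if "\<forall>i. 0 < z $ i" for z
    using joint_G_slice(1)[of z a X y] that by (simp add: state_measure_def space_orthant_measure)
  have cz: "\<forall>i. 0 < (c *\<^sub>R z) $ i" using z c by simp
  have slice: "(\<lambda>S. ennreal (joint_G a X y (\<beta>, S) z)) \<in> borel_measurable spd_measure"
    if "\<forall>i. 0 < z $ i" for \<beta> z
    using measurable_compose[OF measurable_Pair1' Gm[OF that], of \<beta>] by simp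
  have "norm_G a X y (c *\<^sub>R z) = (\<integral>\<^sup>+\<beta>. \<integral>\<^sup>+S. ennreal (joint_G a X y (\<beta>, S) (c *\<^sub>R z)) \<partial>spd_measure \<partial>lborel)"
    unfolding norm_G_def state_measure_def by (rule Sp.nn_integral_fst[symmetric, OF Gm[OF cz], simplified])
  also have "\<dots> = (\<integral>\<^sup>+\<beta>. ennreal (c powr (?e1 + ?e2)) * (\<integral>\<^sup>+S. ennreal (joint_G a X y (\<beta>, S) z) \<partial>spd_measure) \<partial>lborel)"
  proof (rule nn_integral_cong)
    fix \<beta> :: "real^'d^'p"
    have "(\<integral>\<^sup>+S. ennreal (joint_G a X y (\<beta>, S) (c *\<^sub>R z)) \<partial>spd_measure) =
        ennreal (c powr ?e1) * (\<integral>\<^sup>+S. ennreal (joint_G a X y (\<beta>, c *\<^sub>R S) (c *\<^sub>R z)) \<partial>spd_measure)"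
      by (rule nn_integral_spd_scale[OF slice[OF cz] c])
    also have "(\<integral>\<^sup>+S. ennreal (joint_G a X y (\<beta>, c *\<^sub>R S) (c *\<^sub>R z)) \<partial>spd_measure) =
        (\<integral>\<^sup>+S. ennreal (c powr ?e2) * ennreal (joint_G a X y (\<beta>, S) z) \<partial>spd_measure)"
      by (intro nn_integral_cong) (simp add: joint_G_scale c ennreal_mult joint_G_nonneg)
    also have "\<dots> = ennreal (c powr ?e2) * (\<integral>\<^sup>+S. ennreal (joint_G a X y (\<beta>, S) z) \<partial>spd_measure)"
      by (rule nn_integral_cmult[OF slice[OF z]])
    finally show "(\<integral>\<^sup>+S. ennreal (joint_G a X y (\<beta>, S) (c *\<^sub>R z)) \<partial>spd_measure) =
        ennreal (c powr (?e1 + ?e2)) * (\<integral>\<^sup>+S. ennreal (joint_G a X y (\<beta>, S) z) \<partial>spd_measure)"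
      by (simp only: powr_add ennreal_mult powr_ge_zero mult.assoc)
  qed
  also have "\<dots> = ennreal (c powr (?e1 + ?e2)) * (\<integral>\<^sup>+\<beta>. \<integral>\<^sup>+S. ennreal (joint_G a X y (\<beta>, S) z) \<partial>spd_measure \<partial>lborel)"
    using Sp.borel_measurable_nn_integral_fst[OF Gm[OF z]] by (intro nn_integral_cmult) simp
  also have "(\<integral>\<^sup>+\<beta>. \<integral>\<^sup>+S. ennreal (joint_G a X y (\<beta>, S) z) \<partial>spd_measure \<partial>lborel) = norm_G a X y z"
    unfolding norm_G_def state_measure_def by (rule Sp.nn_integral_fst[OF Gm[OF z], simplified])
  also have "?e1 + ?e2 = (real CARD('d) + 1 - 2 * a) * real CARD('d) / 2 - real CARD('d) * real CARD('n) / 2"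
    by (simp add: field_simps)
  finally show ?thesis .
qed

section \<open>Mixing densities with a light left tail\<close>

text \<open>The feature near \<open>0\<close> that the four families have in common.\<close>

definition dilation_gain :: "(real \<Rightarrow> real) \<Rightarrow> bool" where
  "dilation_gain h \<longleftrightarrow> (\<exists>C>0. \<exists>\<epsilon>>0. \<forall>z v. 0 < z \<and> z \<le> 1 \<and> 5/4 * z \<le> v \<and> v \<le> 3/2 * z \<longrightarrow>
      h z \<le> C * z powr \<epsilon> * h v)"

lemma dilation_gainI:
  assumes "0 < C" "0 < \<epsilon>"
    "\<And>z v. 0 < z \<Longrightarrow> z \<le> 1 \<Longrightarrow> 5/4 * z \<le> v \<Longrightarrow> v \<le> 3/2 * z \<Longrightarrow> h z \<le> C * z powr \<epsilon> * h v"
  shows "dilation_gain h"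
  using assms unfolding dilation_gain_def by blast

text \<open>The absolute value of the exponent covers increasing and decreasing powers
  alike.\<close>

lemma powr_dilation:
  fixes z v q :: real
  assumes "0 < z" "z \<le> v" "v \<le> 3/2 * z"
  shows "z powr q \<le> (3/2) powr \<bar>q\<bar> * v powr q"
proof (cases "0 \<le> q")
  case True
  have "z powr q \<le> v powr q" using assms True by (intro powr_mono2) auto
  also have "\<dots> \<le> (3/2) powr \<bar>q\<bar> * v powr q" using ge_one_powr_ge_zero[of "3/2" "\<bar>q\<bar>"] by (simp add: mult_le_cancel_right1)
  finally show ?thesis .
next
  case False
  have "z powr q \<le> (2/3 * v) powr q" using assms False by (intro powr_mono2') auto
  also have "\<dots> = (2/3) powr q * v powr q" by (rule powr_mult)
  also have "(2/3 :: real) powr q = (3/2) powr \<bar>q\<bar>"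
  proof -
    have "(2/3 :: real) powr q * (3/2) powr q = 1"
      using powr_mult[of "2/3 :: real" "3/2" q] by simp
    then show ?thesis using False by (simp add: powr_minus field_simps)
  qed
  finally show ?thesis .
qed

text \<open>Trades exponential decay in 1/z for the power of z that \<open>dilation_gain\<close>
  asks for.\<close>

lemma exp_neg_le_inverse: "exp (- x) \<le> 1 / x" if "0 < x" for x :: real
proof -
  have "x \<le> exp x" using exp_ge_add_one_self[of x] by linarith
  then show ?thesis using that by (simp add: exp_minus divide_simps)
qed

lemma inverse_gap:
  fixes z v :: real
  assumes "0 < z" "5/4 * z \<le> v"
  shows "1 / v \<le> 4 / (5 * z)"
  using assms by (simp add: field_simps)

text \<open>Since v \<ge> 5z/4, the reciprocals differ by at least 1/(5z), so the ratio gains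
  exp(-\<gamma>/(10z)) \<le> 10z/\<gamma>. The linear term costs at most \<alpha>/4 in the exponent
  because v - z \<le> 1/2.\<close>

lemma dilation_gain_gig:
  assumes "\<alpha> > 0" "\<gamma> > 0"
  shows "dilation_gain (\<lambda>u. u powr (q - 1) * exp (- (1/2) * (\<alpha> * u + \<gamma> / u)))"
proof (rule dilation_gainI)
  let ?K = "(3/2) powr \<bar>q - 1\<bar>"
  show "0 < ?K * exp (\<alpha> / 4) * (10 / \<gamma>)" "(0::real) < 1" using assms by simp_all
  fix z v :: real assume z: "0 < z" "z \<le> 1" "5/4 * z \<le> v" "v \<le> 3/2 * z"
  have "- (1/2) * (\<alpha> * z + \<gamma> / z) \<le> \<alpha> / 4 + - (\<gamma> / (10 * z)) + - (1/2) * (\<alpha> * v + \<gamma> / v)"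
  proof -
    have "\<alpha> * (v - z) \<le> \<alpha> * (1/2)" using assms z by (intro mult_left_mono) auto
    moreover have "\<gamma> * (1 / v) \<le> \<gamma> * (4 / (5 * z))" using assms inverse_gap[OF z(1,3)] by (intro mult_left_mono) auto
    moreover have "\<gamma> * (4 / (5 * z)) = \<gamma> / z - 2 * (\<gamma> / (10 * z))" using z by (simp add: field_simps)
    ultimately show ?thesis by (simp add: algebra_simps)
  qed
  then have "exp (- (1/2) * (\<alpha> * z + \<gamma> / z)) \<le> exp (\<alpha> / 4 + - (\<gamma> / (10 * z)) + - (1/2) * (\<alpha> * v + \<gamma> / v))"
    by (rule exp_le_cancel_iff[THEN iffD2])
  also have "\<dots> = exp (\<alpha> / 4) * exp (- (\<gamma> / (10 * z))) * exp (- (1/2) * (\<alpha> * v + \<gamma> / v))"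
    by (simp only: exp_add)
  also have "\<dots> \<le> exp (\<alpha> / 4) * (10 / \<gamma> * z) * exp (- (1/2) * (\<alpha> * v + \<gamma> / v))"
    using exp_neg_le_inverse[of "\<gamma> / (10 * z)"] assms z by (intro mult_left_mono mult_right_mono) auto
  finally have e: "exp (- (1/2) * (\<alpha> * z + \<gamma> / z)) \<le> exp (\<alpha> / 4) * (10 / \<gamma> * z) * exp (- (1/2) * (\<alpha> * v + \<gamma> / v))" .
  have "z powr (q - 1) * exp (- (1/2) * (\<alpha> * z + \<gamma> / z)) \<le>
      (?K * v powr (q - 1)) * (exp (\<alpha> / 4) * (10 / \<gamma> * z) * exp (- (1/2) * (\<alpha> * v + \<gamma> / v)))"
    using z by (intro mult_mono powr_dilation e) auto
  also have "\<dots> = ?K * exp (\<alpha> / 4) * (10 / \<gamma>) * z powr 1 * (v powr (q - 1) * exp (- (1/2) * (\<alpha> * v + \<gamma> / v)))"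
    using z by (simp only: powr_one mult_ac less_imp_le)
  finally show "z powr (q - 1) * exp (- (1/2) * (\<alpha> * z + \<gamma> / z)) \<le>
    ?K * exp (\<alpha> / 4) * (10 / \<gamma>) * z powr 1 * (v powr (q - 1) * exp (- (1/2) * (\<alpha> * v + \<gamma> / v)))" .
qed

lemma dilation_gain_inv_gamma:
  assumes "\<gamma> > 0"
  shows "dilation_gain (\<lambda>u. u powr q * exp (- \<gamma> / u))"
proof (rule dilation_gainI)
  let ?K = "(3/2) powr \<bar>q\<bar>"
  show "0 < ?K * (5 / \<gamma>)" "(0::real) < 1" using assms by simp_all
  fix z v :: real assume z: "0 < z" "z \<le> 1" "5/4 * z \<le> v" "v \<le> 3/2 * z"
  have "- \<gamma> / z \<le> - (\<gamma> / (5 * z)) + - \<gamma> / v"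
  proof -
    have "\<gamma> * (1 / v) \<le> \<gamma> * (4 / (5 * z))" using assms inverse_gap[OF z(1,3)] by (intro mult_left_mono) auto
    moreover have "\<gamma> * (4 / (5 * z)) = \<gamma> / z - \<gamma> / (5 * z)" using z by (simp add: field_simps)
    ultimately show ?thesis by simp
  qed
  then have "exp (- \<gamma> / z) \<le> exp (- (\<gamma> / (5 * z)) + - \<gamma> / v)" by (rule exp_le_cancel_iff[THEN iffD2])
  also have "\<dots> = exp (- (\<gamma> / (5 * z))) * exp (- \<gamma> / v)" by (simp only: exp_add)
  also have "\<dots> \<le> (5 / \<gamma> * z) * exp (- \<gamma> / v)"
    using exp_neg_le_inverse[of "\<gamma> / (5 * z)"] assms z by (intro mult_right_mono) auto
  finally have e: "exp (- \<gamma> / z) \<le> (5 / \<gamma> * z) * exp (- \<gamma> / v)" .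
  have "z powr q * exp (- \<gamma> / z) \<le> (?K * v powr q) * ((5 / \<gamma> * z) * exp (- \<gamma> / v))"
    using z by (intro mult_mono powr_dilation e) auto
  also have "\<dots> = ?K * (5 / \<gamma>) * z powr 1 * (v powr q * exp (- \<gamma> / v))"
    using z by (simp only: powr_one mult_ac less_imp_le)
  finally show "z powr q * exp (- \<gamma> / z) \<le> ?K * (5 / \<gamma>) * z powr 1 * (v powr q * exp (- \<gamma> / v))" .
qed

text \<open>As for the inverted gamma density, with u replaced by its power of order \<alpha>; the
  gain is therefore z to the power \<alpha>, and the factor 5/4 enters as \<open>k\<close>.\<close>

lemma dilation_gain_frechet:
  assumes "\<gamma> > 0" "\<alpha> > 0"
  shows "dilation_gain (\<lambda>u. u powr q * exp (- (\<gamma> powr \<alpha> / u powr \<alpha>)))"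
proof (rule dilation_gainI)
  let ?K = "(3/2) powr \<bar>q\<bar>"
  define G where "G = \<gamma> powr \<alpha>"
  define k where "k = (5/4 :: real) powr \<alpha>"
  have G: "G > 0" using assms by (simp add: G_def)
  have k: "k > 1" using assms by (simp add: k_def)
  define c where "c = G * (1 - 1 / k)"
  have c: "c > 0" using G k by (simp add: c_def)
  show "0 < ?K * (1 / c)" using c by simp
  show "0 < \<alpha>" by fact
  fix z v :: real assume z: "0 < z" "z \<le> 1" "5/4 * z \<le> v" "v \<le> 3/2 * z"
  define Z V where "Z = z powr \<alpha>" and "V = v powr \<alpha>"
  have Z: "Z > 0" using z by (simp add: Z_def)
  have "k * Z = (5/4 * z) powr \<alpha>" unfolding k_def Z_def by (rule powr_mult[symmetric])
  also have "\<dots> \<le> V" unfolding V_def using z assms by (intro powr_mono2) auto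
  finally have V: "k * Z \<le> V" .
  have "G / V \<le> G / (k * Z)" using V Z G k by (intro divide_left_mono) (auto intro!: mult_pos_pos order_less_le_trans[OF _ V])
  moreover have "G / Z - G / (k * Z) = c / Z" using Z k by (simp add: c_def field_simps)
  ultimately have "- (G / Z) \<le> - (c / Z) + - (G / V)" by linarith
  then have "exp (- (G / Z)) \<le> exp (- (c / Z) + - (G / V))" by (rule exp_le_cancel_iff[THEN iffD2])
  also have "\<dots> = exp (- (c / Z)) * exp (- (G / V))" by (simp only: exp_add)
  also have "\<dots> \<le> (1 / c * Z) * exp (- (G / V))"
    using exp_neg_le_inverse[of "c / Z"] c Z by (intro mult_right_mono) auto
  finally have e: "exp (- (G / Z)) \<le> (1 / c * Z) * exp (- (G / V))" .
  have "z powr q * exp (- (G / Z)) \<le> (?K * v powr q) * ((1 / c * Z) * exp (- (G / V)))"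
    using z by (intro mult_mono powr_dilation e) auto
  also have "\<dots> = ?K * (1 / c) * Z * (v powr q * exp (- (G / V)))" by (simp only: mult_ac)
  finally show "z powr q * exp (- (\<gamma> powr \<alpha> / z powr \<alpha>)) \<le> ?K * (1 / c) * z powr \<alpha> * (v powr q * exp (- (\<gamma> powr \<alpha> / v powr \<alpha>)))"
    by (simp only: G_def Z_def V_def)
qed

text \<open>On the logarithmic scale the dilation is a shift by \<delta> \<ge> ln(5/4). The cross
  term of the shifted square contributes \<delta> ln z / \<gamma>, so the gain is only the power
  ln(5/4)/\<gamma> of z. This is the reason for an arbitrary positive exponent in
  \<open>dilation_gain\<close>.\<close>

lemma dilation_gain_lognormal:
  assumes "\<gamma> > 0"
  shows "dilation_gain (\<lambda>u. 1 / u * exp (- (1 / (2 * \<gamma>)) * (ln u - \<mu>)\<^sup>2))"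
proof (rule dilation_gainI)
  define \<delta>0 \<delta>1 where "\<delta>0 = ln (5/4 :: real)" and "\<delta>1 = ln (3/2 :: real)"
  have \<delta>: "\<delta>0 > 0" "\<delta>1 > 0" by (simp_all add: \<delta>0_def \<delta>1_def)
  define A where "A = (\<bar>\<mu>\<bar> * \<delta>1 + \<delta>1\<^sup>2 / 2) / \<gamma>"
  show "0 < 3/2 * exp A" by simp
  show "0 < \<delta>0 / \<gamma>" using \<delta> assms by simp
  fix z v :: real assume z: "0 < z" "z \<le> 1" "5/4 * z \<le> v" "v \<le> 3/2 * z"
  define l \<delta> where "l = ln z" and "\<delta> = ln v - ln z"
  have l: "l \<le> 0" using z by (simp add: l_def)
  have "\<delta>0 + ln z = ln (5/4 * z)" unfolding \<delta>0_def using z by (intro ln_mult_pos[symmetric]) auto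
  also have "\<dots> \<le> ln v" using z by (subst ln_le_cancel_iff) auto
  finally have d0: "\<delta>0 \<le> \<delta>" by (simp add: \<delta>_def)
  have "ln v \<le> ln (3/2 * z)" using z by (subst ln_le_cancel_iff) auto
  also have "\<dots> = \<delta>1 + ln z" unfolding \<delta>1_def using z by (intro ln_mult_pos) auto
  finally have d1: "\<delta> \<le> \<delta>1" by (simp add: \<delta>_def)
  have "2 * ((l - \<mu>) * \<delta>) + \<delta>\<^sup>2 \<le> 2 * (\<bar>\<mu>\<bar> * \<delta>1 + \<delta>1\<^sup>2 / 2 + \<delta>0 * l)"
  proof -
    have "l * \<delta> \<le> l * \<delta>0" using l d0 by (rule mult_left_mono_neg[rotated])
    moreover have "- \<mu> * \<delta> \<le> \<bar>\<mu>\<bar> * \<delta>1" using d0 d1 \<delta> by (intro mult_mono) auto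
    moreover have "\<delta>\<^sup>2 \<le> \<delta>1\<^sup>2" using d0 d1 \<delta> by (intro power_mono) auto
    ultimately show ?thesis by (simp add: algebra_simps)
  qed
  then have "(2 * ((l - \<mu>) * \<delta>) + \<delta>\<^sup>2) / (2 * \<gamma>) \<le> 2 * (\<bar>\<mu>\<bar> * \<delta>1 + \<delta>1\<^sup>2 / 2 + \<delta>0 * l) / (2 * \<gamma>)"
    using assms by (intro divide_right_mono) auto
  also have "\<dots> = A + \<delta>0 / \<gamma> * l" using assms by (simp add: A_def add_divide_distrib)
  finally have "(2 * ((l - \<mu>) * \<delta>) + \<delta>\<^sup>2) / (2 * \<gamma>) \<le> A + \<delta>0 / \<gamma> * l" .
  moreover have "(l + \<delta> - \<mu>)\<^sup>2 = (l - \<mu>)\<^sup>2 + (2 * ((l - \<mu>) * \<delta>) + \<delta>\<^sup>2)"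
    by (simp add: power2_eq_square algebra_simps)
  moreover have "- (1 / (2 * \<gamma>)) * ((l - \<mu>)\<^sup>2 + (2 * ((l - \<mu>) * \<delta>) + \<delta>\<^sup>2)) =
      - (1 / (2 * \<gamma>)) * (l - \<mu>)\<^sup>2 - (2 * ((l - \<mu>) * \<delta>) + \<delta>\<^sup>2) / (2 * \<gamma>)"
    by (simp add: add_divide_distrib)
  ultimately have "- (1 / (2 * \<gamma>)) * (l - \<mu>)\<^sup>2 \<le> A + \<delta>0 / \<gamma> * l + - (1 / (2 * \<gamma>)) * (l + \<delta> - \<mu>)\<^sup>2"
    by simp
  then have "- (1 / (2 * \<gamma>)) * (ln z - \<mu>)\<^sup>2 \<le> A + \<delta>0 / \<gamma> * ln z + - (1 / (2 * \<gamma>)) * (ln v - \<mu>)\<^sup>2"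
    by (simp add: l_def \<delta>_def)
  then have "exp (- (1 / (2 * \<gamma>)) * (ln z - \<mu>)\<^sup>2) \<le> exp (A + \<delta>0 / \<gamma> * ln z + - (1 / (2 * \<gamma>)) * (ln v - \<mu>)\<^sup>2)"
    by (rule exp_le_cancel_iff[THEN iffD2])
  also have "\<dots> = exp A * z powr (\<delta>0 / \<gamma>) * exp (- (1 / (2 * \<gamma>)) * (ln v - \<mu>)\<^sup>2)"
    using z by (simp only: exp_add powr_def) simp
  finally have e: "exp (- (1 / (2 * \<gamma>)) * (ln z - \<mu>)\<^sup>2) \<le> exp A * z powr (\<delta>0 / \<gamma>) * exp (- (1 / (2 * \<gamma>)) * (ln v - \<mu>)\<^sup>2)" .
  have "1 / z \<le> 3/2 * (1 / v)" using z by (simp add: field_simps)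
  then have "1 / z * exp (- (1 / (2 * \<gamma>)) * (ln z - \<mu>)\<^sup>2) \<le> (3/2 * (1 / v)) * (exp A * z powr (\<delta>0 / \<gamma>) * exp (- (1 / (2 * \<gamma>)) * (ln v - \<mu>)\<^sup>2))"
    using z by (intro mult_mono e) auto
  also have "\<dots> = 3/2 * exp A * z powr (\<delta>0 / \<gamma>) * (1 / v * exp (- (1 / (2 * \<gamma>)) * (ln v - \<mu>)\<^sup>2))"
    by (simp only: mult_ac)
  finally show "1 / z * exp (- (1 / (2 * \<gamma>)) * (ln z - \<mu>)\<^sup>2) \<le>
    3/2 * exp A * z powr (\<delta>0 / \<gamma>) * (1 / v * exp (- (1 / (2 * \<gamma>)) * (ln v - \<mu>)\<^sup>2))" .
qed

text \<open>The normalising constant cancels from the dilation inequality. It is nonzero, since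
  division by 0 would make h vanish although h integrates to 1.\<close>

lemma normalized_family:
  assumes h: "mixing_density h" and eq: "\<And>u. 0 < u \<Longrightarrow> h u = normalized pos_measure g u"
    and pos: "\<And>u. 0 < u \<Longrightarrow> 0 < g u" and gain: "dilation_gain g"
  shows "(\<forall>u>0. 0 < h u) \<and> dilation_gain h"
proof -
  define c where "c = (LINT t|pos_measure. g t)"
  have hc: "h u = g u / c" if "0 < u" for u using eq[OF that] by (simp add: normalized_def c_def)
  have "0 \<le> c" unfolding c_def by (rule Bochner_Integration.integral_nonneg) (simp add: pos less_imp_le)
  moreover have "c \<noteq> 0"
  proof
    assume "c = 0"
    then have "(LINT u|pos_measure. h u) = (LINT u|pos_measure. 0)"
      by (intro Bochner_Integration.integral_cong) (simp_all add: hc)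
    moreover have "(LINT u|pos_measure. h u) = 1"
      using h unfolding mixing_density_def by (auto dest: has_bochner_integral_integral_eq)
    ultimately show False by simp
  qed
  ultimately have c: "0 < c" by simp
  obtain C \<epsilon> where C: "0 < C" "0 < \<epsilon>"
    "\<And>z v. 0 < z \<Longrightarrow> z \<le> 1 \<Longrightarrow> 5/4 * z \<le> v \<Longrightarrow> v \<le> 3/2 * z \<Longrightarrow> g z \<le> C * z powr \<epsilon> * g v"
    using gain unfolding dilation_gain_def by blast
  have "dilation_gain h"
  proof (rule dilation_gainI[OF C(1,2)])
    fix z v :: real assume z: "0 < z" "z \<le> 1" "5/4 * z \<le> v" "v \<le> 3/2 * z"
    have "0 < v" using z by linarith
    have "g z / c \<le> C * z powr \<epsilon> * g v / c" using C(3)[OF z] c by (intro divide_right_mono) auto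
    then show "h z \<le> C * z powr \<epsilon> * h v" using z \<open>0 < v\<close> by (simp add: hc)
  qed
  then show ?thesis using c pos by (simp add: hc)
qed

lemma divide_left_mono_ennreal:
  fixes a b c :: ennreal
  assumes "b \<le> c"
  shows "a / c \<le> a / b"
proof -
  have "inverse c \<le> inverse b"
  proof (cases "b = 0 \<or> c = \<top>")
    case False
    then obtain r s where r: "b = ennreal r" "0 < r" and s: "c = ennreal s"
      using assms by (cases b; cases c) (auto simp: top_unique less_le)
    have "r \<le> s" using assms r s by (simp add: ennreal_le_iff2)
    then show ?thesis using r s by (simp add: inverse_ennreal ennreal_leI)
  qed auto
  then show ?thesis unfolding divide_ennreal_def by (rule mult_left_mono) simp
qed

lemma nn_integral_powr_unit_interval:
  assumes "0 < \<epsilon>"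
  shows "(\<integral>\<^sup>+z. ennreal (z powr (\<epsilon> - 1)) * indicator {0..1} z \<partial>lborel) = ennreal (1 / \<epsilon>)"
  using nn_integral_has_integral_lebesgue'[OF _ has_integral_powr_from_0[of "\<epsilon> - 1" 1]] assms by simp

text \<open>For z \<le> 1 the integral c z is at least that over [5z/4, 3z/2], an interval of length
  z/4 on which k is at least k z / (C z^\<epsilon>). The ratio is thus at most 4 C z^(\<epsilon> -
  1), integrable at 0 because \<epsilon> > 0. For z > 1 the denominator is at least c 1 > 0 and k is
  integrable.\<close>

lemma integrable_tail_ratio:
  fixes k :: "real \<Rightarrow> real"
  assumes k_meas [measurable]: "k \<in> borel_measurable borel" and k_nonneg: "\<And>u. 0 \<le> k u"
    and k_pos: "\<And>u. 0 < u \<Longrightarrow> 0 < k u" and k_int: "(\<integral>\<^sup>+u. ennreal (k u) \<partial>pos_measure) < \<infinity>"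
    and C: "0 < C" "0 < \<epsilon>"
    and gain: "\<And>z v. 0 < z \<Longrightarrow> z \<le> 1 \<Longrightarrow> 5/4 * z \<le> v \<Longrightarrow> v \<le> 3/2 * z \<Longrightarrow> k z \<le> C * z powr \<epsilon> * k v"
  defines "c z \<equiv> (\<integral>\<^sup>+u. ennreal (k u) * indicator {..3/2 * z} u \<partial>pos_measure)"
  shows "(\<integral>\<^sup>+z. ennreal (k z) / c z \<partial>pos_measure) < \<infinity>" and "\<And>z. 0 < z \<Longrightarrow> c z \<noteq> 0"
proof -
  have c_eq: "c z = (\<integral>\<^sup>+u. ennreal (k u) * indicator {0<..3/2 * z} u \<partial>lborel)" for z
    unfolding c_def nn_integral_pos_measure by (intro nn_integral_cong) (auto simp: indicator_def)
  have c_ge: "c z \<ge> ennreal (b * (z / 4))"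
    if z: "0 < z" and b: "0 \<le> b" "\<And>v. 5/4 * z \<le> v \<Longrightarrow> v \<le> 3/2 * z \<Longrightarrow> b \<le> k v" for z b
  proof -
    have "ennreal (b * (z / 4)) = (\<integral>\<^sup>+u. ennreal b * indicator {5/4 * z..3/2 * z} u \<partial>lborel)"
      using z b by (simp add: nn_integral_cmult ennreal_mult[symmetric] field_simps)
    also have "\<dots> \<le> c z"
      unfolding c_eq using z b by (intro nn_integral_mono) (auto simp: indicator_def intro!: ennreal_leI)
    finally show ?thesis .
  qed
  show c_nz: "c z \<noteq> 0" if z: "0 < z" for z
  proof
    assume "c z = 0"
    then have "AE u in lborel. ennreal (k u) * indicator {0<..3/2 * z} u = 0"
      unfolding c_eq by (subst (asm) nn_integral_0_iff_AE) auto
    then have "AE u in lborel. u \<notin> {0<..3/2 * z}"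
    proof eventually_elim
      case (elim u)
      then show ?case using k_pos[of u] by (auto simp: indicator_def)
    qed
    then have "{0<..3/2 * z} \<in> null_sets lborel" by (subst AE_iff_null_sets) auto
    then show False using z by (simp add: null_sets_def)
  qed
  have small: "ennreal (k z) / c z \<le> ennreal (4 * C * z powr (\<epsilon> - 1))" if z: "0 < z" "z \<le> 1" for z
  proof -
    let ?b = "k z / (C * z powr \<epsilon>)"
    have p: "0 < C * z powr \<epsilon>" using z C by simp
    have "c z \<ge> ennreal (?b * (z / 4))"
      using gain[OF z] p k_nonneg by (intro c_ge[OF z(1)]) (auto simp: divide_le_eq mult.commute)
    then have "ennreal (k z) / c z \<le> ennreal (k z) / ennreal (?b * (z / 4))"
      by (intro divide_left_mono_ennreal)
    also have "\<dots> = ennreal (k z / (?b * (z / 4)))"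
      using k_pos[OF z(1)] p z by (intro divide_ennreal) auto
    also have "k z / (?b * (z / 4)) = 4 * C * z powr (\<epsilon> - 1)"
      using k_pos[OF z(1)] p z C by (simp add: powr_diff field_simps)
    finally show ?thesis .
  qed
  have large: "ennreal (k z) / c z \<le> ennreal (k z) / c 1" if "1 < z" for z
  proof (intro divide_left_mono_ennreal)
    show "c 1 \<le> c z" unfolding c_def using that by (intro nn_integral_mono) (auto simp: indicator_def)
  qed
  have "(\<integral>\<^sup>+z. ennreal (k z) / c z \<partial>pos_measure) \<le>
      (\<integral>\<^sup>+z. ennreal (4 * C) * (ennreal (z powr (\<epsilon> - 1)) * indicator {0..1} z) + ennreal (k z) * inverse (c 1) \<partial>pos_measure)"
  proof (rule nn_integral_mono)
    fix z :: real assume "z \<in> space pos_measure"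
    then have z: "0 < z" by simp
    show "ennreal (k z) / c z \<le> ennreal (4 * C) * (ennreal (z powr (\<epsilon> - 1)) * indicator {0..1} z) + ennreal (k z) * inverse (c 1)"
    proof (cases "z \<le> 1")
      case True
      have "ennreal (k z) / c z \<le> ennreal (4 * C) * (ennreal (z powr (\<epsilon> - 1)) * indicator {0..1} z)"
        using small[OF z True] z True C by (simp add: ennreal_mult)
      then show ?thesis by (rule order_trans) simp
    next
      case False
      then show ?thesis using large[of z] by (simp add: divide_ennreal_def)
    qed
  qed
  also have "\<dots> = (\<integral>\<^sup>+z. ennreal (4 * C) * (ennreal (z powr (\<epsilon> - 1)) * indicator {0..1} z) \<partial>pos_measure)
      + (\<integral>\<^sup>+z. ennreal (k z) * inverse (c 1) \<partial>pos_measure)"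
    by (rule nn_integral_add) (auto intro!: pos_measure_measurable)
  also have "\<dots> < \<infinity>"
  proof -
    have "(\<integral>\<^sup>+z. ennreal (4 * C) * (ennreal (z powr (\<epsilon> - 1)) * indicator {0..1} z) \<partial>pos_measure) \<le>
        (\<integral>\<^sup>+z. ennreal (4 * C) * (ennreal (z powr (\<epsilon> - 1)) * indicator {0..1} z) \<partial>lborel)"
      unfolding nn_integral_pos_measure by (intro nn_integral_mono) (auto simp: indicator_def)
    also have "\<dots> = ennreal (4 * C) * ennreal (1 / \<epsilon>)"
      by (subst nn_integral_cmult) (auto simp: nn_integral_powr_unit_interval[OF C(2)])
    also have "\<dots> < \<infinity>" by (simp add: ennreal_mult_less_top)
    finally have 1: "(\<integral>\<^sup>+z. ennreal (4 * C) * (ennreal (z powr (\<epsilon> - 1)) * indicator {0..1} z) \<partial>pos_measure) < \<infinity>" .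
    have "(\<integral>\<^sup>+z. ennreal (k z) * inverse (c 1) \<partial>pos_measure) = (\<integral>\<^sup>+z. ennreal (k z) \<partial>pos_measure) * inverse (c 1)"
      by (rule nn_integral_multc) (auto intro!: pos_measure_measurable)
    also have "\<dots> < \<infinity>"
    proof -
      have "inverse (c 1) < \<top>" using c_nz[of 1] by (cases "c 1") (auto simp: inverse_ennreal less_le)
      then show ?thesis using k_int by (simp add: ennreal_mult_less_top)
    qed
    finally have 2: "(\<integral>\<^sup>+z. ennreal (k z) * inverse (c 1) \<partial>pos_measure) < \<infinity>" .
    show ?thesis using 1 2 by simp
  qed
  finally show "(\<integral>\<^sup>+z. ennreal (k z) / c z \<partial>pos_measure) < \<infinity>" .
qed

section \<open>The model\<close>

lemma pos_measure_nonnull: "\<not> (AE u in pos_measure. False)"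
proof
  assume "AE u in pos_measure. False"
  then have "emeasure pos_measure {u \<in> space pos_measure. True} = 0"
    by (intro emeasure_eq_0_AE) simp
  then have "emeasure pos_measure (space pos_measure) = 0"
    by (simp only: simp_thms Collect_mem_eq)
  moreover have "emeasure pos_measure (space pos_measure) = emeasure lborel {0::real<..}"
    unfolding pos_measure_def by (subst emeasure_restrict_space) (auto simp: space_restrict_space)
  moreover have "emeasure lborel {0<..<1::real} \<le> emeasure lborel {0::real<..}"
    by (rule emeasure_mono) auto
  ultimately show False by simp
qed

text \<open>The four families enter through positivity and \<open>dilation_gain\<close>: positivity
  keeps all densities strictly positive, and the gain makes \<open>\<phi>\<close>
  integrable.\<close>

locale mixing_model =
  fixes X :: "real^'p^'n" and y :: "real^'d^'n" and a :: real and h :: "real \<Rightarrow> real"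
  assumes rank: "rank (concat_cols X y) = CARD('p) + CARD('d)"
    and h_meas: "h \<in> borel_measurable pos_measure"
    and h_pos: "\<And>u. 0 < u \<Longrightarrow> 0 < h u"
    and S3: "integrable pos_measure (\<lambda>u. u powr (real CARD('d) / 2) * h u)"
    and gain: "dilation_gain h"
begin

abbreviation L :: "((real^'d^'p) \<times> (real^'d^'d)) measure" where "L \<equiv> state_measure"
abbreviation N :: "(real^'n) measure" where "N \<equiv> orthant_measure"
abbreviation G :: "(real^'d^'p) \<times> (real^'d^'d) \<Rightarrow> real^'n \<Rightarrow> real" where "G \<equiv> joint_G a X y"
abbreviation nG :: "real^'n \<Rightarrow> ennreal" where "nG \<equiv> norm_G a X y"

text \<open>Values of h off (0, \<infinity>) are unspecified; extension by 0 gives Borel functions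
  on the line. Among the abbreviations that follow, \<open>B s\<close> is the reciprocal of the
  constant b(s), and \<open>J\<close> is likelihood times prior up to a power of 2\<pi>.\<close>

definition h0 :: "real \<Rightarrow> real" where "h0 u = (if 0 < u then h u else 0)"
definition kf :: "real \<Rightarrow> real" where "kf u = (if 0 < u then u powr (real CARD('d) / 2) * h u else 0)"
definition H :: "real^'n \<Rightarrow> real" where "H z = (\<Prod>i\<in>UNIV. kf (z $ i))"
definition B :: "real \<Rightarrow> real" where "B s = (LINT u|pos_measure. exp (- (s * u / 2)) * kf u)"
definition res :: "(real^'d^'p) \<times> (real^'d^'d) \<Rightarrow> 'n \<Rightarrow> real" where "res x i = sq_resid X y (fst x) (snd x) i"
definition J :: "(real^'d^'p) \<times> (real^'d^'d) \<Rightarrow> real" where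
  "J x = det (snd x) powr (- (real CARD('n) / 2) - a) * (\<Prod>i\<in>UNIV. B (res x i))"
definition \<theta> :: "(real^'d^'p) \<times> (real^'d^'d) \<Rightarrow> real^'n \<Rightarrow> real" where "\<theta> x z = G x z / enn2real (nG z)"
definition w :: "real^'n \<Rightarrow> real" where "w z = H z * enn2real (nG z)"

lemma h0_measurable [measurable]: "h0 \<in> borel_measurable borel"
proof -
  have "(\<lambda>u. indicator {0<..} u *\<^sub>R h u) \<in> borel_measurable lborel"
    using h_meas unfolding pos_measure_def by (subst (asm) borel_measurable_restrict_space_iff) auto
  moreover have "(\<lambda>u. indicator {0<..} u *\<^sub>R h u) = h0" by (auto simp: h0_def indicator_def fun_eq_iff)
  ultimately show ?thesis by simp
qed

lemma kf_eq: "kf u = u powr (real CARD('d) / 2) * h0 u"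
  by (simp add: kf_def h0_def)

lemma kf_measurable [measurable]: "kf \<in> borel_measurable borel"
  unfolding kf_eq[abs_def] by measurable

lemma h0_nonneg: "0 \<le> h0 u" using h_pos[of u] by (simp add: h0_def less_imp_le)
lemma kf_nonneg: "0 \<le> kf u" by (simp add: kf_eq h0_nonneg)
lemma kf_pos: "0 < u \<Longrightarrow> 0 < kf u" using h_pos[of u] by (simp add: kf_def)

lemma H_measurable [measurable]: "H \<in> borel_measurable borel"
  unfolding H_def[abs_def] by measurable

lemma H_measurable_N [measurable]: "H \<in> borel_measurable N"
  using measurable_compose[OF ident_orthant_measure H_measurable] by simp

lemma H_nonneg: "0 \<le> H z" by (simp add: H_def prod_nonneg kf_nonneg)
lemma H_pos: "z \<in> space N \<Longrightarrow> 0 < H z" by (simp add: H_def prod_pos kf_pos space_orthant_measure)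

lemma snd_spd: "x \<in> space L \<Longrightarrow> snd x \<in> spd" by (auto simp: space_state_measure)

lemma res_measurable [measurable]: "(\<lambda>x. res x i) \<in> borel_measurable L"
  unfolding res_def by measurable

lemma det_snd_measurable [measurable]: "(\<lambda>x. det (snd x)) \<in> borel_measurable L"
  by measurable

lemma res_nonneg:
  assumes "x \<in> space L"
  shows "0 \<le> res x i"
proof -
  let ?r = "y $ i - transpose (fst x) *v (X $ i)"
  have "0 \<le> ?r \<bullet> (matrix_inv (snd x) *v ?r)"
    using spdD(2)[OF matrix_inv_spd[OF snd_spd[OF assms]], of ?r] by (cases "?r = 0") auto
  then show ?thesis by (simp add: res_def sq_resid_def Let_def)
qed

lemma G_eq: "G x z = (\<Prod>i\<in>UNIV. exp (- (res x i * z $ i / 2))) * det (snd x) powr (- (real CARD('n) / 2) - a)"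
  by (simp add: joint_G_def split_def res_def exp_sum[symmetric] sum_distrib_left sum_negf mult_ac
      flip: sum_divide_distrib)

lemma G_pos: "x \<in> space L \<Longrightarrow> 0 < G x z"
  unfolding G_eq using spd_det_pos[OF snd_spd, of x]
  by (intro mult_pos_pos prod_pos powr_gt_zero[THEN iffD2]) auto

lemma kf_integrable: "integrable pos_measure kf"
  using S3 by (rule Bochner_Integration.integrable_cong[OF refl, THEN iffD1, rotated]) (simp add: kf_def)

lemma B_integrable:
  assumes "0 \<le> s"
  shows "integrable pos_measure (\<lambda>u. exp (- (s * u / 2)) * kf u)"
proof (rule Bochner_Integration.integrable_bound[OF kf_integrable])
  show "(\<lambda>u. exp (- (s * u / 2)) * kf u) \<in> borel_measurable pos_measure"
    by (rule pos_measure_measurable) measurable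
  show "AE u in pos_measure. norm (exp (- (s * u / 2)) * kf u) \<le> norm (kf u)"
    using assms by (intro AE_I2) (auto simp: abs_mult intro!: mult_left_le_one_le)
qed

lemma B_nn: "0 \<le> s \<Longrightarrow> (\<integral>\<^sup>+u. ennreal (exp (- (s * u / 2)) * kf u) \<partial>pos_measure) = ennreal (B s)"
  unfolding B_def by (rule nn_integral_eq_integral[OF B_integrable]) (simp_all add: kf_nonneg)

lemma B_pos:
  assumes "0 \<le> s"
  shows "0 < B s"
proof -
  have "0 \<le> B s" unfolding B_def by (rule Bochner_Integration.integral_nonneg) (simp add: kf_nonneg)
  moreover have "B s \<noteq> 0"
  proof
    assume "B s = 0"
    then have "AE u in pos_measure. exp (- (s * u / 2)) * kf u = 0"
      unfolding B_def using integral_nonneg_eq_0_iff_AE[OF B_integrable[OF assms]] by (simp add: kf_nonneg)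
    then have "AE u in pos_measure. False"
      using AE_space by eventually_elim (use kf_pos in force)
    then show False using pos_measure_nonnull by simp
  qed
  ultimately show ?thesis by simp
qed

lemma B_measurable [measurable]: "B \<in> borel_measurable borel"
proof -
  interpret sigma_finite_measure pos_measure by (rule sigma_finite_pos_measure)
  have "(\<lambda>p. exp (- (fst p * snd p / 2)) * kf (snd p)) \<in> borel_measurable (borel \<Otimes>\<^sub>M borel)" by measurable
  then have "(\<lambda>p. exp (- (fst p * snd p / 2)) * kf (snd p)) \<in> borel_measurable (borel \<Otimes>\<^sub>M pos_measure)"
    using measurable_compose[OF measurable_Pair[OF measurable_fst measurable_compose[OF measurable_snd ident_pos_measure]]]
    by fastforce
  then have "(\<lambda>(s, u). exp (- (s * u / 2)) * kf u) \<in> borel_measurable (borel \<Otimes>\<^sub>M pos_measure)"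
    by (simp add: split_def)
  from borel_measurable_lebesgue_integral[OF this] show ?thesis unfolding B_def[abs_def] by simp
qed

lemma J_measurable [measurable]: "J \<in> borel_measurable L"
  unfolding J_def[abs_def] by measurable

lemma J_pos: "x \<in> space L \<Longrightarrow> 0 < J x"
  unfolding J_def using spd_det_pos[OF snd_spd, of x]
  by (intro mult_pos_pos prod_pos powr_gt_zero[THEN iffD2]) (auto simp: B_pos res_nonneg)

lemma H_G: "G x z * H z = det (snd x) powr (- (real CARD('n) / 2) - a) * (\<Prod>i\<in>UNIV. exp (- (res x i * z $ i / 2)) * kf (z $ i))"
  by (simp add: G_eq H_def prod.distrib mult_ac)

lemma J_eq:
  assumes x: "x \<in> space L"
  shows "(\<integral>\<^sup>+z. ennreal (G x z * H z) \<partial>N) = ennreal (J x)"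
proof -
  let ?c = "det (snd x) powr (- (real CARD('n) / 2) - a)"
  let ?f = "\<lambda>i u. exp (- (res x i * u / 2)) * kf u"
  have "(\<integral>\<^sup>+z. ennreal (G x z * H z) \<partial>N) = (\<integral>\<^sup>+z. ennreal ?c * (\<Prod>i\<in>UNIV. ennreal (?f i (z $ i))) \<partial>N)"
  proof (rule nn_integral_cong)
    fix z
    have "(\<Prod>i\<in>UNIV. ennreal (?f i (z $ i))) = ennreal (\<Prod>i\<in>UNIV. ?f i (z $ i))"
      by (rule prod_ennreal) (simp add: kf_nonneg)
    then show "ennreal (G x z * H z) = ennreal ?c * (\<Prod>i\<in>UNIV. ennreal (?f i (z $ i)))"
      by (simp only: H_G) (rule ennreal_mult', simp)
  qed
  also have "\<dots> = ennreal ?c * (\<integral>\<^sup>+z. (\<Prod>i\<in>UNIV. ennreal (?f i (z $ i))) \<partial>N)"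
    by (rule nn_integral_cmult) (intro borel_measurable_prod_ennreal, measurable)
  also have "(\<integral>\<^sup>+z. (\<Prod>i\<in>UNIV. ennreal (?f i (z $ i))) \<partial>N) = (\<Prod>i\<in>UNIV. \<integral>\<^sup>+u. ennreal (?f i u) \<partial>pos_measure)"
    by (rule nn_integral_orthant_prod) measurable
  also have "\<dots> = ennreal (\<Prod>i\<in>UNIV. B (res x i))"
    using x by (simp add: B_nn res_nonneg prod_ennreal less_imp_le B_pos)
  finally show ?thesis
    using x by (simp add: J_def ennreal_mult prod_nonneg less_imp_le B_pos res_nonneg)
qed

text \<open>Bayes' rule: the power of the determinant in \<open>G\<close> cancels against the one in
  \<open>J\<close>.\<close>

lemma cond_z_eq:
  assumes x: "x \<in> space L" and z: "z \<in> space N"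
  shows "cond_z h X y x z = G x z * H z / J x"
proof -
  obtain \<beta> S where xS: "x = (\<beta>, S)" by (cases x)
  have d: "0 < det (snd x)" by (rule spd_det_pos[OF snd_spd[OF x]])
  have psi: "psi_density CARD('d) h s u = exp (- (s * u / 2)) * kf u / B s" if "0 < u" for s u
  proof -
    have "(LINT t|pos_measure. t powr (real CARD('d) / 2) * exp (- (s * t / 2)) * h t) = B s"
      unfolding B_def by (intro Bochner_Integration.integral_cong) (auto simp: kf_def)
    then show ?thesis using that by (simp add: psi_density_def normalized_def kf_def)
  qed
  have "cond_z h X y x z = (\<Prod>i\<in>UNIV. exp (- (res x i * z $ i / 2)) * kf (z $ i) / B (res x i))"
    using z by (simp add: cond_z_def xS res_def psi space_orthant_measure)
  then show ?thesis using d by (simp add: H_G J_def prod_dividef)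
qed

lemma cond_param_eq:
  assumes "x \<in> space L" and z: "z \<in> space N"
  shows "cond_beta X y (snd x) z (fst x) * cond_Sigma a X y z (snd x) = \<theta> x z"
  using cond_beta_cond_Sigma[OF rank, of z "snd x" "fst x" a] snd_spd[OF assms(1)] z
  by (simp add: \<theta>_def space_orthant_measure)

lemma posterior_density_eq:
  assumes x: "x \<in> space L"
  shows "posterior_density h a X y x = J x / (LINT x|L. J x)"
proof -
  \<comment> \<open>The powers of 2\<pi> from the n Gaussian densities; they do not depend on the
    state and drop out on normalising.\<close>
  define \<kappa> :: real where "\<kappa> = (1 / (2 * pi) powr (real CARD('d) / 2)) ^ CARD('n)"
  have \<kappa>: "0 < \<kappa>" by (simp add: \<kappa>_def)
  have lik: "likelihood h X y x * det (snd x) powr (- a) = \<kappa> * J x" if x: "x \<in> space L" for x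
  proof -
    obtain \<beta> S where xS: "x = (\<beta>, S)" by (cases x)
    have d: "0 < det S" using spd_det_pos[OF snd_spd[OF x]] by (simp add: xS)
    let ?c = "(2 * pi) powr (real CARD('d) / 2) * det S powr (1 / 2)"
    have "(LINT u|pos_measure. u powr (real CARD('d) / 2) / ?c * exp (- (u / 2) * sq_resid X y \<beta> S i) * h u)
        = B (res x i) / ?c" for i
    proof -
      have "(LINT u|pos_measure. u powr (real CARD('d) / 2) / ?c * exp (- (u / 2) * sq_resid X y \<beta> S i) * h u)
          = (LINT u|pos_measure. (exp (- (res x i * u / 2)) * kf u) / ?c)"
        by (intro Bochner_Integration.integral_cong) (auto simp: kf_def res_def xS mult_ac)
      then show ?thesis by (simp add: B_def)
    qed
    then have "likelihood h X y x = (\<Prod>i\<in>(UNIV :: 'n set). B (res x i) / ?c)"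
      by (simp only: likelihood_def xS prod.case)
    also have "\<dots> = (\<Prod>i\<in>UNIV. B (res x i)) * (1 / ?c) ^ CARD('n)"
      by (simp add: prod_dividef power_divide)
    also have "(1 / ?c) ^ CARD('n) = \<kappa> * det S powr (- (real CARD('n) / 2))"
      using d by (simp add: \<kappa>_def power_divide power_mult_distrib powr_realpow[symmetric] powr_powr powr_minus field_simps)
    finally have "likelihood h X y x * det (snd x) powr (- a) =
        \<kappa> * (\<Prod>i\<in>UNIV. B (res x i)) * (det S powr (- (real CARD('n) / 2)) * det S powr (- a))"
      by (simp add: xS mult_ac)
    also have "det S powr (- (real CARD('n) / 2)) * det S powr (- a) = det S powr (- (real CARD('n) / 2) - a)"
      by (simp add: powr_add[symmetric])
    finally show ?thesis by (simp add: J_def xS mult_ac)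
  qed
  have "(LINT x|L. (case x of (\<beta>, S) \<Rightarrow> likelihood h X y (\<beta>, S) * det S powr - a)) = (LINT x|L. \<kappa> * J x)"
    using lik by (intro Bochner_Integration.integral_cong) (auto simp: split_def)
  moreover have "(case x of (\<beta>, S) \<Rightarrow> likelihood h X y (\<beta>, S) * det S powr - a) = \<kappa> * J x"
    using lik[OF x] by (simp add: split_def)
  ultimately show ?thesis using \<kappa> by (simp add: posterior_density_def normalized_def)
qed

lemma posterior_eq: "posterior h a X y = density L (\<lambda>x. ennreal (J x / (LINT x|L. J x)))"
  by (simp add: posterior_def density_def posterior_density_eq cong: nn_integral_cong)

sublocale L: sigma_finite_measure L by (rule sigma_finite_state_measure)
sublocale N: sigma_finite_measure N by (rule sigma_finite_orthant_measure)
sublocale LN: pair_sigma_finite L N ..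

lemma theta_nonneg: "0 \<le> \<theta> x z" by (simp add: \<theta>_def joint_G_nonneg)
lemma w_nonneg: "0 \<le> w z" by (simp add: w_def H_nonneg)

lemma theta_measurable [measurable]: "(\<lambda>(x, z). \<theta> x z) \<in> borel_measurable (L \<Otimes>\<^sub>M N)"
proof -
  have [measurable]: "(\<lambda>p. enn2real (nG (snd p))) \<in> borel_measurable (L \<Otimes>\<^sub>M N)"
    using measurable_compose[OF measurable_snd norm_G_measurable[of a X y]] by measurable
  show ?thesis unfolding \<theta>_def split_def by measurable
qed

lemma w_measurable [measurable]: "w \<in> borel_measurable N"
  unfolding w_def[abs_def] by measurable

lemma G_nn_measurable: "z \<in> space N \<Longrightarrow> (\<lambda>x. ennreal (G x z)) \<in> borel_measurable L"
  by (rule measurable_compose[OF joint_G_slice(1) measurable_ennreal])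

lemma nn_integral_theta:
  assumes z: "z \<in> space N" and n: "0 < enn2real (nG z)"
  shows "(\<integral>\<^sup>+x. ennreal (\<theta> x z) \<partial>L) = 1"
proof -
  have fin: "nG z = ennreal (enn2real (nG z))"
    using n by (simp add: enn2real_positive_iff)
  have "(\<integral>\<^sup>+x. ennreal (\<theta> x z) \<partial>L) = (\<integral>\<^sup>+x. ennreal (1 / enn2real (nG z)) * ennreal (G x z) \<partial>L)"
    by (intro nn_integral_cong) (simp add: \<theta>_def joint_G_nonneg flip: ennreal_mult)
  also have "\<dots> = ennreal (1 / enn2real (nG z)) * nG z"
    unfolding norm_G_def by (rule nn_integral_cmult[OF G_nn_measurable[OF z]])
  also have "\<dots> = ennreal (1 / enn2real (nG z)) * ennreal (enn2real (nG z))" using fin by (rule arg_cong)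
  also have "\<dots> = ennreal (1 / enn2real (nG z) * enn2real (nG z))"
    by (rule ennreal_mult[symmetric]) simp_all
  also have "\<dots> = 1" using n by simp
  finally show ?thesis .
qed

lemma G_H_nn_meas: "(\<lambda>(x, z). ennreal (G x z * H z)) \<in> borel_measurable (L \<Otimes>\<^sub>M N)"
proof -
  have [measurable]: "(\<lambda>p. H (snd p)) \<in> borel_measurable (L \<Otimes>\<^sub>M N)"
    using measurable_compose[OF measurable_snd H_measurable_N] by simp
  show ?thesis unfolding split_def by measurable
qed

text \<open>Where the normaliser is \<open>0\<close> (or \<open>\<infinity>\<close>), \<open>\<theta>\<close> vanishes.\<close>

lemma theta_G_H: "\<theta> x' z * (G x z * H z) = \<theta> x' z * \<theta> x z * w z"
  by (simp add: \<theta>_def w_def)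

lemma da_kernel_eq:
  assumes x: "x \<in> space L" "x' \<in> space L"
  shows "da_kernel h a X y x' x = (LINT z|N. \<theta> x' z * \<theta> x z * w z) / J x"
proof -
  obtain \<beta>' S' where x': "x' = (\<beta>', S')" by (cases x')
  have "da_kernel h a X y x' x = (LINT z|N. (\<theta> x' z * \<theta> x z * w z) / J x)"
    unfolding da_kernel_def x' prod.case
  proof (rule Bochner_Integration.integral_cong[OF refl])
    fix z :: "real^'n" assume z: "z \<in> space N"
    have "cond_beta X y S' z \<beta>' * cond_Sigma a X y z S' * cond_z h X y x z = \<theta> x' z * (G x z * H z) / J x"
      using cond_param_eq[OF x(2) z] cond_z_eq[OF x(1) z] by (simp add: x')
    then show "cond_beta X y S' z \<beta>' * cond_Sigma a X y z S' * cond_z h X y x z = \<theta> (\<beta>', S') z * \<theta> x z * w z / J x"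
      using theta_G_H[of x' z x] by (simp add: x')
  qed
  then show ?thesis by simp
qed

section \<open>Finiteness of the Hilbert-Schmidt norm\<close>

definition c_tail :: "real \<Rightarrow> ennreal" where
  "c_tail z = (\<integral>\<^sup>+u. ennreal (kf u) * indicator {..3/2 * z} u \<partial>pos_measure)"

lemma c_tail_finite: "c_tail z < \<infinity>"
proof -
  have "c_tail z \<le> (\<integral>\<^sup>+u. ennreal (kf u) \<partial>pos_measure)"
    unfolding c_tail_def by (intro nn_integral_mono) (auto simp: indicator_def)
  also have "\<dots> < \<infinity>" using B_nn[of 0] by simp
  finally show ?thesis .
qed

lemma tail_ratio: "(\<integral>\<^sup>+z. ennreal (kf z) / c_tail z \<partial>pos_measure) < \<infinity>" "0 < z \<Longrightarrow> c_tail z \<noteq> 0"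
proof -
  obtain C \<epsilon> where C: "0 < C" "0 < \<epsilon>"
    "\<And>z v. 0 < z \<Longrightarrow> z \<le> 1 \<Longrightarrow> 5/4 * z \<le> v \<Longrightarrow> v \<le> 3/2 * z \<Longrightarrow> h z \<le> C * z powr \<epsilon> * h v"
    using gain unfolding dilation_gain_def by blast
  have gk: "kf z \<le> C * z powr \<epsilon> * kf v" if z: "0 < z" "z \<le> 1" "5/4 * z \<le> v" "v \<le> 3/2 * z" for z v
  proof -
    have v: "0 < v" "z \<le> v" using z by auto
    have "kf z \<le> v powr (real CARD('d) / 2) * (C * z powr \<epsilon> * h v)"
    proof -
      have "z powr (real CARD('d) / 2) * h z \<le> v powr (real CARD('d) / 2) * (C * z powr \<epsilon> * h v)"
        using z v h_pos[of z] by (intro mult_mono powr_mono2 C(3)[OF z]) (auto simp: less_imp_le)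
      then show ?thesis using z by (simp add: kf_def)
    qed
    then show ?thesis using v by (simp add: kf_def mult_ac)
  qed
  have int: "(\<integral>\<^sup>+u. ennreal (kf u) \<partial>pos_measure) < \<infinity>" using B_nn[of 0] by simp
  show "(\<integral>\<^sup>+z. ennreal (kf z) / c_tail z \<partial>pos_measure) < \<infinity>" "0 < z \<Longrightarrow> c_tail z \<noteq> 0"
    unfolding c_tail_def using integrable_tail_ratio[OF kf_measurable kf_nonneg kf_pos int C(1,2) gk] by blast+
qed

definition \<phi> :: "real \<Rightarrow> real" where "\<phi> z = kf z / enn2real (c_tail z)"

lemma phi_nonneg: "0 \<le> \<phi> z" by (simp add: \<phi>_def kf_nonneg)

lemma enn2real_c_tail: "0 < z \<Longrightarrow> 0 < enn2real (c_tail z)"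
  using tail_ratio(2)[of z] c_tail_finite[of z] by (simp add: enn2real_positive_iff less_top zero_less_iff_neq_zero)

lemma c_tail_measurable [measurable]: "c_tail \<in> borel_measurable borel"
proof -
  interpret sigma_finite_measure pos_measure by (rule sigma_finite_pos_measure)
  let ?f = "\<lambda>p :: real \<times> real. ennreal (kf (snd p)) * (if snd p \<le> 3/2 * fst p then 1 else 0)"
  have f: "?f \<in> borel_measurable (borel \<Otimes>\<^sub>M borel)" by measurable
  have "(\<lambda>(z, u). ?f (z, u)) \<in> borel_measurable (borel \<Otimes>\<^sub>M pos_measure)"
    using measurable_compose[OF measurable_Pair[OF measurable_fst measurable_compose[OF measurable_snd ident_pos_measure]] f]
    by (simp add: split_def)
  from borel_measurable_nn_integral[OF this]
  have "(\<lambda>z. \<integral>\<^sup>+u. ennreal (kf u) * (if u \<le> 3/2 * z then 1 else 0) \<partial>pos_measure) \<in> borel_measurable borel" by simp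
  moreover have "c_tail z = (\<integral>\<^sup>+u. ennreal (kf u) * (if u \<le> 3/2 * z then 1 else 0) \<partial>pos_measure)" for z
    unfolding c_tail_def by (intro nn_integral_cong) (auto simp: indicator_def)
  ultimately show ?thesis by (simp cong: measurable_cong)
qed

lemma phi_measurable [measurable]: "\<phi> \<in> borel_measurable borel"
  unfolding \<phi>_def[abs_def] by measurable

lemma phi_integral: "(\<integral>\<^sup>+z. ennreal (\<phi> z) \<partial>pos_measure) < \<infinity>"
proof -
  have "(\<integral>\<^sup>+z. ennreal (\<phi> z) \<partial>pos_measure) = (\<integral>\<^sup>+z. ennreal (kf z) / c_tail z \<partial>pos_measure)"
  proof (rule nn_integral_cong)
    fix z :: real assume "z \<in> space pos_measure"
    then have z: "0 < z" by simp
    have "c_tail z = ennreal (enn2real (c_tail z))" using c_tail_finite[of z] by simp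
    then show "ennreal (\<phi> z) = ennreal (kf z) / c_tail z"
      using divide_ennreal[OF kf_nonneg[of z] enn2real_c_tail[OF z]] by (simp add: \<phi>_def)
  qed
  then show ?thesis using tail_ratio(1) by simp
qed

text \<open>For u \<le> 3z/2 the exponential is at least exp(-3sz/4), so B s is at least that times
  \<open>c_tail z\<close>; the quotient leaves -sz/2 + 3sz/4 = sz/4 in the exponent.\<close>

lemma B_lower:
  assumes "0 \<le> s" "0 < z"
  shows "exp (- (s * z / 2)) * kf z / B s \<le> \<phi> z * exp (s * z / 4)"
proof -
  have "ennreal (exp (- (3/4 * s * z)) * enn2real (c_tail z)) = (\<integral>\<^sup>+u. ennreal (exp (- (3/4 * s * z))) * (ennreal (kf u) * indicator {..3/2 * z} u) \<partial>pos_measure)"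
  proof -
    have "(\<integral>\<^sup>+u. ennreal (exp (- (3/4 * s * z))) * (ennreal (kf u) * indicator {..3/2 * z} u) \<partial>pos_measure) =
        ennreal (exp (- (3/4 * s * z))) * c_tail z"
      unfolding c_tail_def by (rule nn_integral_cmult) (intro pos_measure_measurable, measurable)
    then show ?thesis using c_tail_finite[of z] by (simp add: ennreal_mult)
  qed
  also have "\<dots> \<le> (\<integral>\<^sup>+u. ennreal (exp (- (s * u / 2)) * kf u) \<partial>pos_measure)"
  proof (rule nn_integral_mono)
    fix u :: real
    show "ennreal (exp (- (3/4 * s * z))) * (ennreal (kf u) * indicator {..3/2 * z} u) \<le> ennreal (exp (- (s * u / 2)) * kf u)"
    proof (cases "u \<le> 3/2 * z")
      case True
      have "s * u \<le> s * (3/2 * z)" using True assms by (intro mult_left_mono) auto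
      then have "exp (- (3/4 * s * z)) \<le> exp (- (s * u / 2))" by simp
      then have "exp (- (3/4 * s * z)) * kf u \<le> exp (- (s * u / 2)) * kf u" by (rule mult_right_mono[OF _ kf_nonneg])
      then show ?thesis using True by (simp add: ennreal_leI kf_nonneg flip: ennreal_mult)
    qed simp
  qed
  also have "\<dots> = ennreal (B s)" using assms by (simp add: B_nn)
  finally have le: "exp (- (3/4 * s * z)) * enn2real (c_tail z) \<le> B s"
    using B_pos[OF assms(1)] by (simp add: ennreal_le_iff)
  have c: "0 < enn2real (c_tail z)" by (rule enn2real_c_tail[OF assms(2)])
  have "exp (- (s * z / 2)) * kf z / B s \<le> exp (- (s * z / 2)) * kf z / (exp (- (3/4 * s * z)) * enn2real (c_tail z))"
    using le c B_pos[OF assms(1)] kf_nonneg by (intro divide_left_mono mult_pos_pos mult_nonneg_nonneg) auto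
  also have "\<dots> = \<phi> z * (exp (- (s * z / 2)) / exp (- (3/4 * s * z)))"
  proof -
    have "x * k / (y * c) = k / c * (x / y)" for x k y c :: real by (simp add: mult.commute)
    then show ?thesis unfolding \<phi>_def by this
  qed
  also have "exp (- (s * z / 2)) / exp (- (3/4 * s * z)) = exp (s * z / 4)" by (simp add: exp_diff[symmetric])
  finally show ?thesis .
qed

text \<open>The left side is G/nG times GH/J, and only the second factor is estimated. The untouched
  \<open>G\<close> absorbs the growing exponentials, each exponent -sz/2 becoming -sz/4, which is
  \<open>G\<close> at z/2.\<close>

lemma theta_G_bound:
  assumes x: "x \<in> space L" and z: "z \<in> space N"
  shows "(\<theta> x z)\<^sup>2 * w z / J x \<le> (\<Prod>i\<in>UNIV. \<phi> (z $ i)) * (G x ((1/2) *\<^sub>R z) / enn2real (nG z))"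
proof (cases "enn2real (nG z) = 0")
  case True
  then show ?thesis by (simp add: \<theta>_def)
next
  case False
  then have n: "0 < enn2real (nG z)" by (simp add: less_le)
  have z0: "0 < z $ i" for i using z by (simp add: space_orthant_measure)
  have d: "0 < det (snd x)" by (rule spd_det_pos[OF snd_spd[OF x]])
  have "G x z * H z / J x = (\<Prod>i\<in>UNIV. exp (- (res x i * z $ i / 2)) * kf (z $ i) / B (res x i))"
    using d by (simp add: H_G J_def prod_dividef)
  also have "\<dots> \<le> (\<Prod>i\<in>UNIV. \<phi> (z $ i) * exp (res x i * z $ i / 4))"
    using B_lower[OF res_nonneg[OF x] z0] kf_nonneg
    by (intro prod_mono conjI divide_nonneg_nonneg mult_nonneg_nonneg less_imp_le[OF B_pos[OF res_nonneg[OF x]]]) auto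
  finally have le: "G x z * H z / J x \<le> (\<Prod>i\<in>UNIV. \<phi> (z $ i)) * (\<Prod>i\<in>UNIV. exp (res x i * z $ i / 4))"
    by (simp add: prod.distrib)
  have half: "G x z * (\<Prod>i\<in>UNIV. exp (res x i * z $ i / 4)) = G x ((1/2) *\<^sub>R z)"
    by (simp add: G_eq mult_ac prod.distrib[symmetric] flip: exp_add)
  have "(\<theta> x z)\<^sup>2 * w z / J x = (G x z / enn2real (nG z)) * (G x z * H z / J x)"
    using n by (simp add: \<theta>_def w_def power2_eq_square)
  also have "\<dots> \<le> (G x z / enn2real (nG z)) * ((\<Prod>i\<in>UNIV. \<phi> (z $ i)) * (\<Prod>i\<in>UNIV. exp (res x i * z $ i / 4)))"
    using le n by (intro mult_left_mono) (auto simp: joint_G_nonneg)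
  also have "\<dots> = (\<Prod>i\<in>UNIV. \<phi> (z $ i)) * (G x z * (\<Prod>i\<in>UNIV. exp (res x i * z $ i / 4)) / enn2real (nG z))"
    by simp
  finally show ?thesis by (simp only: half)
qed

text \<open>Integrating over the parameters first turns \<open>G\<close> at z/2 into nG(z/2), a
  constant multiple \<kappa> of nG z. The normaliser cancels, and what is left is the integral of a
  product of functions of single coordinates.\<close>

lemma theta_sq_finite: "(\<integral>\<^sup>+x. \<integral>\<^sup>+z. ennreal ((\<theta> x z)\<^sup>2 * w z / J x) \<partial>N \<partial>L) < \<infinity>"
proof -
  define \<kappa> where "\<kappa> = (1/2 :: real) powr ((real CARD('d) + 1 - 2 * a) * real CARD('d) / 2 - real CARD('d) * real CARD('n) / 2)"
  define F where "F z = (\<Prod>i\<in>(UNIV :: 'n set). \<phi> (z $ i))" for z :: "real^'n"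
  have F: "0 \<le> F z" for z by (simp add: F_def prod_nonneg phi_nonneg)
  have halfN: "(\<lambda>z. (1/2) *\<^sub>R z) \<in> measurable N N"
    unfolding orthant_measure_def
    by (rule measurable_restrict_space3) auto
  have [measurable]: "(\<lambda>p. G (fst p) ((1/2) *\<^sub>R snd p)) \<in> borel_measurable (L \<Otimes>\<^sub>M N)"
    using measurable_compose[OF measurable_Pair[OF measurable_fst measurable_compose[OF measurable_snd halfN]] joint_G_measurable[of a X y]]
    by simp
  have [measurable]: "(\<lambda>p. enn2real (nG (snd p))) \<in> borel_measurable (L \<Otimes>\<^sub>M N)"
    using measurable_compose[OF measurable_snd norm_G_measurable[of a X y]] by measurable
  have [measurable]: "F \<in> borel_measurable N"
    unfolding F_def[abs_def] by measurable
  have [measurable]: "(\<lambda>p. F (snd p)) \<in> borel_measurable (L \<Otimes>\<^sub>M N)" by measurable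
  have "(\<integral>\<^sup>+x. \<integral>\<^sup>+z. ennreal ((\<theta> x z)\<^sup>2 * w z / J x) \<partial>N \<partial>L) \<le>
      (\<integral>\<^sup>+x. \<integral>\<^sup>+z. ennreal (F z * (G x ((1/2) *\<^sub>R z) / enn2real (nG z))) \<partial>N \<partial>L)"
    unfolding F_def by (intro nn_integral_mono ennreal_leI theta_G_bound)
  also have "\<dots> = (\<integral>\<^sup>+z. \<integral>\<^sup>+x. ennreal (F z * (G x ((1/2) *\<^sub>R z) / enn2real (nG z))) \<partial>L \<partial>N)"
    by (rule LN.Fubini'[symmetric]) (simp add: split_def, measurable)
  also have "\<dots> \<le> (\<integral>\<^sup>+z. ennreal \<kappa> * (\<Prod>i\<in>UNIV. ennreal (\<phi> (z $ i))) \<partial>N)"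
  proof (rule nn_integral_mono)
    fix z :: "real^'n" assume z: "z \<in> space N"
    have hz: "(1/2) *\<^sub>R z \<in> space N" using measurable_space[OF halfN z] .
    have zp: "\<forall>i. 0 < z $ i" using z by (simp add: space_orthant_measure)
    have "(\<integral>\<^sup>+x. ennreal (F z * (G x ((1/2) *\<^sub>R z) / enn2real (nG z))) \<partial>L) =
        (\<integral>\<^sup>+x. ennreal (F z / enn2real (nG z)) * ennreal (G x ((1/2) *\<^sub>R z)) \<partial>L)"
      using F[of z] by (intro nn_integral_cong) (simp add: joint_G_nonneg flip: ennreal_mult)
    also have "\<dots> = ennreal (F z / enn2real (nG z)) * nG ((1/2) *\<^sub>R z)"
      unfolding norm_G_def by (rule nn_integral_cmult[OF G_nn_measurable[OF hz]])
    also have "nG ((1/2) *\<^sub>R z) = ennreal \<kappa> * nG z"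
      unfolding \<kappa>_def using zp by (intro norm_G_scale) auto
    also have "ennreal (F z / enn2real (nG z)) * (ennreal \<kappa> * nG z) \<le> ennreal \<kappa> * ennreal (F z)"
    \<comment> \<open>\<open>enn2real\<close> is 0 both for a zero and for an infinite normaliser;
      then the quotient is 0 and so is the left side.\<close>
    proof (cases "enn2real (nG z) = 0")
      case False
      then have "nG z = ennreal (enn2real (nG z))" by (metis enn2real_top ennreal_enn2real less_top)
      then have "ennreal (F z / enn2real (nG z)) * nG z = ennreal (F z)"
        using False F[of z] by (metis ennreal_mult' enn2real_nonneg nonzero_eq_divide_eq divide_nonneg_nonneg)
      then show ?thesis by (metis mult.assoc mult.commute order_refl)
    qed simp
    also have "ennreal (F z) = (\<Prod>i\<in>UNIV. ennreal (\<phi> (z $ i)))" by (simp add: F_def prod_ennreal phi_nonneg)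
    finally show "(\<integral>\<^sup>+x. ennreal (F z * (G x ((1/2) *\<^sub>R z) / enn2real (nG z))) \<partial>L) \<le> ennreal \<kappa> * (\<Prod>i\<in>UNIV. ennreal (\<phi> (z $ i)))" .
  qed
  also have "\<dots> = ennreal \<kappa> * (\<integral>\<^sup>+z. (\<Prod>i\<in>UNIV. ennreal (\<phi> (z $ i))) \<partial>N)"
    by (rule nn_integral_cmult) (intro borel_measurable_prod_ennreal, measurable)
  also have "(\<integral>\<^sup>+z. (\<Prod>i\<in>UNIV. ennreal (\<phi> (z $ i))) \<partial>N) = (\<Prod>i\<in>(UNIV :: 'n set). \<integral>\<^sup>+u. ennreal (\<phi> u) \<partial>pos_measure)"
    by (rule nn_integral_orthant_prod) measurable
  also have "ennreal \<kappa> * \<dots> < \<infinity>"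
    using phi_integral by (simp add: ennreal_mult_less_top power_less_top_ennreal)
  finally show ?thesis .
qed

text \<open>Generic in \<theta>', so that it serves both chains. The kernel \<open>k\<close> is
  known only on the state space, so measurability is shown for the explicit integral and then
  transferred.\<close>

lemma kernel_op_measurable:
  assumes meas: "(\<lambda>(x', x). LINT z|N. \<theta>' x' z * \<theta>' x z * w z) \<in> borel_measurable (L \<Otimes>\<^sub>M L)"
    and k: "\<And>x x'. x \<in> space L \<Longrightarrow> x' \<in> space L \<Longrightarrow> k x' x = (LINT z|N. \<theta>' x' z * \<theta>' x z * w z) / J x"
    and f: "f \<in> borel_measurable L"
  shows "kernel_op L k f \<in> borel_measurable L"
proof -
  interpret LL: pair_sigma_finite L L ..
  have [measurable]: "(\<lambda>p. LINT z|N. \<theta>' (snd p) z * \<theta>' (fst p) z * w z) \<in> borel_measurable (L \<Otimes>\<^sub>M L)"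
    using measurable_pair_swap[OF meas] by (simp add: split_def)
  note f [measurable]
  have "(\<lambda>(x, x'). f x' * ((LINT z|N. \<theta>' x' z * \<theta>' x z * w z) / J x)) \<in> borel_measurable (L \<Otimes>\<^sub>M L)"
    unfolding split_def by measurable
  from L.borel_measurable_lebesgue_integral[OF this]
  have m: "(\<lambda>x. LINT x'|L. f x' * ((LINT z|N. \<theta>' x' z * \<theta>' x z * w z) / J x)) \<in> borel_measurable L" .
  show ?thesis
  proof (rule measurable_cong[THEN iffD1, OF _ m])
    fix x assume x: "x \<in> space L"
    show "(LINT x'|L. f x' * ((LINT z|N. \<theta>' x' z * \<theta>' x z * w z) / J x)) = kernel_op L k f x"
      unfolding kernel_op_def by (rule Bochner_Integration.integral_cong[OF refl]) (simp add: k x)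
  qed
qed

lemma kernel_measurable:
  assumes [measurable]: "(\<lambda>(x, z). \<theta>' x z) \<in> borel_measurable (L \<Otimes>\<^sub>M N)"
  shows "(\<lambda>(x', x). LINT z|N. \<theta>' x' z * \<theta>' x z * w z) \<in> borel_measurable (L \<Otimes>\<^sub>M L)"
proof -
  have m: "(\<lambda>p. \<theta>' (fst p) (snd p)) \<in> borel_measurable (L \<Otimes>\<^sub>M N)" using assms by (simp add: split_def)
  have [measurable]: "(\<lambda>p. \<theta>' (fst (fst p)) (snd p)) \<in> borel_measurable ((L \<Otimes>\<^sub>M L) \<Otimes>\<^sub>M N)"
    "(\<lambda>p. \<theta>' (snd (fst p)) (snd p)) \<in> borel_measurable ((L \<Otimes>\<^sub>M L) \<Otimes>\<^sub>M N)"
    using measurable_compose[OF _ m, of "\<lambda>p. (fst (fst p), snd p)" "(L \<Otimes>\<^sub>M L) \<Otimes>\<^sub>M N"]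
      measurable_compose[OF _ m, of "\<lambda>p. (snd (fst p), snd p)" "(L \<Otimes>\<^sub>M L) \<Otimes>\<^sub>M N"] by simp_all
  have "(\<lambda>(q, z). \<theta>' (fst q) z * \<theta>' (snd q) z * w z) \<in> borel_measurable ((L \<Otimes>\<^sub>M L) \<Otimes>\<^sub>M N)"
    unfolding split_def by measurable
  from N.borel_measurable_lebesgue_integral[OF this] show ?thesis by (simp add: split_def)
qed

section \<open>Proper and improper posterior\<close>

definition mass :: real where "mass = (LINT x|L. J x)"

lemma improper_trace_class:
  assumes "mass = 0" and meas: "(\<lambda>(x, z). \<theta>' x z) \<in> borel_measurable (L \<Otimes>\<^sub>M N)"
    and k: "\<And>x x'. x \<in> space L \<Longrightarrow> x' \<in> space L \<Longrightarrow> k x' x = (LINT z|N. \<theta>' x' z * \<theta>' x z * w z) / J x"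
  shows "trace_class_L20 (posterior h a X y) (kernel_op L k)"
proof (rule trace_class_null_density)
  have eq: "posterior h a X y = density L (\<lambda>x. 0)"
    using assms(1) by (simp add: posterior_eq mass_def)
  show "emeasure (posterior h a X y) (space (posterior h a X y)) = 0"
    by (simp add: eq emeasure_density)
  fix f :: "(real^'d^'p) \<times> (real^'d^'d) \<Rightarrow> real" assume "f \<in> borel_measurable (posterior h a X y)"
  then have "f \<in> borel_measurable L" by (simp add: eq)
  then show "kernel_op L k f \<in> borel_measurable (posterior h a X y)"
    using kernel_op_measurable[OF kernel_measurable[OF meas] k] by (simp add: eq)
qed

context
  assumes proper: "mass \<noteq> 0"
begin

lemma J_integrable: "integrable L J"
  using proper not_integrable_integral_eq unfolding mass_def by blast

lemma mass_pos: "0 < mass"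
proof -
  have "0 \<le> mass" unfolding mass_def by (rule Bochner_Integration.integral_nonneg) (simp add: J_pos less_imp_le)
  then show ?thesis using proper by simp
qed

lemma J_mass: "(\<integral>\<^sup>+x. ennreal (J x) \<partial>L) = ennreal mass"
  unfolding mass_def by (rule nn_integral_eq_integral[OF J_integrable]) (simp add: J_pos less_imp_le)

text \<open>By Tonelli the integral of H nG is the finite mass of \<open>J\<close>, and
  \<open>H\<close> is positive.\<close>

lemma nG_finite: "AE z in N. nG z < \<infinity>"
proof -
  have "(\<integral>\<^sup>+z. ennreal (H z) * nG z \<partial>N) = (\<integral>\<^sup>+z. \<integral>\<^sup>+x. ennreal (G x z * H z) \<partial>L \<partial>N)"
  proof (rule nn_integral_cong)
    fix z :: "real^'n" assume z: "z \<in> space N"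
    have "(\<integral>\<^sup>+x. ennreal (H z) * ennreal (G x z) \<partial>L) = ennreal (H z) * nG z"
      unfolding norm_G_def by (rule nn_integral_cmult[OF G_nn_measurable[OF z]])
    then show "ennreal (H z) * nG z = (\<integral>\<^sup>+x. ennreal (G x z * H z) \<partial>L)"
      by (simp add: ennreal_mult joint_G_nonneg H_nonneg mult.commute)
  qed
  also have "\<dots> = (\<integral>\<^sup>+x. \<integral>\<^sup>+z. ennreal (G x z * H z) \<partial>N \<partial>L)"
    by (rule LN.Fubini'[OF G_H_nn_meas])
  also have "\<dots> = ennreal mass" using J_mass by (simp add: J_eq cong: nn_integral_cong)
  finally have "AE z in N. ennreal (H z) * nG z \<noteq> \<infinity>"
    by (intro nn_integral_PInf_AE) auto
  then show ?thesis
    using AE_space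
  proof eventually_elim
    case (elim z)
    then have "ennreal (H z) \<noteq> 0" using H_pos[of z] by (simp add: ennreal_eq_0_iff)
    then show ?case using elim by (simp add: ennreal_mult_eq_top_iff less_top)
  qed
qed

text \<open>\<open>G\<close> is strictly positive, so a vanishing integral would make the reference
  measure null and the mass 0.\<close>

lemma nG_nonzero: "z \<in> space N \<Longrightarrow> nG z \<noteq> 0"
proof
  assume z: "z \<in> space N" and "nG z = 0"
  then have "AE x in L. ennreal (G x z) = 0"
    unfolding norm_G_def by (subst (asm) nn_integral_0_iff_AE[OF G_nn_measurable[OF z]])
  then have "AE x in L. J x = 0"
    using AE_space
  proof eventually_elim
    case (elim x)
    then have "G x z \<le> 0" by (simp add: ennreal_eq_0_iff)
    then show ?case using G_pos[of x z] elim by simp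
  qed
  then have "mass = 0" unfolding mass_def by (rule integral_eq_zero_AE)
  then show False using proper by simp
qed

lemma nG_real: "AE z in N. z \<in> space N \<and> 0 < enn2real (nG z) \<and> ennreal (enn2real (nG z)) = nG z"
  using nG_finite AE_space
  by eventually_elim (use nG_nonzero in \<open>auto simp: enn2real_positive_iff zero_less_iff_neq_zero\<close>)

lemma theta_1: "AE z in N. (\<integral>\<^sup>+x. ennreal (\<theta> x z) \<partial>L) = 1"
  using nG_real by eventually_elim (simp add: nn_integral_theta)

lemma theta_w: 
  assumes x: "x \<in> space L"
  shows "(\<integral>\<^sup>+z. ennreal (\<theta> x z * w z) \<partial>N) = ennreal (J x)"
proof -
  have "(\<integral>\<^sup>+z. ennreal (\<theta> x z * w z) \<partial>N) = (\<integral>\<^sup>+z. ennreal (G x z * H z) \<partial>N)"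
    using nG_real by (intro nn_integral_cong_AE) (auto elim!: eventually_mono simp: \<theta>_def w_def)
  then show ?thesis using J_eq[OF x] by simp
qed

text \<open>The conditional density is left free: it is \<theta> for the DA chain and its average
  over scales for the Haar chain, with the same marginals \<open>J\<close> and
  \<open>w\<close>.\<close>

lemma trace_class_of_theta:
  assumes "(\<lambda>(x, z). \<theta>' x z) \<in> borel_measurable (L \<Otimes>\<^sub>M N)" "\<And>x z. 0 \<le> \<theta>' x z"
    "AE z in N. (\<integral>\<^sup>+x. ennreal (\<theta>' x z) \<partial>L) = 1"
    "\<And>x. x \<in> space L \<Longrightarrow> (\<integral>\<^sup>+z. ennreal (\<theta>' x z * w z) \<partial>N) = ennreal (J x)"
    "(\<integral>\<^sup>+x. \<integral>\<^sup>+z. ennreal ((\<theta>' x z)\<^sup>2 * w z / J x) \<partial>N \<partial>L) < \<infinity>"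
    "\<And>x x'. x \<in> space L \<Longrightarrow> x' \<in> space L \<Longrightarrow> k x' x = (LINT z|N. \<theta>' x' z * \<theta>' x z * w z) / J x"
  shows "trace_class_L20 (posterior h a X y) (kernel_op L k)"
  unfolding posterior_eq mass_def[symmetric]
  by (rule trace_class_latent_kernel[OF sigma_finite_state_measure sigma_finite_orthant_measure J_measurable w_measurable
        assms(1) J_pos assms(2) w_nonneg mass_pos J_mass assms(3) _ assms(5,6)])
    (auto intro!: AE_I2 assms(4))

end

theorem da_trace_class: "trace_class_L20 (posterior h a X y) (kernel_op L (da_kernel h a X y))"
proof (cases "mass = 0")
  case True
  then show ?thesis using theta_measurable da_kernel_eq by (rule improper_trace_class)
next
  case False
  show ?thesis
    by (rule trace_class_of_theta[OF False theta_measurable theta_nonneg theta_1[OF False] theta_w[OF False] theta_sq_finite da_kernel_eq])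
qed

end

section \<open>The Haar PX-DA chain\<close>

context mixing_model
begin

text \<open>The Haar weight is \<open>t powr c0\<close> times the product of the h's relative to
  dt/t. Up to a factor free of t this is the density of the latent marginal along the ray through z,
  so \<open>e z\<close> is the conditional law of the position on that ray.\<close>

definition c0 :: real where
  "c0 = real CARD('n) + (real CARD('d) + 1 - 2 * a) * real CARD('d) / 2"

definition hw :: "real^'n \<Rightarrow> real \<Rightarrow> real" where
  "hw z t = t powr (c0 - 1) * (\<Prod>i\<in>UNIV. h0 (t * z $ i))"

definition D :: "real^'n \<Rightarrow> ennreal" where
  "D z = (\<integral>\<^sup>+t. ennreal (hw z t) \<partial>pos_measure)"

definition e :: "real^'n \<Rightarrow> real \<Rightarrow> real" where
  "e z v = hw z v / enn2real (D z)"

lemma hw_nonneg: "0 \<le> hw z t" by (simp add: hw_def prod_nonneg h0_nonneg)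
lemma e_nonneg: "0 \<le> e z v" by (simp add: e_def hw_nonneg)

lemma hw_measurable: "(\<lambda>p. hw (fst p) (snd p)) \<in> borel_measurable (borel \<Otimes>\<^sub>M borel)"
  unfolding hw_def by measurable

lemma hw_measurable' [measurable]: "(\<lambda>p. hw (fst p) (snd p)) \<in> borel_measurable (N \<Otimes>\<^sub>M pos_measure)"
  using measurable_compose[OF measurable_Pair[OF measurable_compose[OF measurable_fst ident_orthant_measure]
      measurable_compose[OF measurable_snd ident_pos_measure]] hw_measurable]
  by simp

lemma hw_slice [measurable]: "hw z \<in> borel_measurable borel"
  unfolding hw_def[abs_def] by measurable

lemma hw_nn_slice: "(\<lambda>t. ennreal (hw z t)) \<in> borel_measurable pos_measure"
  by (rule pos_measure_measurable) measurable

sublocale P: sigma_finite_measure pos_measure by (rule sigma_finite_pos_measure)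
sublocale NP: pair_sigma_finite N pos_measure ..
sublocale LP: pair_sigma_finite L pos_measure ..

lemma D_measurable [measurable]: "D \<in> borel_measurable N"
proof -
  have "(\<lambda>(z, t). ennreal (hw z t)) \<in> borel_measurable (N \<Otimes>\<^sub>M pos_measure)"
    unfolding split_def by measurable
  from P.borel_measurable_nn_integral[OF this] show ?thesis by (simp add: D_def[abs_def])
qed

lemma e_measurable [measurable]: "(\<lambda>p. e (fst p) (snd p)) \<in> borel_measurable (N \<Otimes>\<^sub>M pos_measure)"
proof -
  have [measurable]: "(\<lambda>p. enn2real (D (fst p))) \<in> borel_measurable (N \<Otimes>\<^sub>M pos_measure)"
    using measurable_compose[OF measurable_fst D_measurable] by measurable
  show ?thesis unfolding e_def by measurable
qed

lemma e_slice: "e z \<in> borel_measurable pos_measure"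
  unfolding e_def[abs_def] by (rule pos_measure_measurable) measurable

lemma scale_measurable: "(\<lambda>p. snd p *\<^sub>R fst p) \<in> measurable (N \<Otimes>\<^sub>M pos_measure) N"
proof -
  have 1: "fst \<in> borel_measurable (N \<Otimes>\<^sub>M pos_measure)"
    using measurable_compose[OF measurable_fst ident_orthant_measure] by simp
  have 2: "snd \<in> borel_measurable (N \<Otimes>\<^sub>M pos_measure)"
    using measurable_compose[OF measurable_snd ident_pos_measure] by simp
  have m: "(\<lambda>p. snd p *\<^sub>R fst p) \<in> measurable (N \<Otimes>\<^sub>M pos_measure) lborel"
    using borel_measurable_scaleR[OF 2 1] by simp
  show ?thesis
    unfolding orthant_measure_def
    by (rule measurable_restrict_space2[OF _ m[unfolded orthant_measure_def]])
      (auto simp: space_pair_measure space_restrict_space)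
qed

lemma scale_space: "z \<in> space N \<Longrightarrow> 0 < v \<Longrightarrow> v *\<^sub>R z \<in> space N"
  by (simp add: space_orthant_measure)

lemma scale_slice: "z \<in> space N \<Longrightarrow> (\<lambda>v. v *\<^sub>R z) \<in> measurable pos_measure N"
  using measurable_compose[OF measurable_Pair1' scale_measurable, of z] by simp

lemma inverse_pos: "(\<lambda>v. 1 / v) \<in> measurable pos_measure pos_measure"
  unfolding pos_measure_def by (rule measurable_restrict_space3) auto

lemma inv_scale_measurable: "(\<lambda>p. (1 / snd p) *\<^sub>R fst p) \<in> measurable (N \<Otimes>\<^sub>M pos_measure) N"
  using measurable_compose[OF measurable_Pair[OF measurable_fst measurable_compose[OF measurable_snd inverse_pos]] scale_measurable]
  by simp

lemma haar_weight_eq: "z \<in> space N \<Longrightarrow> 0 < t \<Longrightarrow> haar_weight CARD('d) a h z t = hw z t"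
  by (simp add: haar_weight_def hw_def c0_def h0_def space_orthant_measure)

lemma haar_density_eq:
  assumes z: "z \<in> space N" and v: "0 < v"
  shows "haar_density CARD('d) a h z v = e z v"
proof -
  have "(LINT t|pos_measure. haar_weight CARD('d) a h z t) = (LINT t|pos_measure. hw z t)"
    by (rule Bochner_Integration.integral_cong[OF refl]) (simp add: haar_weight_eq z)
  also have "\<dots> = enn2real (D z)"
    unfolding D_def by (rule integral_eq_nn_integral) (auto intro!: pos_measure_measurable simp: hw_nonneg)
  finally show ?thesis using haar_weight_eq[OF z v] by (simp add: haar_density_def normalized_def e_def)
qed

lemma hw_scale: "0 < v \<Longrightarrow> 0 < t \<Longrightarrow> hw z (v * t) = v powr (c0 - 1) * hw (v *\<^sub>R z) t"
  by (simp add: hw_def powr_mult mult_ac)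

lemma D_scale:
  assumes v: "0 < v"
  shows "D z = ennreal (v powr c0) * D (v *\<^sub>R z)"
proof -
  have "D z = ennreal v * (\<integral>\<^sup>+t. ennreal (hw z (v * t)) \<partial>pos_measure)"
    unfolding D_def by (rule nn_integral_pos_measure_scale[OF hw_nn_slice v])
  also have "(\<integral>\<^sup>+t. ennreal (hw z (v * t)) \<partial>pos_measure) = (\<integral>\<^sup>+t. ennreal (v powr (c0 - 1)) * ennreal (hw (v *\<^sub>R z) t) \<partial>pos_measure)"
    by (rule nn_integral_cong) (simp add: hw_scale v ennreal_mult hw_nonneg)
  also have "\<dots> = ennreal (v powr (c0 - 1)) * D (v *\<^sub>R z)"
    unfolding D_def by (rule nn_integral_cmult[OF hw_nn_slice])
  also have "ennreal v * (ennreal (v powr (c0 - 1)) * D (v *\<^sub>R z)) = ennreal (v * v powr (c0 - 1)) * D (v *\<^sub>R z)"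
    using v by (simp add: ennreal_mult mult.assoc)
  also have "v * v powr (c0 - 1) = v powr c0" using v by (simp add: powr_diff)
  finally show ?thesis .
qed

lemma D_scale_real: "0 < v \<Longrightarrow> enn2real (D z) = v powr c0 * enn2real (D (v *\<^sub>R z))"
  by (subst D_scale[of v]) (simp_all add: enn2real_mult)

text \<open>The law on a ray does not depend on the point chosen to parametrise it: by invariance of
  dt/t, the weight and its integral change by the same power.\<close>

lemma e_scale:
  assumes u: "0 < u" and v: "0 < v"
  shows "u * e z (u * v) = e (u *\<^sub>R z) v"
proof -
  have "u * (u powr (c0 - 1) * x / (u powr c0 * y)) = x / y" for x y
    using u by (simp add: powr_diff)
  then show ?thesis unfolding e_def hw_scale[OF u v] D_scale_real[OF u, of z] by this
qed

text \<open>If the integral \<open>D z\<close> is 0 or infinite, \<open>e z\<close> is identically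
  0. The bound by 1 therefore holds at every z and can be used in Jensen's inequality without an
  exceptional set.\<close>

lemma e_integral_le: "(\<integral>\<^sup>+v. ennreal (e z v) \<partial>pos_measure) \<le> 1"
  and e_integral: "D z \<noteq> 0 \<Longrightarrow> D z < \<infinity> \<Longrightarrow> (\<integral>\<^sup>+v. ennreal (e z v) \<partial>pos_measure) = 1"
proof -
  have eq: "(\<integral>\<^sup>+v. ennreal (e z v) \<partial>pos_measure) = ennreal (1 / enn2real (D z)) * D z"
  proof -
    have "(\<integral>\<^sup>+v. ennreal (e z v) \<partial>pos_measure) = (\<integral>\<^sup>+v. ennreal (1 / enn2real (D z)) * ennreal (hw z v) \<partial>pos_measure)"
      by (rule nn_integral_cong) (simp add: e_def hw_nonneg flip: ennreal_mult)
    also have "\<dots> = ennreal (1 / enn2real (D z)) * D z"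
      unfolding D_def by (rule nn_integral_cmult[OF hw_nn_slice])
    finally show ?thesis .
  qed
  show one: "(\<integral>\<^sup>+v. ennreal (e z v) \<partial>pos_measure) = 1" if D: "D z \<noteq> 0" "D z < \<infinity>"
  proof -
    have n: "0 < enn2real (D z)" using D by (simp add: enn2real_positive_iff zero_less_iff_neq_zero)
    have "ennreal (1 / enn2real (D z)) * D z = ennreal (1 / enn2real (D z)) * ennreal (enn2real (D z))"
      using D by simp
    also have "\<dots> = ennreal (1 / enn2real (D z) * enn2real (D z))" by (rule ennreal_mult[symmetric]) simp_all
    finally show ?thesis using n by (simp add: eq)
  qed
  show "(\<integral>\<^sup>+v. ennreal (e z v) \<partial>pos_measure) \<le> 1"
  proof (cases "D z \<noteq> 0 \<and> D z < \<infinity>")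
    case False
    then have "D z = 0 \<or> D z = \<top>" by (auto simp: less_top[symmetric])
    then have "enn2real (D z) = 0" by auto
    then show ?thesis by (simp add: eq)
  qed (simp add: one)
qed

lemma D_nonzero: 
  assumes z: "z \<in> space N"
  shows "D z \<noteq> 0"
proof
  assume "D z = 0"
  then have "AE t in pos_measure. ennreal (hw z t) = 0"
    unfolding D_def by (subst (asm) nn_integral_0_iff_AE[OF hw_nn_slice])
  then have "AE t in pos_measure. False"
    using AE_space
  proof eventually_elim
    case (elim t)
    then have "0 < hw z t"
      using z by (auto simp: hw_def h0_def space_orthant_measure intro!: mult_pos_pos prod_pos h_pos)
    then show ?case using elim by (simp add: ennreal_eq_0_iff)
  qed
  then show False using pos_measure_nonnull by simp
qed

lemma nG_scale_real:
  assumes z: "z \<in> space N" and v: "0 < v"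
  shows "enn2real (nG (v *\<^sub>R z)) = v powr (c0 - real CARD('n) - real CARD('d) * real CARD('n) / 2) * enn2real (nG z)"
proof -
  have e: "(real CARD('d) + 1 - 2 * a) * real CARD('d) / 2 - real CARD('d) * real CARD('n) / 2 =
      c0 - real CARD('n) - real CARD('d) * real CARD('n) / 2"
    by (simp add: c0_def)
  show ?thesis
    using norm_G_scale[of z v a X y] z v unfolding e by (simp add: enn2real_mult space_orthant_measure)
qed

text \<open>The powers from \<open>H\<close> and from nG, dn/2 and c0 - n - dn/2, add up to c0 - n.
  The products of the h's stand crosswise so that no quotient appears.\<close>

lemma w_scale:
  assumes z: "z \<in> space N" and q: "0 < q"
  shows "w (q *\<^sub>R z) * (\<Prod>i\<in>UNIV. h0 (z $ i)) = q powr (c0 - real CARD('n)) * (\<Prod>i\<in>UNIV. h0 (q * z $ i)) * w z"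
proof -
  have z0: "0 < z $ i" for i using z by (simp add: space_orthant_measure)
  let ?P = "\<Prod>i\<in>(UNIV :: 'n set). z $ i powr (real CARD('d) / 2)"
  have H1: "H (q *\<^sub>R z) = q powr (real CARD('d) * real CARD('n) / 2) * ?P * (\<Prod>i\<in>UNIV. h0 (q * z $ i))"
  proof -
    have "H (q *\<^sub>R z) = (\<Prod>i\<in>UNIV. q powr (real CARD('d) / 2) * z $ i powr (real CARD('d) / 2) * h0 (q * z $ i))"
      unfolding H_def using q z0 by (intro prod.cong refl) (simp add: kf_eq powr_mult)
    also have "\<dots> = (q powr (real CARD('d) / 2)) ^ CARD('n) * ?P * (\<Prod>i\<in>UNIV. h0 (q * z $ i))"
      by (simp add: prod.distrib)
    also have "(q powr (real CARD('d) / 2)) ^ CARD('n) = q powr (real CARD('d) * real CARD('n) / 2)"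
      using q by (simp add: powr_realpow[symmetric] powr_powr)
    finally show ?thesis .
  qed
  have H2: "H z = ?P * (\<Prod>i\<in>UNIV. h0 (z $ i))" by (simp add: H_def kf_eq prod.distrib)
  have "q powr (c0 - real CARD('n)) = q powr (real CARD('d) * real CARD('n) / 2) * q powr (c0 - real CARD('n) - real CARD('d) * real CARD('n) / 2)"
    by (simp add: powr_add[symmetric])
  then show ?thesis unfolding w_def nG_scale_real[OF z q] H1 H2 by (simp only: mult_ac)
qed

text \<open>The invariance of the marginal density of the latent data under the Haar step, before integrating over the
  group variable \<open>v\<close>.\<close>

lemma haar_balance:
  assumes u: "u \<in> space N" and v: "0 < v"
  shows "(1 / v) ^ CARD('n) * (w ((1 / v) *\<^sub>R u) * e ((1 / v) *\<^sub>R u) v) =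
    w u / enn2real (D u) * ((1 / v) * hw u (1 / v)) * (1 / v)"
proof -
  define q where "q = 1 / v"
  have q: "0 < q" and vq: "v = 1 / q" using v by (simp_all add: q_def)
  have "hw (q *\<^sub>R u) v = v powr (c0 - 1) * (\<Prod>i\<in>UNIV. h0 (u $ i))"
    using v by (simp add: hw_def q_def)
  then have e: "e (q *\<^sub>R u) v = v powr (c0 - 1) * (\<Prod>i\<in>UNIV. h0 (u $ i)) * q powr c0 / enn2real (D u)"
    using q by (simp add: e_def D_scale_real[OF q, of u])
  have pq: "q ^ CARD('n) * q powr (c0 - real CARD('n)) = q powr c0"
    using q by (simp add: powr_realpow[symmetric] powr_add[symmetric])
  have vq': "v powr (c0 - 1) * q powr c0 = q" 
    unfolding vq using q by (simp add: powr_divide powr_diff)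
  have "q ^ CARD('n) * (w (q *\<^sub>R u) * e (q *\<^sub>R u) v) =
      q ^ CARD('n) * (w (q *\<^sub>R u) * (\<Prod>i\<in>UNIV. h0 (u $ i))) * (v powr (c0 - 1) * q powr c0) / enn2real (D u)"
    unfolding e by simp
  also have "\<dots> = (q ^ CARD('n) * q powr (c0 - real CARD('n))) * (\<Prod>i\<in>UNIV. h0 (q * u $ i)) * w u * q / enn2real (D u)"
    unfolding w_scale[OF u q] vq' by simp
  also have "\<dots> = q powr c0 * (\<Prod>i\<in>UNIV. h0 (q * u $ i)) * w u * q / enn2real (D u)" by (simp only: pq)
  also have "q powr c0 * (\<Prod>i\<in>UNIV. h0 (q * u $ i)) = q * hw u q"
    using q by (simp add: hw_def powr_diff)
  finally show ?thesis by (simp add: q_def mult_ac)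
qed

context
  assumes haar_defined: "AE z in N. integrable pos_measure (haar_weight CARD('d) a h z)"
begin

lemma D_finite: "AE z in N. z \<in> space N \<and> D z < \<infinity>"
  using haar_defined AE_space
proof eventually_elim
  case (elim z)
  have "D z = (\<integral>\<^sup>+t. ennreal (norm (haar_weight CARD('d) a h z t)) \<partial>pos_measure)"
    unfolding D_def using elim by (intro nn_integral_cong) (simp add: haar_weight_eq hw_nonneg)
  then show ?case using elim by (simp add: integrable_iff_bounded)
qed

text \<open>The Haar step leaves the latent marginal invariant. Substituting u = vz at fixed v and
  using \<open>haar_balance\<close>, all dependence on v sits in the weight at 1/v; inversion turns
  its integral into \<open>D u\<close>, which cancels the denominator.\<close>

lemma haar_stationary:
  assumes \<Phi> [measurable]: "\<Phi> \<in> borel_measurable N"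
  shows "(\<integral>\<^sup>+z. ennreal (w z) * (\<integral>\<^sup>+v. \<Phi> (v *\<^sub>R z) * ennreal (e z v) \<partial>pos_measure) \<partial>N) = (\<integral>\<^sup>+z. \<Phi> z * ennreal (w z) \<partial>N)"
proof -
  have w_fst: "(\<lambda>p. ennreal (w (fst p))) \<in> borel_measurable (N \<Otimes>\<^sub>M pos_measure)"
    using measurable_compose[OF measurable_compose[OF measurable_fst w_measurable] measurable_ennreal] by simp
  have e_nn: "(\<lambda>p. ennreal (e (fst p) (snd p))) \<in> borel_measurable (N \<Otimes>\<^sub>M pos_measure)"
    by (rule measurable_compose[OF e_measurable measurable_ennreal])
  have \<Phi>_sc: "(\<lambda>p. \<Phi> (snd p *\<^sub>R fst p)) \<in> borel_measurable (N \<Otimes>\<^sub>M pos_measure)"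
    by (rule measurable_compose[OF scale_measurable \<Phi>])
  have joint: "(\<lambda>p. ennreal (w (fst p)) * (\<Phi> (snd p *\<^sub>R fst p) * ennreal (e (fst p) (snd p)))) \<in> borel_measurable (N \<Otimes>\<^sub>M pos_measure)"
    by (intro borel_measurable_times_ennreal w_fst e_nn \<Phi>_sc)
  have inv: "(\<lambda>p. ((1 / snd p) *\<^sub>R fst p, snd p)) \<in> measurable (N \<Otimes>\<^sub>M pos_measure) (N \<Otimes>\<^sub>M pos_measure)"
    by (intro measurable_Pair inv_scale_measurable measurable_snd)
  have joint': "(\<lambda>p. ennreal (w ((1 / snd p) *\<^sub>R fst p)) * (\<Phi> (snd p *\<^sub>R (1 / snd p) *\<^sub>R fst p) * ennreal (e ((1 / snd p) *\<^sub>R fst p) (snd p))))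
      \<in> borel_measurable (N \<Otimes>\<^sub>M pos_measure)"
    using measurable_compose[OF inv joint] by simp
  have npow: "(\<lambda>p. ennreal ((1 / snd p) ^ CARD('n))) \<in> borel_measurable (N \<Otimes>\<^sub>M pos_measure)"
    using measurable_compose[OF measurable_snd ident_pos_measure] by measurable
  have "(\<integral>\<^sup>+z. ennreal (w z) * (\<integral>\<^sup>+v. \<Phi> (v *\<^sub>R z) * ennreal (e z v) \<partial>pos_measure) \<partial>N) =
      (\<integral>\<^sup>+z. \<integral>\<^sup>+v. ennreal (w z) * (\<Phi> (v *\<^sub>R z) * ennreal (e z v)) \<partial>pos_measure \<partial>N)"
  proof (rule nn_integral_cong)
    fix z :: "real^'n" assume z: "z \<in> space N"
    have "(\<lambda>v. \<Phi> (v *\<^sub>R z) * ennreal (e z v)) \<in> borel_measurable pos_measure"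
      by (intro borel_measurable_times_ennreal measurable_compose[OF scale_slice[OF z] \<Phi>] measurable_compose[OF e_slice measurable_ennreal])
    then show "ennreal (w z) * (\<integral>\<^sup>+v. \<Phi> (v *\<^sub>R z) * ennreal (e z v) \<partial>pos_measure) =
        (\<integral>\<^sup>+v. ennreal (w z) * (\<Phi> (v *\<^sub>R z) * ennreal (e z v)) \<partial>pos_measure)"
      by (rule nn_integral_cmult[symmetric])
  qed
  also have "\<dots> = (\<integral>\<^sup>+v. \<integral>\<^sup>+z. ennreal (w z) * (\<Phi> (v *\<^sub>R z) * ennreal (e z v)) \<partial>N \<partial>pos_measure)"
    by (rule NP.Fubini'[symmetric]) (use joint in \<open>simp add: split_def\<close>)
  also have "\<dots> = (\<integral>\<^sup>+v. \<integral>\<^sup>+u. \<Phi> u * ennreal (w u / enn2real (D u) * ((1 / v) * hw u (1 / v)) * (1 / v)) \<partial>N \<partial>pos_measure)"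
  proof (rule nn_integral_cong)
    fix v :: real assume v': "v \<in> space pos_measure"
    then have v: "0 < v" by simp
    have slice: "(\<lambda>z. ennreal (w z) * (\<Phi> (v *\<^sub>R z) * ennreal (e z v))) \<in> borel_measurable N"
      using measurable_compose[OF measurable_Pair2'[OF v'] joint] by simp
    have slice': "(\<lambda>u. ennreal (w ((1 / v) *\<^sub>R u)) * (\<Phi> (v *\<^sub>R (1 / v) *\<^sub>R u) * ennreal (e ((1 / v) *\<^sub>R u) v))) \<in> borel_measurable N"
      using measurable_compose[OF measurable_Pair2'[OF v'] joint'] by simp
    have "(\<integral>\<^sup>+z. ennreal (w z) * (\<Phi> (v *\<^sub>R z) * ennreal (e z v)) \<partial>N) =
        ennreal ((1 / v) ^ CARD('n)) * (\<integral>\<^sup>+u. ennreal (w ((1 / v) *\<^sub>R u)) * (\<Phi> (v *\<^sub>R (1 / v) *\<^sub>R u) * ennreal (e ((1 / v) *\<^sub>R u) v)) \<partial>N)"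
      using v by (intro nn_integral_orthant_scale[OF slice]) simp
    also have "\<dots> = (\<integral>\<^sup>+u. ennreal ((1 / v) ^ CARD('n)) * (ennreal (w ((1 / v) *\<^sub>R u)) * (\<Phi> (v *\<^sub>R (1 / v) *\<^sub>R u) * ennreal (e ((1 / v) *\<^sub>R u) v))) \<partial>N)"
      by (rule nn_integral_cmult[OF slice', symmetric])
    also have "\<dots> = (\<integral>\<^sup>+u. \<Phi> u * ennreal (w u / enn2real (D u) * ((1 / v) * hw u (1 / v)) * (1 / v)) \<partial>N)"
    proof (rule nn_integral_cong)
      fix u :: "real^'n" assume u: "u \<in> space N"
      have v1: "v *\<^sub>R (1 / v) *\<^sub>R u = u" using v by simp
      have ac: "A * (W * (P * E)) = P * (A * (W * E))" for A W P E :: ennreal by (simp only: mult_ac)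
      have bal: "ennreal ((1 / v) ^ CARD('n)) * (ennreal (w ((1 / v) *\<^sub>R u)) * ennreal (e ((1 / v) *\<^sub>R u) v)) =
          ennreal (w u / enn2real (D u) * ((1 / v) * hw u (1 / v)) * (1 / v))"
        unfolding haar_balance[OF u v, symmetric] using v
        by (simp add: ennreal_mult w_nonneg e_nonneg)
      show "ennreal ((1 / v) ^ CARD('n)) * (ennreal (w ((1 / v) *\<^sub>R u)) * (\<Phi> (v *\<^sub>R (1 / v) *\<^sub>R u) * ennreal (e ((1 / v) *\<^sub>R u) v))) =
          \<Phi> u * ennreal (w u / enn2real (D u) * ((1 / v) * hw u (1 / v)) * (1 / v))"
        unfolding v1 by (rule trans[OF ac arg_cong[where f="\<lambda>t. \<Phi> u * t", OF bal]])
    qed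
    finally show "(\<integral>\<^sup>+z. ennreal (w z) * (\<Phi> (v *\<^sub>R z) * ennreal (e z v)) \<partial>N) =
        (\<integral>\<^sup>+u. \<Phi> u * ennreal (w u / enn2real (D u) * ((1 / v) * hw u (1 / v)) * (1 / v)) \<partial>N)" .
  qed
  also have "\<dots> = (\<integral>\<^sup>+u. \<integral>\<^sup>+v. \<Phi> u * ennreal (w u / enn2real (D u) * ((1 / v) * hw u (1 / v)) * (1 / v)) \<partial>pos_measure \<partial>N)"
  proof (rule NP.Fubini')
    have 1: "(\<lambda>p. \<Phi> (fst p)) \<in> borel_measurable (N \<Otimes>\<^sub>M pos_measure)" by (rule measurable_compose[OF measurable_fst \<Phi>])
    have 2: "(\<lambda>p. w (fst p) / enn2real (D (fst p))) \<in> borel_measurable (N \<Otimes>\<^sub>M pos_measure)"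
    proof -
      have [measurable]: "(\<lambda>p. enn2real (D (fst p))) \<in> borel_measurable (N \<Otimes>\<^sub>M pos_measure)"
        using measurable_compose[OF measurable_fst D_measurable] by measurable
      show ?thesis
        using measurable_compose[OF measurable_fst w_measurable] by (rule borel_measurable_divide) measurable
    qed
    have 3: "(\<lambda>p. hw (fst p) (1 / snd p)) \<in> borel_measurable (N \<Otimes>\<^sub>M pos_measure)"
      using measurable_compose[OF measurable_Pair[OF measurable_fst measurable_compose[OF measurable_snd inverse_pos]] hw_measurable'] by simp
    have 4: "(\<lambda>p. 1 / snd p) \<in> borel_measurable (N \<Otimes>\<^sub>M pos_measure)"
      using measurable_compose[OF measurable_compose[OF measurable_snd inverse_pos] ident_pos_measure] by simp
    show "(\<lambda>(u, v). \<Phi> u * ennreal (w u / enn2real (D u) * ((1 / v) * hw u (1 / v)) * (1 / v))) \<in> borel_measurable (N \<Otimes>\<^sub>M pos_measure)"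
      unfolding split_def
      by (intro borel_measurable_times_ennreal 1 measurable_compose[OF _ measurable_ennreal] borel_measurable_times 2 3 4)
  qed
  also have "\<dots> = (\<integral>\<^sup>+u. \<Phi> u * ennreal (w u) \<partial>N)"
  proof (rule nn_integral_cong_AE)
    show "AE u in N. (\<integral>\<^sup>+v. \<Phi> u * ennreal (w u / enn2real (D u) * ((1 / v) * hw u (1 / v)) * (1 / v)) \<partial>pos_measure) = \<Phi> u * ennreal (w u)"
      using D_finite
    proof eventually_elim
      case (elim u)
      then have D: "D u \<noteq> 0" "D u < \<infinity>" using D_nonzero by auto
      have n: "0 < enn2real (D u)" using D by (simp add: enn2real_positive_iff zero_less_iff_neq_zero)
      \<comment> \<open>The weight rewritten relative to dt/t, the form in which inversion
        invariance applies.\<close>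
      let ?f = "\<lambda>t. ennreal (t * hw u t)"
      have fm: "?f \<in> borel_measurable pos_measure" by (rule pos_measure_measurable) measurable
      have fm': "(\<lambda>v. ?f (1 / v) * ennreal (1 / v)) \<in> borel_measurable pos_measure"
        by (rule pos_measure_measurable) measurable
      have "(\<integral>\<^sup>+v. \<Phi> u * ennreal (w u / enn2real (D u) * ((1 / v) * hw u (1 / v)) * (1 / v)) \<partial>pos_measure) =
          (\<integral>\<^sup>+v. (\<Phi> u * ennreal (w u / enn2real (D u))) * (?f (1 / v) * ennreal (1 / v)) \<partial>pos_measure)"
      proof (rule nn_integral_cong)
        fix v :: real assume "v \<in> space pos_measure"
        then have v: "0 < v" by simp
        have "ennreal (w u / enn2real (D u) * ((1 / v) * hw u (1 / v)) * (1 / v)) =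
            ennreal (w u / enn2real (D u)) * ennreal ((1 / v) * hw u (1 / v)) * ennreal (1 / v)"
          using v by (simp only: ennreal_mult mult_nonneg_nonneg divide_nonneg_nonneg w_nonneg hw_nonneg enn2real_nonneg zero_le_one less_imp_le)
        then show "\<Phi> u * ennreal (w u / enn2real (D u) * ((1 / v) * hw u (1 / v)) * (1 / v)) =
            (\<Phi> u * ennreal (w u / enn2real (D u))) * (?f (1 / v) * ennreal (1 / v))"
          by (simp only: mult.assoc)
      qed
      also have "\<dots> = (\<Phi> u * ennreal (w u / enn2real (D u))) * (\<integral>\<^sup>+v. ?f (1 / v) * ennreal (1 / v) \<partial>pos_measure)"
        by (rule nn_integral_cmult[OF fm'])
      also have "(\<integral>\<^sup>+v. ?f (1 / v) * ennreal (1 / v) \<partial>pos_measure) = (\<integral>\<^sup>+t. ?f t * ennreal (1 / t) \<partial>pos_measure)"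
        by (rule nn_integral_inversion[OF fm])
      also have "\<dots> = D u"
        unfolding D_def by (rule nn_integral_cong) (simp add: hw_nonneg flip: ennreal_mult)
      also have "\<Phi> u * ennreal (w u / enn2real (D u)) * D u = \<Phi> u * (ennreal (w u / enn2real (D u)) * ennreal (enn2real (D u)))"
        using D by (simp add: mult.assoc)
      also have "ennreal (w u / enn2real (D u)) * ennreal (enn2real (D u)) = ennreal (w u / enn2real (D u) * enn2real (D u))"
        by (rule ennreal_mult[symmetric]) (simp_all add: w_nonneg)
      also have "w u / enn2real (D u) * enn2real (D u) = w u" using n by simp
      finally show ?case .
    qed
  qed
  finally show ?thesis .
qed

section \<open>The conditional density averaged over scales\<close>

definition \<Theta> :: "(real^'d^'p) \<times> (real^'d^'d) \<Rightarrow> real^'n \<Rightarrow> ennreal" where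
  "\<Theta> x z = (\<integral>\<^sup>+v. ennreal (\<theta> x (v *\<^sub>R z) * e z v) \<partial>pos_measure)"

text \<open>The same average as a Bochner integral, the form in which it occurs in the kernel; the
  version in [0, \<infinity>] is used for Tonelli arguments.\<close>

definition \<theta>s :: "(real^'d^'p) \<times> (real^'d^'d) \<Rightarrow> real^'n \<Rightarrow> real" where
  "\<theta>s x z = (LINT v|pos_measure. \<theta> x (v *\<^sub>R z) * e z v)"

lemma theta_slice: "x \<in> space L \<Longrightarrow> \<theta> x \<in> borel_measurable N"
  using measurable_Pair2[OF theta_measurable] by simp

lemma integrand_joint: "(\<lambda>p. \<theta> (fst (fst p)) (snd p *\<^sub>R snd (fst p)) * e (snd (fst p)) (snd p)) \<in> borel_measurable ((L \<Otimes>\<^sub>M N) \<Otimes>\<^sub>M pos_measure)"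
proof -
  have t: "(\<lambda>p. \<theta> (fst p) (snd p)) \<in> borel_measurable (L \<Otimes>\<^sub>M N)" using theta_measurable by (simp add: split_def)
  have zv: "(\<lambda>p. (snd (fst p), snd p)) \<in> measurable ((L \<Otimes>\<^sub>M N) \<Otimes>\<^sub>M pos_measure) (N \<Otimes>\<^sub>M pos_measure)" by measurable
  have sc: "(\<lambda>p. snd p *\<^sub>R snd (fst p)) \<in> measurable ((L \<Otimes>\<^sub>M N) \<Otimes>\<^sub>M pos_measure) N"
    using measurable_compose[OF zv scale_measurable] by simp
  have x: "(\<lambda>p. fst (fst p)) \<in> measurable ((L \<Otimes>\<^sub>M N) \<Otimes>\<^sub>M pos_measure) L"
    by (rule measurable_compose[OF measurable_fst measurable_fst])
  have 1: "(\<lambda>p. \<theta> (fst (fst p)) (snd p *\<^sub>R snd (fst p))) \<in> borel_measurable ((L \<Otimes>\<^sub>M N) \<Otimes>\<^sub>M pos_measure)"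
    using measurable_compose[OF measurable_Pair[OF x sc] t] by simp
  have 2: "(\<lambda>p. e (snd (fst p)) (snd p)) \<in> borel_measurable ((L \<Otimes>\<^sub>M N) \<Otimes>\<^sub>M pos_measure)"
    using measurable_compose[OF zv e_measurable] by simp
  show ?thesis using 1 2 by (rule borel_measurable_times)
qed

lemma thetas_measurable: "(\<lambda>(x, z). \<theta>s x z) \<in> borel_measurable (L \<Otimes>\<^sub>M N)"
proof -
  have "(\<lambda>(q, v). \<theta> (fst q) (v *\<^sub>R snd q) * e (snd q) v) \<in> borel_measurable ((L \<Otimes>\<^sub>M N) \<Otimes>\<^sub>M pos_measure)"
    using integrand_joint by (simp add: split_def)
  from P.borel_measurable_lebesgue_integral[OF this] show ?thesis by (simp add: \<theta>s_def split_def)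
qed

lemma integrand_slice:
  assumes "x \<in> space L" "z \<in> space N"
  shows "(\<lambda>v. \<theta> x (v *\<^sub>R z) * e z v) \<in> borel_measurable pos_measure"
  by (intro borel_measurable_times measurable_compose[OF scale_slice[OF assms(2)] theta_slice[OF assms(1)]] e_slice)

lemma thetas_nonneg: "0 \<le> \<theta>s x z"
  unfolding \<theta>s_def by (rule Bochner_Integration.integral_nonneg) (simp add: theta_nonneg e_nonneg)

lemma thetas_eq: "x \<in> space L \<Longrightarrow> z \<in> space N \<Longrightarrow> \<theta>s x z = enn2real (\<Theta> x z)"
  unfolding \<theta>s_def \<Theta>_def by (rule integral_eq_nn_integral[OF integrand_slice]) (auto simp: theta_nonneg e_nonneg)

text \<open>Averages over the law on a ray depend on the ray alone: this is the scale invariance of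
  functions in the range of the conditional expectation.\<close>

lemma Theta_scale:
  assumes x: "x \<in> space L" and z: "z \<in> space N" and u: "0 < u"
  shows "\<Theta> x (u *\<^sub>R z) = \<Theta> x z"
proof -
  have m: "(\<lambda>v. ennreal (\<theta> x (v *\<^sub>R z) * e z v)) \<in> borel_measurable pos_measure"
    by (rule measurable_compose[OF integrand_slice[OF x z] measurable_ennreal])
  have m': "(\<lambda>v. ennreal (\<theta> x (v *\<^sub>R u *\<^sub>R z) * e (u *\<^sub>R z) v)) \<in> borel_measurable pos_measure"
    by (rule measurable_compose[OF integrand_slice[OF x scale_space[OF z u]] measurable_ennreal])
  have "\<Theta> x z = ennreal u * (\<integral>\<^sup>+v. ennreal (\<theta> x ((u * v) *\<^sub>R z) * e z (u * v)) \<partial>pos_measure)"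
    unfolding \<Theta>_def by (rule nn_integral_pos_measure_scale[OF m u])
  also have "(\<integral>\<^sup>+v. ennreal (\<theta> x ((u * v) *\<^sub>R z) * e z (u * v)) \<partial>pos_measure) =
      (\<integral>\<^sup>+v. ennreal (1 / u) * ennreal (\<theta> x (v *\<^sub>R u *\<^sub>R z) * e (u *\<^sub>R z) v) \<partial>pos_measure)"
  proof (rule nn_integral_cong)
    fix v :: real assume "v \<in> space pos_measure"
    then have v: "0 < v" by simp
    have "\<theta> x ((u * v) *\<^sub>R z) * e z (u * v) = (1 / u) * (\<theta> x (v *\<^sub>R u *\<^sub>R z) * e (u *\<^sub>R z) v)"
      using u by (simp add: e_scale[OF u v, symmetric] mult.commute[of v u])
    then show "ennreal (\<theta> x ((u * v) *\<^sub>R z) * e z (u * v)) = ennreal (1 / u) * ennreal (\<theta> x (v *\<^sub>R u *\<^sub>R z) * e (u *\<^sub>R z) v)"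
      using u by (simp only:) (rule ennreal_mult, simp_all add: theta_nonneg e_nonneg)
  qed
  also have "\<dots> = ennreal (1 / u) * \<Theta> x (u *\<^sub>R z)"
    unfolding \<Theta>_def by (rule nn_integral_cmult[OF m'])
  also have "ennreal u * (ennreal (1 / u) * \<Theta> x (u *\<^sub>R z)) = (ennreal u * ennreal (1 / u)) * \<Theta> x (u *\<^sub>R z)"
    by (simp only: mult.assoc)
  also have "ennreal u * ennreal (1 / u) = 1" using u by (simp flip: ennreal_mult)
  finally show ?thesis by simp
qed

lemma thetas_scale: "x \<in> space L \<Longrightarrow> z \<in> space N \<Longrightarrow> 0 < u \<Longrightarrow> \<theta>s x (u *\<^sub>R z) = \<theta>s x z"
  by (simp add: thetas_eq Theta_scale scale_space)

text \<open>If the normaliser degenerates at z, it does so on the whole ray by homogeneity, and the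
  average vanishes as well.\<close>

lemma thetas_G_H:
  assumes "z \<in> space N"
  shows "\<theta>s x' z * (G x z * H z) = \<theta>s x' z * \<theta> x z * w z"
proof (cases "enn2real (nG z) = 0")
  case True
  have "\<theta>s x' z = (LINT v|pos_measure. 0)"
    unfolding \<theta>s_def
    by (rule Bochner_Integration.integral_cong[OF refl]) (simp add: \<theta>_def nG_scale_real[OF assms] True)
  then show ?thesis by simp
qed (simp add: \<theta>_def w_def)

text \<open>The chain averages only the density of the new state, so this form is not visibly
  symmetric in the two states.\<close>

lemma haar_kernel_eq1:
  assumes x: "x \<in> space L" "x' \<in> space L"
  shows "haar_kernel h a X y x' x = (LINT z|N. \<theta>s x' z * \<theta> x z * w z) / J x"
proof -
  obtain \<beta>' S' where x': "x' = (\<beta>', S')" by (cases x')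
  have "haar_kernel h a X y x' x = (LINT z|N. (\<theta>s x' z * \<theta> x z * w z) / J x)"
    unfolding haar_kernel_def x' prod.case
  proof (rule Bochner_Integration.integral_cong[OF refl])
    fix z :: "real^'n" assume z: "z \<in> space N"
    have "(LINT v|pos_measure. cond_beta X y S' (v *\<^sub>R z) \<beta>' * cond_Sigma a X y (v *\<^sub>R z) S' * haar_density CARD('d) a h z v * cond_z h X y x z)
        = (LINT v|pos_measure. (\<theta> x' (v *\<^sub>R z) * e z v) * (G x z * H z / J x))"
    proof (rule Bochner_Integration.integral_cong[OF refl])
      fix v :: real assume "v \<in> space pos_measure"
      then have v: "0 < v" by simp
      show "cond_beta X y S' (v *\<^sub>R z) \<beta>' * cond_Sigma a X y (v *\<^sub>R z) S' * haar_density CARD('d) a h z v * cond_z h X y x z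
        = (\<theta> x' (v *\<^sub>R z) * e z v) * (G x z * H z / J x)"
        using cond_param_eq[OF x(2) scale_space[OF z v]] cond_z_eq[OF x(1) z] haar_density_eq[OF z v] by (simp add: x')
    qed
    also have "\<dots> = \<theta>s x' z * (G x z * H z) / J x" by (simp add: \<theta>s_def)
    also have "\<dots> = \<theta>s x' z * \<theta> x z * w z / J x" by (simp only: thetas_G_H[OF z])
    finally show "(LINT v|pos_measure. cond_beta X y S' (v *\<^sub>R z) \<beta>' * cond_Sigma a X y (v *\<^sub>R z) S' * haar_density CARD('d) a h z v * cond_z h X y x z)
        = \<theta>s (\<beta>', S') z * \<theta> x z * w z / J x" by (simp add: x')
  qed
  then show ?thesis by simp
qed

lemma theta_nn_slice: "x \<in> space L \<Longrightarrow> (\<lambda>z. ennreal (\<theta> x z)) \<in> borel_measurable N"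
  by (rule measurable_compose[OF theta_slice measurable_ennreal])

lemma Theta_split: "\<Theta> x z = (\<integral>\<^sup>+v. ennreal (\<theta> x (v *\<^sub>R z)) * ennreal (e z v) \<partial>pos_measure)"
  by (simp add: \<Theta>_def ennreal_mult theta_nonneg e_nonneg)

lemma Theta_w:
  "x \<in> space L \<Longrightarrow> (\<integral>\<^sup>+z. ennreal (w z) * \<Theta> x z \<partial>N) = (\<integral>\<^sup>+z. ennreal (\<theta> x z * w z) \<partial>N)"
  using haar_stationary[OF theta_nn_slice, of x] by (simp add: Theta_split ennreal_mult theta_nonneg w_nonneg)

lemma Theta_measurable: "x \<in> space L \<Longrightarrow> \<Theta> x \<in> borel_measurable N"
proof -
  assume x: "x \<in> space L"
  have zv: "(\<lambda>p. ((x, fst p), snd p)) \<in> measurable (N \<Otimes>\<^sub>M pos_measure) ((L \<Otimes>\<^sub>M N) \<Otimes>\<^sub>M pos_measure)"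
    using x by measurable
  have "(\<lambda>(z, v). ennreal (\<theta> x (v *\<^sub>R z) * e z v)) \<in> borel_measurable (N \<Otimes>\<^sub>M pos_measure)"
    using measurable_compose[OF measurable_compose[OF zv integrand_joint] measurable_ennreal] by (simp add: split_def)
  from P.borel_measurable_nn_integral[OF this] show ?thesis by (simp add: \<Theta>_def[abs_def])
qed

text \<open>By stationarity the integral of w \<Theta> is at most J x, so \<Theta> is finite almost
  everywhere where w is positive. Elsewhere its real version may differ, but it is only ever
  multiplied by w.\<close>

lemma Theta_finite:
  assumes x: "x \<in> space L"
  shows "AE z in N. z \<in> space N \<and> (w z = 0 \<or> \<Theta> x z = ennreal (\<theta>s x z))"
proof -
  have "(\<integral>\<^sup>+z. ennreal (w z) * \<Theta> x z \<partial>N) \<le> (\<integral>\<^sup>+z. ennreal (G x z * H z) \<partial>N)"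
    unfolding Theta_w[OF x]
    by (intro nn_integral_mono ennreal_leI) (auto simp: \<theta>_def w_def joint_G_nonneg H_nonneg)
  also have "\<dots> < \<infinity>" by (simp add: J_eq[OF x])
  finally have "AE z in N. ennreal (w z) * \<Theta> x z \<noteq> \<infinity>"
    using Theta_measurable[OF x] by (intro nn_integral_PInf_AE borel_measurable_times_ennreal) auto
  then show ?thesis
    using AE_space
  proof eventually_elim
    case (elim z)
    show ?case
    proof (cases "w z = 0")
      case False
      then have "ennreal (w z) \<noteq> 0" using w_nonneg[of z] by (simp add: ennreal_eq_0_iff)
      then have "\<Theta> x z < \<top>" using elim by (auto simp: ennreal_mult_eq_top_iff less_top)
      then show ?thesis using elim by (simp add: thetas_eq[OF x])
    qed (use elim in simp)
  qed
qed

text \<open>A conditional expectation is self-adjoint and idempotent: stationarity is applied to the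
  product of the averaged and the plain density, and the averaged factor, constant on rays, leaves
  the inner integral.\<close>

lemma thetas_product:
  assumes x: "x \<in> space L" and x': "x' \<in> space L"
  shows "(LINT z|N. \<theta>s x' z * \<theta> x z * w z) = (LINT z|N. \<theta>s x' z * \<theta>s x z * w z)"
proof -
  have sl: "\<theta>s x \<in> borel_measurable N" if "x \<in> space L" for x
    using measurable_Pair2[OF thetas_measurable that] by simp
  let ?\<Phi> = "\<lambda>z. ennreal (\<theta>s x' z * \<theta> x z)"
  have \<Phi>: "?\<Phi> \<in> borel_measurable N"
    by (intro measurable_compose[OF borel_measurable_times measurable_ennreal] sl[OF x'] theta_slice[OF x])
  have "(\<integral>\<^sup>+z. ennreal (\<theta>s x' z * \<theta>s x z * w z) \<partial>N) =
      (\<integral>\<^sup>+z. ennreal (w z) * (\<integral>\<^sup>+v. ?\<Phi> (v *\<^sub>R z) * ennreal (e z v) \<partial>pos_measure) \<partial>N)"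
  proof (rule nn_integral_cong_AE)
    show "AE z in N. ennreal (\<theta>s x' z * \<theta>s x z * w z) = ennreal (w z) * (\<integral>\<^sup>+v. ?\<Phi> (v *\<^sub>R z) * ennreal (e z v) \<partial>pos_measure)"
      using Theta_finite[OF x]
    proof eventually_elim
      case (elim z)
      then have z: "z \<in> space N" by simp
      have "(\<integral>\<^sup>+v. ?\<Phi> (v *\<^sub>R z) * ennreal (e z v) \<partial>pos_measure) =
          (\<integral>\<^sup>+v. ennreal (\<theta>s x' z) * ennreal (\<theta> x (v *\<^sub>R z) * e z v) \<partial>pos_measure)"
        by (rule nn_integral_cong) (simp add: thetas_scale[OF x' z] ennreal_mult thetas_nonneg theta_nonneg e_nonneg mult.assoc)
      also have "\<dots> = ennreal (\<theta>s x' z) * \<Theta> x z"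
        unfolding \<Theta>_def by (rule nn_integral_cmult[OF measurable_compose[OF integrand_slice[OF x z] measurable_ennreal]])
      finally have "ennreal (w z) * (\<integral>\<^sup>+v. ?\<Phi> (v *\<^sub>R z) * ennreal (e z v) \<partial>pos_measure) = ennreal (w z) * (ennreal (\<theta>s x' z) * \<Theta> x z)"
        by simp
      also have "\<dots> = ennreal (\<theta>s x' z * \<theta>s x z * w z)"
      proof (cases "w z = 0")
        case False
        then have "\<Theta> x z = ennreal (\<theta>s x z)" using elim by simp
        then show ?thesis by (simp add: ennreal_mult thetas_nonneg w_nonneg mult_ac)
      qed simp
      finally show ?case by simp
    qed
  qed
  also have "\<dots> = (\<integral>\<^sup>+z. ?\<Phi> z * ennreal (w z) \<partial>N)" by (rule haar_stationary[OF \<Phi>])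
  also have "\<dots> = (\<integral>\<^sup>+z. ennreal (\<theta>s x' z * \<theta> x z * w z) \<partial>N)"
    by (rule nn_integral_cong) (simp add: ennreal_mult thetas_nonneg theta_nonneg w_nonneg)
  finally have eq: "(\<integral>\<^sup>+z. ennreal (\<theta>s x' z * \<theta>s x z * w z) \<partial>N) = (\<integral>\<^sup>+z. ennreal (\<theta>s x' z * \<theta> x z * w z) \<partial>N)" .
  have 1: "(LINT z|N. \<theta>s x' z * \<theta>s x z * w z) = enn2real (\<integral>\<^sup>+z. ennreal (\<theta>s x' z * \<theta>s x z * w z) \<partial>N)"
    by (intro integral_eq_nn_integral borel_measurable_times sl[OF x] sl[OF x'] w_measurable) (simp add: thetas_nonneg w_nonneg)
  have 2: "(LINT z|N. \<theta>s x' z * \<theta> x z * w z) = enn2real (\<integral>\<^sup>+z. ennreal (\<theta>s x' z * \<theta> x z * w z) \<partial>N)"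
    by (intro integral_eq_nn_integral borel_measurable_times theta_slice[OF x] sl[OF x'] w_measurable)
      (simp add: thetas_nonneg theta_nonneg w_nonneg)
  show ?thesis by (simp only: 1 2 eq)
qed

lemma haar_kernel_eq:
  "x \<in> space L \<Longrightarrow> x' \<in> space L \<Longrightarrow> haar_kernel h a X y x' x = (LINT z|N. \<theta>s x' z * \<theta>s x z * w z) / J x"
  by (simp only: haar_kernel_eq1 thetas_product)

lemma thetas_w:
  assumes x: "x \<in> space L"
  shows "(\<integral>\<^sup>+z. ennreal (\<theta>s x z * w z) \<partial>N) = (\<integral>\<^sup>+z. ennreal (\<theta> x z * w z) \<partial>N)"
proof -
  have "(\<integral>\<^sup>+z. ennreal (\<theta>s x z * w z) \<partial>N) = (\<integral>\<^sup>+z. ennreal (w z) * \<Theta> x z \<partial>N)"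
  proof (rule nn_integral_cong_AE)
    show "AE z in N. ennreal (\<theta>s x z * w z) = ennreal (w z) * \<Theta> x z"
      using Theta_finite[OF x]
      by eventually_elim (auto simp: ennreal_mult thetas_nonneg w_nonneg mult.commute)
  qed
  then show ?thesis by (simp only: Theta_w[OF x])
qed

text \<open>Jensen's inequality for the law of v, obtained from Cauchy-Schwarz by distributing the
  square root of \<open>e z v\<close> over both factors.\<close>

lemma thetas_sq_le:
  assumes x: "x \<in> space L" and z: "z \<in> space N"
  shows "ennreal ((\<theta>s x z)\<^sup>2) \<le> (\<integral>\<^sup>+v. ennreal ((\<theta> x (v *\<^sub>R z))\<^sup>2) * ennreal (e z v) \<partial>pos_measure)"
proof -
  let ?f = "\<lambda>v. ennreal (\<theta> x (v *\<^sub>R z) * sqrt (e z v))" and ?g = "\<lambda>v. ennreal (sqrt (e z v))"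
  have sq: "(\<lambda>v. sqrt (e z v)) \<in> borel_measurable pos_measure"
    by (rule measurable_compose[OF e_slice]) measurable
  have f: "?f \<in> borel_measurable pos_measure"
    by (intro measurable_compose[OF _ measurable_ennreal] borel_measurable_times sq
        measurable_compose[OF scale_slice[OF z] theta_slice[OF x]])
  have g: "?g \<in> borel_measurable pos_measure"
    by (rule measurable_compose[OF sq measurable_ennreal])
  have "ennreal ((\<theta>s x z)\<^sup>2) = (ennreal (\<theta>s x z))\<^sup>2" by (simp add: ennreal_power thetas_nonneg)
  also have "\<dots> \<le> (\<Theta> x z)\<^sup>2"
    unfolding thetas_eq[OF x z] by (intro power_mono) (auto simp: ennreal_enn2real_if)
  also have "\<Theta> x z = (\<integral>\<^sup>+v. ?f v * ?g v \<partial>pos_measure)"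
    unfolding \<Theta>_def
    by (rule nn_integral_cong) (simp add: theta_nonneg e_nonneg mult.assoc flip: ennreal_mult)
  also have "(\<integral>\<^sup>+v. ?f v * ?g v \<partial>pos_measure)\<^sup>2 \<le> (\<integral>\<^sup>+v. (?f v)\<^sup>2 \<partial>pos_measure) * (\<integral>\<^sup>+v. (?g v)\<^sup>2 \<partial>pos_measure)"
    by (rule Cauchy_Schwarz_nn_integral[OF f g])
  also have "\<dots> \<le> (\<integral>\<^sup>+v. (?f v)\<^sup>2 \<partial>pos_measure) * 1"
    using e_integral_le[of z] by (intro mult_left_mono) (simp_all add: ennreal_power e_nonneg)
  also have "\<dots> = (\<integral>\<^sup>+v. ennreal ((\<theta> x (v *\<^sub>R z))\<^sup>2) * ennreal (e z v) \<partial>pos_measure)"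
    by (simp add: ennreal_power theta_nonneg e_nonneg power_mult_distrib flip: ennreal_mult)
  finally show ?thesis .
qed

text \<open>Averaging is a contraction in L2: Jensen at each z, then stationarity removes the
  average of the squares.\<close>

lemma thetas_sq_finite: "(\<integral>\<^sup>+x. \<integral>\<^sup>+z. ennreal ((\<theta>s x z)\<^sup>2 * w z / J x) \<partial>N \<partial>L) < \<infinity>"
proof -
  have "(\<integral>\<^sup>+x. \<integral>\<^sup>+z. ennreal ((\<theta>s x z)\<^sup>2 * w z / J x) \<partial>N \<partial>L) \<le> (\<integral>\<^sup>+x. \<integral>\<^sup>+z. ennreal ((\<theta> x z)\<^sup>2 * w z / J x) \<partial>N \<partial>L)"
  proof (rule nn_integral_mono)
    fix x assume x: "x \<in> space L"
    have J: "0 < J x" by (rule J_pos[OF x])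
    let ?\<Phi> = "\<lambda>z. ennreal ((\<theta> x z)\<^sup>2 / J x)"
    have \<Phi>: "?\<Phi> \<in> borel_measurable N"
      by (intro measurable_compose[OF _ measurable_ennreal] borel_measurable_divide borel_measurable_power
          borel_measurable_const theta_slice[OF x])
    have "(\<integral>\<^sup>+z. ennreal ((\<theta>s x z)\<^sup>2 * w z / J x) \<partial>N) \<le> (\<integral>\<^sup>+z. ennreal (w z) * (\<integral>\<^sup>+v. ?\<Phi> (v *\<^sub>R z) * ennreal (e z v) \<partial>pos_measure) \<partial>N)"
    proof (rule nn_integral_mono)
      fix z :: "real^'n" assume z: "z \<in> space N"
      have m: "(\<lambda>v. ennreal ((\<theta> x (v *\<^sub>R z))\<^sup>2) * ennreal (e z v)) \<in> borel_measurable pos_measure"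
        using measurable_compose[OF scale_slice[OF z] theta_slice[OF x]] e_slice[of z]
        by (intro borel_measurable_times_ennreal measurable_compose[OF _ measurable_ennreal]) (auto intro: borel_measurable_power)
      have "ennreal ((\<theta>s x z)\<^sup>2 * w z / J x) = ennreal (w z) * (ennreal (1 / J x) * ennreal ((\<theta>s x z)\<^sup>2))"
        using J w_nonneg[of z] by (simp add: mult_ac flip: ennreal_mult)
      also have "\<dots> \<le> ennreal (w z) * (ennreal (1 / J x) * (\<integral>\<^sup>+v. ennreal ((\<theta> x (v *\<^sub>R z))\<^sup>2) * ennreal (e z v) \<partial>pos_measure))"
        by (intro mult_left_mono thetas_sq_le[OF x z]) auto
      also have "ennreal (1 / J x) * (\<integral>\<^sup>+v. ennreal ((\<theta> x (v *\<^sub>R z))\<^sup>2) * ennreal (e z v) \<partial>pos_measure) =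
          (\<integral>\<^sup>+v. ennreal (1 / J x) * (ennreal ((\<theta> x (v *\<^sub>R z))\<^sup>2) * ennreal (e z v)) \<partial>pos_measure)"
        by (rule nn_integral_cmult[OF m, symmetric])
      also have "\<dots> = (\<integral>\<^sup>+v. ?\<Phi> (v *\<^sub>R z) * ennreal (e z v) \<partial>pos_measure)"
        using J by (intro nn_integral_cong) (simp add: mult_ac e_nonneg flip: ennreal_mult)
      finally show "ennreal ((\<theta>s x z)\<^sup>2 * w z / J x) \<le> ennreal (w z) * (\<integral>\<^sup>+v. ?\<Phi> (v *\<^sub>R z) * ennreal (e z v) \<partial>pos_measure)" .
    qed
    also have "\<dots> = (\<integral>\<^sup>+z. ?\<Phi> z * ennreal (w z) \<partial>N)" by (rule haar_stationary[OF \<Phi>])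
    also have "\<dots> = (\<integral>\<^sup>+z. ennreal ((\<theta> x z)\<^sup>2 * w z / J x) \<partial>N)"
      using J w_nonneg by (intro nn_integral_cong) (simp flip: ennreal_mult)
    finally show "(\<integral>\<^sup>+z. ennreal ((\<theta>s x z)\<^sup>2 * w z / J x) \<partial>N) \<le> (\<integral>\<^sup>+z. ennreal ((\<theta> x z)\<^sup>2 * w z / J x) \<partial>N)" .
  qed
  then show ?thesis using theta_sq_finite by (rule order_le_less_trans)
qed

text \<open>After Tonelli the inner integral is 1 at every point of the ray, because by homogeneity
  the normaliser is nondegenerate along all of it; the law of v integrates to 1.\<close>

lemma thetas_1:
  assumes proper: "mass \<noteq> 0"
  shows "AE z in N. (\<integral>\<^sup>+x. ennreal (\<theta>s x z) \<partial>L) = 1"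
  using nG_real[OF proper] D_finite
proof eventually_elim
  case (elim z)
  then have z: "z \<in> space N" by simp
  have D: "D z \<noteq> 0" "D z < \<infinity>" using D_nonzero[OF z] elim by auto
  have xv: "(\<lambda>p. ((fst p, z), snd p)) \<in> measurable (L \<Otimes>\<^sub>M pos_measure) ((L \<Otimes>\<^sub>M N) \<Otimes>\<^sub>M pos_measure)"
    using z by measurable
  have joint: "(\<lambda>(x, v). ennreal (\<theta> x (v *\<^sub>R z) * e z v)) \<in> borel_measurable (L \<Otimes>\<^sub>M pos_measure)"
    using measurable_compose[OF measurable_compose[OF xv integrand_joint] measurable_ennreal] by (simp add: split_def)
  have "(\<integral>\<^sup>+x. \<Theta> x z \<partial>L) = (\<integral>\<^sup>+v. \<integral>\<^sup>+x. ennreal (\<theta> x (v *\<^sub>R z) * e z v) \<partial>L \<partial>pos_measure)"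
    unfolding \<Theta>_def by (rule LP.Fubini'[OF joint, symmetric])
  also have "\<dots> = (\<integral>\<^sup>+v. ennreal (e z v) \<partial>pos_measure)"
  proof (rule nn_integral_cong)
    fix v :: real assume "v \<in> space pos_measure"
    then have v: "0 < v" by simp
    have vz: "v *\<^sub>R z \<in> space N" by (rule scale_space[OF z v])
    have m: "(\<lambda>x. ennreal (\<theta> x (v *\<^sub>R z))) \<in> borel_measurable L"
      using measurable_compose[OF measurable_Pair1[OF theta_measurable vz] measurable_ennreal] by simp
    have "(\<integral>\<^sup>+x. ennreal (\<theta> x (v *\<^sub>R z) * e z v) \<partial>L) = (\<integral>\<^sup>+x. ennreal (\<theta> x (v *\<^sub>R z)) * ennreal (e z v) \<partial>L)"
      by (simp add: ennreal_mult theta_nonneg e_nonneg)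
    also have "\<dots> = (\<integral>\<^sup>+x. ennreal (\<theta> x (v *\<^sub>R z)) \<partial>L) * ennreal (e z v)" by (rule nn_integral_multc[OF m])
    also have "(\<integral>\<^sup>+x. ennreal (\<theta> x (v *\<^sub>R z)) \<partial>L) = 1"
      using elim v by (intro nn_integral_theta[OF vz]) (simp add: nG_scale_real)
    finally show "(\<integral>\<^sup>+x. ennreal (\<theta> x (v *\<^sub>R z) * e z v) \<partial>L) = ennreal (e z v)" by simp
  qed
  also have "\<dots> = 1" by (rule e_integral[OF D])
  finally have one: "(\<integral>\<^sup>+x. \<Theta> x z \<partial>L) = 1" .
  have m: "(\<lambda>x. \<Theta> x z) \<in> borel_measurable L"
    using P.borel_measurable_nn_integral[OF joint] by (simp add: \<Theta>_def)
  have "AE x in L. \<Theta> x z \<noteq> \<infinity>" using m one by (intro nn_integral_PInf_AE) auto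
  then have "AE x in L. ennreal (\<theta>s x z) = \<Theta> x z"
    using AE_space by eventually_elim (simp add: thetas_eq[OF _ z] less_top)
  then show ?case using one by (simp cong: nn_integral_cong_AE)
qed

theorem haar_trace_class: "trace_class_L20 (posterior h a X y) (kernel_op L (haar_kernel h a X y))"
proof (cases "mass = 0")
  case True
  then show ?thesis using thetas_measurable haar_kernel_eq by (rule improper_trace_class)
next
  case False
  show ?thesis
    by (rule trace_class_of_theta[OF False thetas_measurable thetas_nonneg thetas_1[OF False] _ thetas_sq_finite haar_kernel_eq])
      (simp_all add: thetas_w theta_w[OF False])
qed

end

end

theorem mainTheorem4:
  fixes X :: "real ^ 'p ^ 'n" and y :: "real ^ 'd ^ 'n"
    and a :: real and h :: "real \<Rightarrow> real"
  assumes h: "mixing_density h"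
    and S1: "rank (concat_cols X y) = CARD('p) + CARD('d)"
    and S2: "real CARD('n) > real CARD('p) + 2 * real CARD('d) - 2 * a"
    and S3: "integrable pos_measure (\<lambda>u. u powr (real CARD('d) / 2) * h u)"
    and S4: "integrable pos_measure (\<lambda>u.
        u powr (- (real CARD('n) - real CARD('p) + 2 * a - 2 * real CARD('d) - 1) / 2) * h u)"
    and family:
      "(\<exists>v \<alpha> \<gamma>. \<alpha> > 0 \<and> \<gamma> > 0 \<and> (\<forall>u>0. h u = gig_density v \<alpha> \<gamma> u)) \<or>
       (\<exists>\<mu>\<^sub>0 \<gamma>. \<gamma> > 0 \<and> (\<forall>u>0. h u = lognormal_density \<mu>\<^sub>0 \<gamma> u)) \<or>
       (\<exists>\<alpha> \<gamma>. \<gamma> > 0 \<and> \<alpha> > real CARD('d) / 2 \<and> (\<forall>u>0. h u = frechet_density \<alpha> \<gamma> u)) \<or>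
       (\<exists>\<alpha> \<gamma>. \<gamma> > 0 \<and> \<alpha> > real CARD('d) / 2 \<and> (\<forall>u>0. h u = inv_gamma_density \<alpha> \<gamma> u))"
  shows "trace_class_L20 (posterior h a X y) (kernel_op state_measure (da_kernel h a X y)) \<and>
    ((AE z in (orthant_measure :: (real ^ 'n) measure).
        integrable pos_measure (haar_weight CARD('d) a h z)) \<longrightarrow>
      trace_class_L20 (posterior h a X y) (kernel_op state_measure (haar_kernel h a X y)))"
proof -
  \<comment> \<open>Each family is handled through its unnormalised density; the exponent of its
    power factor is the parameter supplied to the dilation lemma.\<close>
  have "(\<forall>u>0. 0 < h u) \<and> dilation_gain h"
    using family
  proof (elim disjE exE conjE)
    fix v \<alpha> \<gamma> :: real assume "\<alpha> > 0" "\<gamma> > 0" "\<forall>u>0. h u = gig_density v \<alpha> \<gamma> u"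
    then show ?thesis
      by (intro normalized_family[OF h _ _ dilation_gain_gig[of \<alpha> \<gamma> v]]) (auto simp: gig_density_def)
  next
    fix \<mu> \<gamma> :: real assume "\<gamma> > 0" "\<forall>u>0. h u = lognormal_density \<mu> \<gamma> u"
    then show ?thesis
      by (intro normalized_family[OF h _ _ dilation_gain_lognormal[of \<gamma> \<mu>]]) (auto simp: lognormal_density_def)
  next
    fix \<alpha> \<gamma> :: real assume "\<gamma> > 0" "\<alpha> > real CARD('d) / 2" "\<forall>u>0. h u = frechet_density \<alpha> \<gamma> u"
    moreover from this have "\<alpha> > 0" by (meson divide_nonneg_nonneg of_nat_0_le_iff order_le_less_trans zero_le_numeral)
    ultimately show ?thesis
      by (intro normalized_family[OF h _ _ dilation_gain_frechet[of \<gamma> \<alpha> "- (\<alpha> + 1)"]]) (auto simp: frechet_density_def)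
  next
    fix \<alpha> \<gamma> :: real assume "\<gamma> > 0" "\<forall>u>0. h u = inv_gamma_density \<alpha> \<gamma> u"
    then show ?thesis
      by (intro normalized_family[OF h _ _ dilation_gain_inv_gamma[of \<gamma> "- \<alpha> - 1"]]) (auto simp: inv_gamma_density_def)
  qed
  then interpret mixing_model X y a h
    using h S1 S3 by unfold_locales (auto simp: mixing_density_def has_bochner_integral_iff)
  show ?thesis using da_trace_class haar_trace_class by blast
qed

end
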